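(* Let $n\in\mathbb N$, $n\ge2$, $N=2^{\lfloor(n+1)/2\rfloor}$, and let $G_0(z;\cdot,\cdot)$, $z\in\overline{\mathbb C_+}$, be the Green's function of the free massless Dirac operator in $[L^2(\mathbb R^n)]^N$. If $R_{0,\delta}$ is an integral operator in $[L^2(\mathbb R^n)]^N$ whose integral kernel satisfies for some $C\in(0,\infty)$ and some $\delta>1/2$ the entrywise bound $$|R_{0,\delta}(x,y)_{j,k}|\le C\langle x\rangle^{-\delta}|G_0(0+i0;x,y)_{j,k}|\langle y\rangle^{-\delta},\quad 1\le j,k\le N,$$ then $R_{0,\delta}\in\mathcal B_p([L^2(\mathbb R^n)]^N)$ for all $p>n$. Similarly, if for $z\in\overline{\mathbb C_+}$, $R_{0,\delta}(z)$ is an integral operator in $[L^2(\mathbb R^n)]^N$ whose integral kernel satisfies for some $C\in(0,\infty)$ and some $\delta>(n+1)/4$ the entrywise bound $$|R_{0,\delta}(z;x,y)_{j,k}|\le C\langle x\rangle^{-\delta}|G_0(z;x,y)_{j,k}|\langle y\rangle^{-\delta},\quad 1\le j,k\le N,$$ then $R_{0,\delta}(z)\in\mathcal B_p([L^2(\mathbb R^n)]^N)$ for all $p>n$.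
   Context: $\mathcal B_p$ denotes the $\ell^p$-based Schatten--von Neumann ideal; $\langle x\rangle=(1+|x|^2)^{1/2}$; $\overline{\mathbb C_+}=\{z:\operatorname{Im}z\ge0\}$. The matrices $\alpha_1,\dots,\alpha_{n+1}\in\mathbb C^{N\times N}$ are Hermitian with $\alpha_j\alpha_k+\alpha_k\alpha_j=2\delta_{j,k}I_N$. The Green's function of $H_0=\alpha\cdot(-i\nabla)$ is, for $z\in\overline{\mathbb C_+}\backslash\{0\}$, $x\ne y$, $$G_0(z;x,y)=\tfrac i4(2\pi)^{(2-n)/2}|x-y|^{2-n}z\,[z|x-y|]^{(n-2)/2}H^{(1)}_{(n-2)/2}(z|x-y|)I_N-\tfrac14(2\pi)^{(2-n)/2}|x-y|^{1-n}[z|x-y|]^{n/2}H^{(1)}_{n/2}(z|x-y|)\,\alpha\cdot\tfrac{x-y}{|x-y|},$$ with $H^{(1)}_\nu$ the Hankel function of the first kind (for $z\in\mathbb C_+$ the integral kernel of $(H_0-zI)^{-1}$), and $G_0(0;x,y)=G_0(0+i0;x,y)=\tfrac i2\pi^{-n/2}\Gamma(n/2)\,\alpha\cdot\frac{x-y}{|x-y|^n}$. *)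

theory Defs
  imports "HOL-Analysis.Analysis"
begin

section \<open>Cylinder functions\<close>

text \<open>Powers are principal values, and \<^const>\<open>Ln\<close> takes the argument \<open>\<pi>\<close> on the negative
  half-line. On the closed upper half-plane without the origin the functions below therefore agree
  with their continuous boundary values from the open upper half-plane.\<close>

definition bessel_J :: "complex \<Rightarrow> complex \<Rightarrow> complex" where
  "bessel_J \<nu> z = (z / 2) powr \<nu> *
     (\<Sum>k. (-1) ^ k * rGamma (\<nu> + of_nat k + 1) / fact k * (z / 2) ^ (2 * k))"

definition bessel_Y :: "complex \<Rightarrow> complex \<Rightarrow> complex" where
  "bessel_Y \<nu> z =
     (let q = \<lambda>\<mu>. (bessel_J \<mu> z * cos (\<mu> * of_real pi) - bessel_J (- \<mu>) z) / sin (\<mu> * of_real pi)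
      in if \<nu> \<in> \<int> then Lim (at \<nu>) q else q \<nu>)"

definition hankel_H1 :: "complex \<Rightarrow> complex \<Rightarrow> complex" where
  "hankel_H1 \<nu> z = bessel_J \<nu> z + \<i> * bessel_Y \<nu> z"


section \<open>The free massless Dirac operator\<close>

definition scale_matrix :: "complex \<Rightarrow> complex^'m^'k \<Rightarrow> complex^'m^'k" (infixr \<open>*\<^sub>M\<close> 75) where
  "c *\<^sub>M A = map_matrix (\<lambda>a. c * a) A"

definition hermitian :: "complex^'m^'m \<Rightarrow> bool" where
  "hermitian A \<longleftrightarrow> map_matrix cnj (transpose A) = A"

text \<open>The \<open>n + 1\<close> matrices are indexed by \<^typ>\<open>'n option\<close>: \<^term>\<open>Some j\<close> is the index of the
  coordinate \<open>j\<close> of \<^typ>\<open>real^'n\<close>, and \<^const>\<open>None\<close> stands for the index \<open>n + 1\<close>.\<close>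

definition dirac_matrices :: "('n::finite option \<Rightarrow> complex^'m^'m) \<Rightarrow> bool" where
  "dirac_matrices \<alpha> \<longleftrightarrow>
     (\<forall>j. hermitian (\<alpha> j)) \<and>
     (\<forall>j k. \<alpha> j ** \<alpha> k + \<alpha> k ** \<alpha> j = (2 * (if j = k then 1 else 0)) *\<^sub>M mat 1)"

definition dirac_dot :: "('n::finite option \<Rightarrow> complex^'m^'m) \<Rightarrow> real^'n \<Rightarrow> complex^'m^'m" where
  "dirac_dot \<alpha> v = (\<Sum>j\<in>UNIV. of_real (v $ j) *\<^sub>M \<alpha> (Some j))"

definition dirac_green ::
  "('n::finite option \<Rightarrow> complex^'m^'m) \<Rightarrow> complex \<Rightarrow> real^'n \<Rightarrow> real^'n \<Rightarrow> complex^'m^'m" where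
  "dirac_green \<alpha> z x y =
     (let n = real CARD('n); r = norm (x - y); \<omega> = (1 / r) *\<^sub>R (x - y); \<zeta> = z * of_real r in
      if z = 0 then
        (\<i> / 2 * of_real (pi powr (- n / 2) * Gamma (n / 2)))
          *\<^sub>M dirac_dot \<alpha> ((1 / r powr n) *\<^sub>R (x - y))
      else
        (\<i> / 4 * of_real ((2 * pi) powr ((2 - n) / 2) * r powr (2 - n)) * z
            * \<zeta> powr of_real ((n - 2) / 2) * hankel_H1 (of_real ((n - 2) / 2)) \<zeta>) *\<^sub>M mat 1
        - (1 / 4 * of_real ((2 * pi) powr ((2 - n) / 2) * r powr (1 - n))
            * \<zeta> powr of_real (n / 2) * hankel_H1 (of_real (n / 2)) \<zeta>) *\<^sub>M dirac_dot \<alpha> \<omega>)"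

definition bracket :: "'a::real_normed_vector \<Rightarrow> real" where
  "bracket x = sqrt (1 + (norm x)\<^sup>2)"


section \<open>The complex Hilbert space of vector-valued square integrable functions\<close>

definition square_integrable :: "('a::euclidean_space \<Rightarrow> complex^'m) \<Rightarrow> bool" where
  "square_integrable f \<longleftrightarrow>
     f \<in> borel_measurable lebesgue \<and> integrable lebesgue (\<lambda>x. (norm (f x))\<^sup>2)"

definition L2_rel :: "('a::euclidean_space \<Rightarrow> complex^'m) \<Rightarrow> ('a \<Rightarrow> complex^'m) \<Rightarrow> bool" where
  "L2_rel f g \<longleftrightarrow> square_integrable f \<and> square_integrable g \<and> (AE x in lebesgue. f x = g x)"

definition vec_cinner :: "complex^'m \<Rightarrow> complex^'m \<Rightarrow> complex" where
  "vec_cinner v w = (\<Sum>j\<in>UNIV. cnj (v $ j) * w $ j)"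

lemma vec_cinner_self: "vec_cinner v v = of_real ((norm v)\<^sup>2)"
  by (simp add: vec_cinner_def norm_vec_def L2_set_def sum_nonneg complex_norm_square mult.commute
      flip: of_real_power)

lemma vec_cinner_measurable [measurable]:
  assumes [measurable]: "f \<in> borel_measurable lebesgue" "g \<in> borel_measurable lebesgue"
  shows "(\<lambda>x. vec_cinner (f x) (g x)) \<in> borel_measurable lebesgue"
proof -
  have "continuous_on UNIV (\<lambda>p. vec_cinner (fst p) (snd p) :: complex)"
    unfolding vec_cinner_def by (intro continuous_intros)
  then show ?thesis
    using borel_measurable_continuous_on
      [of "\<lambda>p. vec_cinner (fst p) (snd p)" "\<lambda>x. (f x, g x)" lebesgue] by auto
qed

lemma norm_vec_cinner_le: "norm (vec_cinner v w) \<le> (norm v)\<^sup>2 + (norm w)\<^sup>2"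
proof -
  have "norm (vec_cinner v w) \<le> (\<Sum>j\<in>UNIV. norm (v $ j) * norm (w $ j))"
    unfolding vec_cinner_def by (rule order_trans[OF norm_sum]) (simp add: norm_mult)
  also have "\<dots> \<le> (\<Sum>j\<in>UNIV. (norm (v $ j))\<^sup>2 + (norm (w $ j))\<^sup>2)"
  proof (rule sum_mono)
    fix j
    have "2 * (norm (v $ j) * norm (w $ j)) \<le> (norm (v $ j))\<^sup>2 + (norm (w $ j))\<^sup>2"
      using sum_squares_bound[of "norm (v $ j)" "norm (w $ j)"] by simp
    moreover have "0 \<le> norm (v $ j) * norm (w $ j)"
      by simp
    ultimately show "norm (v $ j) * norm (w $ j) \<le> (norm (v $ j))\<^sup>2 + (norm (w $ j))\<^sup>2"
      by linarith
  qed
  also have "\<dots> = (norm v)\<^sup>2 + (norm w)\<^sup>2"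
    by (simp add: norm_vec_def L2_set_def sum_nonneg sum.distrib)
  finally show ?thesis .
qed

lemma vec_cinner_integrable:
  assumes "square_integrable f" "square_integrable g"
  shows "integrable lebesgue (\<lambda>x. vec_cinner (f x) (g x))"
proof (rule Bochner_Integration.integrable_bound)
  show "integrable lebesgue (\<lambda>x. (norm (f x))\<^sup>2 + (norm (g x))\<^sup>2)"
    using assms by (simp add: square_integrable_def)
  show "(\<lambda>x. vec_cinner (f x) (g x)) \<in> borel_measurable lebesgue"
    using assms by (simp add: square_integrable_def vec_cinner_measurable)
  show "AE x in lebesgue.
      norm (vec_cinner (f x) (g x)) \<le> norm ((norm (f x))\<^sup>2 + (norm (g x))\<^sup>2)"
    using norm_vec_cinner_le by (auto intro: order_trans)
qed

lemma square_integrable_zero: "square_integrable (\<lambda>x. 0)"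
  by (simp add: square_integrable_def)

lemma square_integrable_add:
  assumes "square_integrable f" "square_integrable g"
  shows "square_integrable (\<lambda>x. f x + g x)"
proof -
  have [measurable]: "f \<in> borel_measurable lebesgue" "g \<in> borel_measurable lebesgue"
    using assms by (auto simp: square_integrable_def)
  have "integrable lebesgue (\<lambda>x. (norm (f x + g x))\<^sup>2)"
  proof (rule Bochner_Integration.integrable_bound)
    show "integrable lebesgue (\<lambda>x. 2 * (norm (f x))\<^sup>2 + 2 * (norm (g x))\<^sup>2)"
      using assms by (simp add: square_integrable_def)
    have "(norm (f x + g x))\<^sup>2 \<le> 2 * (norm (f x))\<^sup>2 + 2 * (norm (g x))\<^sup>2" for x
    proof -
      have "(norm (f x + g x))\<^sup>2 \<le> (norm (f x) + norm (g x))\<^sup>2"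
        by (intro power_mono norm_triangle_ineq) auto
      also have "\<dots> \<le> 2 * (norm (f x))\<^sup>2 + 2 * (norm (g x))\<^sup>2"
        using sum_squares_bound[of "norm (f x)" "norm (g x)"] by (simp add: power2_sum)
      finally show ?thesis .
    qed
    then show "AE x in lebesgue.
        norm ((norm (f x + g x))\<^sup>2) \<le> norm (2 * (norm (f x))\<^sup>2 + 2 * (norm (g x))\<^sup>2)"
      by (auto intro: order_trans)
  qed measurable
  then show ?thesis
    by (simp add: square_integrable_def)
qed

lemma norm_vector_scalar_mult: "norm (c *s v) = norm c * norm (v :: complex^'m)"
  by (simp add: norm_vec_def L2_set_def norm_mult power_mult_distrib real_sqrt_mult
      flip: sum_distrib_left)

lemma square_integrable_scale:
  assumes "square_integrable f"
  shows "square_integrable (\<lambda>x. c *s f x)"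
proof -
  have "continuous_on UNIV (\<lambda>v. c *s v :: complex^'m)" for c :: complex
    unfolding vector_scalar_mult_def by (intro continuous_intros)
  then have "(\<lambda>x. c *s f x) \<in> borel_measurable lebesgue"
    using assms borel_measurable_continuous_on[of "\<lambda>v. c *s v" f lebesgue]
    by (auto simp: square_integrable_def)
  then show ?thesis
    using assms by (simp add: square_integrable_def norm_vector_scalar_mult power_mult_distrib)
qed

lemma scaleR_eq_vector_scalar_mult: "r *\<^sub>R v = complex_of_real r *s (v :: complex^'m)"
  by (simp add: vec_eq_iff scaleR_conv_of_real[where 'a = complex])

lemma L2_rel_part_equivp: "part_equivp L2_rel"
proof (rule part_equivpI)
  show "\<exists>f. L2_rel f f"
    using square_integrable_zero by (auto simp: L2_rel_def)
  show "symp L2_rel"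
    by (auto simp: symp_def L2_rel_def)
  show "transp L2_rel"
    by (auto simp: transp_def L2_rel_def elim: eventually_elim2)
qed

quotient_type (overloaded) ('a, 'm) L2 = "'a::euclidean_space \<Rightarrow> complex^'m::finite" / partial: L2_rel
  by (rule L2_rel_part_equivp)

lift_definition cinner_L2 :: "('a::euclidean_space, 'm::finite) L2 \<Rightarrow> ('a, 'm) L2 \<Rightarrow> complex"
  is "\<lambda>f g. \<integral>x. vec_cinner (f x) (g x) \<partial>lebesgue"
  by (intro integral_cong_AE)
     (auto simp: L2_rel_def square_integrable_def vec_cinner_measurable elim: eventually_elim2)

lift_definition scaleC_L2 :: "complex \<Rightarrow> ('a::euclidean_space, 'm::finite) L2 \<Rightarrow> ('a, 'm) L2"
    (infixr \<open>*\<^sub>C\<close> 75)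
  is "\<lambda>c f x. c *s f x"
  by (auto simp: L2_rel_def square_integrable_scale elim: eventually_mono)

instantiation L2 :: (euclidean_space, finite) real_inner
begin

lift_definition zero_L2 :: "('a, 'b) L2" is "\<lambda>x. 0"
  by (simp add: L2_rel_def square_integrable_zero)

lift_definition plus_L2 :: "('a, 'b) L2 \<Rightarrow> ('a, 'b) L2 \<Rightarrow> ('a, 'b) L2" is "\<lambda>f g x. f x + g x"
  by (auto simp: L2_rel_def square_integrable_add elim: eventually_elim2)

definition "scaleR r f = complex_of_real r *\<^sub>C f" for f :: "('a, 'b) L2"
definition "- f = (- 1) *\<^sub>C f" for f :: "('a, 'b) L2"
definition "f - g = f + - g" for f g :: "('a, 'b) L2"
definition "inner f g = Re (cinner_L2 f g)" for f g :: "('a, 'b) L2"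
definition "norm f = sqrt (inner f f)" for f :: "('a, 'b) L2"
definition "dist f g = norm (f - g)" for f g :: "('a, 'b) L2"
definition "sgn f = inverse (norm f) *\<^sub>R f" for f :: "('a, 'b) L2"
definition "uniformity = (INF e\<in>{0<..}. principal {(f, g :: ('a, 'b) L2). dist f g < e})"
definition "open U \<longleftrightarrow> (\<forall>f\<in>U. eventually (\<lambda>(f', g). f' = f \<longrightarrow> g \<in> U) uniformity)"
  for U :: "('a, 'b) L2 set"

lemma scaleC_L2_module:
  fixes f g :: "('a, 'b) L2"
  shows "c *\<^sub>C (f + g) = c *\<^sub>C f + c *\<^sub>C g"
    and "(c + d) *\<^sub>C f = c *\<^sub>C f + d *\<^sub>C f"
    and "c *\<^sub>C d *\<^sub>C f = (c * d) *\<^sub>C f"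
    and "1 *\<^sub>C f = f"
    and "0 *\<^sub>C f = 0"
  by (transfer, simp add: L2_rel_def square_integrable_add square_integrable_scale
      square_integrable_zero vector_add_ldistrib vector_sadd_rdistrib; fail)+

lemma plus_L2_comm_monoid:
  fixes f g h :: "('a, 'b) L2"
  shows "f + g + h = f + (g + h)" and "f + g = g + f" and "0 + f = f"
  by (transfer, simp add: L2_rel_def square_integrable_add add_ac; fail)+

lemma inner_L2_transferred:
  fixes f g h :: "('a, 'b) L2"
  shows "cinner_L2 (f + g) h = cinner_L2 f h + cinner_L2 g h"
    and "cinner_L2 (c *\<^sub>C f) g = cnj c * cinner_L2 f g"
    and "cinner_L2 f (c *\<^sub>C g) = c * cinner_L2 f g"
    and "cinner_L2 g f = cnj (cinner_L2 f g)"
    and "Re (cinner_L2 f f) \<ge> 0"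
    and "Re (cinner_L2 f f) = 0 \<longleftrightarrow> f = 0"
proof -
  show "cinner_L2 (f + g) h = cinner_L2 f h + cinner_L2 g h"
  proof transfer
    fix f g h :: "'a \<Rightarrow> complex^'b"
    assume "L2_rel f f" "L2_rel g g" "L2_rel h h"
    then have "integrable lebesgue (\<lambda>x. vec_cinner (f x) (h x))"
      "integrable lebesgue (\<lambda>x. vec_cinner (g x) (h x))"
      by (auto simp: L2_rel_def vec_cinner_integrable)
    moreover have "vec_cinner (f x + g x) (h x) = vec_cinner (f x) (h x) + vec_cinner (g x) (h x)"
      for x
      by (simp add: vec_cinner_def algebra_simps sum.distrib)
    ultimately show "(\<integral>x. vec_cinner (f x + g x) (h x) \<partial>lebesgue) =
        (\<integral>x. vec_cinner (f x) (h x) \<partial>lebesgue) + (\<integral>x. vec_cinner (g x) (h x) \<partial>lebesgue)"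
      by simp
  qed
  have *: "vec_cinner (c *s v) w = cnj c * vec_cinner v w"
    "vec_cinner v (c *s w) = c * vec_cinner v w"
    "vec_cinner w v = cnj (vec_cinner v w)" for v w :: "complex^'b" and c
    by (simp_all add: vec_cinner_def sum_distrib_left mult_ac)
  show "cinner_L2 (c *\<^sub>C f) g = cnj c * cinner_L2 f g"
    by transfer (simp add: *(1,2))
  show "cinner_L2 f (c *\<^sub>C g) = c * cinner_L2 f g"
    by transfer (simp add: *(1,2))
  show "cinner_L2 g f = cnj (cinner_L2 f g)"
  proof transfer
    fix f g :: "'a \<Rightarrow> complex^'b"
    show "(\<integral>x. vec_cinner (g x) (f x) \<partial>lebesgue) = cnj (\<integral>x. vec_cinner (f x) (g x) \<partial>lebesgue)"
      by (subst *(3)) simp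
  qed
  have self: "Re (\<integral>x. vec_cinner (f x) (f x) \<partial>lebesgue) = (\<integral>x. (norm (f x))\<^sup>2 \<partial>lebesgue)"
    for f :: "'a \<Rightarrow> complex^'b"
    unfolding vec_cinner_self by (simp only: integral_complex_of_real Re_complex_of_real)
  show "Re (cinner_L2 f f) \<ge> 0"
    by transfer (simp add: self)
  show "Re (cinner_L2 f f) = 0 \<longleftrightarrow> f = 0"
  proof transfer
    fix f :: "'a \<Rightarrow> complex^'b"
    assume "L2_rel f f"
    then show "Re (\<integral>x. vec_cinner (f x) (f x) \<partial>lebesgue) = 0 \<longleftrightarrow> L2_rel f (\<lambda>x. 0)"
      unfolding self
      by (subst integral_nonneg_eq_0_iff_AE)
        (auto simp: L2_rel_def square_integrable_zero square_integrable_def)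
  qed
qed

instance
proof
  fix f g h :: "('a, 'b) L2" and r s :: real
  show "f + g + h = f + (g + h)" "f + g = g + f" "0 + f = f"
    by (fact plus_L2_comm_monoid)+
  have "(- 1) *\<^sub>C f + 1 *\<^sub>C f = 0"
    by (simp only: scaleC_L2_module(2)[symmetric] add.left_inverse scaleC_L2_module(5))
  then show "- f + f = 0"
    by (simp only: uminus_L2_def scaleC_L2_module(4))
  show "f - g = f + - g" "dist f g = norm (f - g)" "sgn f = inverse (norm f) *\<^sub>R f"
    "norm f = sqrt (inner f f)"
    by (fact minus_L2_def dist_L2_def sgn_L2_def norm_L2_def)+
  show "r *\<^sub>R (f + g) = r *\<^sub>R f + r *\<^sub>R g" "(r + s) *\<^sub>R f = r *\<^sub>R f + s *\<^sub>R f"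
    "r *\<^sub>R s *\<^sub>R f = (r * s) *\<^sub>R f" "1 *\<^sub>R f = f"
    by (simp_all add: scaleR_L2_def scaleC_L2_module)
  show "inner f g = inner g f"
    using inner_L2_transferred(4)[of f g] by (simp add: inner_L2_def)
  show "inner (f + g) h = inner f h + inner g h" "inner (r *\<^sub>R f) g = r * inner f g"
    "0 \<le> inner f f" "inner f f = 0 \<longleftrightarrow> f = 0"
    by (simp_all add: inner_L2_def scaleR_L2_def inner_L2_transferred(1,2,5,6))
  show "uniformity = (INF e\<in>{0<..}. principal {(f, g :: ('a, 'b) L2). dist f g < e})"
    by (fact uniformity_L2_def)
  show "open U \<longleftrightarrow> (\<forall>f\<in>U. \<forall>\<^sub>F (f', g) in uniformity. f' = f \<longrightarrow> g \<in> U)"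
    for U :: "('a, 'b) L2 set"
    by (fact open_L2_def)
qed

end

global_interpretation L2: vector_space
    "scaleC_L2 :: complex \<Rightarrow> ('a::euclidean_space, 'm::finite) L2 \<Rightarrow> ('a, 'm) L2"
  by standard (simp_all add: scaleC_L2_module)


section \<open>Schatten--von Neumann ideals\<close>

definition compact_operator ::
  "(('a::euclidean_space, 'm::finite) L2 \<Rightarrow> ('a, 'm) L2) \<Rightarrow> bool" where
  "compact_operator T \<longleftrightarrow>
     Vector_Spaces.linear scaleC_L2 scaleC_L2 T \<and> compact (closure (T ` cball 0 1))"

text \<open>The adjoint of an everywhere defined bounded operator; by nondegeneracy of the inner product
  it is the only function with this property.\<close>

definition adjoint_L2 ::
  "(('a::euclidean_space, 'm::finite) L2 \<Rightarrow> ('a, 'm) L2) \<Rightarrow> ('a, 'm) L2 \<Rightarrow> ('a, 'm) L2" where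
  "adjoint_L2 T = (THE S. \<forall>f g. cinner_L2 (T f) g = cinner_L2 f (S g))"

definition eigenspace ::
  "(('a::euclidean_space, 'm::finite) L2 \<Rightarrow> ('a, 'm) L2) \<Rightarrow> complex \<Rightarrow> ('a, 'm) L2 set" where
  "eigenspace A \<mu> = {f. A f = \<mu> *\<^sub>C f}"

text \<open>A nonzero singular value of \<open>T\<close> is an \<open>s > 0\<close> such that \<open>s\<^sup>2\<close> is an eigenvalue of \<open>T\<^sup>* T\<close>;
  its multiplicity is the complex dimension of the eigenspace, which is finite for compact \<open>T\<close>
  (\<^term>\<open>L2.dim\<close> would be \<open>0\<close> on an infinite-dimensional space). An \<open>s\<close> that is not a singular value
  has multiplicity \<open>0\<close>, so the condition below says that the nonzero singular values, counted with
  multiplicity, form an \<open>\<ell>\<^sup>p\<close> family.\<close>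

definition singular_multiplicity ::
  "(('a::euclidean_space, 'm::finite) L2 \<Rightarrow> ('a, 'm) L2) \<Rightarrow> real \<Rightarrow> nat" where
  "singular_multiplicity T s = L2.dim (eigenspace (adjoint_L2 T \<circ> T) (of_real (s\<^sup>2)))"

definition schatten_class ::
  "real \<Rightarrow> (('a::euclidean_space, 'm::finite) L2 \<Rightarrow> ('a, 'm) L2) set" where
  "schatten_class p = {T. compact_operator T \<and>
     (\<lambda>s. real (singular_multiplicity T s) * s powr p) summable_on {0<..}}"


section \<open>Integral operators\<close>

text \<open>Operators are partial functions on \<^typ>\<open>('a, 'm) L2\<close>. The integral operator with kernel \<open>K\<close>
  has its maximal domain: it is defined at \<open>f\<close> if the integral converges absolutely almost everywhere
  and gives a square integrable function. Since \<^typ>\<open>('a, 'm) L2\<close> consists of equivalence classes,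
  \<^const>\<open>rep_L2\<close> picks an arbitrary representative.\<close>

definition is_integral_operator ::
  "(('a::euclidean_space, 'm::finite) L2 \<rightharpoonup> ('a, 'm) L2) \<Rightarrow> ('a \<Rightarrow> 'a \<Rightarrow> complex^'m^'m) \<Rightarrow> bool" where
  "is_integral_operator R K \<longleftrightarrow>
     (\<lambda>(x, y). K x y) \<in> borel_measurable lebesgue \<and>
     (\<forall>f g. R f = Some g \<longleftrightarrow>
        (AE x in lebesgue. integrable lebesgue (\<lambda>y. K x y *v rep_L2 f y) \<and>
           rep_L2 g x = (\<integral>y. K x y *v rep_L2 f y \<partial>lebesgue)))"

definition in_schatten_class ::
  "(('a::euclidean_space, 'm::finite) L2 \<rightharpoonup> ('a, 'm) L2) \<Rightarrow> real \<Rightarrow> bool" where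
  "in_schatten_class R p \<longleftrightarrow> (\<exists>T \<in> schatten_class p. R = (\<lambda>f. Some (T f)))"

text \<open>Kernels are determined only up to null sets, so the bound is required for almost all pairs.\<close>

definition kernel_bound ::
  "real \<Rightarrow> real \<Rightarrow> (real^'n \<Rightarrow> real^'n \<Rightarrow> complex^'m^'m) \<Rightarrow> (real^'n \<Rightarrow> real^'n \<Rightarrow> complex^'m^'m) \<Rightarrow> bool"
  where
  "kernel_bound C \<delta> G K \<longleftrightarrow>
     (AE (x, y) in lebesgue. \<forall>j k.
        cmod (K x y $ j $ k)
          \<le> C * bracket x powr (- \<delta>) * cmod (G x y $ j $ k) * bracket y powr (- \<delta>))"

end

theory Submission
  imports Defs "HOL-Complex_Analysis.Cauchy_Integral_Formula"
begin

text \<open>Both Green's functions are dominated by \<open>r powr (1 - n) + r powr (- a)\<close>, \<open>r = norm (x - y)\<close>, with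
  \<open>a = n - 1\<close> or \<open>a = (n - 1) / 2\<close>. For \<open>z \<noteq> 0\<close> this rests on the bound
  \<open>C (1 / \<bar>w\<bar> + 1 / sqrt \<bar>w\<bar>)\<close>, uniform in \<open>0 \<le> \<nu> \<le> 1\<close> and \<open>Re w > 0\<close>, for the Macdonald integral
  \<open>\<integral> exp (- w cosh t) cosh (\<nu> t) dt\<close> over \<open>t > 0\<close> (integration by parts beyond \<open>t = min 1 (1 / sqrt \<bar>w\<bar>)\<close>); the
  integral is matched with the power series through Wronskians of the first-order system satisfied
  by the orders \<open>\<nu>\<close> and \<open>1 - \<nu>\<close>, the orders \<open>0\<close> and \<open>1\<close> are limits, the real axis is reached by
  continuity, and higher orders come from the recurrence.

  For \<open>n < q < p\<close> a weighted Riesz kernel is a geometric mean \<open>g0 powr (2 / q) * g1 powr (1 - 2 / q)\<close>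
  of a Hilbert--Schmidt kernel and a kernel satisfying a weighted Schur test. Cutting along
  \<open>g1 \<le> t * g0\<close> and choosing \<open>t\<close> by the level \<open>l\<close> shows that an orthonormal family with
  \<open>norm (T e) > l\<close> has at most \<open>O(l powr (- q))\<close> members. Applied to maximal families this gives
  compactness, and applied to eigenvectors of \<open>T\<^sup>* T\<close> it gives summability of the \<open>p\<close>-th powers of
  the singular values.\<close>

section \<open>The space of square integrable functions\<close>

text \<open>Both thresholds for \<open>\<delta>\<close> are the condition
  \<open>2 * \<delta> > n - b\<close>, at \<open>b = n - 1\<close> and at
  \<open>b = (n - 1) / 2\<close>: the singularity on the diagonal is always of the first kind, but
  for real \<open>z \<noteq> 0\<close> the decay at large distance is only of the second. Hence two
  Riesz exponents have to be served by one pair of comparison kernels. The auxiliary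
  \<open>q\<close> must exceed \<open>n\<close> because interpolation replaces \<open>b\<close> by
  \<open>c = b q / (q - 1)\<close>, and for \<open>b = n - 1\<close> local integrability,
  \<open>c < n\<close>, holds exactly if \<open>q > n\<close>. It must stay below \<open>p\<close>
  because the count is an estimate of weak type: summing over dyadic levels of singular values gives
  a convergent geometric series only for \<open>q < p\<close>. For the special functions the
  obstacle is that the integral representation converges absolutely only off the real
  \<open>z\<close>-axis, while a bound up to that axis is wanted; the estimate therefore uses
  nothing of the exponential beyond modulus at most 1.\<close>

lemma L2_rel_rep: "L2_rel (rep_L2 f) (rep_L2 f)"
  by (rule Quotient3_rep_reflp[OF Quotient3_L2])

lemma square_integrable_rep: "square_integrable (rep_L2 f)"
  using L2_rel_rep by (auto simp: L2_rel_def)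

lemma rep_L2_measurable [measurable]: "rep_L2 f \<in> borel_measurable lebesgue"
  using square_integrable_rep by (auto simp: square_integrable_def)

lemma rep_abs_L2: "square_integrable f \<Longrightarrow> AE x in lebesgue. rep_L2 (abs_L2 f) x = f x"
proof -
  assume "square_integrable f"
  then have "L2_rel f f" by (simp add: L2_rel_def)
  then have "L2_rel (rep_L2 (abs_L2 f)) f"
    by (rule rep_abs_rsp_left[OF Quotient3_L2])
  then show ?thesis by (simp add: L2_rel_def)
qed

lemma L2_eqI: "AE x in lebesgue. rep_L2 f x = rep_L2 g x \<Longrightarrow> f = g"
proof -
  assume "AE x in lebesgue. rep_L2 f x = rep_L2 g x"
  then have "L2_rel (rep_L2 f) (rep_L2 g)"
    by (simp add: L2_rel_def square_integrable_rep)
  then have "abs_L2 (rep_L2 f) = abs_L2 (rep_L2 g)"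
    by (rule Quotient3_rel_abs[OF Quotient3_L2])
  then show ?thesis by (simp add: Quotient3_abs_rep[OF Quotient3_L2])
qed

lemma cinner_L2_rep: "cinner_L2 f g = (\<integral>x. vec_cinner (rep_L2 f x) (rep_L2 g x) \<partial>lebesgue)"
  by (simp add: cinner_L2_def)

lemma rep_add: "AE x in lebesgue. rep_L2 (f + g) x = rep_L2 f x + rep_L2 g x"
  using rep_abs_L2[OF square_integrable_add[OF square_integrable_rep square_integrable_rep], of f g]
  by (simp add: plus_L2_def)

lemma rep_scale: "AE x in lebesgue. rep_L2 (c *\<^sub>C f) x = c *s rep_L2 f x"
  using rep_abs_L2[OF square_integrable_scale[OF square_integrable_rep], of c f]
  by (simp add: scaleC_L2_def)

lemma minus_L2_eq: "f - g = f + (- 1) *\<^sub>C (g :: ('a::euclidean_space, 'm::finite) L2)"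
  by (simp only: minus_L2_def uminus_L2_def)

lemma rep_diff: "AE x in lebesgue. rep_L2 (f - g) x = rep_L2 f x - rep_L2 g x"
  unfolding minus_L2_eq
  using rep_add[of f "(- 1) *\<^sub>C g"] rep_scale[of "-1" g]
  by eventually_elim (simp add: vec_eq_iff)

lemma norm_L2_sq: "(norm f)\<^sup>2 = (\<integral>x. (norm (rep_L2 f x))\<^sup>2 \<partial>lebesgue)"
  for f :: "('a::euclidean_space, 'm::finite) L2"
proof -
  have "(norm f)\<^sup>2 = Re (cinner_L2 f f)"
    unfolding norm_L2_def by (simp add: inner_L2_def inner_L2_transferred(5))
  also have "\<dots> = (\<integral>x. (norm (rep_L2 f x))\<^sup>2 \<partial>lebesgue)"
    unfolding cinner_L2_rep vec_cinner_self
    by (simp only: integral_complex_of_real Re_complex_of_real)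
  finally show ?thesis .
qed

lemma nn_integral_norm_L2: "(\<integral>\<^sup>+x. (ennreal (norm (rep_L2 f x)))\<^sup>2 \<partial>lebesgue) = ennreal ((norm f)\<^sup>2)"
  for f :: "('a::euclidean_space, 'm::finite) L2"
  unfolding norm_L2_sq
  using square_integrable_rep[of f]
  by (simp add: square_integrable_def nn_integral_eq_integral ennreal_power)

lemma square_integrable_iff_nn:
  "square_integrable f \<longleftrightarrow> f \<in> borel_measurable lebesgue \<and> (\<integral>\<^sup>+x. (ennreal (norm (f x)))\<^sup>2 \<partial>lebesgue) < \<infinity>"
  unfolding square_integrable_def
  by (auto simp: integrable_iff_bounded ennreal_power)

lemma nn_integral_norm_abs_L2:
  fixes f :: "'a::euclidean_space \<Rightarrow> complex^'m::finite"
  assumes "square_integrable f"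
  shows "ennreal ((norm (abs_L2 f))\<^sup>2) = (\<integral>\<^sup>+x. (ennreal (norm (f x)))\<^sup>2 \<partial>lebesgue)"
  unfolding nn_integral_norm_L2[symmetric]
  by (rule nn_integral_cong_AE) (use rep_abs_L2[OF assms] in auto)

lemma cinner_L2_abs:
  assumes "square_integrable f" "square_integrable g"
  shows "cinner_L2 (abs_L2 f) (abs_L2 g) = (\<integral>x. vec_cinner (f x) (g x) \<partial>lebesgue)"
  unfolding cinner_L2_rep
  using rep_abs_L2[OF assms(1)] rep_abs_L2[OF assms(2)] assms
  by (intro integral_cong_AE)
     (auto simp: square_integrable_def vec_cinner_measurable elim: eventually_elim2)

lemma abs_rep_L2: "abs_L2 (rep_L2 f) = f"
  by (rule Quotient3_abs_rep[OF Quotient3_L2])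

lemma norm_scaleC_L2: "norm (c *\<^sub>C f) = cmod c * norm f"
  for f :: "('a::euclidean_space, 'm::finite) L2"
proof -
  have "cinner_L2 (c *\<^sub>C f) (c *\<^sub>C f) = of_real ((cmod c)\<^sup>2) * cinner_L2 f f"
    by (simp add: inner_L2_transferred(2,3) complex_norm_square del: of_real_power)
  then have "(norm (c *\<^sub>C f))\<^sup>2 = (cmod c * norm f)\<^sup>2"
    by (simp add: norm_L2_def inner_L2_def inner_L2_transferred(5) power_mult_distrib
        real_sqrt_mult Re_complex_of_real del: of_real_power)
  then show ?thesis
    by (simp add: power2_eq_iff_nonneg)
qed

text \<open>Conjugate-linearity in the first argument gives Re <i f, g> = Im <f, g>. This is the
  bridge from complex coefficients to the real inner product in which orthonormal families are
  taken.\<close>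

lemma cinner_L2_eq_inner:
  "cinner_L2 f g = Complex (inner f g) (inner (\<i> *\<^sub>C f) g)"
  by (simp add: complex_eq_iff inner_L2_def inner_L2_transferred(2))

text \<open>A countable cover by Borel sets of finite measure remains one after completion.
  Sigma-finiteness is what Fubini and Tonelli ask of the two Lebesgue factors.\<close>

interpretation lebesgue: sigma_finite_measure "lebesgue :: 'a::euclidean_space measure"
proof
  obtain A :: "'a set set" where "countable A" "A \<subseteq> sets lborel" "\<Union>A = space lborel" "\<forall>a\<in>A. emeasure lborel a \<noteq> \<infinity>"
    using lborel.sigma_finite_countable by metis
  then show "\<exists>A::'a set set. countable A \<and> A \<subseteq> sets lebesgue \<and> \<Union>A = space lebesgue
      \<and> (\<forall>a\<in>A. emeasure lebesgue a \<noteq> \<infinity>)"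
    by (intro exI[of _ A]) (auto simp: subset_eq)
qed

interpretation lebesgue_pair: pair_sigma_finite
  "lebesgue :: 'a::euclidean_space measure" "lebesgue :: 'b::euclidean_space measure" ..

subsection \<open>Completeness\<close>

text \<open>Riesz--Fischer for vector-valued functions: a rapidly convergent subsequence converges
  almost everywhere, and a weighted square sum of its increments controls the distance to the limit.
  Completeness enters where compactness is deduced from total boundedness.\<close>

lemma Cauchy_imp_convergent_L2:
  fixes F :: "nat \<Rightarrow> ('a::euclidean_space, 'm::finite) L2"
  assumes "Cauchy F"
  shows "convergent F"
proof -
  have "\<exists>r :: nat \<Rightarrow> nat. strict_mono r \<and> (\<forall>k. norm (F (r (Suc k)) - F (r k)) < (1/2) ^ k)"
  proof -
    have "\<forall>k. \<exists>N. \<forall>i\<ge>N. \<forall>j\<ge>N. norm (F i - F j) < (1/2) ^ k"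
      using assms unfolding Cauchy_def dist_norm by (metis zero_less_power half_gt_zero_iff zero_less_one)
    then obtain N where N: "\<And>k i j. i \<ge> N k \<Longrightarrow> j \<ge> N k \<Longrightarrow> norm (F i - F j) < (1/2) ^ k"
      by metis
    define r where "r = rec_nat (N 0) (\<lambda>k m. max (Suc m) (N (Suc k)))"
    have r_Suc: "r (Suc k) = max (Suc (r k)) (N (Suc k))" for k by (simp add: r_def)
    have rN: "r k \<ge> N k" for k by (cases k) (simp_all add: r_def)
    have sm: "strict_mono r" by (rule strict_monoI_Suc) (simp add: r_Suc)
    have "norm (F (r (Suc k)) - F (r k)) < (1/2) ^ k" for k
      by (rule N) (use rN[of k] r_Suc[of k] in auto)
    with sm show ?thesis by blast
  qed
  then obtain r :: "nat \<Rightarrow> nat" where r: "strict_mono r"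
    and d: "\<And>k. norm (F (r (Suc k)) - F (r k)) < (1/2) ^ k" by blast
  define f where "f k = rep_L2 (F (r k))" for k
  have [measurable]: "f k \<in> borel_measurable lebesgue" for k by (simp add: f_def)
  define a where "a k x = norm (f (Suc k) x - f k x)" for k x
  have [measurable]: "a k \<in> borel_measurable lebesgue" for k unfolding a_def by measurable
  have a_nonneg: "a k x \<ge> 0" for k x by (simp add: a_def)
  have ia: "(\<integral>\<^sup>+x. (ennreal (a k x))\<^sup>2 \<partial>lebesgue) \<le> ennreal ((1/4) ^ k)" for k
  proof -
    have "(\<integral>\<^sup>+x. (ennreal (a k x))\<^sup>2 \<partial>lebesgue)
       = (\<integral>\<^sup>+x. (ennreal (norm (rep_L2 (F (r (Suc k)) - F (r k)) x)))\<^sup>2 \<partial>lebesgue)"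
      by (rule nn_integral_cong_AE) (use rep_diff[of "F (r (Suc k))" "F (r k)"] in \<open>auto simp: a_def f_def\<close>)
    also have "\<dots> = ennreal ((norm (F (r (Suc k)) - F (r k)))\<^sup>2)"
      by (rule nn_integral_norm_L2)
    also have "\<dots> \<le> ennreal (((1/2) ^ k)\<^sup>2)"
      by (intro ennreal_leI power_mono less_imp_le[OF d]) auto
    also have "((1/2::real) ^ k)\<^sup>2 = (1/4) ^ k"
      by (simp add: power2_eq_square flip: power_mult_distrib)
    finally show ?thesis .
  qed
  \<comment> \<open>The weight \<open>2 ^ k\<close> lies between 1 and \<open>4 ^ k\<close>: the
    increments have squared norm at most \<open>(1/4) ^ k\<close>, so \<open>G\<close> stays
    integrable, while Cauchy--Schwarz against \<open>(1/2) ^ k\<close> turns finiteness of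
    \<open>G x\<close> into a geometric bound for the pointwise tails.\<close>
  define G where "G x = (\<Sum>k. ennreal (2 ^ k * (a k x)\<^sup>2))" for x
  have [measurable]: "G \<in> borel_measurable lebesgue" unfolding G_def by measurable
  have iG: "(\<integral>\<^sup>+x. G x \<partial>lebesgue) \<le> 2"
  proof -
    have "(\<integral>\<^sup>+x. G x \<partial>lebesgue) = (\<Sum>k. \<integral>\<^sup>+x. ennreal (2 ^ k * (a k x)\<^sup>2) \<partial>lebesgue)"
      unfolding G_def by (rule nn_integral_suminf) measurable
    also have "\<dots> \<le> (\<Sum>k. ennreal ((1/2) ^ k))"
    proof (rule suminf_le)
      fix k
      have "(\<integral>\<^sup>+x. ennreal (2 ^ k * (a k x)\<^sup>2) \<partial>lebesgue) = ennreal (2 ^ k) * (\<integral>\<^sup>+x. (ennreal (a k x))\<^sup>2 \<partial>lebesgue)"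
        by (subst nn_integral_cmult[symmetric]) (auto simp: ennreal_mult' ennreal_power a_nonneg)
      also have "\<dots> \<le> ennreal (2 ^ k) * ennreal ((1/4) ^ k)"
        by (intro mult_left_mono ia) auto
      also have "\<dots> = ennreal ((1/2) ^ k)"
        by (simp add: ennreal_mult'[symmetric] flip: power_mult_distrib)
      finally show "(\<integral>\<^sup>+x. ennreal (2 ^ k * (a k x)\<^sup>2) \<partial>lebesgue) \<le> ennreal ((1/2) ^ k)" .
    qed auto
    also have "\<dots> = ennreal (\<Sum>k. (1/2) ^ k)"
      by (rule suminf_ennreal2) (auto intro: summable_geometric)
    also have "\<dots> = 2" by (simp add: suminf_geometric)
    finally show ?thesis .
  qed
  have AEG: "AE x in lebesgue. G x \<noteq> \<infinity>"
    by (rule nn_integral_PInf_AE) (use iG in \<open>auto simp: top_unique\<close>)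
  have sumdiff: "norm (f (K + j) x - f K x) \<le> (\<Sum>k<j. a (K + k) x)" for K j x
  proof (induction j)
    case (Suc j)
    have "norm (f (K + Suc j) x - f K x) \<le> norm (f (K + Suc j) x - f (K + j) x) + norm (f (K + j) x - f K x)"
      by (metis norm_triangle_ineq diff_add_cancel add_diff_eq)
    with Suc show ?case by (simp add: a_def)
  qed auto
  have tail: "norm (f (K + j) x - f K x) ^ 2 \<le> 2 * (1/2) ^ K * enn2real (G x)"
    if Gx: "G x \<noteq> \<infinity>" for K j x
  proof -
    have sumG: "(\<Sum>k<j. 2 ^ (K + k) * (a (K + k) x)\<^sup>2) \<le> enn2real (G x)"
    proof -
      have "ennreal (\<Sum>k<j. 2 ^ (K + k) * (a (K + k) x)\<^sup>2) = (\<Sum>k<j. ennreal (2 ^ (K + k) * (a (K + k) x)\<^sup>2))"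
        by (simp add: sum_ennreal)
      also have "\<dots> = (\<Sum>i\<in>(+) K ` {..<j}. ennreal (2 ^ i * (a i x)\<^sup>2))"
        by (subst sum.reindex) auto
      also have "\<dots> \<le> G x"
        unfolding G_def by (rule sum_le_suminf) auto
      finally have "ennreal (\<Sum>k<j. 2 ^ (K + k) * (a (K + k) x)\<^sup>2) \<le> ennreal (enn2real (G x))"
        using Gx by (simp add: less_top)
      then show ?thesis by (simp add: ennreal_le_iff)
    qed
    have "(\<Sum>k<j. a (K + k) x)\<^sup>2 = (\<Sum>k<j. sqrt ((1/2) ^ (K+k)) * (sqrt (2 ^ (K+k)) * a (K + k) x))\<^sup>2"
    proof -
      have "sqrt ((1/2) ^ (K+k)) * sqrt (2 ^ (K+k)) = 1" for k
        by (simp flip: real_sqrt_mult power_mult_distrib)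
      then have "sqrt ((1/2) ^ (K+k)) * (sqrt (2 ^ (K+k)) * a (K + k) x) = a (K+k) x" for k
        by (simp only: mult.assoc[symmetric] mult_1)
      then show ?thesis by presburger
    qed
    also have "\<dots> \<le> (\<Sum>k<j. (sqrt ((1/2) ^ (K+k)))\<^sup>2) * (\<Sum>k<j. (sqrt (2 ^ (K+k)) * a (K + k) x)\<^sup>2)"
      by (rule Cauchy_Schwarz_ineq_sum)
    also have "\<dots> = (\<Sum>k<j. (1/2) ^ (K+k)) * (\<Sum>k<j. 2 ^ (K+k) * (a (K + k) x)\<^sup>2)"
      by (simp add: power_mult_distrib)
    also have "\<dots> \<le> (2 * (1/2) ^ K) * enn2real (G x)"
    proof (rule mult_mono)
      have "(\<Sum>k<j. (1/2::real) ^ (K+k)) = (1/2)^K * (\<Sum>k<j. (1/2) ^ k)"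
        by (simp add: power_add sum_distrib_left)
      also have "(\<Sum>k<j. (1/2::real) ^ k) \<le> 2"
        using sum_le_suminf[of "\<lambda>k. (1/2::real)^k" "{..<j}"] suminf_geometric[of "1/2::real"]
        by (simp add: summable_geometric)
      finally show "(\<Sum>k<j. (1/2::real) ^ (K+k)) \<le> 2 * (1/2)^K" by simp
    qed (use sumG in \<open>auto simp: sum_nonneg\<close>)
    finally have "(\<Sum>k<j. a (K + k) x)\<^sup>2 \<le> 2 * (1/2) ^ K * enn2real (G x)" .
    moreover have "norm (f (K + j) x - f K x) ^ 2 \<le> (\<Sum>k<j. a (K + k) x)\<^sup>2"
      by (intro power_mono sumdiff) auto
    ultimately show ?thesis by linarith
  qed
  \<comment> \<open>On the null set where \<open>G\<close> is infinite the value 0 is chosen, so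
    that \<open>g\<close> is an everywhere limit of measurable functions.\<close>
  define g where "g x = (if G x \<noteq> \<infinity> then lim (\<lambda>k. f k x) else 0)" for x
  have conv: "(\<lambda>k. f k x) \<longlonglongrightarrow> g x" if Gx: "G x \<noteq> \<infinity>" for x
  proof -
    have "Cauchy (\<lambda>k. f k x)"
    proof (rule CauchyI')
      fix e :: real assume "e > 0"
      have "(\<lambda>K. 2 * (1/2::real) ^ K * enn2real (G x)) \<longlonglongrightarrow> 2 * 0 * enn2real (G x)"
        by (intro tendsto_intros LIMSEQ_power_zero) auto
      then have "eventually (\<lambda>K. 2 * (1/2::real) ^ K * enn2real (G x) < e\<^sup>2) sequentially"
        using \<open>e > 0\<close> by (auto simp: order_tendsto_iff)
      then obtain K0 where K0: "\<And>K. K \<ge> K0 \<Longrightarrow> 2 * (1/2::real) ^ K * enn2real (G x) < e\<^sup>2"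
        by (auto simp: eventually_sequentially)
      show "\<exists>M. \<forall>m\<ge>M. \<forall>n>m. dist (f m x) (f n x) < e"
      proof (intro exI[of _ K0] allI impI)
        fix m n assume "K0 \<le> m" "m < n"
        then obtain j where "n = m + j" using less_imp_add_positive by blast
        with tail[OF Gx, of m j] K0[OF \<open>K0 \<le> m\<close>] have "norm (f n x - f m x) ^ 2 < e\<^sup>2" by simp
        then have "norm (f n x - f m x) < e"
          using \<open>e > 0\<close> by (auto intro: power_less_imp_less_base)
        then show "dist (f m x) (f n x) < e"
          by (simp add: dist_norm norm_minus_commute)
      qed
    qed
    then have "convergent (\<lambda>k. f k x)" by (simp add: Cauchy_convergent_iff)
    then show ?thesis using Gx by (simp add: g_def convergent_LIMSEQ_iff)
  qed
  have [measurable]: "g \<in> borel_measurable lebesgue"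
  proof (rule borel_measurable_LIMSEQ_metric)
    show "(\<lambda>x. if G x \<noteq> \<infinity> then f k x else 0) \<in> borel_measurable lebesgue" for k by measurable
    show "(\<lambda>k. if G x \<noteq> \<infinity> then f k x else 0) \<longlonglongrightarrow> g x" for x
      using conv[of x] by (cases "G x = \<infinity>") (auto simp: g_def)
  qed
  \<comment> \<open>The pointwise tail bound passes to the limit and is integrated; the integral of
    \<open>G\<close> is at most 2, which turns \<open>2 * (1/2) ^ K\<close> into
    \<open>4 * (1/2) ^ K\<close>.\<close>
  have close: "(\<integral>\<^sup>+x. (ennreal (norm (f K x - g x)))\<^sup>2 \<partial>lebesgue) \<le> ennreal (4 * (1/2) ^ K)" for K
  proof -
    have "(\<integral>\<^sup>+x. (ennreal (norm (f K x - g x)))\<^sup>2 \<partial>lebesgue) \<le> (\<integral>\<^sup>+x. ennreal (2 * (1/2) ^ K) * G x \<partial>lebesgue)"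
    proof (rule nn_integral_mono_AE, use AEG in eventually_elim)
      fix x assume Gx: "G x \<noteq> \<infinity>"
      have "(\<lambda>j. norm (f (K + j) x - f K x) ^ 2) \<longlonglongrightarrow> norm (g x - f K x) ^ 2"
        using LIMSEQ_ignore_initial_segment[OF conv[OF Gx], of K]
        by (intro tendsto_intros) (simp add: add.commute)
      then have "norm (g x - f K x) ^ 2 \<le> 2 * (1/2) ^ K * enn2real (G x)"
        by (rule LIMSEQ_le_const2) (use tail[OF Gx] in auto)
      then have "ennreal (norm (f K x - g x) ^ 2) \<le> ennreal (2 * (1/2) ^ K * enn2real (G x))"
        by (simp add: norm_minus_commute ennreal_leI)
      also have "\<dots> = ennreal (2 * (1/2) ^ K) * G x"
        using Gx by (simp add: ennreal_mult less_top)
      finally show "(ennreal (norm (f K x - g x)))\<^sup>2 \<le> ennreal (2 * (1/2) ^ K) * G x"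
        by (simp add: ennreal_power)
    qed
    also have "\<dots> = ennreal (2 * (1/2) ^ K) * (\<integral>\<^sup>+x. G x \<partial>lebesgue)"
      by (rule nn_integral_cmult) measurable
    also have "\<dots> \<le> ennreal (2 * (1/2) ^ K) * 2"
      by (intro mult_left_mono iG) auto
    also have "\<dots> = ennreal (2 * (1/2) ^ K * 2)"
      by (subst ennreal_mult) auto
    finally show ?thesis by (simp add: mult_ac)
  qed
  have sqd: "square_integrable (\<lambda>x. f K x - g x)" for K
    unfolding square_integrable_iff_nn using close[of K]
    by (auto intro: le_less_trans)
  have sqg: "square_integrable g"
  proof -
    have "square_integrable (\<lambda>x. f 0 x + (-1) *s (f 0 x - g x))"
      by (intro square_integrable_add square_integrable_scale sqd)
         (simp add: f_def square_integrable_rep)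
    moreover have "f 0 x + (-1) *s (f 0 x - g x) = g x" for x
      by (simp add: vec_eq_iff)
    ultimately show ?thesis by simp
  qed
  have nd: "norm (F (r K) - abs_L2 g) ^ 2 \<le> 4 * (1/2) ^ K" for K
  proof -
    have "ennreal (norm (F (r K) - abs_L2 g) ^ 2) = (\<integral>\<^sup>+x. (ennreal (norm (f K x - g x)))\<^sup>2 \<partial>lebesgue)"
      unfolding nn_integral_norm_L2[symmetric]
      by (rule nn_integral_cong_AE)
         (use rep_diff[of "F (r K)" "abs_L2 g"] rep_abs_L2[OF sqg] in \<open>eventually_elim, simp add: f_def\<close>)
    with close[of K] have "ennreal (norm (F (r K) - abs_L2 g) ^ 2) \<le> ennreal (4 * (1/2) ^ K)" by simp
    then show ?thesis by (subst (asm) ennreal_le_iff) auto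
  qed
  have "(\<lambda>K. norm (F (r K) - abs_L2 g) ^ 2) \<longlonglongrightarrow> 0"
  proof (rule real_tendsto_sandwich[of "\<lambda>_. 0" _ _ "\<lambda>K. 4 * (1/2) ^ K"])
    have "(\<lambda>K. 4 * (1/2::real) ^ K) \<longlonglongrightarrow> 4 * 0"
      by (intro tendsto_intros LIMSEQ_power_zero) auto
    then show "(\<lambda>K. 4 * (1/2::real) ^ K) \<longlonglongrightarrow> 0" by simp
    show "\<forall>\<^sub>F K in sequentially. (norm (F (r K) - abs_L2 g))\<^sup>2 \<le> 4 * (1/2) ^ K"
      using nd by (intro always_eventually) blast
  qed auto
  then have "(\<lambda>K. norm (F (r K) - abs_L2 g)) \<longlonglongrightarrow> 0"
    using tendsto_real_sqrt by fastforce
  then have "(F \<circ> r) \<longlonglongrightarrow> abs_L2 g"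
    by (simp add: tendsto_iff dist_norm o_def)
  then show ?thesis
    using assms r by (metis LIMSEQ_imp_Suc Cauchy_converges_subseq convergent_def)
qed

lemma complete_L2: "complete (UNIV :: ('a::euclidean_space, 'm::finite) L2 set)"
  unfolding complete_def using Cauchy_imp_convergent_L2 by (auto simp: convergent_def)

section \<open>Integral operators with bounded kernels\<close>

text \<open>The norm of nested vectors is the Frobenius norm, so this is Cauchy--Schwarz in each
  row.\<close>

lemma norm_matrix_vector_mult_le: "norm (A *v v) \<le> norm A * norm v"
  for A :: "complex^'n::finite^'m::finite"
proof -
  have "norm ((A *v v) $ i) \<le> norm (A $ i) * norm v" for i
  proof -
    have "norm ((A *v v) $ i) \<le> (\<Sum>j\<in>UNIV. norm (A $ i $ j) * norm (v $ j))"
      unfolding matrix_vector_mult_def by (simp add: norm_sum order_trans[OF norm_sum] norm_mult sum_mono)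
    also have "\<dots> = (\<Sum>j\<in>UNIV. \<bar>norm (A $ i $ j)\<bar> * \<bar>norm (v $ j)\<bar>)" by simp
    also have "\<dots> \<le> L2_set (\<lambda>j. norm (A $ i $ j)) UNIV * L2_set (\<lambda>j. norm (v $ j)) UNIV"
      by (rule L2_set_mult_ineq)
    finally show ?thesis by (simp add: norm_vec_def)
  qed
  then have "norm (A *v v) \<le> L2_set (\<lambda>i. norm (A $ i) * norm v) UNIV"
    unfolding norm_vec_def[of "A *v v"] by (intro L2_set_mono) auto
  also have "\<dots> = norm A * norm v"
    by (simp add: L2_set_left_distrib[symmetric] norm_vec_def[of A])
  finally show ?thesis .
qed

lemma norm_vec_cinner_le_mult: "norm (vec_cinner v w) \<le> norm v * norm w"
proof -
  have "norm (vec_cinner v w) \<le> (\<Sum>j\<in>UNIV. \<bar>norm (v $ j)\<bar> * \<bar>norm (w $ j)\<bar>)"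
    unfolding vec_cinner_def by (rule order_trans[OF norm_sum]) (simp add: norm_mult)
  also have "\<dots> \<le> L2_set (\<lambda>j. norm (v $ j)) UNIV * L2_set (\<lambda>j. norm (w $ j)) UNIV"
    by (rule L2_set_mult_ineq)
  finally show ?thesis by (simp add: norm_vec_def)
qed

lemma borel_measurable_matrix_vector_mult [measurable]:
  fixes f :: "'b \<Rightarrow> complex^'n::finite^'m::finite"
  assumes [measurable]: "f \<in> borel_measurable M" "g \<in> borel_measurable M"
  shows "(\<lambda>x. f x *v g x) \<in> borel_measurable M"
proof -
  have "continuous_on UNIV (\<lambda>p. fst p *v snd p :: complex^'m)"
    unfolding matrix_vector_mult_def by (intro continuous_intros)
  then show ?thesis
    using borel_measurable_continuous_on[of "\<lambda>p. fst p *v snd p" "\<lambda>x. (f x, g x)" M] by auto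
qed

lemma borel_measurable_vec_cinner [measurable]:
  assumes [measurable]: "f \<in> borel_measurable M" "g \<in> borel_measurable M"
  shows "(\<lambda>x. vec_cinner (f x) (g x)) \<in> borel_measurable M"
proof -
  have "continuous_on UNIV (\<lambda>p. vec_cinner (fst p) (snd p) :: complex)"
    unfolding vec_cinner_def by (intro continuous_intros)
  then show ?thesis
    using borel_measurable_continuous_on
      [of "\<lambda>p. vec_cinner (fst p) (snd p)" "\<lambda>x. (f x, g x)" M] by auto
qed

text \<open>The estimate is required of the scalar kernel \<open>norm (K x y)\<close> acting on
  nonnegative functions. In extended reals it presupposes no integrability, and it yields at once
  absolute convergence almost everywhere, the operator bound and the integrability behind
  Fubini.\<close>

definition bounded_kernel :: "('a::euclidean_space \<Rightarrow> 'a \<Rightarrow> complex^'m::finite^'m) \<Rightarrow> real \<Rightarrow> bool" where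
  "bounded_kernel K B \<longleftrightarrow> 0 \<le> B \<and>
     (\<lambda>(x, y). K x y) \<in> borel_measurable (lebesgue \<Otimes>\<^sub>M lebesgue) \<and>
     (\<forall>f\<in>borel_measurable lebesgue.
        (\<integral>\<^sup>+x. (\<integral>\<^sup>+y. ennreal (norm (K x y)) * f y \<partial>lebesgue)\<^sup>2 \<partial>lebesgue)
          \<le> ennreal (B\<^sup>2) * (\<integral>\<^sup>+y. (f y)\<^sup>2 \<partial>lebesgue))"

definition kernel_op :: "('a::euclidean_space \<Rightarrow> 'a \<Rightarrow> complex^'m::finite^'m) \<Rightarrow> ('a, 'm) L2 \<Rightarrow> ('a, 'm) L2" where
  "kernel_op K f = abs_L2 (\<lambda>x. \<integral>y. K x y *v rep_L2 f y \<partial>lebesgue)"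

definition adjoint_kernel :: "('a \<Rightarrow> 'a \<Rightarrow> complex^'m::finite^'m) \<Rightarrow> 'a \<Rightarrow> 'a \<Rightarrow> complex^'m^'m" where
  "adjoint_kernel K x y = (\<chi> j k. cnj (K y x $ k $ j))"

lemma vec_cinner_adjoint_kernel: "vec_cinner (K x y *v v) w = vec_cinner v (adjoint_kernel K y x *v w)"
  unfolding vec_cinner_def adjoint_kernel_def matrix_vector_mult_def
  by (simp add: sum_distrib_left sum_distrib_right mult_ac) (rule sum.swap)

context
  fixes K :: "'a::euclidean_space \<Rightarrow> 'a \<Rightarrow> complex^'m::finite^'m" and B :: real
  assumes K: "bounded_kernel K B"
begin

lemma bounded_kernel_measurable:
  "case_prod K \<in> borel_measurable (lebesgue \<Otimes>\<^sub>M lebesgue)"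
  using K by (simp add: bounded_kernel_def)

lemma bounded_kernel_section [measurable]: "K x \<in> borel_measurable lebesgue"
  using measurable_compose[OF measurable_Pair1' bounded_kernel_measurable, of x] by simp

lemma bounded_kernel_nonneg: "0 \<le> B"
  using K by (simp add: bounded_kernel_def)

lemma bounded_kernel_estimate:
  "f \<in> borel_measurable lebesgue \<Longrightarrow>
    (\<integral>\<^sup>+x. (\<integral>\<^sup>+y. ennreal (norm (K x y)) * f y \<partial>lebesgue)\<^sup>2 \<partial>lebesgue)
          \<le> ennreal (B\<^sup>2) * (\<integral>\<^sup>+y. (f y)\<^sup>2 \<partial>lebesgue)"
  using K by (simp add: bounded_kernel_def)

lemma bounded_kernel_AE_finite:
  assumes f: "square_integrable f"
  shows "AE x in lebesgue. (\<integral>\<^sup>+y. ennreal (norm (K x y)) * ennreal (norm (f y)) \<partial>lebesgue) < \<infinity>"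
proof -
  note [measurable] = bounded_kernel_measurable
  have [measurable]: "f \<in> borel_measurable lebesgue" using f by (simp add: square_integrable_def)
  let ?F = "\<lambda>x. (\<integral>\<^sup>+y. ennreal (norm (K x y)) * ennreal (norm (f y)) \<partial>lebesgue)"
  have "(\<integral>\<^sup>+x. (?F x)\<^sup>2 \<partial>lebesgue) \<le> ennreal (B\<^sup>2) * (\<integral>\<^sup>+y. (ennreal (norm (f y)))\<^sup>2 \<partial>lebesgue)"
    by (rule bounded_kernel_estimate) measurable
  also have "\<dots> < \<infinity>"
    using f by (simp add: square_integrable_iff_nn ennreal_mult_less_top)
  finally have "AE x in lebesgue. (?F x)\<^sup>2 \<noteq> \<infinity>"
    by (intro nn_integral_PInf_AE) auto
  then show ?thesis
    by eventually_elim (auto simp: less_top[symmetric] power2_eq_square ennreal_mult_eq_top_iff)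
qed

lemma bounded_kernel_integrable:
  assumes f: "square_integrable f"
  shows "AE x in lebesgue. integrable lebesgue (\<lambda>y. K x y *v f y)"
  using bounded_kernel_AE_finite[OF f]
proof eventually_elim
  have [measurable]: "f \<in> borel_measurable lebesgue" using f by (simp add: square_integrable_def)
  fix x assume fin: "(\<integral>\<^sup>+y. ennreal (norm (K x y)) * ennreal (norm (f y)) \<partial>lebesgue) < \<infinity>"
  show "integrable lebesgue (\<lambda>y. K x y *v f y)"
  proof (rule integrableI_bounded)
    show "(\<integral>\<^sup>+y. ennreal (norm (K x y *v f y)) \<partial>lebesgue) < \<infinity>"
      by (rule le_less_trans[OF nn_integral_mono fin])
         (simp add: norm_matrix_vector_mult_le ennreal_leI flip: ennreal_mult)
  qed measurable
qed

lemma
  assumes f: "square_integrable f"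
  shows nn_integral_kernel_le:
    "(\<integral>\<^sup>+x. (ennreal (norm (\<integral>y. K x y *v f y \<partial>lebesgue)))\<^sup>2 \<partial>lebesgue)
       \<le> ennreal (B\<^sup>2) * (\<integral>\<^sup>+y. (ennreal (norm (f y)))\<^sup>2 \<partial>lebesgue)" (is ?A)
  and square_integrable_kernel: "square_integrable (\<lambda>x. \<integral>y. K x y *v f y \<partial>lebesgue)" (is ?B)
proof -
  note [measurable] = bounded_kernel_measurable
  have [measurable]: "f \<in> borel_measurable lebesgue" using f by (simp add: square_integrable_def)
  have "(\<integral>\<^sup>+x. (ennreal (norm (\<integral>y. K x y *v f y \<partial>lebesgue)))\<^sup>2 \<partial>lebesgue)
     \<le> (\<integral>\<^sup>+x. (\<integral>\<^sup>+y. ennreal (norm (K x y)) * ennreal (norm (f y)) \<partial>lebesgue)\<^sup>2 \<partial>lebesgue)"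
  proof (rule nn_integral_mono_AE, use bounded_kernel_integrable[OF f] in eventually_elim)
    fix x assume "integrable lebesgue (\<lambda>y. K x y *v f y)"
    then have "ennreal (norm (\<integral>y. K x y *v f y \<partial>lebesgue)) \<le> (\<integral>\<^sup>+y. ennreal (norm (K x y *v f y)) \<partial>lebesgue)"
      by (rule integral_norm_bound_ennreal)
    also have "\<dots> \<le> (\<integral>\<^sup>+y. ennreal (norm (K x y)) * ennreal (norm (f y)) \<partial>lebesgue)"
      by (rule nn_integral_mono) (simp add: norm_matrix_vector_mult_le ennreal_leI flip: ennreal_mult)
    finally show "(ennreal (norm (\<integral>y. K x y *v f y \<partial>lebesgue)))\<^sup>2 \<le> (\<integral>\<^sup>+y. ennreal (norm (K x y)) * ennreal (norm (f y)) \<partial>lebesgue)\<^sup>2"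
      by (rule power_mono) simp
  qed
  also have "\<dots> \<le> ennreal (B\<^sup>2) * (\<integral>\<^sup>+y. (ennreal (norm (f y)))\<^sup>2 \<partial>lebesgue)"
    by (rule bounded_kernel_estimate) measurable
  finally show ?A .
  also have "ennreal (B\<^sup>2) * (\<integral>\<^sup>+y. (ennreal (norm (f y)))\<^sup>2 \<partial>lebesgue) < \<infinity>"
    using f by (simp add: square_integrable_iff_nn ennreal_mult_less_top)
  finally show ?B
    unfolding square_integrable_iff_nn by (auto intro!: lebesgue.borel_measurable_lebesgue_integral)
qed

lemma rep_kernel_op: "AE x in lebesgue. rep_L2 (kernel_op K f) x = (\<integral>y. K x y *v rep_L2 f y \<partial>lebesgue)"
  unfolding kernel_op_def by (intro rep_abs_L2 square_integrable_kernel square_integrable_rep)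

lemma norm_kernel_op_le: "norm (kernel_op K f) \<le> B * norm f"
proof -
  have "ennreal ((norm (kernel_op K f))\<^sup>2) \<le> ennreal (B\<^sup>2) * ennreal ((norm f)\<^sup>2)"
    using nn_integral_kernel_le[OF square_integrable_rep, of f]
    unfolding kernel_op_def nn_integral_norm_abs_L2[OF square_integrable_kernel[OF square_integrable_rep]]
      nn_integral_norm_L2 .
  then have "ennreal ((norm (kernel_op K f))\<^sup>2) \<le> ennreal ((B * norm f)\<^sup>2)"
    by (simp add: ennreal_mult' power_mult_distrib)
  then have "(norm (kernel_op K f))\<^sup>2 \<le> (B * norm f)\<^sup>2"
    by (subst (asm) ennreal_le_iff) auto
  then show ?thesis
    by (rule power2_le_imp_le) (simp add: bounded_kernel_nonneg)
qed

lemma kernel_op_scale: "kernel_op K (c *\<^sub>C f) = c *\<^sub>C kernel_op K f"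
proof (rule L2_eqI)
  have bl: "bounded_linear (\<lambda>v::complex^'m. c *s v)"
    unfolding vector_scalar_mult_def
    by (intro bounded_linear_intro[of _ "cmod c"])
       (auto simp: vec_eq_iff algebra_simps norm_vector_scalar_mult[unfolded vector_scalar_mult_def])
  show "AE x in lebesgue. rep_L2 (kernel_op K (c *\<^sub>C f)) x = rep_L2 (c *\<^sub>C kernel_op K f) x"
    using rep_kernel_op[of "c *\<^sub>C f"] rep_kernel_op[of f] rep_scale[of c "kernel_op K f"]
      bounded_kernel_integrable[OF square_integrable_rep, of f]
  proof eventually_elim
    fix x
    assume int: "integrable lebesgue (\<lambda>y. K x y *v rep_L2 f y)"
      and e: "rep_L2 (kernel_op K (c *\<^sub>C f)) x = (\<integral>y. K x y *v rep_L2 (c *\<^sub>C f) y \<partial>lebesgue)"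
      "rep_L2 (kernel_op K f) x = (\<integral>y. K x y *v rep_L2 f y \<partial>lebesgue)"
      "rep_L2 (c *\<^sub>C kernel_op K f) x = c *s rep_L2 (kernel_op K f) x"
    have "(\<integral>y. K x y *v rep_L2 (c *\<^sub>C f) y \<partial>lebesgue) = (\<integral>y. c *s (K x y *v rep_L2 f y) \<partial>lebesgue)"
    proof (rule integral_cong_AE)
      show "(\<lambda>y. c *s (K x y *v rep_L2 f y)) \<in> borel_measurable lebesgue"
        using int bl by (intro borel_measurable_integrable integrable_bounded_linear[OF bl])
      show "AE y in lebesgue. K x y *v rep_L2 (c *\<^sub>C f) y = c *s (K x y *v rep_L2 f y)"
        using rep_scale[of c f] by eventually_elim (simp add: vector_scalar_commute)
    qed measurable
    also have "\<dots> = c *s (\<integral>y. K x y *v rep_L2 f y \<partial>lebesgue)"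
      by (rule integral_bounded_linear[OF bl int])
    finally show "rep_L2 (kernel_op K (c *\<^sub>C f)) x = rep_L2 (c *\<^sub>C kernel_op K f) x"
      by (simp add: e)
  qed
qed

lemma kernel_op_add: "kernel_op K (f + g) = kernel_op K f + kernel_op K g"
proof (rule L2_eqI)
  show "AE x in lebesgue. rep_L2 (kernel_op K (f + g)) x = rep_L2 (kernel_op K f + kernel_op K g) x"
    using rep_kernel_op[of "f + g"] rep_kernel_op[of f] rep_kernel_op[of g]
      rep_add[of "kernel_op K f" "kernel_op K g"]
      bounded_kernel_integrable[OF square_integrable_rep, of f]
      bounded_kernel_integrable[OF square_integrable_rep, of g]
  proof eventually_elim
    fix x
    assume int: "integrable lebesgue (\<lambda>y. K x y *v rep_L2 f y)" "integrable lebesgue (\<lambda>y. K x y *v rep_L2 g y)"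
      and e: "rep_L2 (kernel_op K (f + g)) x = (\<integral>y. K x y *v rep_L2 (f + g) y \<partial>lebesgue)"
      "rep_L2 (kernel_op K f) x = (\<integral>y. K x y *v rep_L2 f y \<partial>lebesgue)"
      "rep_L2 (kernel_op K g) x = (\<integral>y. K x y *v rep_L2 g y \<partial>lebesgue)"
      "rep_L2 (kernel_op K f + kernel_op K g) x = rep_L2 (kernel_op K f) x + rep_L2 (kernel_op K g) x"
    have "(\<integral>y. K x y *v rep_L2 (f + g) y \<partial>lebesgue) = (\<integral>y. K x y *v rep_L2 f y + K x y *v rep_L2 g y \<partial>lebesgue)"
    proof (rule integral_cong_AE)
      show "AE y in lebesgue. K x y *v rep_L2 (f + g) y = K x y *v rep_L2 f y + K x y *v rep_L2 g y"
        using rep_add[of f g] by eventually_elim (simp add: matrix_vector_right_distrib)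
    qed measurable
    with int show "rep_L2 (kernel_op K (f + g)) x = rep_L2 (kernel_op K f + kernel_op K g) x"
      by (simp add: e)
  qed
qed

lemma linear_kernel_op: "Vector_Spaces.linear scaleC_L2 scaleC_L2 (kernel_op K)"
  by unfold_locales (simp_all add: kernel_op_scale kernel_op_add)

lemma kernel_op_eq_iff:
  "kernel_op K f = g \<longleftrightarrow> (AE x in lebesgue. rep_L2 g x = (\<integral>y. K x y *v rep_L2 f y \<partial>lebesgue))"
proof
  assume "AE x in lebesgue. rep_L2 g x = (\<integral>y. K x y *v rep_L2 f y \<partial>lebesgue)"
  with rep_kernel_op[of f] have "AE x in lebesgue. rep_L2 (kernel_op K f) x = rep_L2 g x"
    by eventually_elim simp
  then show "kernel_op K f = g" by (rule L2_eqI)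
qed (use rep_kernel_op in auto)

end

section \<open>Sums and adjoints of kernel operators\<close>

lemma kernel_op_split:
  assumes K1: "bounded_kernel K1 B1" and K2: "bounded_kernel K2 B2"
    and K: "bounded_kernel K B" and eq: "\<And>x y. K x y = K1 x y + K2 x y"
  shows "kernel_op K f = kernel_op K1 f + kernel_op K2 f"
  unfolding kernel_op_eq_iff[OF K]
  using rep_kernel_op[OF K1, of f] rep_kernel_op[OF K2, of f]
      rep_add[of "kernel_op K1 f" "kernel_op K2 f"]
      bounded_kernel_integrable[OF K1 square_integrable_rep, of f]
      bounded_kernel_integrable[OF K2 square_integrable_rep, of f]
  by eventually_elim (simp add: eq matrix_vector_mult_add_rdistrib)

text \<open>Fubini for the scalar function \<open>H\<close>. Absolute integrability comes from
  \<open>a * b \<le> a\<^sup>2 + b\<^sup>2\<close>, where \<open>a\<close> is the absolute kernel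
  applied to the norm of \<open>f\<close> and \<open>b\<close> is the norm of \<open>g\<close>; both
  have finite square integral.\<close>

lemma cinner_kernel_op_adjoint:
  fixes K :: "'a::euclidean_space \<Rightarrow> 'a \<Rightarrow> complex^'m::finite^'m"
  assumes K: "bounded_kernel K B" and K': "bounded_kernel (adjoint_kernel K) B'"
  shows "cinner_L2 (kernel_op K f) g = cinner_L2 f (kernel_op (adjoint_kernel K) g)"
proof -
  note [measurable] = bounded_kernel_measurable[OF K] bounded_kernel_section[OF K]
    bounded_kernel_measurable[OF K']
  define H where "H x y = vec_cinner (K x y *v rep_L2 f y) (rep_L2 g x)" for x y
  have H': "H x y = vec_cinner (rep_L2 f y) (adjoint_kernel K y x *v rep_L2 g x)" for x y
    unfolding H_def by (rule vec_cinner_adjoint_kernel)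
  have Hm [measurable]: "(\<lambda>(x, y). H x y) \<in> borel_measurable (lebesgue \<Otimes>\<^sub>M lebesgue)"
    unfolding H_def by measurable
  have bl1: "bounded_linear (\<lambda>v. cnj (vec_cinner v w))" for w :: "complex^'m"
  proof (rule bounded_linear_intro[of _ "norm w"])
    show "norm (cnj (vec_cinner v w)) \<le> norm v * norm w" for v
      using norm_vec_cinner_le_mult[of v w] by simp
  qed (auto simp: vec_cinner_def algebra_simps sum.distrib scaleR_sum_right)
  have bl2: "bounded_linear (\<lambda>w. vec_cinner v w)" for v :: "complex^'m"
  proof (rule bounded_linear_intro[of _ "norm v"])
    show "norm (vec_cinner v w) \<le> norm w * norm v" for w
      using norm_vec_cinner_le_mult[of v w] by (simp add: mult.commute)
  qed (auto simp: vec_cinner_def algebra_simps sum.distrib scaleR_sum_right)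
  have int: "integrable (lebesgue \<Otimes>\<^sub>M lebesgue) (\<lambda>(x, y). H x y)"
  proof (rule integrableI_bounded)
    let ?F = "\<lambda>x. \<integral>\<^sup>+y. ennreal (norm (K x y)) * ennreal (norm (rep_L2 f y)) \<partial>lebesgue"
    have "(\<integral>\<^sup>+z. ennreal (norm (case z of (x, y) \<Rightarrow> H x y)) \<partial>(lebesgue \<Otimes>\<^sub>M lebesgue))
       = (\<integral>\<^sup>+x. \<integral>\<^sup>+y. ennreal (norm (H x y)) \<partial>lebesgue \<partial>lebesgue)"
      by (subst lebesgue.nn_integral_fst[symmetric]) auto
    also have "\<dots> \<le> (\<integral>\<^sup>+x. (?F x)\<^sup>2 + (ennreal (norm (rep_L2 g x)))\<^sup>2 \<partial>lebesgue)"
    proof (rule nn_integral_mono)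
      fix x
      have "(\<integral>\<^sup>+y. ennreal (norm (H x y)) \<partial>lebesgue)
         \<le> (\<integral>\<^sup>+y. (ennreal (norm (K x y)) * ennreal (norm (rep_L2 f y))) * ennreal (norm (rep_L2 g x)) \<partial>lebesgue)"
      proof (rule nn_integral_mono)
        fix y
        have "norm (H x y) \<le> norm (K x y *v rep_L2 f y) * norm (rep_L2 g x)"
          unfolding H_def by (rule norm_vec_cinner_le_mult)
        also have "\<dots> \<le> (norm (K x y) * norm (rep_L2 f y)) * norm (rep_L2 g x)"
          by (intro mult_right_mono norm_matrix_vector_mult_le) auto
        finally show "ennreal (norm (H x y)) \<le> (ennreal (norm (K x y)) * ennreal (norm (rep_L2 f y))) * ennreal (norm (rep_L2 g x))"
          by (simp add: ennreal_leI flip: ennreal_mult)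
      qed
      also have "\<dots> = ?F x * ennreal (norm (rep_L2 g x))"
        by (rule nn_integral_multc) measurable
      also have "\<dots> \<le> (?F x)\<^sup>2 + (ennreal (norm (rep_L2 g x)))\<^sup>2"
      proof -
        have "a * b \<le> a\<^sup>2 + b\<^sup>2" for a b :: ennreal
        proof (cases "a \<le> b")
          case True
          then have "a * b \<le> b * b" by (intro mult_right_mono) auto
          then show ?thesis by (simp add: power2_eq_square add_increasing)
        next
          case False
          then have "a * b \<le> a * a" by (intro mult_left_mono) auto
          then show ?thesis by (simp add: power2_eq_square add_increasing2)
        qed
        then show ?thesis .
      qed
      finally show "(\<integral>\<^sup>+y. ennreal (norm (H x y)) \<partial>lebesgue) \<le> (?F x)\<^sup>2 + (ennreal (norm (rep_L2 g x)))\<^sup>2" .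
    qed
    also have "\<dots> = (\<integral>\<^sup>+x. (?F x)\<^sup>2 \<partial>lebesgue) + (\<integral>\<^sup>+x. (ennreal (norm (rep_L2 g x)))\<^sup>2 \<partial>lebesgue)"
      by (rule nn_integral_add) measurable
    also have "\<dots> \<le> ennreal (B\<^sup>2) * (\<integral>\<^sup>+y. (ennreal (norm (rep_L2 f y)))\<^sup>2 \<partial>lebesgue) + (\<integral>\<^sup>+x. (ennreal (norm (rep_L2 g x)))\<^sup>2 \<partial>lebesgue)"
      by (intro add_right_mono bounded_kernel_estimate[OF K]) measurable
    also have "\<dots> < \<infinity>"
      by (simp add: nn_integral_norm_L2 ennreal_mult_less_top)
    finally show "(\<integral>\<^sup>+z. ennreal (norm (case z of (x, y) \<Rightarrow> H x y)) \<partial>(lebesgue \<Otimes>\<^sub>M lebesgue)) < \<infinity>" .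
  qed measurable
  have "cinner_L2 (kernel_op K f) g = (\<integral>x. (\<integral>y. H x y \<partial>lebesgue) \<partial>lebesgue)"
    unfolding cinner_L2_rep
  proof (rule integral_cong_AE)
    show "AE x in lebesgue. vec_cinner (rep_L2 (kernel_op K f) x) (rep_L2 g x) = (\<integral>y. H x y \<partial>lebesgue)"
      using rep_kernel_op[OF K, of f] bounded_kernel_integrable[OF K square_integrable_rep, of f]
    proof eventually_elim
      fix x assume e: "rep_L2 (kernel_op K f) x = (\<integral>y. K x y *v rep_L2 f y \<partial>lebesgue)"
        and i: "integrable lebesgue (\<lambda>y. K x y *v rep_L2 f y)"
      have "cnj (vec_cinner (rep_L2 (kernel_op K f) x) (rep_L2 g x)) = (\<integral>y. cnj (H x y) \<partial>lebesgue)"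
        unfolding e H_def by (rule integral_bounded_linear[OF bl1 i, symmetric])
      then show "vec_cinner (rep_L2 (kernel_op K f) x) (rep_L2 g x) = (\<integral>y. H x y \<partial>lebesgue)"
        by simp
    qed
  qed measurable
  also have "\<dots> = (\<integral>y. (\<integral>x. H x y \<partial>lebesgue) \<partial>lebesgue)"
    by (rule lebesgue_pair.Fubini_integral[OF int, symmetric])
  also have "\<dots> = cinner_L2 f (kernel_op (adjoint_kernel K) g)"
    unfolding cinner_L2_rep
  proof (rule integral_cong_AE)
    show "AE y in lebesgue. (\<integral>x. H x y \<partial>lebesgue) = vec_cinner (rep_L2 f y) (rep_L2 (kernel_op (adjoint_kernel K) g) y)"
      using rep_kernel_op[OF K', of g] bounded_kernel_integrable[OF K' square_integrable_rep, of g]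
    proof eventually_elim
      fix y assume e: "rep_L2 (kernel_op (adjoint_kernel K) g) y = (\<integral>x. adjoint_kernel K y x *v rep_L2 g x \<partial>lebesgue)"
        and i: "integrable lebesgue (\<lambda>x. adjoint_kernel K y x *v rep_L2 g x)"
      show "(\<integral>x. H x y \<partial>lebesgue) = vec_cinner (rep_L2 f y) (rep_L2 (kernel_op (adjoint_kernel K) g) y)"
        unfolding e H' by (rule integral_bounded_linear[OF bl2 i])
    qed
  qed measurable
  finally show ?thesis .
qed

text \<open>As \<open>adjoint_L2\<close> is a definite description, uniqueness has to be shown
  besides the adjoint identity; the real parts of the pairings with all \<open>f\<close> already
  determine \<open>S g\<close>.\<close>

lemma adjoint_L2_kernel_op:
  assumes "bounded_kernel K B" "bounded_kernel (adjoint_kernel K) B'"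
  shows "adjoint_L2 (kernel_op K) = kernel_op (adjoint_kernel K)"
  unfolding adjoint_L2_def
proof (rule the_equality)
  show "\<forall>f g. cinner_L2 (kernel_op K f) g = cinner_L2 f (kernel_op (adjoint_kernel K) g)"
    using cinner_kernel_op_adjoint[OF assms] by blast
next
  fix S assume S: "\<forall>f g. cinner_L2 (kernel_op K f) g = cinner_L2 f (S g)"
  show "S = kernel_op (adjoint_kernel K)"
  proof
    fix g
    have "cinner_L2 f (S g) = cinner_L2 f (kernel_op (adjoint_kernel K) g)" for f
      using S cinner_kernel_op_adjoint[OF assms] by metis
    then have "inner f (S g) = inner f (kernel_op (adjoint_kernel K) g)" for f
      by (simp add: inner_L2_def)
    then show "S g = kernel_op (adjoint_kernel K) g"
      by (metis vector_eq_ldot)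
  qed
qed

section \<open>Counting orthonormal vectors\<close>

lemma orthogonal_projection_residual:
  fixes f :: "'a::real_inner"
  assumes "finite E" "pairwise orthogonal E" "\<And>e. e \<in> E \<Longrightarrow> norm e = 1" "e \<in> E"
  shows "inner e (f - (\<Sum>b\<in>E. inner b f *\<^sub>R b)) = 0"
proof -
  have "inner e (\<Sum>b\<in>E. inner b f *\<^sub>R b) = (\<Sum>b\<in>E. if b = e then inner e f else 0)"
    unfolding inner_sum_right
    using assms by (intro sum.cong) (auto simp: pairwise_def orthogonal_def norm_eq_1)
  also have "\<dots> = inner e f"
    using assms by simp
  finally show ?thesis by (simp add: inner_diff_right)
qed

text \<open>Pythagoras with the residual kept: dropping the residual gives Bessel's inequality,
  dropping the coefficients shows that projecting off \<open>E\<close> does not increase the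
  norm.\<close>

lemma Bessel_finite:
  fixes f :: "'a::real_inner"
  assumes "finite E" "pairwise orthogonal E" "\<And>e. e \<in> E \<Longrightarrow> norm e = 1"
  shows "(norm f)\<^sup>2 = (norm (f - (\<Sum>b\<in>E. inner b f *\<^sub>R b)))\<^sup>2 + (\<Sum>e\<in>E. (inner e f)\<^sup>2)"
proof -
  define h where "h = f - (\<Sum>b\<in>E. inner b f *\<^sub>R b)"
  have h0: "inner e h = 0" if "e \<in> E" for e
    unfolding h_def by (rule orthogonal_projection_residual[OF assms that])
  have "inner h h = inner h (f - (\<Sum>b\<in>E. inner b f *\<^sub>R b))" by (simp only: h_def)
  also have "\<dots> = inner h f"
    by (simp add: inner_diff_right inner_sum_right h0 inner_commute[of h])
  also have "\<dots> = inner f f - (\<Sum>e\<in>E. (inner e f)\<^sup>2)"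
    by (simp add: h_def inner_diff_left inner_sum_left power2_eq_square)
  finally show ?thesis by (simp add: power2_norm_eq_inner flip: h_def)
qed

lemma Bessel_inequality:
  fixes f :: "'a::real_inner"
  assumes "finite E" "pairwise orthogonal E" "\<And>e. e \<in> E \<Longrightarrow> norm e = 1"
  shows "(\<Sum>e\<in>E. (inner e f)\<^sup>2) \<le> (norm f)\<^sup>2"
  using Bessel_finite[OF assms, of f] by simp

text \<open>Cardinalities of admissible families are bounded by \<open>N\<close>, so one of greatest
  cardinality exists; a unit vector orthogonal to it that satisfies \<open>P\<close> would enlarge
  it.\<close>

lemma ex_maximal_orthonormal:
  fixes P :: "'a::real_inner \<Rightarrow> bool"
  assumes bound: "\<And>E. finite E \<Longrightarrow> pairwise orthogonal E \<Longrightarrow> (\<And>e. e \<in> E \<Longrightarrow> norm e = 1 \<and> P e) \<Longrightarrow> card E \<le> N"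
  obtains E where "finite E" "pairwise orthogonal E" "\<And>e. e \<in> E \<Longrightarrow> norm e = 1 \<and> P e"
    "\<And>f. norm f = 1 \<Longrightarrow> (\<And>e. e \<in> E \<Longrightarrow> inner e f = 0) \<Longrightarrow> \<not> P f"
proof -
  define Q where "Q E \<longleftrightarrow> finite E \<and> pairwise orthogonal E \<and> (\<forall>e\<in>E. norm e = 1 \<and> P e)" for E
  have "Q {}" by (simp add: Q_def)
  moreover have "\<forall>E. Q E \<longrightarrow> card E < Suc N" using bound by (auto simp: Q_def less_Suc_eq_le)
  ultimately obtain E where E: "Q E" "\<forall>E'. Q E' \<longrightarrow> card E' \<le> card E"
    using ex_has_greatest_nat[of Q "{}" card "Suc N"] by blast
  show ?thesis
  proof (rule that[of E])
    fix f assume f: "norm f = 1" "\<And>e. e \<in> E \<Longrightarrow> inner e f = 0"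
    show "\<not> P f"
    proof
      assume "P f"
      have "f \<notin> E" using f by (metis norm_eq_1 zero_neq_one)
      moreover have "Q (insert f E)"
        using E(1) f \<open>P f\<close> by (auto simp: Q_def pairwise_insert orthogonal_def inner_commute)
      ultimately show False using E by (auto simp: Q_def dest!: spec[of _ "insert f E"])
    qed
  qed (use E(1) in \<open>auto simp: Q_def\<close>)
qed

text \<open>By induction: one more vector replaces the set by its Minkowski sum with a compact
  segment. The coefficient cube contains the coefficients of every vector of the unit ball along an
  orthonormal family.\<close>

lemma compact_bounded_combinations:
  fixes v :: "'b \<Rightarrow> 'a::real_normed_vector"
  assumes "finite E"
  shows "compact {\<Sum>e\<in>E. c e *\<^sub>R v e | c. \<forall>e\<in>E. \<bar>c e :: real\<bar> \<le> 1}"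
  using assms
proof induction
  case empty
  then show ?case by simp
next
  case (insert a E)
  let ?Q = "{\<Sum>e\<in>E. c e *\<^sub>R v e | c. \<forall>e\<in>E. \<bar>c e :: real\<bar> \<le> 1}"
  have eq: "{\<Sum>e\<in>insert a E. c e *\<^sub>R v e | c. \<forall>e\<in>insert a E. \<bar>c e :: real\<bar> \<le> 1}
     = {x + y | x y. x \<in> (\<lambda>t. t *\<^sub>R v a) ` {-1..1} \<and> y \<in> ?Q}" (is "?L = ?R")
  proof
    show "?L \<subseteq> ?R"
    proof
      fix z assume "z \<in> ?L"
      then obtain c where c: "z = (\<Sum>e\<in>insert a E. c e *\<^sub>R v e)" "\<forall>e\<in>insert a E. \<bar>c e :: real\<bar> \<le> 1" by blast
      then have "z = c a *\<^sub>R v a + (\<Sum>e\<in>E. c e *\<^sub>R v e)" using insert by simp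
      moreover have "c a *\<^sub>R v a \<in> (\<lambda>t. t *\<^sub>R v a) ` {-1..1}" using c(2) by (auto simp: abs_le_iff)
      ultimately show "z \<in> ?R" using c(2) by blast
    qed
    show "?R \<subseteq> ?L"
    proof
      fix z assume "z \<in> ?R"
      then obtain t c where t: "z = t *\<^sub>R v a + (\<Sum>e\<in>E. c e *\<^sub>R v e)" "t \<in> {-1..1}" "\<forall>e\<in>E. \<bar>c e :: real\<bar> \<le> 1" by blast
      have "(\<Sum>e\<in>E. c e *\<^sub>R v e) = (\<Sum>e\<in>E. (c(a := t)) e *\<^sub>R v e)"
        using insert by (intro sum.cong) auto
      then have "z = (\<Sum>e\<in>insert a E. (c(a := t)) e *\<^sub>R v e)" using t insert by simp
      moreover have "\<forall>e\<in>insert a E. \<bar>(c(a := t)) e\<bar> \<le> 1" using t by auto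
      ultimately show "z \<in> ?L" by blast
    qed
  qed
  have "compact ((\<lambda>t. t *\<^sub>R v a) ` {-1..1})"
    by (intro compact_continuous_image continuous_intros) auto
  then show ?case unfolding eq by (rule compact_sums) (rule insert.IH)
qed

text \<open>\<open>T\<close> behaves like an operator in the weak Schatten class of exponent \<open>q\<close>. Orthonormality refers
  to the real inner product, which spares complex Gram--Schmidt arguments.\<close>

definition orthonormal_count :: "('a::real_inner \<Rightarrow> 'a) \<Rightarrow> real \<Rightarrow> real \<Rightarrow> bool" where
  "orthonormal_count T q A \<longleftrightarrow>
     (\<forall>l>0. \<forall>E. finite E \<longrightarrow> pairwise orthogonal E \<longrightarrow> (\<forall>e\<in>E. norm e = 1 \<and> l < norm (T e)) \<longrightarrow>
        real (card E) * l powr q \<le> A)"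

lemma orthonormal_count_card_le:
  assumes "orthonormal_count T q A" "l > 0" "finite E" "pairwise orthogonal E"
    "\<And>e. e \<in> E \<Longrightarrow> norm e = 1 \<and> l < norm (T e)"
  shows "card E \<le> nat \<lfloor>A / l powr q\<rfloor>"
proof -
  have "real (card E) * l powr q \<le> A"
    using assms unfolding orthonormal_count_def by blast
  then have "real (card E) \<le> A / l powr q"
    using \<open>l > 0\<close> by (simp add: field_simps)
  then show ?thesis by (simp add: le_nat_floor)
qed

text \<open>On the orthogonal complement of a maximal orthonormal family with
  \<open>norm (T e) > l\<close> the operator has norm at most \<open>l\<close>. The image of the
  unit ball thus lies within \<open>l\<close> of the image of a finite-dimensional cube, which is
  compact.\<close>

lemma compact_closure_image_cball:
  fixes T :: "'a::real_inner \<Rightarrow> 'a"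
  assumes T: "linear T" and cnt: "orthonormal_count T q A" and compl: "complete (UNIV :: 'a set)"
  shows "compact (closure (T ` cball 0 1))"
  unfolding compact_eq_totally_bounded
proof (intro conjI allI impI)
  show "complete (closure (T ` cball 0 1))"
    by (rule complete_closed_subset[OF closed_closure subset_UNIV compl])
next
  fix \<epsilon> :: real assume "\<epsilon> > 0"
  \<comment> \<open>A quarter of \<open>\<epsilon>\<close> goes to the residual and a quarter to the
    net. The resulting radius \<open>\<epsilon> / 2\<close> leaves room for closed balls, whose
    finite union also covers the closure.\<close>
  define l where "l = \<epsilon> / 4"
  have "l > 0" using \<open>\<epsilon> > 0\<close> by (simp add: l_def)
  obtain E where E: "finite E" "pairwise orthogonal E" "\<And>e. e \<in> E \<Longrightarrow> norm e = 1 \<and> l < norm (T e)"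
    "\<And>f. norm f = 1 \<Longrightarrow> (\<And>e. e \<in> E \<Longrightarrow> inner e f = 0) \<Longrightarrow> \<not> l < norm (T f)"
  proof (rule ex_maximal_orthonormal[of "\<lambda>e. l < norm (T e)"])
    fix E assume "finite E" "pairwise orthogonal E" "\<And>e. e \<in> E \<Longrightarrow> norm e = 1 \<and> l < norm (T e)"
    then show "card E \<le> nat \<lfloor>A / l powr q\<rfloor>"
      by (intro orthonormal_count_card_le[OF cnt \<open>l > 0\<close>]) auto
  qed blast
  have small: "norm (T g) \<le> l * norm g" if g: "\<And>e. e \<in> E \<Longrightarrow> inner e g = 0" for g
  proof (cases "g = 0")
    case True
    then show ?thesis using linear_0[OF T] by simp
  next
    case False
    have "\<not> l < norm (T ((1 / norm g) *\<^sub>R g))"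
      by (rule E(4)) (use False g in auto)
    then show ?thesis
      using False by (simp add: linear_scale[OF T] field_simps)
  qed
  define Q where "Q = {\<Sum>e\<in>E. c e *\<^sub>R T e | c. \<forall>e\<in>E. \<bar>c e :: real\<bar> \<le> 1}"
  have "compact Q" unfolding Q_def by (rule compact_bounded_combinations[OF E(1)])
  then obtain k where k: "finite k" "Q \<subseteq> (\<Union>x\<in>k. ball x (\<epsilon> / 4))"
    unfolding compact_eq_totally_bounded using \<open>\<epsilon> > 0\<close> by (metis zero_less_divide_iff zero_less_numeral)
  have "T f \<in> (\<Union>x\<in>k. cball x (\<epsilon> / 2))" if f: "f \<in> cball 0 1" for f
  proof -
    define g where "g = f - (\<Sum>b\<in>E. inner b f *\<^sub>R b)"
    have E3: "\<And>e. e \<in> E \<Longrightarrow> norm e = 1" using E(3) by blast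
    have "(norm g)\<^sup>2 \<le> (norm f)\<^sup>2"
      using Bessel_finite[OF E(1,2) E3, of f] sum_nonneg[of E "\<lambda>e. (inner e f)\<^sup>2"]
      unfolding g_def[symmetric] by simp
    then have "norm g \<le> norm f" by (rule power2_le_imp_le) simp
    then have "norm g \<le> 1" using f by simp
    have "norm (T g) \<le> l * norm g"
      by (rule small) (simp add: g_def orthogonal_projection_residual[OF E(1,2) E3])
    also have "\<dots> \<le> l * 1"
      using \<open>norm g \<le> 1\<close> \<open>l > 0\<close> by (intro mult_left_mono) auto
    finally have Tg: "norm (T g) \<le> \<epsilon> / 4" by (simp add: l_def)
    have "T f = T (g + (\<Sum>b\<in>E. inner b f *\<^sub>R b))" by (simp add: g_def)
    then have Tf: "T f = T g + (\<Sum>b\<in>E. inner b f *\<^sub>R T b)"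
      by (simp only: linear_add[OF T] linear_sum[OF T] linear_scale[OF T] o_def)
    have "(\<Sum>b\<in>E. inner b f *\<^sub>R T b) \<in> Q"
    proof -
      have "\<bar>inner b f\<bar> \<le> 1" if "b \<in> E" for b
        using order_trans[OF Cauchy_Schwarz_ineq2[of b f], of 1] E3[OF that] f by simp
      then show ?thesis unfolding Q_def by (auto intro!: exI[of _ "\<lambda>b. inner b f"])
    qed
    then obtain x where x: "x \<in> k" "dist x (\<Sum>b\<in>E. inner b f *\<^sub>R T b) < \<epsilon> / 4"
      using k by auto
    have "dist x (T f) \<le> dist x (\<Sum>b\<in>E. inner b f *\<^sub>R T b) + dist (\<Sum>b\<in>E. inner b f *\<^sub>R T b) (T f)"
      by (rule dist_triangle)
    also have "\<dots> \<le> \<epsilon> / 4 + \<epsilon> / 4"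
      using x Tg by (intro add_mono) (auto simp: dist_norm Tf)
    finally show ?thesis using x by (auto intro!: bexI[of _ x])
  qed
  then have "T ` cball 0 1 \<subseteq> (\<Union>x\<in>k. cball x (\<epsilon> / 2))" by blast
  then have "closure (T ` cball 0 1) \<subseteq> (\<Union>x\<in>k. cball x (\<epsilon> / 2))"
    by (rule closure_minimal) (use k in auto)
  also have "\<dots> \<subseteq> (\<Union>x\<in>k. ball x \<epsilon>)"
    using \<open>\<epsilon> > 0\<close> by (intro UN_mono) (auto simp: subset_eq)
  finally show "\<exists>k. finite k \<and> closure (T ` cball 0 1) \<subseteq> (\<Union>x\<in>k. ball x \<epsilon>)"
    using k(1) by blast
qed

text \<open>Dyadic levels below \<open>M\<close>: at most
  \<open>\<bar>A\<bar> * (M / 2 ^ Suc j) powr (- q)\<close> vectors have \<open>norm (T e)\<close>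
  between \<open>M / 2 ^ Suc j\<close> and \<open>M / 2 ^ j\<close>, and each contributes at most
  \<open>(M / 2 ^ j) powr p\<close>. The level sums are geometric with ratio
  \<open>(1/2) powr (p - q)\<close>; the factor \<open>2 powr q\<close> is the loss between the two
  ends of a level.\<close>

lemma sum_powr_orthonormal_le:
  fixes T :: "'a::real_inner \<Rightarrow> 'a"
  assumes cnt: "orthonormal_count T q A" and "q < p" "0 < q" and "M > 0"
    and U: "finite U" "pairwise orthogonal U" "\<And>e. e \<in> U \<Longrightarrow> norm e = 1 \<and> 0 < norm (T e) \<and> norm (T e) \<le> M"
  shows "(\<Sum>e\<in>U. norm (T e) powr p) \<le> (2 powr q * \<bar>A\<bar> * M powr (p - q)) / (1 - (1/2) powr (p - q))"
proof -
  have ex: "\<exists>j. M / 2 ^ Suc j < t \<and> t \<le> M / 2 ^ j" if t: "0 < t" "t \<le> M" for t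
  proof -
    have "\<exists>j. M / t < 2 ^ j" using real_arch_pow[of 2 "M / t"] by simp
    then obtain j0 :: nat where "M / t < 2 ^ j0" by blast
    then have ex0: "\<exists>j. M / 2 ^ j < t" using t by (auto simp: field_simps intro!: exI[of _ j0])
    define m where "m = (LEAST j. M / 2 ^ j < t)"
    have m: "M / 2 ^ m < t" unfolding m_def using ex0 by (rule LeastI_ex)
    then have "m \<noteq> 0" using t by (cases m) auto
    then obtain j where j: "m = Suc j" by (cases m) auto
    then have "\<not> M / 2 ^ j < t" using not_less_Least[of j "\<lambda>j. M / 2 ^ j < t"] by (simp add: m_def)
    then show ?thesis using m j by (intro exI[of _ j]) auto
  qed
  define J where "J e = (SOME j. M / 2 ^ Suc j < norm (T e) \<and> norm (T e) \<le> M / 2 ^ j)" for e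
  have J: "M / 2 ^ Suc (J e) < norm (T e)" "norm (T e) \<le> M / 2 ^ J e" if "e \<in> U" for e
    using someI_ex[OF ex[of "norm (T e)"]] U(3)[OF that] unfolding J_def by auto
  define L where "L = Suc (Max (J ` U))"
  have JL: "J e < L" if "e \<in> U" for e
    using Max_ge[of "J ` U" "J e"] U(1) that by (auto simp: L_def less_Suc_eq_le)
  have level: "(\<Sum>e\<in>{e\<in>U. J e = j}. norm (T e) powr p) \<le> 2 powr q * \<bar>A\<bar> * M powr (p - q) * ((1/2) powr (p - q)) ^ j" for j
  proof -
    let ?V = "{e\<in>U. J e = j}"
    have "(\<Sum>e\<in>?V. norm (T e) powr p) \<le> real (card ?V) * (M / 2 ^ j) powr p"
      by (rule sum_bounded_above) (use J(2) \<open>0 < q\<close> \<open>q < p\<close> in \<open>auto intro!: powr_mono2\<close>)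
    also have "\<dots> = real (card ?V) * (M / 2 ^ Suc j) powr q * (2 powr q * (M / 2 ^ j) powr (p - q))"
    proof -
      have "(M / 2 ^ Suc j) powr q * 2 powr q = (M / 2 ^ j) powr q"
        using \<open>M > 0\<close> by (simp flip: powr_mult)
      moreover have "(M / 2 ^ j) powr p = (M / 2 ^ j) powr q * (M / 2 ^ j) powr (p - q)"
        by (simp flip: powr_add)
      ultimately show ?thesis by (simp add: mult_ac)
    qed
    also have "\<dots> \<le> \<bar>A\<bar> * (2 powr q * (M / 2 ^ j) powr (p - q))"
    proof (rule mult_right_mono)
      have "pairwise orthogonal ?V" using U(2) by (rule pairwise_subset) auto
      moreover have "\<forall>e\<in>?V. norm e = 1 \<and> M / 2 ^ Suc j < norm (T e)" using U(3) J(1) by auto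
      moreover have "M / 2 ^ Suc j > 0" using \<open>M > 0\<close> by simp
      ultimately have "real (card ?V) * (M / 2 ^ Suc j) powr q \<le> A"
        using cnt[unfolded orthonormal_count_def, rule_format, of "M / 2 ^ Suc j" ?V] U(1) by simp
      then show "real (card ?V) * (M / 2 ^ Suc j) powr q \<le> \<bar>A\<bar>" by simp
    qed simp
    also have "(M / 2 ^ j) powr (p - q) = M powr (p - q) * ((1/2) powr (p - q)) ^ j"
    proof -
      have "(M / 2 ^ j) powr (p - q) = M powr (p - q) * ((1/2) ^ j) powr (p - q)"
        using \<open>M > 0\<close> by (simp add: power_one_over flip: powr_mult)
      also have "((1/2::real) ^ j) powr (p - q) = ((1/2) powr (p - q)) ^ j"
        by (simp add: powr_powr mult.commute flip: powr_realpow)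
      finally show ?thesis .
    qed
    finally show ?thesis by (simp add: mult_ac)
  qed
  have r: "(1/2) powr (p - q) < (1::real)"
    using \<open>q < p\<close> powr_less_mono2[of "p - q" "1/2" 1] by simp
  have "(\<Sum>e\<in>U. norm (T e) powr p) = (\<Sum>j<L. \<Sum>e\<in>{e\<in>U. J e = j}. norm (T e) powr p)"
    by (rule sum.group[symmetric]) (use U(1) JL in auto)
  also have "\<dots> \<le> (\<Sum>j<L. 2 powr q * \<bar>A\<bar> * M powr (p - q) * ((1/2) powr (p - q)) ^ j)"
    by (rule sum_mono) (rule level)
  also have "\<dots> = 2 powr q * \<bar>A\<bar> * M powr (p - q) * (\<Sum>j<L. ((1/2) powr (p - q)) ^ j)"
    by (simp add: sum_distrib_left)
  also have "\<dots> \<le> 2 powr q * \<bar>A\<bar> * M powr (p - q) * (1 / (1 - (1/2) powr (p - q)))"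
  proof (rule mult_left_mono)
    have "(\<Sum>j<L. ((1/2) powr (p - q)) ^ j) \<le> (\<Sum>j. ((1/2::real) powr (p - q)) ^ j)"
      by (rule sum_le_suminf) (use r in \<open>auto intro: summable_geometric\<close>)
    also have "\<dots> = 1 / (1 - (1/2) powr (p - q))"
      by (rule suminf_geometric) (use r in auto)
    finally show "(\<Sum>j<L. ((1/2::real) powr (p - q)) ^ j) \<le> 1 / (1 - (1/2) powr (p - q))" .
  qed auto
  finally show ?thesis by simp
qed

section \<open>Membership in the Schatten classes\<close>

lemma linear_of_clinear:
  fixes T :: "('a::euclidean_space, 'm::finite) L2 \<Rightarrow> ('a, 'm) L2"
  assumes "Vector_Spaces.linear scaleC_L2 scaleC_L2 T"
  shows "linear T"
proof -
  interpret C: Vector_Spaces.linear "scaleC_L2 :: _ \<Rightarrow> ('a, 'm) L2 \<Rightarrow> _" "scaleC_L2 :: _ \<Rightarrow> ('a, 'm) L2 \<Rightarrow> _" T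
    by (fact assms)
  show ?thesis
    by (rule linearI) (simp_all add: C.add C.scale scaleR_L2_def)
qed

lemma eigenspace_subspace_real:
  fixes A :: "('a::euclidean_space, 'm::finite) L2 \<Rightarrow> ('a, 'm) L2"
  assumes "linear A" "f \<in> eigenspace A (of_real r)" "g \<in> eigenspace A (of_real r)"
  shows "f - c *\<^sub>R g \<in> eigenspace A (of_real r)"
  using assms by (simp add: eigenspace_def linear_diff linear_scale scaleR_L2_def[symmetric] algebra_simps)

text \<open>For an eigenvector \<open>f\<close> of \<open>S \<circ> T\<close> with eigenvalue
  \<open>s\<^sup>2\<close> the adjoint relation gives \<open>norm (T f) = s * norm f\<close>, and
  eigenvectors for distinct \<open>s\<close> are orthogonal. Orthonormal families of the eigenspaces
  therefore join to a single one, and the dyadic estimate for it bounds every finite partial sum by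
  the same constant.\<close>

theorem schatten_classI:
  fixes T S :: "('a::euclidean_space, 'm::finite) L2 \<Rightarrow> ('a, 'm) L2"
  assumes T: "Vector_Spaces.linear scaleC_L2 scaleC_L2 T" and S: "Vector_Spaces.linear scaleC_L2 scaleC_L2 S"
    and bound: "\<And>f. norm (T f) \<le> M * norm f"
    and adj: "adjoint_L2 T = S" "\<And>f g. cinner_L2 (T f) g = cinner_L2 f (S g)"
    and cnt: "orthonormal_count T q A" and q: "0 < q" "q < p"
  shows "T \<in> schatten_class p"
proof -
  note lT = linear_of_clinear[OF T] and lS = linear_of_clinear[OF S]
  have lST: "linear (S \<circ> T)" by (rule linear_compose[OF lT lS])
  define V where "V s = eigenspace (S \<circ> T) (of_real (s\<^sup>2))" for s
  have STV: "S (T f) = (s\<^sup>2) *\<^sub>R f" if "f \<in> V s" for f s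
    using that by (simp add: V_def eigenspace_def scaleR_L2_def)
  have inner_TT: "inner (T f) (T g) = s\<^sup>2 * inner f g" if "g \<in> V s" for f g s
    using adj(2)[of f "T g"] STV[OF that] by (simp add: inner_L2_def) (simp add: inner_L2_def[symmetric])
  have norm_T: "norm (T f) = s * norm f" if "f \<in> V s" "s > 0" for f s
  proof -
    have "(norm (T f))\<^sup>2 = (s * norm f)\<^sup>2"
      using inner_TT[OF that(1), of f] by (simp add: power2_norm_eq_inner power_mult_distrib)
    then show ?thesis using that by (simp add: power2_eq_iff_nonneg)
  qed
  have diffV: "f - g \<in> V s" if "f \<in> V s" "g \<in> V s" for f g s
    using eigenspace_subspace_real[OF lST, of f "s\<^sup>2" g 1] that by (simp add: V_def)
  have scaleV: "c *\<^sub>R f \<in> V s" if "f \<in> V s" for f c s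
    using that linear_scale[OF lST, of c f] by (simp add: V_def eigenspace_def scaleR_L2_def mult.commute)
  have zeroV: "0 \<in> V s" for s
    using linear_0[OF lST] by (simp add: V_def eigenspace_def)
  have sumV: "(\<Sum>b\<in>B. c b *\<^sub>R b) \<in> V s" if "finite B" "B \<subseteq> V s" for B c s
    using that
  proof induction
    case (insert b B)
    then have "(\<Sum>b\<in>B. c b *\<^sub>R b) - (- c b) *\<^sub>R b \<in> V s"
      by (intro diffV scaleV) auto
    then show ?case using insert by (simp add: add.commute)
  qed (simp add: zeroV)
  \<comment> \<open>A maximal family that is orthonormal for the real inner product spans the
    eigenspace, in particular over the complex numbers. It may have twice the complex dimension as
    cardinality; only the inequality \<open>L2.dim (V s) \<le> card E\<close> is claimed.\<close>
  have ex: "\<exists>E. finite E \<and> pairwise orthogonal E \<and> (\<forall>e\<in>E. norm e = 1) \<and> E \<subseteq> V s \<and> L2.dim (V s) \<le> card E"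
    if "s > 0" for s
  proof -
    obtain E where E: "finite E" "pairwise orthogonal E" "\<And>e. e \<in> E \<Longrightarrow> norm e = 1 \<and> e \<in> V s"
      "\<And>f. norm f = 1 \<Longrightarrow> (\<And>e. e \<in> E \<Longrightarrow> inner e f = 0) \<Longrightarrow> \<not> f \<in> V s"
    proof (rule ex_maximal_orthonormal[of "\<lambda>e. e \<in> V s"])
      fix E assume E: "finite E" "pairwise orthogonal E" "\<And>e. e \<in> E \<Longrightarrow> norm e = 1 \<and> e \<in> V s"
      \<comment> \<open>The count concerns strict excess over a level, while unit eigenvectors have
        \<open>norm (T e) = s\<close> exactly; hence the level \<open>s / 2\<close>.\<close>
      show "card E \<le> nat \<lfloor>A / (s / 2) powr q\<rfloor>"
        by (rule orthonormal_count_card_le[OF cnt _ E(1,2)])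
           (use E(3) \<open>s > 0\<close> in \<open>auto simp: norm_T[OF _ \<open>s > 0\<close>]\<close>)
    qed blast
    have E3: "\<And>e. e \<in> E \<Longrightarrow> norm e = 1" using E(3) by blast
    have "f \<in> L2.span E" if f: "f \<in> V s" for f
    proof -
      define g where "g = f - (\<Sum>b\<in>E. inner b f *\<^sub>R b)"
      have gV: "g \<in> V s" unfolding g_def using E f by (intro diffV sumV) auto
      have "g = 0"
      proof (rule ccontr)
        assume "g \<noteq> 0"
        have "(1 / norm g) *\<^sub>R g \<notin> V s"
          by (rule E(4)) (use \<open>g \<noteq> 0\<close> in \<open>auto simp: g_def orthogonal_projection_residual[OF E(1,2) E3]\<close>)
        with scaleV[OF gV] show False by blast
      qed
      then have "f = (\<Sum>b\<in>E. inner b f *\<^sub>R b)" by (simp add: g_def)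
      also have "\<dots> \<in> L2.span E"
        unfolding scaleR_L2_def by (intro L2.span_sum L2.span_scale L2.span_base)
      finally show ?thesis .
    qed
    then have VE: "V s \<subseteq> L2.span E" by blast
    obtain B where B: "B \<subseteq> V s" "L2.independent B" "V s \<subseteq> L2.span B" "card B = L2.dim (V s)"
      by (rule L2.basis_exists)
    have "card B \<le> card E"
      using L2.independent_span_bound[OF E(1) B(2) order_trans[OF B(1) VE]] by blast
    then show ?thesis using B(4) E(1,2,3) by (intro exI[of _ E] conjI) auto
  qed
  define E where "E s = (SOME E. finite E \<and> pairwise orthogonal E \<and> (\<forall>e\<in>E. norm e = 1) \<and> E \<subseteq> V s \<and> L2.dim (V s) \<le> card E)" for s
  have E: "finite (E s)" "pairwise orthogonal (E s)" "\<And>e. e \<in> E s \<Longrightarrow> norm e = 1" "E s \<subseteq> V s"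
    "L2.dim (V s) \<le> card (E s)" if "s > 0" for s
    using someI_ex[OF ex[OF that]] unfolding E_def by auto
  have ortho: "inner f g = 0" if "f \<in> V s" "g \<in> V t" "s > 0" "t > 0" "s \<noteq> t" for f g s t
  proof -
    have "t\<^sup>2 * inner f g = s\<^sup>2 * inner f g"
      using inner_TT[OF that(2), of f] inner_TT[OF that(1), of g] by (simp add: inner_commute)
    moreover have "t\<^sup>2 \<noteq> s\<^sup>2" using that by (simp add: power2_eq_iff_nonneg)
    ultimately show ?thesis by simp
  qed
  \<comment> \<open>The dyadic estimate starts from a positive upper bound, and \<open>M\<close>
    itself is not known to be positive.\<close>
  define M' where "M' = max M 1"
  let ?C = "(2 powr q * \<bar>A\<bar> * M' powr (p - q)) / (1 - (1/2) powr (p - q))"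
  have "(\<lambda>s. real (singular_multiplicity T s) * s powr p) summable_on {0<..}"
  proof (rule nonneg_bdd_above_summable_on)
    show "bdd_above (sum (\<lambda>s. real (singular_multiplicity T s) * s powr p) ` {F. F \<subseteq> {0<..} \<and> finite F})"
    proof (rule bdd_aboveI2)
      fix F :: "real set" assume "F \<in> {F. F \<subseteq> {0<..} \<and> finite F}"
      then have F: "\<And>s. s \<in> F \<Longrightarrow> s > 0" "finite F" by auto
      have disj: "E s \<inter> E t = {}" if "s \<in> F" "t \<in> F" "s \<noteq> t" for s t
      proof (rule ccontr)
        assume "E s \<inter> E t \<noteq> {}"
        then obtain e where "e \<in> E s" "e \<in> E t" by blast
        then have "inner e e = 0" using ortho[of e s e t] E(4) F that by blast
        moreover have "norm e = 1" using E(3) F \<open>e \<in> E s\<close> that by blast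
        ultimately show False by simp
      qed
      have "(\<Sum>s\<in>F. real (singular_multiplicity T s) * s powr p) \<le> (\<Sum>s\<in>F. \<Sum>e\<in>E s. norm (T e) powr p)"
      proof (rule sum_mono)
        fix s assume s: "s \<in> F"
        have "norm (T e) = s" if "e \<in> E s" for e
          using norm_T[of e s] E(3,4)[OF F(1)[OF s]] that F(1)[OF s] by auto
        then have "(\<Sum>e\<in>E s. norm (T e) powr p) = real (card (E s)) * s powr p" by simp
        moreover have "singular_multiplicity T s \<le> card (E s)"
          using E(5)[OF F(1)[OF s]] by (simp add: singular_multiplicity_def adj(1) V_def)
        ultimately show "real (singular_multiplicity T s) * s powr p \<le> (\<Sum>e\<in>E s. norm (T e) powr p)"
          by (simp add: mult_right_mono)
      qed
      also have "\<dots> = (\<Sum>e\<in>(\<Union>s\<in>F. E s). norm (T e) powr p)"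
        by (rule sum.UNION_disjoint[symmetric]) (use F E(1) disj in auto)
      also have "\<dots> \<le> ?C"
      proof (rule sum_powr_orthonormal_le[OF cnt q(2,1)])
        show "M' > 0" by (simp add: M'_def)
        show "finite (\<Union>s\<in>F. E s)" using F E(1) by auto
        show "pairwise orthogonal (\<Union>s\<in>F. E s)"
        proof (rule pairwiseI)
          fix e e' assume "e \<in> (\<Union>s\<in>F. E s)" "e' \<in> (\<Union>s\<in>F. E s)" "e \<noteq> e'"
          then obtain s t where st: "s \<in> F" "t \<in> F" "e \<in> E s" "e' \<in> E t" by blast
          show "orthogonal e e'"
          proof (cases "s = t")
            case True
            then show ?thesis using E(2)[OF F(1)[OF st(1)]] st \<open>e \<noteq> e'\<close> by (auto simp: pairwise_def)
          next
            case False
            then show ?thesis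
              using ortho[of e s e' t] E(4)[OF F(1)[OF st(1)]] E(4)[OF F(1)[OF st(2)]] F(1) st
              by (auto simp: orthogonal_def)
          qed
        qed
        fix e assume "e \<in> (\<Union>s\<in>F. E s)"
        then obtain s where s: "s \<in> F" "e \<in> E s" by blast
        have ne: "norm e = 1" using E(3) F s by blast
        moreover have "norm (T e) = s" using norm_T[of e s] ne E(4)[OF F(1)[OF s(1)]] s F(1) by auto
        moreover have "norm (T e) \<le> M'" using bound[of e] ne by (simp add: M'_def)
        ultimately show "norm e = 1 \<and> 0 < norm (T e) \<and> norm (T e) \<le> M'" using F(1)[OF s(1)] by simp
      qed
      finally show "(\<Sum>s\<in>F. real (singular_multiplicity T s) * s powr p) \<le> ?C" .
    qed
  qed auto
  moreover have "compact_operator T"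
    unfolding compact_operator_def
    using T compact_closure_image_cball[OF lT cnt complete_L2] by blast
  ultimately show ?thesis by (simp add: schatten_class_def)
qed

section \<open>Schatten class criterion for integral operators\<close>

lemma bounded_kernel_HS:
  fixes K :: "'a::euclidean_space \<Rightarrow> 'a \<Rightarrow> complex^'m::finite^'m"
  assumes m [measurable]: "(\<lambda>(x, y). K x y) \<in> borel_measurable (lebesgue \<Otimes>\<^sub>M lebesgue)"
    and HS: "(\<integral>\<^sup>+x. \<integral>\<^sup>+y. (ennreal (norm (K x y)))\<^sup>2 \<partial>lebesgue \<partial>lebesgue) \<le> ennreal A" and "A \<ge> 0"
  shows "bounded_kernel K (sqrt A)"
  unfolding bounded_kernel_def
proof (intro conjI ballI)
  fix f :: "'a \<Rightarrow> ennreal" assume [measurable]: "f \<in> borel_measurable lebesgue"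
  have "(\<integral>\<^sup>+x. (\<integral>\<^sup>+y. ennreal (norm (K x y)) * f y \<partial>lebesgue)\<^sup>2 \<partial>lebesgue)
    \<le> (\<integral>\<^sup>+x. (\<integral>\<^sup>+y. (ennreal (norm (K x y)))\<^sup>2 \<partial>lebesgue) * (\<integral>\<^sup>+y. (f y)\<^sup>2 \<partial>lebesgue) \<partial>lebesgue)"
    by (intro nn_integral_mono Cauchy_Schwarz_nn_integral) measurable
  also have "\<dots> = (\<integral>\<^sup>+x. \<integral>\<^sup>+y. (ennreal (norm (K x y)))\<^sup>2 \<partial>lebesgue \<partial>lebesgue) * (\<integral>\<^sup>+y. (f y)\<^sup>2 \<partial>lebesgue)"
    by (rule nn_integral_multc) measurable
  also have "\<dots> \<le> ennreal A * (\<integral>\<^sup>+y. (f y)\<^sup>2 \<partial>lebesgue)"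
    by (intro mult_right_mono HS) auto
  finally show "(\<integral>\<^sup>+x. (\<integral>\<^sup>+y. ennreal (norm (K x y)) * f y \<partial>lebesgue)\<^sup>2 \<partial>lebesgue)
      \<le> ennreal ((sqrt A)\<^sup>2) * (\<integral>\<^sup>+y. (f y)\<^sup>2 \<partial>lebesgue)"
    using \<open>A \<ge> 0\<close> by simp
qed (use assms in auto)

text \<open>Schur test with one weight for rows and columns: \<open>norm (K x y)\<close> is written
  as \<open>sqrt (norm (K x y) * w y) * sqrt (norm (K x y) / w y)\<close>. Cauchy--Schwarz and
  \<open>S1\<close> dispose of the first factor, an exchange of the integrals and \<open>S2\<close>
  of the second.\<close>

lemma bounded_kernel_Schur:
  fixes K :: "'a::euclidean_space \<Rightarrow> 'a \<Rightarrow> complex^'m::finite^'m"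
  assumes m [measurable]: "(\<lambda>(x, y). K x y) \<in> borel_measurable (lebesgue \<Otimes>\<^sub>M lebesgue)"
    and w [measurable]: "w \<in> borel_measurable lebesgue" and w_pos: "\<And>x. (w x :: real) > 0"
    and "B \<ge> 0"
    and S1: "\<And>x. (\<integral>\<^sup>+y. ennreal (norm (K x y) * w y) \<partial>lebesgue) \<le> ennreal (B * w x)"
    and S2: "\<And>y. (\<integral>\<^sup>+x. ennreal (norm (K x y) * w x) \<partial>lebesgue) \<le> ennreal (B * w y)"
  shows "bounded_kernel K B"
  unfolding bounded_kernel_def
proof (intro conjI ballI)
  fix f :: "'a \<Rightarrow> ennreal" assume [measurable]: "f \<in> borel_measurable lebesgue"
  let ?u = "\<lambda>x y. ennreal (sqrt (norm (K x y) * w y))"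
  let ?v = "\<lambda>x y. ennreal (sqrt (norm (K x y) / w y)) * f y"
  have uv: "ennreal (norm (K x y)) * f y = ?u x y * ?v x y" for x y
  proof -
    have "sqrt (norm (K x y) * w y) * sqrt (norm (K x y) / w y) = norm (K x y)"
      using w_pos[of y] by (simp flip: real_sqrt_mult)
    then have "ennreal (norm (K x y)) = ?u x y * ennreal (sqrt (norm (K x y) / w y))"
      by (metis ennreal_mult' real_sqrt_ge_zero mult_nonneg_nonneg norm_ge_zero less_imp_le w_pos)
    then show ?thesis by (simp add: mult.assoc)
  qed
  have u2: "(?u x y)\<^sup>2 = ennreal (norm (K x y) * w y)" for x y
    using w_pos[of y] by (subst ennreal_power) auto
  have v2: "(?v x y)\<^sup>2 = ennreal (norm (K x y) / w y) * (f y)\<^sup>2" for x y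
    unfolding power_mult_distrib using w_pos[of y] by (subst ennreal_power) auto
  have "(\<integral>\<^sup>+x. (\<integral>\<^sup>+y. ennreal (norm (K x y)) * f y \<partial>lebesgue)\<^sup>2 \<partial>lebesgue)
    \<le> (\<integral>\<^sup>+x. \<integral>\<^sup>+y. (ennreal B * ennreal (w x)) * (ennreal (norm (K x y) / w y) * (f y)\<^sup>2) \<partial>lebesgue \<partial>lebesgue)"
  proof (rule nn_integral_mono)
    fix x
    have "(\<integral>\<^sup>+y. ennreal (norm (K x y)) * f y \<partial>lebesgue)\<^sup>2
       \<le> (\<integral>\<^sup>+y. (?u x y)\<^sup>2 \<partial>lebesgue) * (\<integral>\<^sup>+y. (?v x y)\<^sup>2 \<partial>lebesgue)"
      unfolding uv by (rule Cauchy_Schwarz_nn_integral) measurable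
    also have "\<dots> \<le> ennreal (B * w x) * (\<integral>\<^sup>+y. ennreal (norm (K x y) / w y) * (f y)\<^sup>2 \<partial>lebesgue)"
      unfolding u2 v2 by (intro mult_right_mono S1) auto
    also have "\<dots> = (\<integral>\<^sup>+y. (ennreal B * ennreal (w x)) * (ennreal (norm (K x y) / w y) * (f y)\<^sup>2) \<partial>lebesgue)"
      using \<open>B \<ge> 0\<close> by (subst nn_integral_cmult) (auto simp: ennreal_mult')
    finally show "(\<integral>\<^sup>+y. ennreal (norm (K x y)) * f y \<partial>lebesgue)\<^sup>2
      \<le> (\<integral>\<^sup>+y. (ennreal B * ennreal (w x)) * (ennreal (norm (K x y) / w y) * (f y)\<^sup>2) \<partial>lebesgue)" .
  qed
  also have "\<dots> = (\<integral>\<^sup>+y. \<integral>\<^sup>+x. (ennreal B * ennreal (w x)) * (ennreal (norm (K x y) / w y) * (f y)\<^sup>2) \<partial>lebesgue \<partial>lebesgue)"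
    by (rule lebesgue_pair.Fubini'[symmetric]) measurable
  also have "\<dots> = (\<integral>\<^sup>+y. (ennreal B * (ennreal (1 / w y) * (f y)\<^sup>2)) * (\<integral>\<^sup>+x. ennreal (norm (K x y) * w x) \<partial>lebesgue) \<partial>lebesgue)"
  proof (rule nn_integral_cong)
    fix y
    have "(ennreal B * ennreal (w x)) * (ennreal (norm (K x y) / w y) * (f y)\<^sup>2)
      = (ennreal B * (ennreal (1 / w y) * (f y)\<^sup>2)) * ennreal (norm (K x y) * w x)" for x
    proof -
      have "ennreal (norm (K x y) / w y) = ennreal (1 / w y) * ennreal (norm (K x y))"
        using w_pos[of y] by (simp flip: ennreal_mult)
      moreover have "ennreal (norm (K x y) * w x) = ennreal (norm (K x y)) * ennreal (w x)"
        using w_pos[of x] by (simp add: ennreal_mult)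
      ultimately show ?thesis by (simp only: mult_ac)
    qed
    then show "(\<integral>\<^sup>+x. (ennreal B * ennreal (w x)) * (ennreal (norm (K x y) / w y) * (f y)\<^sup>2) \<partial>lebesgue)
      = (ennreal B * (ennreal (1 / w y) * (f y)\<^sup>2)) * (\<integral>\<^sup>+x. ennreal (norm (K x y) * w x) \<partial>lebesgue)"
      by (simp add: nn_integral_cmult)
  qed
  also have "\<dots> \<le> (\<integral>\<^sup>+y. (ennreal B * (ennreal (1 / w y) * (f y)\<^sup>2)) * ennreal (B * w y) \<partial>lebesgue)"
    by (intro nn_integral_mono mult_left_mono S2) auto
  also have "\<dots> = (\<integral>\<^sup>+y. ennreal (B\<^sup>2) * (f y)\<^sup>2 \<partial>lebesgue)"
  proof (rule nn_integral_cong)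
    fix y
    have "ennreal (1 / w y) * ennreal (B * w y) = ennreal B"
      using w_pos[of y] \<open>B \<ge> 0\<close> by (simp flip: ennreal_mult)
    moreover have "ennreal (B\<^sup>2) = ennreal B * ennreal B"
      using \<open>B \<ge> 0\<close> by (simp add: power2_eq_square ennreal_mult)
    ultimately show "(ennreal B * (ennreal (1 / w y) * (f y)\<^sup>2)) * ennreal (B * w y) = ennreal (B\<^sup>2) * (f y)\<^sup>2"
      by (metis (no_types, lifting) mult.assoc mult.commute)
  qed
  also have "\<dots> = ennreal (B\<^sup>2) * (\<integral>\<^sup>+y. (f y)\<^sup>2 \<partial>lebesgue)"
    by (rule nn_integral_cmult) measurable
  finally show "(\<integral>\<^sup>+x. (\<integral>\<^sup>+y. ennreal (norm (K x y)) * f y \<partial>lebesgue)\<^sup>2 \<partial>lebesgue)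
      \<le> ennreal (B\<^sup>2) * (\<integral>\<^sup>+y. (f y)\<^sup>2 \<partial>lebesgue)" .
qed (use assms in auto)

text \<open>The constant comes from
  \<open>(a + b)\<^sup>2 \<le> 2 * a\<^sup>2 + 2 * b\<^sup>2\<close> and is not the sharp
  \<open>B1 + B2\<close>; for sums of kernels only the existence of a finite bound is
  exploited.\<close>

lemma bounded_kernel_add:
  fixes K :: "'a::euclidean_space \<Rightarrow> 'a \<Rightarrow> complex^'m::finite^'m"
  assumes K1: "bounded_kernel K1 B1" and K2: "bounded_kernel K2 B2"
    and eq: "\<And>x y. K x y = K1 x y + K2 x y"
  shows "bounded_kernel K (sqrt (2 * B1\<^sup>2 + 2 * B2\<^sup>2))"
  unfolding bounded_kernel_def
proof (intro conjI ballI)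
  note [measurable] = bounded_kernel_measurable[OF K1] bounded_kernel_measurable[OF K2]
  show "(\<lambda>(x, y). K x y) \<in> borel_measurable (lebesgue \<Otimes>\<^sub>M lebesgue)"
    unfolding eq by measurable
  fix f :: "'a \<Rightarrow> ennreal" assume [measurable]: "f \<in> borel_measurable lebesgue"
  let ?I = "\<lambda>K x. \<integral>\<^sup>+y. ennreal (norm (K x y)) * f y \<partial>lebesgue"
  have sq: "(a + b)\<^sup>2 \<le> 2 * a\<^sup>2 + 2 * b\<^sup>2" for a b :: ennreal
  proof (cases "a = top \<or> b = top")
    case True
    then show ?thesis by (auto simp: power2_eq_square ennreal_mult_top ennreal_top_mult)
  next
    case False
    then obtain r s where "a = ennreal r" "r \<ge> 0" "b = ennreal s" "s \<ge> 0"
      by (metis ennreal_cases infinity_ennreal_def)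
    moreover have "(r + s)\<^sup>2 \<le> 2 * r\<^sup>2 + 2 * s\<^sup>2" for r s :: real
      using sum_squares_bound[of r s] by (simp add: power2_sum)
    ultimately show ?thesis
      by (simp add: ennreal_power ennreal_leI flip: ennreal_plus ennreal_mult' ennreal_numeral)
  qed
  have "(\<integral>\<^sup>+x. (?I K x)\<^sup>2 \<partial>lebesgue) \<le> (\<integral>\<^sup>+x. 2 * (?I K1 x)\<^sup>2 + 2 * (?I K2 x)\<^sup>2 \<partial>lebesgue)"
  proof (rule nn_integral_mono)
    fix x
    have "?I K x \<le> (\<integral>\<^sup>+y. ennreal (norm (K1 x y)) * f y + ennreal (norm (K2 x y)) * f y \<partial>lebesgue)"
      by (intro nn_integral_mono)
         (auto simp: eq norm_triangle_ineq intro!: mult_right_mono ennreal_leI simp flip: distrib_right ennreal_plus)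
    also have "\<dots> = ?I K1 x + ?I K2 x"
      by (rule nn_integral_add) measurable
    finally have "(?I K x)\<^sup>2 \<le> (?I K1 x + ?I K2 x)\<^sup>2" by (rule power_mono) simp
    also note sq
    finally show "(?I K x)\<^sup>2 \<le> 2 * (?I K1 x)\<^sup>2 + 2 * (?I K2 x)\<^sup>2" .
  qed
  also have "\<dots> = 2 * (\<integral>\<^sup>+x. (?I K1 x)\<^sup>2 \<partial>lebesgue) + 2 * (\<integral>\<^sup>+x. (?I K2 x)\<^sup>2 \<partial>lebesgue)"
    by (subst nn_integral_add) (auto simp: nn_integral_cmult)
  also have "\<dots> \<le> 2 * (ennreal (B1\<^sup>2) * (\<integral>\<^sup>+y. (f y)\<^sup>2 \<partial>lebesgue)) + 2 * (ennreal (B2\<^sup>2) * (\<integral>\<^sup>+y. (f y)\<^sup>2 \<partial>lebesgue))"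
    by (intro add_mono mult_left_mono bounded_kernel_estimate[OF K1] bounded_kernel_estimate[OF K2]) auto
  also have "\<dots> = ennreal ((sqrt (2 * B1\<^sup>2 + 2 * B2\<^sup>2))\<^sup>2) * (\<integral>\<^sup>+y. (f y)\<^sup>2 \<partial>lebesgue)"
    by (simp add: distrib_right mult.assoc ennreal_mult)
  finally show "(\<integral>\<^sup>+x. (?I K x)\<^sup>2 \<partial>lebesgue) \<le> \<dots>" .
qed auto

text \<open>For fixed \<open>x\<close> the component \<open>j\<close> of the image of
  \<open>e\<close> is its inner product with the conjugated row \<open>j\<close> of
  \<open>K x\<close>. Bessel's inequality bounds the sum over \<open>E\<close> by the squared norm
  of that row, and integration in \<open>x\<close> gives the Hilbert--Schmidt integral. The factor 2
  arises because \<open>E\<close> is orthonormal only over the reals: real and imaginary parts of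
  the coefficients are summed separately.\<close>

lemma sum_norm_kernel_op_le_HS:
  fixes K :: "'a::euclidean_space \<Rightarrow> 'a \<Rightarrow> complex^'m::finite^'m"
  assumes K: "bounded_kernel K B"
    and HS: "(\<integral>\<^sup>+x. \<integral>\<^sup>+y. (ennreal (norm (K x y)))\<^sup>2 \<partial>lebesgue \<partial>lebesgue) \<le> ennreal A" and "A \<ge> 0"
    and E: "finite E" "pairwise orthogonal E" "\<And>e. e \<in> E \<Longrightarrow> norm e = 1"
  shows "(\<Sum>e\<in>E. (norm (kernel_op K e))\<^sup>2) \<le> 2 * A"
proof -
  note [measurable] = bounded_kernel_measurable[OF K]
  have Ks [measurable]: "K x \<in> borel_measurable lebesgue" for x
    by (rule bounded_kernel_section[OF K])
  have fin: "AE x in lebesgue. (\<integral>\<^sup>+y. (ennreal (norm (K x y)))\<^sup>2 \<partial>lebesgue) \<noteq> \<infinity>"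
    by (rule nn_integral_PInf_AE) (use HS in \<open>auto simp: top_unique\<close>)
  have pt: "(\<Sum>e\<in>E. (norm (\<integral>y. K x y *v rep_L2 e y \<partial>lebesgue))\<^sup>2) \<le> 2 * (\<integral>y. (norm (K x y))\<^sup>2 \<partial>lebesgue)"
    if fx: "(\<integral>\<^sup>+y. (ennreal (norm (K x y)))\<^sup>2 \<partial>lebesgue) \<noteq> \<infinity>"
      and ix: "\<And>e. e \<in> E \<Longrightarrow> integrable lebesgue (\<lambda>y. K x y *v rep_L2 e y)" for x
  proof -
    have intK: "integrable lebesgue (\<lambda>y. (norm (K x y))\<^sup>2)"
      by (rule integrableI_bounded) (use fx in \<open>auto simp: ennreal_power less_top\<close>)
    define \<kappa> where "\<kappa> j y = (\<chi> k. cnj (K x y $ j $ k))" for j y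
    have nk: "(norm (\<kappa> j y))\<^sup>2 = (norm (K x y $ j))\<^sup>2" for j y
      by (simp add: \<kappa>_def norm_vec_def L2_set_def)
    have nK: "(norm (K x y))\<^sup>2 = (\<Sum>j\<in>UNIV. (norm (\<kappa> j y))\<^sup>2)" for y
      unfolding nk by (simp add: norm_vec_def[of "K x y"] L2_set_def sum_nonneg)
    have km [measurable]: "\<kappa> j \<in> borel_measurable lebesgue" for j
    proof -
      have "continuous_on UNIV (\<lambda>A :: complex^'m^'m. \<chi> k. cnj (A $ j $ k))"
        by (intro continuous_intros)
      from borel_measurable_continuous_on[OF this Ks[of x]] show ?thesis
        unfolding \<kappa>_def by simp
    qed
    have ik: "integrable lebesgue (\<lambda>y. (norm (\<kappa> j y))\<^sup>2)" for j
    proof (rule Bochner_Integration.integrable_bound[OF intK])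
      have "(norm (\<kappa> j y))\<^sup>2 \<le> (norm (K x y))\<^sup>2" for y
        unfolding nK by (rule member_le_sum) auto
      then show "AE y in lebesgue. norm ((norm (\<kappa> j y))\<^sup>2) \<le> norm ((norm (K x y))\<^sup>2)"
        by simp
    qed measurable
    have sk: "square_integrable (\<kappa> j)" for j
      using ik by (simp add: square_integrable_def)
    define F where "F j = abs_L2 (\<kappa> j)" for j
    have nF: "(norm (F j))\<^sup>2 = (\<integral>y. (norm (\<kappa> j y))\<^sup>2 \<partial>lebesgue)" for j
      unfolding norm_L2_sq F_def
      using rep_abs_L2[OF sk[of j]] by (intro integral_cong_AE) auto
    have comp: "(\<integral>y. K x y *v rep_L2 e y \<partial>lebesgue) $ j = cinner_L2 (F j) e" if "e \<in> E" for e j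
    proof -
      have "cinner_L2 (F j) e = cinner_L2 (abs_L2 (\<kappa> j)) (abs_L2 (rep_L2 e))"
        by (simp add: F_def abs_rep_L2)
      also have "\<dots> = (\<integral>y. vec_cinner (\<kappa> j y) (rep_L2 e y) \<partial>lebesgue)"
        by (rule cinner_L2_abs[OF sk square_integrable_rep])
      also have "\<dots> = (\<integral>y. (K x y *v rep_L2 e y) $ j \<partial>lebesgue)"
        by (simp add: vec_cinner_def \<kappa>_def matrix_vector_mult_def)
      also have "\<dots> = (\<integral>y. K x y *v rep_L2 e y \<partial>lebesgue) $ j"
        by (rule integral_bounded_linear[OF bounded_linear_vec_nth ix[OF that]])
      finally show ?thesis by simp
    qed
    have cF: "(\<Sum>e\<in>E. (cmod (cinner_L2 (F j) e))\<^sup>2) \<le> 2 * (norm (F j))\<^sup>2" for j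
    proof -
      have "(\<Sum>e\<in>E. (cmod (cinner_L2 (F j) e))\<^sup>2) = (\<Sum>e\<in>E. (inner e (F j))\<^sup>2) + (\<Sum>e\<in>E. (inner e (\<i> *\<^sub>C F j))\<^sup>2)"
        by (simp add: cinner_L2_eq_inner cmod_power2 inner_commute sum.distrib)
      also have "\<dots> \<le> (norm (F j))\<^sup>2 + (norm (\<i> *\<^sub>C F j))\<^sup>2"
        by (intro add_mono Bessel_inequality E)
      finally show ?thesis by (simp add: norm_scaleC_L2)
    qed
    have "(\<Sum>e\<in>E. (norm (\<integral>y. K x y *v rep_L2 e y \<partial>lebesgue))\<^sup>2)
       = (\<Sum>e\<in>E. \<Sum>j\<in>UNIV. (cmod (cinner_L2 (F j) e))\<^sup>2)"
      by (intro sum.cong refl) (simp add: norm_vec_def[where 'b = 'm] L2_set_def sum_nonneg comp)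
    also have "\<dots> = (\<Sum>j\<in>UNIV. \<Sum>e\<in>E. (cmod (cinner_L2 (F j) e))\<^sup>2)"
      by (rule sum.swap)
    also have "\<dots> \<le> (\<Sum>j\<in>UNIV. 2 * (norm (F j))\<^sup>2)"
      by (intro sum_mono cF)
    also have "\<dots> = 2 * (\<integral>y. (norm (K x y))\<^sup>2 \<partial>lebesgue)"
      by (simp add: nF nK ik sum_distrib_left)
    finally show ?thesis .
  qed
  have "ennreal (\<Sum>e\<in>E. (norm (kernel_op K e))\<^sup>2) = (\<Sum>e\<in>E. ennreal ((norm (kernel_op K e))\<^sup>2))"
    by (simp add: sum_ennreal)
  also have "\<dots> = (\<Sum>e\<in>E. \<integral>\<^sup>+x. (ennreal (norm (\<integral>y. K x y *v rep_L2 e y \<partial>lebesgue)))\<^sup>2 \<partial>lebesgue)"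
    unfolding kernel_op_def nn_integral_norm_abs_L2[OF square_integrable_kernel[OF K square_integrable_rep]] ..
  also have "\<dots> = (\<integral>\<^sup>+x. (\<Sum>e\<in>E. (ennreal (norm (\<integral>y. K x y *v rep_L2 e y \<partial>lebesgue)))\<^sup>2) \<partial>lebesgue)"
    by (rule nn_integral_sum[symmetric]) measurable
  also have "\<dots> \<le> (\<integral>\<^sup>+x. 2 * (\<integral>\<^sup>+y. (ennreal (norm (K x y)))\<^sup>2 \<partial>lebesgue) \<partial>lebesgue)"
  proof (rule nn_integral_mono_AE)
    have "AE x in lebesgue. \<forall>e\<in>E. integrable lebesgue (\<lambda>y. K x y *v rep_L2 e y)"
      using E(1) bounded_kernel_integrable[OF K square_integrable_rep] by (intro AE_finite_allI)
    with fin show "AE x in lebesgue. (\<Sum>e\<in>E. (ennreal (norm (\<integral>y. K x y *v rep_L2 e y \<partial>lebesgue)))\<^sup>2)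
       \<le> 2 * (\<integral>\<^sup>+y. (ennreal (norm (K x y)))\<^sup>2 \<partial>lebesgue)"
    proof eventually_elim
      fix x assume fx: "(\<integral>\<^sup>+y. (ennreal (norm (K x y)))\<^sup>2 \<partial>lebesgue) \<noteq> \<infinity>"
        and ix: "\<forall>e\<in>E. integrable lebesgue (\<lambda>y. K x y *v rep_L2 e y)"
      have "(\<Sum>e\<in>E. (ennreal (norm (\<integral>y. K x y *v rep_L2 e y \<partial>lebesgue)))\<^sup>2)
         = ennreal (\<Sum>e\<in>E. (norm (\<integral>y. K x y *v rep_L2 e y \<partial>lebesgue))\<^sup>2)"
        by (simp add: ennreal_power sum_ennreal)
      also have "\<dots> \<le> ennreal (2 * (\<integral>y. (norm (K x y))\<^sup>2 \<partial>lebesgue))"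
        by (intro ennreal_leI pt fx) (use ix in auto)
      also have "\<dots> = 2 * ennreal (\<integral>y. (norm (K x y))\<^sup>2 \<partial>lebesgue)"
        by (simp add: ennreal_mult)
      also have "ennreal (\<integral>y. (norm (K x y))\<^sup>2 \<partial>lebesgue) = (\<integral>\<^sup>+y. (ennreal (norm (K x y)))\<^sup>2 \<partial>lebesgue)"
        using fx by (subst nn_integral_eq_integral[symmetric])
          (auto simp: ennreal_power less_top intro!: integrableI_bounded)
      finally show "(\<Sum>e\<in>E. (ennreal (norm (\<integral>y. K x y *v rep_L2 e y \<partial>lebesgue)))\<^sup>2)
       \<le> 2 * (\<integral>\<^sup>+y. (ennreal (norm (K x y)))\<^sup>2 \<partial>lebesgue)" .
    qed
  qed
  also have "\<dots> = 2 * (\<integral>\<^sup>+x. \<integral>\<^sup>+y. (ennreal (norm (K x y)))\<^sup>2 \<partial>lebesgue \<partial>lebesgue)"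
    by (rule nn_integral_cmult) measurable
  also have "\<dots> \<le> 2 * ennreal A"
    by (intro mult_left_mono HS) auto
  also have "\<dots> = ennreal (2 * A)"
    using \<open>A \<ge> 0\<close> by (simp add: ennreal_mult)
  finally show ?thesis
    using \<open>A \<ge> 0\<close> by (subst (asm) ennreal_le_iff) auto
qed

text \<open>Pointwise domination by a geometric mean of a Hilbert--Schmidt kernel \<open>g0\<close> and a Schur kernel
  \<open>g1\<close>. Cutting along \<open>g1 \<le> t * g0\<close> is a real-variable substitute for complex interpolation.\<close>

locale interpolated_kernel =
  fixes g0 g1 :: "'a::euclidean_space \<Rightarrow> 'a \<Rightarrow> real" and w :: "'a \<Rightarrow> real" and q A B :: real
  assumes g0_meas: "(\<lambda>(x, y). g0 x y) \<in> borel_measurable (lebesgue \<Otimes>\<^sub>M lebesgue)"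
    and g1_meas: "(\<lambda>(x, y). g1 x y) \<in> borel_measurable (lebesgue \<Otimes>\<^sub>M lebesgue)"
    and w_meas: "w \<in> borel_measurable lebesgue"
    and g0_nonneg: "g0 x y \<ge> 0" and g1_nonneg: "g1 x y \<ge> 0" and w_pos: "w x > 0"
    and g0_sym: "g0 x y = g0 y x" and g1_sym: "g1 x y = g1 y x"
    and q_gt: "q > 2" and A_nonneg: "A \<ge> 0" and B_pos: "B > 0"
    and HS: "(\<integral>\<^sup>+x. \<integral>\<^sup>+y. (ennreal (g0 x y))\<^sup>2 \<partial>lebesgue \<partial>lebesgue) \<le> ennreal A"
    and Schur: "(\<integral>\<^sup>+y. ennreal (g1 x y * w y) \<partial>lebesgue) \<le> ennreal (B * w x)"
begin

text \<open>The bound is required at every pair, so that the cut has no exceptional set, and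
  measurability refers to the product of the Lebesgue sigma-algebras, where Tonelli applies. Kernels
  known only up to null sets have to be adjusted beforehand.\<close>

definition dominated :: "('a \<Rightarrow> 'a \<Rightarrow> complex^'m::finite^'m) \<Rightarrow> bool" where
  "dominated K \<longleftrightarrow> (\<lambda>(x, y). K x y) \<in> borel_measurable (lebesgue \<Otimes>\<^sub>M lebesgue) \<and>
     (\<forall>x y. norm (K x y) \<le> g0 x y powr (2 / q) * g1 x y powr (1 - 2 / q))"

lemma dominated_adjoint: "dominated K \<Longrightarrow> dominated (adjoint_kernel K)"
proof -
  assume K: "dominated K"
  then have Km: "(\<lambda>(x, y). K x y) \<in> borel_measurable (lebesgue \<Otimes>\<^sub>M lebesgue)"
    by (simp add: dominated_def)
  have "(\<lambda>(x, y). K y x) \<in> borel_measurable (lebesgue \<Otimes>\<^sub>M lebesgue)"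
    using measurable_compose[OF measurable_pair_swap' Km] by (simp add: case_prod_beta')
  moreover have "continuous_on UNIV (\<lambda>A :: complex^'b^'b. \<chi> j k. cnj (A $ k $ j))"
    by (intro continuous_intros)
  ultimately have "(\<lambda>z. \<chi> j k. cnj ((case z of (x, y) \<Rightarrow> K y x) $ k $ j)) \<in> borel_measurable (lebesgue \<Otimes>\<^sub>M lebesgue)"
    by (rule borel_measurable_continuous_on[rotated])
  then have "(\<lambda>(x, y). adjoint_kernel K x y) \<in> borel_measurable (lebesgue \<Otimes>\<^sub>M lebesgue)"
    by (simp add: adjoint_kernel_def case_prod_beta')
  moreover have "norm (adjoint_kernel K x y) = norm (K y x)" for x y
  proof -
    have "(\<Sum>j\<in>UNIV. \<Sum>k\<in>UNIV. (cmod (K y x $ k $ j))\<^sup>2) = (\<Sum>k\<in>UNIV. \<Sum>j\<in>UNIV. (cmod (K y x $ k $ j))\<^sup>2)"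
      by (rule sum.swap)
    then show ?thesis
      by (simp add: adjoint_kernel_def norm_vec_def L2_set_def sum_nonneg)
  qed
  ultimately show ?thesis
    using K g0_sym g1_sym unfolding dominated_def by metis
qed

text \<open>Where \<open>g1 \<le> t * g0\<close>, replacing \<open>g1\<close> by
  \<open>t * g0\<close> in the geometric mean leaves \<open>t powr (1 - 2 / q) * g0\<close>, which
  is Hilbert--Schmidt. Elsewhere \<open>g0\<close> is at most \<open>g1 / t\<close>, which leaves
  \<open>t powr (- 2 / q) * g1\<close>, a kernel for the Schur test. Large \<open>t\<close> makes
  the second part small in norm at the expense of the first.\<close>

lemma dominated_split:
  assumes K: "dominated (K :: 'a \<Rightarrow> 'a \<Rightarrow> complex^'m::finite^'m)" and "t > 0"
  obtains K1 K2 where "\<And>x y. K x y = K1 x y + K2 x y"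
    "bounded_kernel K1 (sqrt (t powr (2 - 4 / q) * A))"
    "(\<integral>\<^sup>+x. \<integral>\<^sup>+y. (ennreal (norm (K1 x y)))\<^sup>2 \<partial>lebesgue \<partial>lebesgue) \<le> ennreal (t powr (2 - 4 / q) * A)"
    "bounded_kernel K2 (t powr (- 2 / q) * B)"
proof -
  note [measurable] = g0_meas g1_meas w_meas
  have Km [measurable]: "(\<lambda>(x, y). K x y) \<in> borel_measurable (lebesgue \<Otimes>\<^sub>M lebesgue)"
    and Kle: "\<And>x y. norm (K x y) \<le> g0 x y powr (2 / q) * g1 x y powr (1 - 2 / q)"
    using K by (auto simp: dominated_def)
  have q: "2 / q > 0" "1 - 2 / q > 0" using q_gt by (auto simp: field_simps)
  define K1 where "K1 x y = (if g1 x y \<le> t * g0 x y then K x y else 0)" for x y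
  define K2 where "K2 x y = (if g1 x y \<le> t * g0 x y then 0 else K x y)" for x y
  have m1 [measurable]: "(\<lambda>(x, y). K1 x y) \<in> borel_measurable (lebesgue \<Otimes>\<^sub>M lebesgue)"
    unfolding K1_def by measurable
  have m2 [measurable]: "(\<lambda>(x, y). K2 x y) \<in> borel_measurable (lebesgue \<Otimes>\<^sub>M lebesgue)"
    unfolding K2_def by measurable
  have le1: "norm (K1 x y) \<le> t powr (1 - 2 / q) * g0 x y" for x y
  proof (cases "g1 x y \<le> t * g0 x y")
    case True
    then have "norm (K1 x y) \<le> g0 x y powr (2 / q) * g1 x y powr (1 - 2 / q)" using Kle by (simp add: K1_def)
    also have "\<dots> \<le> g0 x y powr (2 / q) * (t * g0 x y) powr (1 - 2 / q)"
      using True q g1_nonneg by (intro mult_left_mono powr_mono2) auto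
    also have "\<dots> = t powr (1 - 2 / q) * (g0 x y powr (2 / q) * g0 x y powr (1 - 2 / q))"
      using \<open>t > 0\<close> g0_nonneg by (simp add: powr_mult)
    also have "g0 x y powr (2 / q) * g0 x y powr (1 - 2 / q) = g0 x y"
      using g0_nonneg[of x y] by (simp flip: powr_add)
    finally show ?thesis .
  qed (use g0_nonneg in \<open>auto simp: K1_def\<close>)
  have le2: "norm (K2 x y) \<le> t powr (- 2 / q) * g1 x y" for x y
  proof (cases "g1 x y \<le> t * g0 x y")
    case False
    then have "norm (K2 x y) \<le> g0 x y powr (2 / q) * g1 x y powr (1 - 2 / q)" using Kle by (simp add: K2_def)
    also have "\<dots> \<le> (inverse t * g1 x y) powr (2 / q) * g1 x y powr (1 - 2 / q)"
      using False q g0_nonneg \<open>t > 0\<close> by (intro mult_right_mono powr_mono2) (auto simp: field_simps)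
    also have "\<dots> = t powr (- 2 / q) * (g1 x y powr (2 / q) * g1 x y powr (1 - 2 / q))"
      using \<open>t > 0\<close> g1_nonneg by (simp add: powr_mult powr_minus inverse_powr)
    also have "g1 x y powr (2 / q) * g1 x y powr (1 - 2 / q) = g1 x y"
      using g1_nonneg[of x y] by (simp flip: powr_add)
    finally show ?thesis .
  qed (use g1_nonneg in \<open>auto simp: K2_def\<close>)
  have HS1: "(\<integral>\<^sup>+x. \<integral>\<^sup>+y. (ennreal (norm (K1 x y)))\<^sup>2 \<partial>lebesgue \<partial>lebesgue) \<le> ennreal (t powr (2 - 4 / q) * A)"
  proof -
    have tt: "(t powr (1 - 2 / q))\<^sup>2 = t powr (2 - 4 / q)"
      using \<open>t > 0\<close> by (simp add: powr_power algebra_simps)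
    have "(\<integral>\<^sup>+x. \<integral>\<^sup>+y. (ennreal (norm (K1 x y)))\<^sup>2 \<partial>lebesgue \<partial>lebesgue)
      \<le> (\<integral>\<^sup>+x. \<integral>\<^sup>+y. ennreal (t powr (2 - 4 / q)) * (ennreal (g0 x y))\<^sup>2 \<partial>lebesgue \<partial>lebesgue)"
    proof (intro nn_integral_mono)
      fix x y
      have "(ennreal (norm (K1 x y)))\<^sup>2 \<le> (ennreal (t powr (1 - 2 / q) * g0 x y))\<^sup>2"
        by (intro power_mono ennreal_leI le1) auto
      also have "\<dots> = ennreal (t powr (2 - 4 / q)) * (ennreal (g0 x y))\<^sup>2"
        using g0_nonneg[of x y] by (simp add: ennreal_power power_mult_distrib tt flip: ennreal_mult)
      finally show "(ennreal (norm (K1 x y)))\<^sup>2 \<le> ennreal (t powr (2 - 4 / q)) * (ennreal (g0 x y))\<^sup>2" .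
    qed
    also have "\<dots> = ennreal (t powr (2 - 4 / q)) * (\<integral>\<^sup>+x. \<integral>\<^sup>+y. (ennreal (g0 x y))\<^sup>2 \<partial>lebesgue \<partial>lebesgue)"
      by (simp add: nn_integral_cmult)
    also have "\<dots> \<le> ennreal (t powr (2 - 4 / q)) * ennreal A"
      by (intro mult_left_mono HS) auto
    finally show ?thesis using A_nonneg by (simp add: ennreal_mult)
  qed
  have b1: "bounded_kernel K1 (sqrt (t powr (2 - 4 / q) * A))"
    by (rule bounded_kernel_HS[OF m1 HS1]) (use A_nonneg in auto)
  have S: "(\<integral>\<^sup>+y. ennreal (norm (K2 x y) * w y) \<partial>lebesgue) \<le> ennreal (t powr (- 2 / q) * B * w x)"
    "(\<integral>\<^sup>+y. ennreal (norm (K2 y x) * w y) \<partial>lebesgue) \<le> ennreal (t powr (- 2 / q) * B * w x)" for x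
  proof -
    have *: "(\<integral>\<^sup>+y. ennreal (h y * w y) \<partial>lebesgue) \<le> ennreal (t powr (- 2 / q) * B * w x)"
      if h: "\<And>y. h y \<le> t powr (- 2 / q) * g1 x y" for h
    proof -
      have "(\<integral>\<^sup>+y. ennreal (h y * w y) \<partial>lebesgue)
        \<le> (\<integral>\<^sup>+y. ennreal (t powr (- 2 / q)) * ennreal (g1 x y * w y) \<partial>lebesgue)"
      proof (rule nn_integral_mono)
        fix y
        have "h y * w y \<le> t powr (- 2 / q) * (g1 x y * w y)"
          using mult_right_mono[OF h[of y], of "w y"] w_pos[of y] by (simp add: mult.assoc)
        then show "ennreal (h y * w y) \<le> ennreal (t powr (- 2 / q)) * ennreal (g1 x y * w y)"
          using g1_nonneg[of x y] w_pos[of y] by (simp add: ennreal_leI flip: ennreal_mult)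
      qed
      also have "\<dots> = ennreal (t powr (- 2 / q)) * (\<integral>\<^sup>+y. ennreal (g1 x y * w y) \<partial>lebesgue)"
        by (rule nn_integral_cmult) measurable
      also have "\<dots> \<le> ennreal (t powr (- 2 / q)) * ennreal (B * w x)"
        by (intro mult_left_mono Schur) auto
      finally show ?thesis using B_pos w_pos[of x] by (simp add: mult.assoc flip: ennreal_mult)
    qed
    show "(\<integral>\<^sup>+y. ennreal (norm (K2 x y) * w y) \<partial>lebesgue) \<le> ennreal (t powr (- 2 / q) * B * w x)"
      by (rule *) (rule le2)
    show "(\<integral>\<^sup>+y. ennreal (norm (K2 y x) * w y) \<partial>lebesgue) \<le> ennreal (t powr (- 2 / q) * B * w x)"
      by (rule *) (metis le2 g1_sym)
  qed
  have b2: "bounded_kernel K2 (t powr (- 2 / q) * B)"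
    by (rule bounded_kernel_Schur[OF m2 w_meas w_pos _ S]) (use B_pos in auto)
  show ?thesis by (rule that[OF _ b1 HS1 b2]) (simp add: K1_def K2_def)
qed

lemma dominated_bounded:
  assumes "dominated (K :: 'a \<Rightarrow> 'a \<Rightarrow> complex^'m::finite^'m)"
  obtains M where "bounded_kernel K M"
  using dominated_split[OF assms, of 1] bounded_kernel_add by (metis zero_less_one)

text \<open>The Schur part sends each member to a vector of norm at most \<open>l / 2\<close>, so
  the Hilbert--Schmidt part sends it to one of norm at least \<open>l / 2\<close>; the total square
  sum of the latter limits the number of members.\<close>

lemma dominated_orthonormal_count:
  assumes K: "dominated (K :: 'a \<Rightarrow> 'a \<Rightarrow> complex^'m::finite^'m)"
  shows "orthonormal_count (kernel_op K) q (8 * (2 * B) powr (q - 2) * A)"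
  unfolding orthonormal_count_def
proof (intro allI impI)
  fix l :: real and E :: "('a, 'm) L2 set"
  assume l: "l > 0" and E: "finite E" "pairwise orthogonal E" "\<forall>e\<in>E. norm e = 1 \<and> l < norm (kernel_op K e)"
  \<comment> \<open>Solves \<open>t powr (- 2 / q) * B = l / 2\<close>. Then
    \<open>t powr (2 - 4 / q) = (2 * B / l) powr (q - 2)\<close>, and division by
    \<open>(l / 2)\<^sup>2\<close> produces the rate \<open>l powr (- q)\<close>.\<close>
  define t where "t = (2 * B / l) powr (q / 2)"
  have "t > 0" using l B_pos by (simp add: t_def)
  from dominated_split[OF K this] obtain K1 K2 where eq: "\<And>x y. K x y = K1 x y + K2 x y"
    and b1: "bounded_kernel K1 (sqrt (t powr (2 - 4 / q) * A))"
    and HS1: "(\<integral>\<^sup>+x. \<integral>\<^sup>+y. (ennreal (norm (K1 x y)))\<^sup>2 \<partial>lebesgue \<partial>lebesgue) \<le> ennreal (t powr (2 - 4 / q) * A)"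
    and b2: "bounded_kernel K2 (t powr (- 2 / q) * B)" by blast
  have t1: "t powr (2 - 4 / q) = (2 * B / l) powr (q - 2)"
    using q_gt by (simp add: t_def powr_powr algebra_simps)
  have t2: "t powr (- 2 / q) * B = l / 2"
    using q_gt l B_pos by (simp add: t_def powr_powr powr_minus_divide)
  have sum: "(\<Sum>e\<in>E. (norm (kernel_op K1 e))\<^sup>2) \<le> 2 * ((2 * B / l) powr (q - 2) * A)"
    using sum_norm_kernel_op_le_HS[OF b1 HS1 _ E(1,2)] E(3) A_nonneg by (simp add: t1)
  have "(l / 2)\<^sup>2 \<le> (norm (kernel_op K1 e))\<^sup>2" if e: "e \<in> E" for e
  proof (rule power_mono)
    have "kernel_op K e = kernel_op K1 e + kernel_op K2 e"
      by (rule kernel_op_split[OF b1 b2 bounded_kernel_add[OF b1 b2 eq] eq])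
    then have "norm (kernel_op K e) \<le> norm (kernel_op K1 e) + norm (kernel_op K2 e)"
      by (simp add: norm_triangle_ineq)
    moreover have "norm (kernel_op K2 e) \<le> l / 2"
      using norm_kernel_op_le[OF b2, of e, unfolded t2] E(3) e by simp
    moreover have "l < norm (kernel_op K e)" using E(3) e by blast
    ultimately show "l / 2 \<le> norm (kernel_op K1 e)" by linarith
  qed (use l in simp)
  then have "real (card E) * (l / 2)\<^sup>2 \<le> (\<Sum>e\<in>E. (norm (kernel_op K1 e))\<^sup>2)"
    using sum_bounded_below[of E "(l / 2)\<^sup>2"] by simp
  with sum have c: "real (card E) * (l / 2)\<^sup>2 \<le> 2 * ((2 * B / l) powr (q - 2) * A)" by linarith
  have lq: "l powr q = l powr (q - 2) * l\<^sup>2"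
    using l by (simp add: powr_diff powr_realpow flip: powr_numeral)
  have "real (card E) * l powr q = (real (card E) * (l / 2)\<^sup>2) * (4 * l powr (q - 2))"
    by (simp add: lq power_divide)
  also have "\<dots> \<le> (2 * ((2 * B / l) powr (q - 2) * A)) * (4 * l powr (q - 2))"
    using c by (rule mult_right_mono) simp
  also have "\<dots> = 8 * (2 * B) powr (q - 2) * A"
    using l B_pos by (simp add: powr_divide)
  finally show "real (card E) * l powr q \<le> 8 * (2 * B) powr (q - 2) * A" .
qed

lemma kernel_op_schatten:
  assumes K: "dominated (K :: 'a \<Rightarrow> 'a \<Rightarrow> complex^'m::finite^'m)" and "p > q"
  shows "kernel_op K \<in> schatten_class p"
proof -
  obtain M where M: "bounded_kernel K M" using dominated_bounded[OF K] .
  obtain M' where M': "bounded_kernel (adjoint_kernel K) M'"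
    using dominated_bounded[OF dominated_adjoint[OF K]] .
  show ?thesis
    by (rule schatten_classI[OF linear_kernel_op[OF M] linear_kernel_op[OF M'] norm_kernel_op_le[OF M]
          adjoint_L2_kernel_op[OF M M'] cinner_kernel_op_adjoint[OF M M'] dominated_orthonormal_count[OF K]])
       (use q_gt \<open>p > q\<close> in auto)
qed

end

subsection \<open>Lebesgue measurable kernels\<close>

text \<open>Completeness of Lebesgue measure: preimages under \<open>f\<close> and \<open>g\<close>
  differ only within a null set.\<close>

lemma borel_measurable_lebesgue_AE_eq:
  assumes f: "f \<in> lebesgue \<rightarrow>\<^sub>M N" and eq: "AE x in lebesgue. f x = g x" and g: "\<And>x. g x \<in> space N"
  shows "g \<in> lebesgue \<rightarrow>\<^sub>M N"
proof (rule measurableI)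
  fix S assume S: "S \<in> sets N"
  show "g -` S \<inter> space lebesgue \<in> sets lebesgue"
  proof (rule completion.in_sets_AE)
    show "f -` S \<inter> space lebesgue \<in> sets lebesgue" using f S by (rule measurable_sets)
    show "AE x in lebesgue. x \<in> f -` S \<inter> space lebesgue \<longleftrightarrow> x \<in> g -` S \<inter> space lebesgue"
      using eq by eventually_elim simp
  qed auto
qed (use g in simp)

text \<open>The product of two Lebesgue sigma-algebras is smaller than the Lebesgue sigma-algebra of
  the product space, but it contains the Borel sets. Borel functions are therefore the link between
  the two notions of a measurable kernel.\<close>

lemma ident_measurable_lebesgue_pair:
  "(\<lambda>z. z) \<in> (lebesgue :: 'a::euclidean_space measure) \<Otimes>\<^sub>M (lebesgue :: 'b::euclidean_space measure) \<rightarrow>\<^sub>M (borel :: ('a \<times> 'b) measure)"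
proof -
  have "(\<lambda>x. x) \<in> (lebesgue :: 'c::euclidean_space measure) \<rightarrow>\<^sub>M borel"
    by (rule measurable_completion) simp
  then have "(\<lambda>z. (fst z, snd z)) \<in> (lebesgue :: 'a measure) \<Otimes>\<^sub>M (lebesgue :: 'b measure) \<rightarrow>\<^sub>M borel \<Otimes>\<^sub>M borel"
    by (intro measurable_Pair measurable_compose[OF measurable_fst] measurable_compose[OF measurable_snd])
       (auto intro: measurable_completion)
  then show ?thesis by (simp add: borel_prod)
qed

text \<open>A null set of the completed product measure lies in a Borel null set, to which Fubini
  for \<open>lborel\<close> applies; completing the factors does not change almost everywhere
  statements.\<close>

lemma AE_lebesgue_pair:
  assumes "AE z in (lebesgue :: ('a::euclidean_space \<times> 'b::euclidean_space) measure). P z"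
  shows "AE x in lebesgue. AE y in lebesgue. P (x, y)"
proof -
  have "AE z in lborel \<Otimes>\<^sub>M lborel. P z"
    using assms unfolding AE_completion_iff lborel_prod .
  then show ?thesis
    unfolding AE_completion_iff by (rule lborel_pair.AE_pair)
qed

text \<open>Real and imaginary parts of the finitely many entries have Borel versions, which are
  reassembled with matrix units.\<close>

lemma lebesgue_ex_borel_matrix:
  fixes K :: "'c::euclidean_space \<Rightarrow> complex^'m::finite^'k::finite"
  assumes K: "K \<in> borel_measurable lebesgue"
  shows "\<exists>K'\<in>borel_measurable borel. AE z in lebesgue. K z = K' z"
proof -
  have cont: "continuous_on UNIV (\<lambda>A :: complex^'m^'k. Re (A $ j $ k))" "continuous_on UNIV (\<lambda>A :: complex^'m^'k. Im (A $ j $ k))" for j k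
    by (intro continuous_intros)+
  have "\<exists>r\<in>borel_measurable lborel. AE z in lborel. Re (K z $ j $ k) = r z" for j k
    by (rule completion_ex_borel_measurable_real) (rule borel_measurable_continuous_on[OF cont(1) K])
  then obtain r where r: "\<And>j k. r j k \<in> borel_measurable lborel" "\<And>j k. AE z in lborel. Re (K z $ j $ k) = r j k z"
    by metis
  have "\<exists>r\<in>borel_measurable lborel. AE z in lborel. Im (K z $ j $ k) = r z" for j k
    by (rule completion_ex_borel_measurable_real) (rule borel_measurable_continuous_on[OF cont(2) K])
  then obtain i where i: "\<And>j k. i j k \<in> borel_measurable lborel" "\<And>j k. AE z in lborel. Im (K z $ j $ k) = i j k z"
    by metis
  define K' where "K' z = (\<Sum>j\<in>UNIV. \<Sum>k\<in>UNIV. r j k z *\<^sub>R (\<chi> a b. if a = j \<and> b = k then 1 else 0) + i j k z *\<^sub>R (\<chi> a b. if a = j \<and> b = k then \<i> else 0) :: complex^'m^'k)" for z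
  have [measurable]: "r j k \<in> borel_measurable borel" "i j k \<in> borel_measurable borel" for j k
    using r(1) i(1) by simp_all
  have "K' \<in> borel_measurable borel"
    unfolding K'_def by (intro borel_measurable_sum borel_measurable_add borel_measurable_scaleR) auto
  moreover have comp: "K' z $ a $ b = Complex (r a b z) (i a b z)" for z a b
  proof -
    have "K' z $ a $ b = (\<Sum>j\<in>UNIV. \<Sum>k\<in>UNIV. if j = a then (if k = b then Complex (r j k z) (i j k z) else 0) else 0)"
      unfolding K'_def by (simp add: sum_component) (intro sum.cong refl, auto simp: complex_eq_iff)
    also have "\<dots> = (\<Sum>j\<in>UNIV. if j = a then (\<Sum>k\<in>UNIV. if k = b then Complex (r j k z) (i j k z) else 0) else 0)"
      by (intro sum.cong refl) simp
    also have "\<dots> = Complex (r a b z) (i a b z)" by simp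
    finally show ?thesis .
  qed
  moreover have "AE z in lebesgue. K z = K' z"
  proof -
    have "AE z in lborel. \<forall>j\<in>UNIV. \<forall>k\<in>UNIV. Re (K z $ j $ k) = r j k z \<and> Im (K z $ j $ k) = i j k z"
      using r(2) i(2) by (intro AE_finite_allI AE_conjI) auto
    then have "AE z in lborel. K z = K' z"
      by eventually_elim (simp add: vec_eq_iff comp complex_eq_iff)
    then show ?thesis by (rule AE_completion)
  qed
  ultimately show ?thesis by blast
qed

text \<open>For almost every \<open>x\<close> the sections of \<open>K\<close> and of its
  modification \<open>L\<close> agree almost everywhere, so the condition that defines
  \<open>R f = Some g\<close> becomes \<open>g = kernel_op L f\<close>. In particular the maximal
  domain of \<open>R\<close> is the whole space.\<close>

theorem (in interpolated_kernel) in_schatten_classI: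
  fixes R :: "('a, 'm::finite) L2 \<rightharpoonup> ('a, 'm) L2"
  assumes R: "is_integral_operator R K"
    and bound: "AE (x, y) in lebesgue. norm (K x y) \<le> g0 x y powr (2 / q) * g1 x y powr (1 - 2 / q)"
    and "p > q"
  shows "in_schatten_class R p"
proof -
  note [measurable] = g0_meas g1_meas
  have "(\<lambda>(x, y). K x y) \<in> borel_measurable lebesgue"
    using R by (simp add: is_integral_operator_def)
  from lebesgue_ex_borel_matrix[OF this] obtain K' where K': "K' \<in> borel_measurable borel"
    and eq': "AE z in lebesgue. (case z of (x, y) \<Rightarrow> K x y) = K' z" by blast
  have K'm: "K' \<in> borel_measurable (lebesgue \<Otimes>\<^sub>M lebesgue)"
    using measurable_compose[OF ident_measurable_lebesgue_pair K'] by simp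
  \<comment> \<open>The value 0 where the bound fails turns an almost everywhere bound into one
    valid at every pair.\<close>
  define L where "L x y = (if norm (K' (x, y)) \<le> g0 x y powr (2 / q) * g1 x y powr (1 - 2 / q) then K' (x, y) else 0)" for x y
  have Lm: "(\<lambda>(x, y). L x y) \<in> borel_measurable (lebesgue \<Otimes>\<^sub>M lebesgue)"
  proof -
    have [measurable]: "(\<lambda>(x, y). K' (x, y)) \<in> borel_measurable (lebesgue \<Otimes>\<^sub>M lebesgue)" using K'm by simp
    show ?thesis unfolding L_def by measurable
  qed
  have "dominated L"
    unfolding dominated_def by (intro conjI Lm) (simp add: L_def)
  obtain M where M: "bounded_kernel L M" using dominated_bounded[OF \<open>dominated L\<close>] .
  have "AE z in lebesgue. case z of (x, y) \<Rightarrow> K x y = L x y"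
    using eq' bound by eventually_elim (auto simp: L_def)
  then have ae: "AE x in lebesgue. AE y in lebesgue. K x y = L x y"
    using AE_lebesgue_pair by fastforce
  have "R f = Some g \<longleftrightarrow> g = kernel_op L f" for f g
  proof -
    have "R f = Some g \<longleftrightarrow> (AE x in lebesgue. integrable lebesgue (\<lambda>y. K x y *v rep_L2 f y) \<and>
           rep_L2 g x = (\<integral>y. K x y *v rep_L2 f y \<partial>lebesgue))"
      using R by (simp add: is_integral_operator_def)
    also have "\<dots> \<longleftrightarrow> (AE x in lebesgue. rep_L2 g x = (\<integral>y. L x y *v rep_L2 f y \<partial>lebesgue))"
    proof -
      have "AE x in lebesgue. (integrable lebesgue (\<lambda>y. K x y *v rep_L2 f y) \<and>
           rep_L2 g x = (\<integral>y. K x y *v rep_L2 f y \<partial>lebesgue)) \<longleftrightarrow> rep_L2 g x = (\<integral>y. L x y *v rep_L2 f y \<partial>lebesgue)"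
        using ae bounded_kernel_integrable[OF M square_integrable_rep, of f]
      proof eventually_elim
        fix x assume e: "AE y in lebesgue. K x y = L x y"
          and i: "integrable lebesgue (\<lambda>y. L x y *v rep_L2 f y)"
        have e': "AE y in lebesgue. L x y *v rep_L2 f y = K x y *v rep_L2 f y"
          using e by eventually_elim simp
        have m: "(\<lambda>y. K x y *v rep_L2 f y) \<in> borel_measurable lebesgue"
          by (rule borel_measurable_lebesgue_AE_eq[OF borel_measurable_integrable[OF i] e']) simp
        have "integrable lebesgue (\<lambda>y. K x y *v rep_L2 f y)"
          using integrable_cong_AE[OF borel_measurable_integrable[OF i] m e'] i by simp
        moreover have "(\<integral>y. K x y *v rep_L2 f y \<partial>lebesgue) = (\<integral>y. L x y *v rep_L2 f y \<partial>lebesgue)"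
          using integral_cong_AE[OF borel_measurable_integrable[OF i] m e'] by simp
        ultimately show "(integrable lebesgue (\<lambda>y. K x y *v rep_L2 f y) \<and>
           rep_L2 g x = (\<integral>y. K x y *v rep_L2 f y \<partial>lebesgue)) \<longleftrightarrow> rep_L2 g x = (\<integral>y. L x y *v rep_L2 f y \<partial>lebesgue)"
          by simp
      qed
      then show ?thesis by (rule eventually_subst)
    qed
    also have "\<dots> \<longleftrightarrow> g = kernel_op L f"
      using kernel_op_eq_iff[OF M, of f g] by auto
    finally show ?thesis .
  qed
  then have "R = (\<lambda>f. Some (kernel_op L f))" by blast
  then show ?thesis
    unfolding in_schatten_class_def using kernel_op_schatten[OF \<open>dominated L\<close> \<open>p > q\<close>] by blast
qed

section \<open>Integrals of power weights\<close>

lemma bracket_ge_1: "bracket x \<ge> 1"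
  by (simp add: bracket_def)

lemma bracket_pos: "bracket x > 0"
  using bracket_ge_1[of x] by linarith

lemma norm_le_bracket: "norm x \<le> bracket x"
  unfolding bracket_def by (rule real_le_rsqrt) simp

lemma bracket_le_add_norm: "bracket x \<le> bracket y + norm (x - y)"
proof -
  have "norm x \<le> norm y + norm (x - y)" by (metis norm_triangle_sub)
  then have "(norm x)\<^sup>2 \<le> (norm y + norm (x - y))\<^sup>2" by (intro power_mono) auto
  moreover have "norm y * norm (x - y) \<le> bracket y * norm (x - y)"
    by (intro mult_right_mono norm_le_bracket) auto
  moreover have "(bracket y)\<^sup>2 = 1 + (norm y)\<^sup>2" by (simp add: bracket_def)
  ultimately have "1 + (norm x)\<^sup>2 \<le> (bracket y + norm (x - y))\<^sup>2"
    by (simp add: power2_sum)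
  then show ?thesis
    unfolding bracket_def[of x] by (rule real_le_lsqrt[rotated -1]) (use bracket_pos[of y] in \<open>auto intro: add_nonneg_nonneg\<close>)
qed

lemma continuous_on_bracket [continuous_intros]:
  "continuous_on S f \<Longrightarrow> continuous_on S (\<lambda>x. bracket (f x))"
  unfolding bracket_def by (intro continuous_intros)

lemma borel_measurable_bracket [measurable]: "bracket \<in> borel_measurable borel"
  by (intro borel_measurable_continuous_onI continuous_intros)

lemma borel_imp_lebesgue: "f \<in> borel \<rightarrow>\<^sub>M N \<Longrightarrow> f \<in> lebesgue \<rightarrow>\<^sub>M N"
  by (rule measurable_completion) simp

lemma half_power: "(1/2::real) ^ k = 2 powr (- real k)"
  by (simp add: powr_minus powr_realpow power_one_over inverse_eq_divide)

text \<open>Dyadic shells: for distances between \<open>(1/2) ^ Suc k\<close> and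
  \<open>(1/2) ^ k\<close> the integrand is at most \<open>2 powr (c * (k + 1))\<close>, and the
  ball of radius \<open>(1/2) ^ k\<close> has volume of order \<open>2 powr (- k * n)\<close>, so
  the series has ratio \<open>2 powr (c - n) < 1\<close>. Volumes of balls do not depend on the
  centre, which makes \<open>D\<close> uniform in \<open>x\<close>.\<close>

lemma nn_integral_norm_powr_local:
  fixes x :: "'a::euclidean_space" and c :: real
  assumes "0 \<le> c" "c < DIM('a)"
  obtains D where "D \<ge> 0"
    "\<And>x::'a. (\<integral>\<^sup>+y. ennreal (norm (x - y) powr (- c)) * indicator (cball x 1) y \<partial>lebesgue) \<le> ennreal D"
proof -
  let ?n = "DIM('a)"
  define V where "V = unit_ball_vol (real ?n)"
  have "V \<ge> 0" by (simp add: V_def unit_ball_vol_nonneg)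
  define \<rho> where "\<rho> = (2::real) powr (c - ?n)"
  have "\<rho> < 2 powr 0" unfolding \<rho>_def using assms by (intro powr_less_mono) auto
  then have \<rho>: "0 < \<rho>" "\<rho> < 1" by (simp_all add: \<rho>_def)
  define D where "D = 2 powr c * V * (1 / (1 - \<rho>))"
  have D: "D \<ge> 0" using \<rho> \<open>V \<ge> 0\<close> by (simp add: D_def)
  have "(\<integral>\<^sup>+y. ennreal (norm (x - y) powr (- c)) * indicator (cball x 1) y \<partial>lebesgue) \<le> ennreal D" for x :: 'a
  proof -
    have "(\<integral>\<^sup>+y. ennreal (norm (x - y) powr (- c)) * indicator (cball x 1) y \<partial>lebesgue)
      \<le> (\<integral>\<^sup>+y. (\<Sum>k. ennreal (2 powr (c * (real k + 1))) * indicator (cball x ((1/2) ^ k)) y) \<partial>lebesgue)"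
    proof (rule nn_integral_mono)
      fix y :: 'a
      let ?r = "norm (x - y)"
      show "ennreal (?r powr (- c)) * indicator (cball x 1) y
         \<le> (\<Sum>k. ennreal (2 powr (c * (real k + 1))) * indicator (cball x ((1/2) ^ k)) y)"
      \<comment> \<open>At \<open>y = x\<close> the integrand is 0, because \<open>powr\<close> with
        base 0 has the value 0; the pole itself therefore joins the trivial case.\<close>
      proof (cases "0 < ?r \<and> ?r \<le> 1")
        case False
        then have "ennreal (?r powr (- c)) * indicator (cball x 1) y = 0"
          by (cases "?r = 0") (simp_all add: dist_norm)
        then show ?thesis by (simp only: zero_le)
      next
        case True
        have "\<exists>k. (1/2::real) ^ k < ?r" using real_arch_pow_inv[of ?r "1/2"] True by simp
        define m where "m = (LEAST k. (1/2::real) ^ k < ?r)"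
        have m: "(1/2::real) ^ m < ?r" unfolding m_def by (rule LeastI_ex) fact
        then have "m \<noteq> 0" using True by (cases m) auto
        then obtain k where k: "m = Suc k" by (cases m) auto
        have "\<not> (1/2::real) ^ k < ?r" using not_less_Least[of k "\<lambda>k. (1/2::real) ^ k < ?r"] k by (simp add: m_def)
        then have in_ball: "y \<in> cball x ((1/2) ^ k)" by (simp add: dist_norm)
        have "?r powr (- c) \<le> ((1/2) ^ m) powr (- c)"
          using m assms True by (intro powr_mono2') auto
        also have "\<dots> = 2 powr (c * (real k + 1))"
        proof -
          have "(1/2::real) ^ m = 2 powr (- (real k + 1))"
            unfolding half_power by (simp add: k algebra_simps)
          then show ?thesis by (simp only: powr_powr) (simp add: algebra_simps)
        qed
        finally have "ennreal (?r powr (- c)) \<le> ennreal (2 powr (c * (real k + 1))) * indicator (cball x ((1/2) ^ k)) y"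
          using in_ball by (simp add: ennreal_leI)
        also have "\<dots> = (\<Sum>i\<in>{k}. ennreal (2 powr (c * (real i + 1))) * indicator (cball x ((1/2) ^ i)) y)"
          by (simp only: sum.insert finite.emptyI empty_iff not_False_eq_True sum.empty add_0_right)
        also have "\<dots> \<le> (\<Sum>k. ennreal (2 powr (c * (real k + 1))) * indicator (cball x ((1/2) ^ k)) y)"
          by (rule sum_le_suminf) auto
        finally have "ennreal (?r powr (- c)) \<le> (\<Sum>k. ennreal (2 powr (c * (real k + 1))) * indicator (cball x ((1/2) ^ k)) y)" .
        moreover have "indicator (cball x 1) y = (1::ennreal)" using True by (simp add: dist_norm)
        ultimately show ?thesis by (simp only: mult_1_right)
      qed
    qed
    also have "\<dots> = (\<Sum>k. \<integral>\<^sup>+y. ennreal (2 powr (c * (real k + 1))) * indicator (cball x ((1/2) ^ k)) y \<partial>lebesgue)"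
      by (rule nn_integral_suminf) (intro borel_measurable_times_ennreal borel_measurable_const borel_measurable_indicator, simp)
    also have "\<dots> = (\<Sum>k. ennreal (2 powr (c * (real k + 1))) * emeasure lebesgue (cball x ((1/2) ^ k)))"
      by (intro suminf_cong nn_integral_cmult_indicator) simp
    also have "\<dots> = (\<Sum>k. ennreal (2 powr c * V * \<rho> ^ k))"
    proof (intro suminf_cong)
      fix k
      have e1: "emeasure lebesgue (cball x ((1/2) ^ k)) = ennreal (V * ((1/2) ^ k) ^ ?n)"
        by (simp add: emeasure_cball V_def)
      have e2: "2 powr (c * (real k + 1)) * (V * ((1/2) ^ k) ^ ?n) = 2 powr c * V * \<rho> ^ k"
      proof -
        have "\<rho> ^ k = 2 powr (c * real k) * 2 powr (- (real k * real ?n))"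
          by (simp add: \<rho>_def powr_realpow[symmetric] powr_powr algebra_simps flip: powr_add)
        moreover have "((1/2::real) ^ k) ^ ?n = 2 powr (- (real k * real ?n))"
          unfolding half_power by (simp add: powr_power mult.commute)
        moreover have "2 powr (c * (real k + 1)) = 2 powr c * 2 powr (c * real k)"
          by (simp add: algebra_simps flip: powr_add)
        ultimately show ?thesis by simp
      qed
      show "ennreal (2 powr (c * (real k + 1))) * emeasure lebesgue (cball x ((1/2) ^ k)) = ennreal (2 powr c * V * \<rho> ^ k)"
        unfolding e1 e2[symmetric] by (rule ennreal_mult[symmetric]) (use \<open>V \<ge> 0\<close> in auto)
    qed
    also have "\<dots> = ennreal (\<Sum>k. 2 powr c * V * \<rho> ^ k)"
      by (rule suminf_ennreal2) (use \<rho> \<open>V \<ge> 0\<close> in \<open>auto intro!: summable_mult summable_geometric\<close>)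
    also have "(\<Sum>k. 2 powr c * V * \<rho> ^ k) = D"
      using \<rho> by (subst suminf_mult) (auto simp: D_def suminf_geometric summable_geometric)
    finally show ?thesis .
  qed
  then show ?thesis using D that by blast
qed

text \<open>The same dyadic sum outwards: where \<open>bracket (x - y)\<close> is comparable to
  \<open>2 ^ k\<close> the integrand is of order \<open>2 powr (- s * k)\<close> on a ball of volume
  of order \<open>2 powr (k * n)\<close>, and the ratio is
  \<open>2 powr (n - s) < 1\<close>.\<close>

lemma nn_integral_bracket_powr:
  fixes x :: "'a::euclidean_space" and s :: real
  assumes "s > DIM('a)"
  obtains D where "D \<ge> 0" "\<And>x::'a. (\<integral>\<^sup>+y. ennreal (bracket (x - y) powr (- s)) \<partial>lebesgue) \<le> ennreal D"
proof -
  let ?n = "DIM('a)"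
  define V where "V = unit_ball_vol (real ?n)"
  have "V \<ge> 0" by (simp add: V_def unit_ball_vol_nonneg)
  define \<rho> where "\<rho> = (2::real) powr (?n - s)"
  have "\<rho> < 2 powr 0" unfolding \<rho>_def using assms by (intro powr_less_mono) auto
  then have \<rho>: "0 < \<rho>" "\<rho> < 1" by (simp_all add: \<rho>_def)
  define D where "D = 2 powr s * V * (1 / (1 - \<rho>))"
  have D: "D \<ge> 0" using \<rho> \<open>V \<ge> 0\<close> by (simp add: D_def)
  have "(\<integral>\<^sup>+y. ennreal (bracket (x - y) powr (- s)) \<partial>lebesgue) \<le> ennreal D" for x :: 'a
  proof -
    have "(\<integral>\<^sup>+y. ennreal (bracket (x - y) powr (- s)) \<partial>lebesgue)
      \<le> (\<integral>\<^sup>+y. (\<Sum>k. ennreal (2 powr (s * (1 - real k))) * indicator (cball x (2 ^ k)) y) \<partial>lebesgue)"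
    proof (rule nn_integral_mono)
      fix y :: 'a
      let ?r = "bracket (x - y)"
      have "\<exists>k. ?r < 2 ^ k" using real_arch_pow[of 2 ?r] by simp
      then have ex: "\<exists>k. ?r \<le> 2 ^ k" using less_imp_le by blast
      define m where "m = (LEAST k. ?r \<le> 2 ^ k)"
      have m: "?r \<le> 2 ^ m" unfolding m_def by (rule LeastI_ex) fact
      have in_ball: "y \<in> cball x (2 ^ m)"
        using m norm_le_bracket[of "x - y"] by (simp add: dist_norm)
      \<comment> \<open>For \<open>m = 0\<close>, where there is no previous radius, the inequality
        degenerates to \<open>1 / 2 \<le> bracket (x - y)\<close>.\<close>
      have lower: "2 powr (real m - 1) \<le> ?r"
      proof (cases m)
        case 0
        have "2 powr (-1) \<le> (1::real)" by (simp add: powr_minus)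
        then show ?thesis using bracket_ge_1[of "x - y"] 0 by simp
      next
        case (Suc k)
        then have "\<not> ?r \<le> 2 ^ k" using not_less_Least[of k "\<lambda>k. ?r \<le> 2 ^ k"] by (simp add: m_def)
        then show ?thesis using Suc by (simp add: powr_realpow)
      qed
      have "?r powr (- s) \<le> (2 powr (real m - 1)) powr (- s)"
        using lower assms by (intro powr_mono2') auto
      also have "\<dots> = 2 powr (s * (1 - real m))"
        by (simp add: powr_powr algebra_simps)
      finally have "ennreal (?r powr (- s)) \<le> ennreal (2 powr (s * (1 - real m))) * indicator (cball x (2 ^ m)) y"
        using in_ball by (simp add: ennreal_leI)
      also have "\<dots> = (\<Sum>i\<in>{m}. ennreal (2 powr (s * (1 - real i))) * indicator (cball x (2 ^ i)) y)"
        by (simp only: sum.insert finite.emptyI empty_iff not_False_eq_True sum.empty add_0_right)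
      also have "\<dots> \<le> (\<Sum>k. ennreal (2 powr (s * (1 - real k))) * indicator (cball x (2 ^ k)) y)"
        by (rule sum_le_suminf) auto
      finally show "ennreal (?r powr (- s)) \<le> (\<Sum>k. ennreal (2 powr (s * (1 - real k))) * indicator (cball x (2 ^ k)) y)" .
    qed
    also have "\<dots> = (\<Sum>k. \<integral>\<^sup>+y. ennreal (2 powr (s * (1 - real k))) * indicator (cball x (2 ^ k)) y \<partial>lebesgue)"
      by (rule nn_integral_suminf) (intro borel_measurable_times_ennreal borel_measurable_const borel_measurable_indicator, simp)
    also have "\<dots> = (\<Sum>k. ennreal (2 powr (s * (1 - real k))) * emeasure lebesgue (cball x (2 ^ k)))"
      by (intro suminf_cong nn_integral_cmult_indicator) simp
    also have "\<dots> = (\<Sum>k. ennreal (2 powr s * V * \<rho> ^ k))"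
    proof (intro suminf_cong)
      fix k
      have e1: "emeasure lebesgue (cball x (2 ^ k)) = ennreal (V * (2 ^ k) ^ ?n)"
        by (simp add: emeasure_cball V_def)
      have e2: "2 powr (s * (1 - real k)) * (V * (2 ^ k) ^ ?n) = 2 powr s * V * \<rho> ^ k"
      proof -
        have "\<rho> ^ k = 2 powr (real k * real ?n) * 2 powr (- (s * real k))"
          by (simp add: \<rho>_def powr_realpow[symmetric] powr_powr algebra_simps flip: powr_add)
        moreover have "((2::real) ^ k) ^ ?n = 2 powr (real k * real ?n)"
          by (simp add: powr_realpow flip: power_mult of_nat_mult)
        moreover have "2 powr (s * (1 - real k)) = 2 powr s * 2 powr (- (s * real k))"
          by (simp add: algebra_simps flip: powr_add)
        ultimately show ?thesis by simp
      qed
      show "ennreal (2 powr (s * (1 - real k))) * emeasure lebesgue (cball x (2 ^ k)) = ennreal (2 powr s * V * \<rho> ^ k)"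
        unfolding e1 e2[symmetric] by (rule ennreal_mult[symmetric]) (use \<open>V \<ge> 0\<close> in auto)
    qed
    also have "\<dots> = ennreal (\<Sum>k. 2 powr s * V * \<rho> ^ k)"
      by (rule suminf_ennreal2) (use \<rho> \<open>V \<ge> 0\<close> in \<open>auto intro!: summable_mult summable_geometric\<close>)
    also have "(\<Sum>k. 2 powr s * V * \<rho> ^ k) = D"
      using \<rho> by (subst suminf_mult) (auto simp: D_def suminf_geometric summable_geometric)
    finally show ?thesis .
  qed
  then show ?thesis using D that by blast
qed

section \<open>Weighted Riesz integrals\<close>

lemma powr_mult_le_add:
  fixes a b :: real
  assumes "a > 0" "b > 0" "\<alpha> \<ge> 0" "\<beta> \<ge> 0"
  shows "a powr (- \<alpha>) * b powr (- \<beta>) \<le> a powr (- (\<alpha> + \<beta>)) + b powr (- (\<alpha> + \<beta>))"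
proof (cases "a \<le> b")
  case True
  then have "a powr (- \<alpha>) * b powr (- \<beta>) \<le> a powr (- \<alpha>) * a powr (- \<beta>)"
    using assms by (intro mult_left_mono powr_mono2') auto
  also have "\<dots> = a powr (- (\<alpha> + \<beta>))" by (simp flip: powr_add)
  finally show ?thesis by (simp add: add_increasing2)
next
  case False
  then have "a powr (- \<alpha>) * b powr (- \<beta>) \<le> b powr (- \<alpha>) * b powr (- \<beta>)"
    using assms by (intro mult_right_mono powr_mono2') auto
  also have "\<dots> = b powr (- (\<alpha> + \<beta>))" by (simp flip: powr_add)
  finally show ?thesis by (simp add: add_increasing)
qed

text \<open>Within distance 1 the brackets of \<open>x\<close> and \<open>y\<close> are comparable.
  Farther away the distance is comparable to \<open>bracket (x - y)\<close>, and one of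
  \<open>bracket y\<close>, \<open>bracket (x - y)\<close> is at least half of
  \<open>bracket x\<close>. A power \<open>c / 2\<close> of that factor is exchanged for
  \<open>bracket x\<close>, and the remaining factors have total exponent \<open>s + c / 2\<close>.
  Half of the exponent \<open>c\<close> thus survives as decay in \<open>x\<close>.\<close>

lemma norm_powr_bracket_le:
  fixes x y :: "'a::euclidean_space" and c s :: real
  assumes "0 \<le> c" "c / 2 \<le> s"
  shows "norm (x - y) powr (- c) * bracket y powr (- s)
    \<le> 2 powr (s + 2 * c) * bracket x powr (- (c / 2)) *
      (bracket y powr (- (s + c / 2)) + bracket (x - y) powr (- (s + c / 2))
        + norm (x - y) powr (- c) * indicator (cball x 1) y)" (is "_ \<le> ?C * ?X * (?Y + ?Z + ?W)")
proof -
  let ?r = "norm (x - y)"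
  note pos = bracket_pos[of x] bracket_pos[of y] bracket_pos[of "x - y"]
  have X: "bracket y powr (- \<gamma>) \<le> 2 powr \<gamma> * bracket x powr (- \<gamma>)"
    if "bracket x \<le> 2 * bracket y" "\<gamma> \<ge> 0" for \<gamma> and y :: 'a
  proof -
    have "(2 * bracket y) powr (- \<gamma>) \<le> bracket x powr (- \<gamma>)"
      using that pos by (intro powr_mono2') auto
    then have "2 powr \<gamma> * (2 powr (- \<gamma>) * bracket y powr (- \<gamma>)) \<le> 2 powr \<gamma> * bracket x powr (- \<gamma>)"
      using bracket_pos[of y] by (intro mult_left_mono) (auto simp: powr_mult)
    then show ?thesis by (simp flip: mult.assoc powr_add)
  qed
  show ?thesis
  proof (cases "?r \<le> 1")
    case True
    then have "bracket x \<le> 2 * bracket y"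
      using bracket_le_add_norm[of x y] bracket_ge_1[of y] by linarith
    then have "bracket y powr (- s) \<le> 2 powr s * bracket x powr (- s)"
      using assms by (intro X) auto
    also have "\<dots> \<le> ?C * ?X"
      using assms bracket_ge_1[of x] by (intro mult_mono powr_mono) auto
    finally have "?r powr (- c) * bracket y powr (- s) \<le> ?r powr (- c) * (?C * ?X)"
      by (rule mult_left_mono) simp
    also have "\<dots> = ?C * ?X * ?W" using True by (simp add: dist_norm)
    also have "\<dots> \<le> ?C * ?X * (?Y + ?Z + ?W)" by (intro mult_left_mono) auto
    finally show ?thesis .
  next
    case False
    have "1 \<le> ?r\<^sup>2" using False power_mono[of 1 ?r 2] by simp
    then have "bracket (x - y) \<le> 2 * ?r"
      unfolding bracket_def by (intro real_le_lsqrt) (auto simp: power_mult_distrib)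
    then have "(2 * ?r) powr (- c) \<le> bracket (x - y) powr (- c)"
      using assms pos by (intro powr_mono2') auto
    then have "2 powr c * (2 powr (- c) * ?r powr (- c)) \<le> 2 powr c * bracket (x - y) powr (- c)"
      using False by (intro mult_left_mono) (auto simp: powr_mult)
    then have r: "?r powr (- c) \<le> 2 powr c * bracket (x - y) powr (- c)"
      by (simp flip: mult.assoc powr_add)
    have main: "bracket (x - y) powr (- c) * bracket y powr (- s) \<le> 2 powr (c / 2) * ?X * (?Y + ?Z)"
    proof (cases "bracket x \<le> 2 * bracket y")
      case True
      have "bracket y powr (- s) = bracket y powr (- (s - c / 2)) * bracket y powr (- (c / 2))"
        by (simp flip: powr_add)
      also have "\<dots> \<le> bracket y powr (- (s - c / 2)) * (2 powr (c / 2) * ?X)"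
        using assms True by (intro mult_left_mono X) auto
      finally have "bracket (x - y) powr (- c) * bracket y powr (- s)
         \<le> bracket (x - y) powr (- c) * (bracket y powr (- (s - c / 2)) * (2 powr (c / 2) * ?X))"
        by (rule mult_left_mono) simp
      also have "\<dots> = 2 powr (c / 2) * ?X * (bracket y powr (- (s - c / 2)) * bracket (x - y) powr (- c))"
        by (simp add: mult_ac)
      also have "\<dots> \<le> 2 powr (c / 2) * ?X * (?Y + ?Z)"
        using powr_mult_le_add[of "bracket y" "bracket (x - y)" "s - c / 2" c] pos assms
        by (intro mult_left_mono) (auto simp: algebra_simps)
      finally show ?thesis .
    next
      case False
      have "bracket x \<le> 2 * bracket (x - y)"
        using bracket_le_add_norm[of x y] norm_le_bracket[of "x - y"] False by linarith
      have "bracket (x - y) powr (- c) = bracket (x - y) powr (- (c / 2)) * bracket (x - y) powr (- (c / 2))"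
        by (simp flip: powr_add)
      also have "\<dots> \<le> bracket (x - y) powr (- (c / 2)) * (2 powr (c / 2) * ?X)"
        using assms \<open>bracket x \<le> 2 * bracket (x - y)\<close> by (intro mult_left_mono X) auto
      finally have "bracket (x - y) powr (- c) * bracket y powr (- s)
         \<le> bracket (x - y) powr (- (c / 2)) * (2 powr (c / 2) * ?X) * bracket y powr (- s)"
        by (rule mult_right_mono) simp
      also have "\<dots> = 2 powr (c / 2) * ?X * (bracket y powr (- s) * bracket (x - y) powr (- (c / 2)))"
        by (simp add: mult_ac)
      also have "\<dots> \<le> 2 powr (c / 2) * ?X * (?Y + ?Z)"
        using powr_mult_le_add[of "bracket y" "bracket (x - y)" s "c / 2"] pos assms
        by (intro mult_left_mono) auto
      finally show ?thesis .
    qed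
    have "?r powr (- c) * bracket y powr (- s) \<le> 2 powr c * (bracket (x - y) powr (- c) * bracket y powr (- s))"
      using mult_right_mono[OF r, of "bracket y powr (- s)"] by (simp add: mult_ac)
    also have "\<dots> \<le> 2 powr c * (2 powr (c / 2) * ?X * (?Y + ?Z))"
      by (intro mult_left_mono main) auto
    also have "\<dots> = 2 powr (c + c / 2) * (?X * (?Y + ?Z))"
      by (simp only: powr_add mult_ac)
    also have "\<dots> \<le> ?C * (?X * (?Y + ?Z + ?W))"
    proof (rule mult_mono)
      show "2 powr (c + c / 2) \<le> ?C" by (rule powr_mono) (use assms in auto)
      show "?X * (?Y + ?Z) \<le> ?X * (?Y + ?Z + ?W)" by (rule mult_left_mono) auto
    qed auto
    finally show ?thesis by (simp add: mult.assoc)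
  qed
qed

text \<open>Integrates the preceding pointwise bound. The hypothesis on \<open>s\<close> says that
  the combined exponent \<open>s + c / 2\<close> exceeds the dimension, and together with
  \<open>c < n\<close> it also gives \<open>c / 2 \<le> s\<close>.\<close>

lemma nn_integral_riesz_bracket:
  fixes c s :: real
  assumes "0 \<le> c" "c < DIM('a::euclidean_space)" "s > DIM('a) - c / 2"
  obtains D where "D > 0"
    "\<And>x::'a. (\<integral>\<^sup>+y. ennreal (norm (x - y) powr (- c) * bracket y powr (- s)) \<partial>lebesgue)
       \<le> ennreal (D * bracket x powr (- (c / 2)))"
proof -
  obtain D1 where D1: "D1 \<ge> 0"
    "\<And>x::'a. (\<integral>\<^sup>+y. ennreal (norm (x - y) powr (- c)) * indicator (cball x 1) y \<partial>lebesgue) \<le> ennreal D1"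
    using nn_integral_norm_powr_local assms by metis
  have "s + c / 2 > DIM('a)" using assms by simp
  then obtain D2 where D2: "D2 \<ge> 0"
    "\<And>x::'a. (\<integral>\<^sup>+y. ennreal (bracket (x - y) powr (- (s + c / 2))) \<partial>lebesgue) \<le> ennreal D2"
    using nn_integral_bracket_powr by metis
  define C where "C = 2 powr (s + 2 * c)"
  show ?thesis
  \<comment> \<open>The summand 1 makes the constant strictly positive.\<close>
  proof (rule that[of "C * (2 * D2 + D1 + 1)"])
    show "C * (2 * D2 + D1 + 1) > 0" using D1 D2 by (simp add: C_def)
    fix x :: 'a
    let ?Y = "\<lambda>y::'a. bracket y powr (- (s + c / 2))" and ?Z = "\<lambda>y. bracket (x - y) powr (- (s + c / 2))"
      and ?W = "\<lambda>y. norm (x - y) powr (- c) * indicator (cball x 1) y"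
    have mY: "(\<lambda>y. ennreal (?Y y)) \<in> borel_measurable lebesgue"
      and mZ: "(\<lambda>y. ennreal (?Z y)) \<in> borel_measurable lebesgue"
      by (rule borel_imp_lebesgue, measurable)+
    have mW: "(\<lambda>y. ennreal (norm (x - y) powr (- c)) * indicator (cball x 1) y) \<in> borel_measurable lebesgue"
    proof (rule borel_imp_lebesgue, rule borel_measurable_times_ennreal)
      show "(\<lambda>y. ennreal (norm (x - y) powr (- c))) \<in> borel_measurable borel" by measurable
    qed (intro borel_measurable_indicator, simp)
    have "(\<integral>\<^sup>+y. ennreal (norm (x - y) powr (- c) * bracket y powr (- s)) \<partial>lebesgue)
      \<le> (\<integral>\<^sup>+y. ennreal (C * bracket x powr (- (c / 2))) * ((ennreal (?Y y) + ennreal (?Z y)) + ennreal (norm (x - y) powr (- c)) * indicator (cball x 1) y) \<partial>lebesgue)"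
    proof (rule nn_integral_mono)
      fix y
      have "norm (x - y) powr (- c) * bracket y powr (- s) \<le> C * bracket x powr (- (c / 2)) * (?Y y + ?Z y + ?W y)"
        unfolding C_def using assms by (intro norm_powr_bracket_le) auto
      then have "ennreal (norm (x - y) powr (- c) * bracket y powr (- s)) \<le> ennreal (C * bracket x powr (- (c / 2)) * (?Y y + ?Z y + ?W y))"
        by (rule ennreal_leI)
      also have "\<dots> = ennreal (C * bracket x powr (- (c / 2))) * ((ennreal (?Y y) + ennreal (?Z y)) + ennreal (?W y))"
        by (subst ennreal_mult) (auto simp: C_def)
      also have "ennreal (?W y) = ennreal (norm (x - y) powr (- c)) * indicator (cball x 1) y"
        by (simp add: indicator_def)
      finally show "ennreal (norm (x - y) powr (- c) * bracket y powr (- s)) \<le> ennreal (C * bracket x powr (- (c / 2))) *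
         ((ennreal (?Y y) + ennreal (?Z y)) + ennreal (norm (x - y) powr (- c)) * indicator (cball x 1) y)" .
    qed
    also have "\<dots> = ennreal (C * bracket x powr (- (c / 2))) * (((\<integral>\<^sup>+y. ennreal (?Y y) \<partial>lebesgue) + (\<integral>\<^sup>+y. ennreal (?Z y) \<partial>lebesgue))
        + (\<integral>\<^sup>+y. ennreal (norm (x - y) powr (- c)) * indicator (cball x 1) y \<partial>lebesgue))"
      by (simp only: nn_integral_add[OF mY mZ] nn_integral_add[OF borel_measurable_add[OF mY mZ] mW]
          nn_integral_cmult[OF borel_measurable_add[OF borel_measurable_add[OF mY mZ] mW]])
    also have "\<dots> \<le> ennreal (C * bracket x powr (- (c / 2))) * ((ennreal D2 + ennreal D2) + ennreal D1)"
      using D2(2)[of 0] by (intro mult_left_mono add_mono D1 D2) (auto simp: bracket_def)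
    also have "\<dots> = ennreal (C * (2 * D2 + D1) * bracket x powr (- (c / 2)))"
      using D1(1) D2(1) by (simp add: C_def mult_ac flip: ennreal_plus ennreal_mult)
    also have "\<dots> \<le> ennreal (C * (2 * D2 + D1 + 1) * bracket x powr (- (c / 2)))"
      by (intro ennreal_leI mult_right_mono mult_left_mono) (auto simp: C_def)
    finally show "(\<integral>\<^sup>+y. ennreal (norm (x - y) powr (- c) * bracket y powr (- s)) \<partial>lebesgue)
      \<le> ennreal (C * (2 * D2 + D1 + 1) * bracket x powr (- (c / 2)))" .
  qed
qed

section \<open>Weighted Riesz kernels\<close>

lemma borel_pair_imp_lebesgue:
  fixes f :: "'a::euclidean_space \<times> 'b::euclidean_space \<Rightarrow> 'c::topological_space"
  assumes "f \<in> borel_measurable borel"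
  shows "f \<in> borel_measurable (lebesgue \<Otimes>\<^sub>M lebesgue)"
  using measurable_compose[OF ident_measurable_lebesgue_pair assms] by simp

definition riesz_weight :: "real \<Rightarrow> real \<Rightarrow> 'a::euclidean_space \<Rightarrow> 'a \<Rightarrow> real" where
  "riesz_weight \<sigma> c x y = bracket x powr (- \<sigma>) * bracket y powr (- \<sigma>) * norm (x - y) powr (- c)"

lemma riesz_weight_nonneg: "riesz_weight \<sigma> c x y \<ge> 0"
  by (simp add: riesz_weight_def)

lemma riesz_weight_sym: "riesz_weight \<sigma> c x y = riesz_weight \<sigma> c y x"
  by (simp add: riesz_weight_def norm_minus_commute)

lemma riesz_weight_measurable_borel:
  "(\<lambda>(x, y). riesz_weight \<sigma> c x y) \<in> borel_measurable (borel :: ('a::euclidean_space \<times> 'a) measure)"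
proof -
  have "(\<lambda>z. riesz_weight \<sigma> c (fst z) (snd z)) \<in> borel_measurable (borel \<Otimes>\<^sub>M borel :: ('a \<times> 'a) measure)"
    unfolding riesz_weight_def by measurable
  then show ?thesis by (simp add: case_prod_beta' borel_prod)
qed

text \<open>Interpolating between \<open>gH\<close> and \<open>gS\<close> in the proportion \<open>2 / q\<close> to \<open>1 - 2 / q\<close> gives back the weighted
  Riesz kernel; \<open>c = b q / (q - 1)\<close> is the exponent of \<open>norm (x - y)\<close> in \<open>gS\<close> and in the square of \<open>gH\<close>.\<close>

lemma riesz_weight_interpolation:
  fixes b \<delta> q n :: real
  assumes n_def: "n = real DIM('a::euclidean_space)"
    and q: "q > n" "n \<ge> 2" and b: "0 < b" "b \<le> n - 1" and \<delta>: "2 * \<delta> > n - b"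
  obtains gH gS :: "'a::euclidean_space \<Rightarrow> 'a \<Rightarrow> real" and D where
    "D > 0"
    "(\<lambda>(x, y). gH x y) \<in> borel_measurable borel" "(\<lambda>(x, y). gS x y) \<in> borel_measurable borel"
    "\<And>x y. gH x y \<ge> 0" "\<And>x y. gS x y \<ge> 0" "\<And>x y. gH x y = gH y x" "\<And>x y. gS x y = gS y x"
    "\<And>x y. gH x y powr (2 / q) * gS x y powr (1 - 2 / q) = riesz_weight \<delta> b x y"
    "(\<integral>\<^sup>+x. \<integral>\<^sup>+y. ennreal ((gH x y)\<^sup>2) \<partial>lebesgue \<partial>lebesgue) \<le> ennreal D"
    "\<And>x. (\<integral>\<^sup>+y. ennreal (gS x y * bracket y powr (- n / 2)) \<partial>lebesgue) \<le> ennreal (D * bracket x powr (- n / 2))"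
proof -
  \<comment> \<open>The mean gives \<open>c / 2\<close> the proportion \<open>2 / q\<close> and
    \<open>c\<close> the proportion \<open>1 - 2 / q\<close>, in total
    \<open>c * (1 - 1 / q)\<close>; the factor \<open>q / (q - 1)\<close> makes this equal to
    \<open>b\<close>.\<close>
  define c where "c = b * q / (q - 1)"
  \<comment> \<open>The surplus of \<open>\<delta>\<close> over its threshold, enlarged by the same
    factor. It is the margin with which both integral tests are passed.\<close>
  define \<epsilon> where "\<epsilon> = (\<delta> - (n - b) / 2) * q / (q - 1)"
  have q1: "q > 1" using q by simp
  have c0: "c > 0" using b q1 by (simp add: c_def)
  have cn: "c < n"
  proof -
    have "b * q \<le> (n - 1) * q" using b q1 by (intro mult_right_mono) auto
    also have "\<dots> < n * (q - 1)" using q by (simp add: algebra_simps)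
    finally show ?thesis using q1 by (simp add: c_def field_simps)
  qed
  have \<epsilon>0: "\<epsilon> > 0" using \<delta> q1 by (simp add: \<epsilon>_def)
  have cb: "c * (1 - 1 / q) = b" using q1 by (simp add: c_def field_simps)
  have ed: "\<epsilon> * (1 - 1 / q) = \<delta> - (n - b) / 2" using q1 by (simp add: \<epsilon>_def field_simps)
  \<comment> \<open>Exceeds by \<open>\<epsilon>\<close> the threshold of the weighted Riesz
    integral. Integrating the square of \<open>gH\<close> in \<open>y\<close> then leaves
    \<open>bracket x powr (- (n + \<epsilon>))\<close>, which is integrable in
    \<open>x\<close>.\<close>
  define s where "s = n - c / 2 + \<epsilon>"
  \<comment> \<open>Equal to \<open>s - n / 2\<close>, so that \<open>gS\<close> times the Schur
    weight \<open>bracket y powr (- n / 2)\<close> has the same integrand in \<open>y\<close>. What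
    is left in \<open>x\<close> is \<open>bracket x powr (- (n / 2 + \<epsilon>))\<close>, below the
    weight at \<open>x\<close>.\<close>
  define \<sigma> where "\<sigma> = (n - c) / 2 + \<epsilon>"
  obtain D1 where D1: "D1 > 0"
    "\<And>x::'a. (\<integral>\<^sup>+y. ennreal (norm (x - y) powr (- c) * bracket y powr (- s)) \<partial>lebesgue)
       \<le> ennreal (D1 * bracket x powr (- (c / 2)))"
    using nn_integral_riesz_bracket[where 'a = 'a, of c s] c0 cn \<epsilon>0 unfolding n_def s_def by auto
  obtain D2 where D2: "D2 \<ge> 0" "\<And>x::'a. (\<integral>\<^sup>+y. ennreal (bracket (x - y) powr (- (n + \<epsilon>))) \<partial>lebesgue) \<le> ennreal D2"
    using nn_integral_bracket_powr[where 'a = 'a, of "n + \<epsilon>"] \<epsilon>0 unfolding n_def by auto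
  define gH :: "'a \<Rightarrow> 'a \<Rightarrow> real" where "gH = riesz_weight (s / 2) (c / 2)"
  define gS :: "'a \<Rightarrow> 'a \<Rightarrow> real" where "gS = riesz_weight \<sigma> c"
  have pw: "(a powr u) powr v = a powr (u * v)" for a u v :: real by (simp add: powr_powr)
  have interp: "gH x y powr (2 / q) * gS x y powr (1 - 2 / q) = riesz_weight \<delta> b x y" for x y
  proof -
    have e1: "- (s / 2) * (2 / q) + - \<sigma> * (1 - 2 / q) = - \<delta>"
    proof -
      have "- (s / 2) * (2 / q) + - \<sigma> * (1 - 2 / q) = - (n / 2 - c * (1 - 1 / q) / 2 + \<epsilon> * (1 - 1 / q))"
        using q1 by (simp add: s_def \<sigma>_def field_simps)
      also have "\<dots> = - \<delta>" unfolding cb ed by (simp add: field_simps)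
      finally show ?thesis .
    qed
    have e2: "- (c / 2) * (2 / q) + - c * (1 - 2 / q) = - b"
    proof -
      have "- (c / 2) * (2 / q) + - c * (1 - 2 / q) = - (c * (1 - 1 / q))"
        using q1 by (simp add: field_simps)
      then show ?thesis by (simp only: cb)
    qed
    have "gH x y powr (2 / q) * gS x y powr (1 - 2 / q)
      = (bracket x powr (- (s / 2) * (2 / q)) * bracket x powr (- \<sigma> * (1 - 2 / q)))
        * (bracket y powr (- (s / 2) * (2 / q)) * bracket y powr (- \<sigma> * (1 - 2 / q)))
        * (norm (x - y) powr (- (c / 2) * (2 / q)) * norm (x - y) powr (- c * (1 - 2 / q)))"
      unfolding gH_def gS_def riesz_weight_def
      by (simp only: powr_mult mult_nonneg_nonneg powr_ge_zero pw) (simp only: mult_ac)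
    then show ?thesis
      unfolding powr_add[symmetric] e1 e2 by (simp add: riesz_weight_def)
  qed
  have HS: "(\<integral>\<^sup>+x. \<integral>\<^sup>+y. ennreal ((gH x y)\<^sup>2) \<partial>lebesgue \<partial>lebesgue) \<le> ennreal (D1 * D2)"
  proof -
    have sq: "(gH x y)\<^sup>2 = bracket x powr (- s) * (norm (x - y) powr (- c) * bracket y powr (- s))" for x y
    proof -
      have "(u powr (- (v / 2)))\<^sup>2 = u powr (- v)" for u v :: real
        unfolding power2_eq_square powr_add[symmetric] by simp
      then show ?thesis
        unfolding gH_def riesz_weight_def power_mult_distrib by (simp only: mult_ac)
    qed
    have "(\<integral>\<^sup>+x. \<integral>\<^sup>+y. ennreal ((gH x y)\<^sup>2) \<partial>lebesgue \<partial>lebesgue) \<le> (\<integral>\<^sup>+x. ennreal D1 * ennreal (bracket (0 - x :: 'a) powr (- (n + \<epsilon>))) \<partial>lebesgue)"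
    proof (rule nn_integral_mono)
      fix x :: 'a
      have m: "(\<lambda>y. ennreal (norm (x - y) powr (- c) * bracket y powr (- s))) \<in> borel_measurable lebesgue"
        by (rule borel_imp_lebesgue) measurable
      have "(\<integral>\<^sup>+y. ennreal ((gH x y)\<^sup>2) \<partial>lebesgue)
        = ennreal (bracket x powr (- s)) * (\<integral>\<^sup>+y. ennreal (norm (x - y) powr (- c) * bracket y powr (- s)) \<partial>lebesgue)"
        unfolding sq nn_integral_cmult[OF m, symmetric] by (intro nn_integral_cong ennreal_mult) auto
      also have "\<dots> \<le> ennreal (bracket x powr (- s)) * ennreal (D1 * bracket x powr (- (c / 2)))"
        by (intro mult_left_mono D1) auto
      also have "\<dots> = ennreal D1 * ennreal (bracket (0 - x) powr (- (n + \<epsilon>)))"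
      proof -
        have "bracket x powr (- s) * (D1 * bracket x powr (- (c / 2))) = D1 * bracket x powr (- (n + \<epsilon>))"
          by (simp add: s_def algebra_simps flip: powr_add)
        moreover have "bracket (0 - x) = bracket x" by (simp add: bracket_def)
        ultimately show ?thesis using D1(1) by (simp flip: ennreal_mult)
      qed
      finally show "(\<integral>\<^sup>+y. ennreal ((gH x y)\<^sup>2) \<partial>lebesgue) \<le> ennreal D1 * ennreal (bracket (0 - x) powr (- (n + \<epsilon>)))" .
    qed
    also have "\<dots> = ennreal D1 * (\<integral>\<^sup>+x. ennreal (bracket (0 - x :: 'a) powr (- (n + \<epsilon>))) \<partial>lebesgue)"
      by (rule nn_integral_cmult, rule borel_imp_lebesgue) measurable
    also have "\<dots> \<le> ennreal D1 * ennreal D2"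
      by (intro mult_left_mono D2) auto
    finally show ?thesis using D1(1) D2(1) by (simp add: ennreal_mult)
  qed
  have S: "(\<integral>\<^sup>+y. ennreal (gS x y * bracket y powr (- n / 2)) \<partial>lebesgue) \<le> ennreal (D1 * bracket x powr (- n / 2))" for x
  proof -
    have m: "(\<lambda>y. ennreal (norm (x - y) powr (- c) * bracket y powr (- s))) \<in> borel_measurable lebesgue"
      by (rule borel_imp_lebesgue) measurable
    have "- \<sigma> + - n / 2 = - s" by (simp add: s_def \<sigma>_def field_simps)
    then have sy: "bracket y powr (- \<sigma>) * bracket y powr (- n / 2) = bracket y powr (- s)" for y :: 'a
      by (simp only: powr_add[symmetric])
    have e: "gS x y * bracket y powr (- n / 2) = bracket x powr (- \<sigma>) * (norm (x - y) powr (- c) * bracket y powr (- s))" for y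
      unfolding gS_def riesz_weight_def sy[symmetric] by (simp only: mult_ac)
    have "(\<integral>\<^sup>+y. ennreal (gS x y * bracket y powr (- n / 2)) \<partial>lebesgue)
      = ennreal (bracket x powr (- \<sigma>)) * (\<integral>\<^sup>+y. ennreal (norm (x - y) powr (- c) * bracket y powr (- s)) \<partial>lebesgue)"
      unfolding e nn_integral_cmult[OF m, symmetric] by (intro nn_integral_cong ennreal_mult) auto
    also have "\<dots> \<le> ennreal (bracket x powr (- \<sigma>)) * ennreal (D1 * bracket x powr (- (c / 2)))"
      by (intro mult_left_mono D1) auto
    also have "\<dots> = ennreal (D1 * bracket x powr (- (n / 2 + \<epsilon>)))"
    proof -
      have "bracket x powr (- \<sigma>) * (D1 * bracket x powr (- (c / 2))) = D1 * (bracket x powr (- \<sigma>) * bracket x powr (- (c / 2)))"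
        by simp
      also have "bracket x powr (- \<sigma>) * bracket x powr (- (c / 2)) = bracket x powr (- \<sigma> + - (c / 2))"
        by (simp only: powr_add)
      also have "- \<sigma> + - (c / 2) = - (n / 2 + \<epsilon>)" by (simp add: \<sigma>_def field_simps)
      finally show ?thesis using D1(1) by (simp flip: ennreal_mult)
    qed
    also have "\<dots> \<le> ennreal (D1 * bracket x powr (- n / 2))"
      using \<epsilon>0 D1(1) bracket_ge_1[of x] by (intro ennreal_leI mult_left_mono powr_mono) auto
    finally show ?thesis .
  qed
  show ?thesis
  proof (rule that[of "D1 + D1 * D2" gH gS])
    show "D1 + D1 * D2 > 0" using D1(1) D2(1) by (simp add: add_pos_nonneg)
    show "(\<integral>\<^sup>+x. \<integral>\<^sup>+y. ennreal ((gH x y)\<^sup>2) \<partial>lebesgue \<partial>lebesgue) \<le> ennreal (D1 + D1 * D2)"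
      using D1(1) by (intro order_trans[OF HS] ennreal_leI) simp
    show "(\<integral>\<^sup>+y. ennreal (gS x y * bracket y powr (- n / 2)) \<partial>lebesgue) \<le> ennreal ((D1 + D1 * D2) * bracket x powr (- n / 2))" for x
      using D1(1) D2(1) by (intro order_trans[OF S] ennreal_leI mult_right_mono) auto
    show "(\<lambda>(x, y). gH x y) \<in> borel_measurable borel" "(\<lambda>(x, y). gS x y) \<in> borel_measurable borel"
      unfolding gH_def gS_def by (rule riesz_weight_measurable_borel)+
    show "gH x y = gH y x" "gS x y = gS y x" for x y
      unfolding gH_def gS_def by (rule riesz_weight_sym)+
  qed (use interp in \<open>simp_all add: gH_def gS_def riesz_weight_nonneg\<close>)
qed

text \<open>Each of the two means is at most the mean of the sums. Two Riesz kernels with different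
  exponents thereby come under a single geometric mean, so that one cut serves for both; the
  constant is distributed by \<open>2 * C = (2 * C) powr t * (2 * C) powr (1 - t)\<close>.\<close>

lemma powr_interpolate_add_le:
  fixes h1 h2 s1 s2 t C :: real
  assumes "h1 \<ge> 0" "h2 \<ge> 0" "s1 \<ge> 0" "s2 \<ge> 0" "0 \<le> t" "t \<le> 1" "C \<ge> 0"
  shows "C * (h1 powr t * s1 powr (1 - t) + h2 powr t * s2 powr (1 - t))
    \<le> (2 * C * (h1 + h2)) powr t * (2 * C * (s1 + s2)) powr (1 - t)"
proof -
  have "h1 powr t * s1 powr (1 - t) \<le> (h1 + h2) powr t * (s1 + s2) powr (1 - t)"
    "h2 powr t * s2 powr (1 - t) \<le> (h1 + h2) powr t * (s1 + s2) powr (1 - t)"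
    using assms by (intro mult_mono powr_mono2; simp)+
  then have "C * (h1 powr t * s1 powr (1 - t) + h2 powr t * s2 powr (1 - t))
     \<le> C * (2 * ((h1 + h2) powr t * (s1 + s2) powr (1 - t)))"
    using assms by (intro mult_left_mono) auto
  also have "\<dots> = ((2 * C) powr t * (2 * C) powr (1 - t)) * ((h1 + h2) powr t * (s1 + s2) powr (1 - t))"
    using assms by (simp flip: powr_add)
  also have "\<dots> = (2 * C * (h1 + h2)) powr t * (2 * C * (s1 + s2)) powr (1 - t)"
    using assms by (simp add: powr_mult)
  finally show ?thesis .
qed

text \<open>The Schur weight \<open>bracket x powr (- n / 2)\<close> depends on the dimension only,
  and \<open>q\<close> is common to both exponents, so the comparison kernels for \<open>a\<close>
  and \<open>b\<close> can be added.\<close>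

theorem in_schatten_class_riesz:
  fixes R :: "('a::euclidean_space, 'm::finite) L2 \<rightharpoonup> ('a, 'm) L2" and a b \<delta> C p :: real
  assumes R: "is_integral_operator R K" and n: "DIM('a) \<ge> 2"
    and a: "0 < a" "a \<le> real DIM('a) - 1" "2 * \<delta> > DIM('a) - a"
    and b: "0 < b" "b \<le> real DIM('a) - 1" "2 * \<delta> > DIM('a) - b"
    and "C > 0" and p: "p > DIM('a)"
    and bound: "AE (x, y) in lebesgue. norm (K x y) \<le> C * (riesz_weight \<delta> a x y + riesz_weight \<delta> b x y)"
  shows "in_schatten_class R p"
proof -
  let ?n = "real DIM('a)"
  obtain q where q: "?n < q" "q < p" using dense p by blast
  have n2: "?n \<ge> 2" using n by simp
  have q2: "q > 2" using q n2 by linarith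
  obtain H1 S1 :: "'a \<Rightarrow> 'a \<Rightarrow> real" and D1 where 1:
    "D1 > 0"
    "(\<lambda>(x, y). H1 x y) \<in> borel_measurable borel" "(\<lambda>(x, y). S1 x y) \<in> borel_measurable borel"
    "\<And>x y. H1 x y \<ge> 0" "\<And>x y. S1 x y \<ge> 0" "\<And>x y. H1 x y = H1 y x" "\<And>x y. S1 x y = S1 y x"
    "\<And>x y. H1 x y powr (2 / q) * S1 x y powr (1 - 2 / q) = riesz_weight \<delta> a x y"
    "(\<integral>\<^sup>+x. \<integral>\<^sup>+y. ennreal ((H1 x y)\<^sup>2) \<partial>lebesgue \<partial>lebesgue) \<le> ennreal D1"
    "\<And>x. (\<integral>\<^sup>+y. ennreal (S1 x y * bracket y powr (- ?n / 2)) \<partial>lebesgue) \<le> ennreal (D1 * bracket x powr (- ?n / 2))"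
    by (rule riesz_weight_interpolation[where 'a = 'a, OF refl q(1) n2 a]) (rule that)
  obtain H2 S2 :: "'a \<Rightarrow> 'a \<Rightarrow> real" and D2 where 2:
    "D2 > 0"
    "(\<lambda>(x, y). H2 x y) \<in> borel_measurable borel" "(\<lambda>(x, y). S2 x y) \<in> borel_measurable borel"
    "\<And>x y. H2 x y \<ge> 0" "\<And>x y. S2 x y \<ge> 0" "\<And>x y. H2 x y = H2 y x" "\<And>x y. S2 x y = S2 y x"
    "\<And>x y. H2 x y powr (2 / q) * S2 x y powr (1 - 2 / q) = riesz_weight \<delta> b x y"
    "(\<integral>\<^sup>+x. \<integral>\<^sup>+y. ennreal ((H2 x y)\<^sup>2) \<partial>lebesgue \<partial>lebesgue) \<le> ennreal D2"
    "\<And>x. (\<integral>\<^sup>+y. ennreal (S2 x y * bracket y powr (- ?n / 2)) \<partial>lebesgue) \<le> ennreal (D2 * bracket x powr (- ?n / 2))"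
    by (rule riesz_weight_interpolation[where 'a = 'a, OF refl q(1) n2 b]) (rule that)
  define g0 where "g0 x y = 2 * C * (H1 x y + H2 x y)" for x y
  define g1 where "g1 x y = 2 * C * (S1 x y + S2 x y)" for x y
  note pm = borel_pair_imp_lebesgue
  have [measurable]: "(\<lambda>(x, y). H1 x y) \<in> borel_measurable (lebesgue \<Otimes>\<^sub>M lebesgue)"
    "(\<lambda>(x, y). S1 x y) \<in> borel_measurable (lebesgue \<Otimes>\<^sub>M lebesgue)"
    "(\<lambda>(x, y). H2 x y) \<in> borel_measurable (lebesgue \<Otimes>\<^sub>M lebesgue)"
    "(\<lambda>(x, y). S2 x y) \<in> borel_measurable (lebesgue \<Otimes>\<^sub>M lebesgue)"
    using 1(2,3) 2(2,3) by (auto intro: pm)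
  have wm [measurable]: "(\<lambda>x::'a. bracket x powr (- ?n / 2)) \<in> borel_measurable lebesgue"
    by (rule borel_imp_lebesgue) measurable
  \<comment> \<open>The Hilbert--Schmidt constant collects \<open>(2 * C)\<^sup>2\<close> and a
    factor 2 from squaring a sum; the Schur constant is linear in the kernel and collects
    \<open>2 * C\<close>.\<close>
  interpret interpolated_kernel g0 g1 "\<lambda>x. bracket x powr (- ?n / 2)" q "8 * C\<^sup>2 * (D1 + D2)" "2 * C * (D1 + D2)"
  proof
    show "(\<lambda>(x, y). g0 x y) \<in> borel_measurable (lebesgue \<Otimes>\<^sub>M lebesgue)"
      "(\<lambda>(x, y). g1 x y) \<in> borel_measurable (lebesgue \<Otimes>\<^sub>M lebesgue)"
      unfolding g0_def g1_def by measurable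
    show "g0 x y \<ge> 0" "g1 x y \<ge> 0" for x y
      using 1(4,5) 2(4,5) \<open>C > 0\<close> by (simp_all add: g0_def g1_def)
    show "g0 x y = g0 y x" "g1 x y = g1 y x" for x y
      unfolding g0_def g1_def using 1(6,7) 2(6,7) by metis+
    show "bracket x powr (- ?n / 2) > 0" for x :: 'a using bracket_pos[of x] by simp
    show "8 * C\<^sup>2 * (D1 + D2) \<ge> 0" "2 * C * (D1 + D2) > 0" using 1(1) 2(1) \<open>C > 0\<close> by simp_all
    show "(\<integral>\<^sup>+x. \<integral>\<^sup>+y. (ennreal (g0 x y))\<^sup>2 \<partial>lebesgue \<partial>lebesgue) \<le> ennreal (8 * C\<^sup>2 * (D1 + D2))"
    proof -
      have "(\<integral>\<^sup>+x. \<integral>\<^sup>+y. (ennreal (g0 x y))\<^sup>2 \<partial>lebesgue \<partial>lebesgue)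
        \<le> (\<integral>\<^sup>+x. \<integral>\<^sup>+y. ennreal (8 * C\<^sup>2) * (ennreal ((H1 x y)\<^sup>2) + ennreal ((H2 x y)\<^sup>2)) \<partial>lebesgue \<partial>lebesgue)"
      proof (intro nn_integral_mono)
        fix x y
        have "(g0 x y)\<^sup>2 = 4 * C\<^sup>2 * (H1 x y + H2 x y)\<^sup>2"
          by (simp add: g0_def power_mult_distrib)
        also have "\<dots> \<le> 4 * C\<^sup>2 * (2 * ((H1 x y)\<^sup>2 + (H2 x y)\<^sup>2))"
          using sum_squares_bound[of "H1 x y" "H2 x y"] by (intro mult_left_mono) (auto simp: power2_sum)
        finally have "(g0 x y)\<^sup>2 \<le> 8 * C\<^sup>2 * ((H1 x y)\<^sup>2 + (H2 x y)\<^sup>2)"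
          by (simp add: algebra_simps)
        moreover have "g0 x y \<ge> 0" using 1(4) 2(4) \<open>C > 0\<close> by (simp add: g0_def)
        ultimately have "(ennreal (g0 x y))\<^sup>2 \<le> ennreal (8 * C\<^sup>2 * ((H1 x y)\<^sup>2 + (H2 x y)\<^sup>2))"
          by (simp add: ennreal_power ennreal_leI)
        also have "\<dots> = ennreal (8 * C\<^sup>2) * (ennreal ((H1 x y)\<^sup>2) + ennreal ((H2 x y)\<^sup>2))"
          by (subst ennreal_mult) auto
        finally show "(ennreal (g0 x y))\<^sup>2 \<le> ennreal (8 * C\<^sup>2) * (ennreal ((H1 x y)\<^sup>2) + ennreal ((H2 x y)\<^sup>2))" .
      qed
      also have "\<dots> = ennreal (8 * C\<^sup>2) * ((\<integral>\<^sup>+x. \<integral>\<^sup>+y. ennreal ((H1 x y)\<^sup>2) \<partial>lebesgue \<partial>lebesgue)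
          + (\<integral>\<^sup>+x. \<integral>\<^sup>+y. ennreal ((H2 x y)\<^sup>2) \<partial>lebesgue \<partial>lebesgue))"
        by (simp add: nn_integral_cmult nn_integral_add)
      also have "\<dots> \<le> ennreal (8 * C\<^sup>2) * (ennreal D1 + ennreal D2)"
        by (intro mult_left_mono add_mono 1 2) auto
      also have "\<dots> = ennreal (8 * C\<^sup>2 * (D1 + D2))"
        using 1(1) 2(1) by (subst ennreal_mult) auto
      finally show ?thesis .
    qed
    show "(\<integral>\<^sup>+y. ennreal (g1 x y * bracket y powr (- ?n / 2)) \<partial>lebesgue) \<le> ennreal (2 * C * (D1 + D2) * bracket x powr (- ?n / 2))" for x
    proof -
      let ?w = "\<lambda>y::'a. bracket y powr (- ?n / 2)"
      have m: "(\<lambda>y. ennreal (S1 x y * ?w y)) \<in> borel_measurable lebesgue" "(\<lambda>y. ennreal (S2 x y * ?w y)) \<in> borel_measurable lebesgue"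
        by measurable
      have "(\<integral>\<^sup>+y. ennreal (g1 x y * ?w y) \<partial>lebesgue) = (\<integral>\<^sup>+y. ennreal (2 * C) * (ennreal (S1 x y * ?w y) + ennreal (S2 x y * ?w y)) \<partial>lebesgue)"
      proof (rule nn_integral_cong)
        fix y
        have "g1 x y * ?w y = 2 * C * (S1 x y * ?w y + S2 x y * ?w y)" by (simp add: g1_def algebra_simps)
        then show "ennreal (g1 x y * ?w y) = ennreal (2 * C) * (ennreal (S1 x y * ?w y) + ennreal (S2 x y * ?w y))"
          using 1(5)[of x y] 2(5)[of x y] \<open>C > 0\<close> by (simp only:) (subst ennreal_mult; simp)
      qed
      also have "\<dots> = ennreal (2 * C) * ((\<integral>\<^sup>+y. ennreal (S1 x y * ?w y) \<partial>lebesgue) + (\<integral>\<^sup>+y. ennreal (S2 x y * ?w y) \<partial>lebesgue))"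
        by (simp only: nn_integral_cmult[OF borel_measurable_add[OF m]] nn_integral_add[OF m])
      also have "\<dots> \<le> ennreal (2 * C) * (ennreal (D1 * ?w x) + ennreal (D2 * ?w x))"
        by (intro mult_left_mono add_mono 1 2) auto
      also have "\<dots> = ennreal (2 * C * (D1 + D2) * ?w x)"
      proof -
        have "ennreal (2 * C) * (ennreal (D1 * ?w x) + ennreal (D2 * ?w x)) = ennreal (2 * C * (D1 * ?w x + D2 * ?w x))"
          using 1(1) 2(1) \<open>C > 0\<close> by (subst ennreal_mult) auto
        then show ?thesis by (simp only: algebra_simps)
      qed
      finally show ?thesis .
    qed
  qed (use q2 wm in auto)
  show ?thesis
  proof (rule in_schatten_classI[OF R _ q(2)], use bound in eventually_elim)
    fix z :: "'a \<times> 'a"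
    assume "case z of (x, y) \<Rightarrow> norm (K x y) \<le> C * (riesz_weight \<delta> a x y + riesz_weight \<delta> b x y)"
    then obtain x y where z: "z = (x, y)" and le: "norm (K x y) \<le> C * (riesz_weight \<delta> a x y + riesz_weight \<delta> b x y)"
      by (cases z) auto
    have "C * (riesz_weight \<delta> a x y + riesz_weight \<delta> b x y) \<le> g0 x y powr (2 / q) * g1 x y powr (1 - 2 / q)"
      unfolding 1(8)[symmetric] 2(8)[symmetric] g0_def g1_def
      using q2 \<open>C > 0\<close> by (intro powr_interpolate_add_le 1(4,5) 2(4,5)) auto
    with le show "case z of (x, y) \<Rightarrow> norm (K x y) \<le> g0 x y powr (2 / q) * g1 x y powr (1 - 2 / q)"
      by (simp add: z)
  qed
qed

section \<open>The power series of the Bessel functions\<close>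

text \<open>The shifts up to \<open>K\<close> stay in a compact ball. Beyond it the argument has
  modulus at least 1, and \<open>rGamma z = z * rGamma (z + 1)\<close> makes the moduli
  nonincreasing. Uniformity in \<open>a\<close> over a ball is what later gives regularity in the
  order.\<close>

lemma rGamma_shift_bounded:
  obtains M where "M > 0" "\<And>(a::complex) k. norm a \<le> r \<Longrightarrow> norm (rGamma (a + of_nat k + 1)) \<le> M"
proof -
  define K where "K = nat \<lceil>r\<rceil>"
  have "compact (rGamma ` cball (0::complex) (r + real K + 1))"
    by (intro compact_continuous_image continuous_on_rGamma) auto
  then have "bounded (rGamma ` cball (0::complex) (r + real K + 1))"
    by (rule compact_imp_bounded)
  then obtain M where M: "M > 0" "\<And>w::complex. norm w \<le> r + real K + 1 \<Longrightarrow> norm (rGamma w) \<le> M"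
    unfolding bounded_pos by auto
  have "norm (rGamma (a + of_nat k + 1)) \<le> M" if a: "norm a \<le> r" for a :: complex and k
  proof (cases "k \<le> K")
    case True
    have "norm (a + of_nat k + 1) \<le> norm a + norm (of_nat k :: complex) + norm (1 :: complex)"
      by (metis norm_triangle_le add_right_mono norm_triangle_ineq order_refl)
    then show ?thesis using a True by (intro M) (auto simp: norm_of_nat)
  next
    case False
    then have "K \<le> k" by simp
    then show ?thesis
    proof (induction k rule: dec_induct)
      case base
      have "norm (a + of_nat K + 1) \<le> norm a + norm (of_nat K :: complex) + norm (1 :: complex)"
        by (metis norm_triangle_le add_right_mono norm_triangle_ineq order_refl)
      then show ?case using a by (intro M) (auto simp: norm_of_nat)
    next
      case (step j)
      let ?z = "a + of_nat j + 1"
      have "r \<le> real K" by (simp add: K_def) linarith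
      then have "Re ?z \<ge> 1" using a step(1) abs_Re_le_cmod[of a] by simp
      then have z1: "norm ?z \<ge> 1" using complex_Re_le_cmod[of ?z] by linarith
      have "norm (rGamma (?z + 1)) \<le> norm ?z * norm (rGamma (?z + 1))"
        using mult_right_mono[OF z1, of "norm (rGamma (?z + 1))"] by simp
      also have "\<dots> = norm (rGamma ?z)"
        by (metis rGamma_plus1 norm_mult)
      finally show ?case using step(3) by (simp add: add_ac)
    qed
  qed
  with M(1) show ?thesis using that by blast
qed

text \<open>The regularized hypergeometric function 0F1 with parameter \<open>a + 1\<close>, entire
  in \<open>y\<close> and in \<open>a\<close>. At \<open>- ((z / 2)\<^sup>2)\<close> and at
  \<open>(w / 2)\<^sup>2\<close> it gives, up to a power, the Bessel function J and the modified
  Bessel function I, which therefore share their derivative and recurrence formulas.\<close>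

definition bessel_series :: "complex \<Rightarrow> complex \<Rightarrow> complex" where
  "bessel_series a y = (\<Sum>k. rGamma (a + of_nat k + 1) / fact k * y ^ k)"

lemma summable_norm_exp_real: "summable (\<lambda>k. M * (r ^ k / fact k))" for r M :: real
  using summable_exp[of r] by (intro summable_mult) (simp add: field_simps)

lemma summable_bessel_series:
  fixes a y :: complex
  shows "summable (\<lambda>k. rGamma (a + of_nat k + 1) / fact k * y ^ k)"
proof -
  obtain M where M: "M > 0" "\<And>(b::complex) k. norm b \<le> norm a \<Longrightarrow> norm (rGamma (b + of_nat k + 1)) \<le> M"
    using rGamma_shift_bounded by blast
  show ?thesis
  proof (rule summable_comparison_test[OF _ summable_norm_exp_real[of M "norm y"]], intro exI allI impI)
    fix k
    have "norm (rGamma (a + of_nat k + 1)) * (norm y ^ k / fact k) \<le> M * (norm y ^ k / fact k)"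
      by (intro mult_right_mono M) auto
    then show "norm (rGamma (a + of_nat k + 1) / fact k * y ^ k) \<le> M * (norm y ^ k / fact k)"
      by (simp add: norm_mult norm_divide norm_power)
  qed
qed

lemma bessel_series_0 [simp]: "bessel_series a 0 = rGamma (a + 1)"
  unfolding bessel_series_def powser_zero by simp

lemma has_field_derivative_bessel_series:
  "(bessel_series a has_field_derivative bessel_series (a + 1) y) (at y)"
proof -
  let ?c = "\<lambda>k. rGamma (a + of_nat k + 1) / fact k"
  have "((\<lambda>x. \<Sum>n. ?c n * x ^ n) has_field_derivative (\<Sum>n. diffs ?c n * y ^ n)) (at y)"
    by (rule termdiffs_strong_converges_everywhere) (rule summable_bessel_series)
  moreover have "diffs ?c = (\<lambda>k. rGamma (a + 1 + of_nat k + 1) / fact k)"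
  proof
    fix k
    have e: "a + of_nat (Suc k) + 1 = a + 1 + of_nat k + 1" by simp
    have "(of_nat (Suc k) :: complex) \<noteq> 0" by (rule of_nat_neq_0)
    then show "diffs ?c k = rGamma (a + 1 + of_nat k + 1) / fact k"
      unfolding diffs_def e by (simp del: of_nat_Suc)
  qed
  ultimately show ?thesis by (simp add: bessel_series_def[abs_def])
qed

lemma bessel_series_recurrence: "bessel_series (a - 1) y = a * bessel_series a y + y * bessel_series (a + 1) y"
proof -
  let ?c = "\<lambda>a k. rGamma (a + of_nat k + 1) / fact k"
  note s = summable_bessel_series
  have split: "bessel_series b y = ?c b 0 + (\<Sum>k. ?c b (Suc k) * y ^ Suc k)" for b
    unfolding bessel_series_def using suminf_split_head[OF s[of b y]] by simp
  have sS: "summable (\<lambda>k. ?c b (Suc k) * y ^ Suc k)" for b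
    using s[of b y] by (subst summable_Suc_iff)
  have coeff: "?c (a - 1) (Suc k) * y ^ Suc k = a * (?c a (Suc k) * y ^ Suc k) + y * (?c (a + 1) k * y ^ k)" for k
  proof -
    let ?z = "a + of_nat k + 1"
    have "rGamma ?z = ?z * rGamma (?z + 1)" by (rule rGamma_plus1[symmetric])
    then have "?c (a - 1) (Suc k) = (a + of_nat (Suc k)) * rGamma (?z + 1) / fact (Suc k)"
      by (simp add: add_ac)
    also have "\<dots> = a * (rGamma (?z + 1) / fact (Suc k)) + rGamma (?z + 1) / fact k"
      by (simp add: field_simps del: of_nat_Suc)
    finally have "?c (a - 1) (Suc k) = a * ?c a (Suc k) + ?c (a + 1) k"
      by (simp add: add_ac)
    then show ?thesis by (simp add: algebra_simps)
  qed
  have "bessel_series (a - 1) y = a * ?c a 0 + (\<Sum>k. a * (?c a (Suc k) * y ^ Suc k) + y * (?c (a + 1) k * y ^ k))"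
    unfolding split[of "a - 1"] coeff using rGamma_plus1[of a] by (simp add: mult.commute)
  also have "\<dots> = a * ?c a 0 + (a * (\<Sum>k. ?c a (Suc k) * y ^ Suc k) + y * bessel_series (a + 1) y)"
    unfolding bessel_series_def
    by (simp only: suminf_add[OF summable_mult[OF sS] summable_mult[OF s], symmetric]
        suminf_mult[OF sS] suminf_mult[OF s])
  also have "\<dots> = a * bessel_series a y + y * bessel_series (a + 1) y"
    unfolding split[of a] by (simp add: algebra_simps)
  finally show ?thesis .
qed

text \<open>Locally uniform convergence in the order by the M-test. Differentiability in the order
  resolves the quotient 0/0 at integer orders.\<close>

lemma holomorphic_bessel_series_order: "(\<lambda>a. bessel_series a y) holomorphic_on UNIV"
proof (rule holomorphic_uniform_sequence[OF open_UNIV])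
  show "(\<lambda>a. \<Sum>k<n. rGamma (a + of_nat k + 1) / fact k * y ^ k) holomorphic_on UNIV" for n
    by (intro holomorphic_intros) auto
  fix a :: complex
  obtain M where M: "M > 0" "\<And>(b::complex) k. norm b \<le> norm a + 1 \<Longrightarrow> norm (rGamma (b + of_nat k + 1)) \<le> M"
    using rGamma_shift_bounded by blast
  have "uniform_limit (cball a 1) (\<lambda>n b. \<Sum>k<n. rGamma (b + of_nat k + 1) / fact k * y ^ k)
     (\<lambda>b. \<Sum>k. rGamma (b + of_nat k + 1) / fact k * y ^ k) sequentially"
  proof (rule Weierstrass_m_test[OF _ summable_norm_exp_real[of M "norm y"]])
    fix k b assume "b \<in> cball a 1"
    then have "norm b \<le> norm a + 1"
      using norm_triangle_sub[of b a] by (simp add: dist_norm norm_minus_commute)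
    then have "norm (rGamma (b + of_nat k + 1)) * (norm y ^ k / fact k) \<le> M * (norm y ^ k / fact k)"
      by (intro mult_right_mono M) auto
    then show "norm (rGamma (b + of_nat k + 1) / fact k * y ^ k) \<le> M * (norm y ^ k / fact k)"
      by (simp add: norm_mult norm_divide norm_power)
  qed
  then show "\<exists>d>0. cball a d \<subseteq> UNIV \<and> uniform_limit (cball a d)
     (\<lambda>n b. \<Sum>k<n. rGamma (b + of_nat k + 1) / fact k * y ^ k) (\<lambda>b. bessel_series b y) sequentially"
    unfolding bessel_series_def by (intro exI[of _ 1]) auto
qed

lemma bessel_J_series: "bessel_J a z = (z / 2) powr a * bessel_series a (- ((z / 2)\<^sup>2))"
proof -
  have "(- 1) ^ k * rGamma (a + of_nat k + 1) / fact k * (z / 2) ^ (2 * k)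
     = rGamma (a + of_nat k + 1) / fact k * (- ((z / 2)\<^sup>2)) ^ k" for k
    by (simp add: power_mult power_minus[of "(z / 2)\<^sup>2"])
  then show ?thesis unfolding bessel_J_def bessel_series_def by presburger
qed

lemma field_differentiable_bessel_J_order:
  assumes "z \<noteq> 0"
  shows "(\<lambda>a. bessel_J a z) field_differentiable (at a)"
proof -
  have "(\<lambda>a. bessel_series a (- ((z / 2)\<^sup>2))) field_differentiable (at a)"
    using holomorphic_bessel_series_order holomorphic_on_imp_differentiable_at by blast
  moreover have "(\<lambda>a. (z / 2) powr a) field_differentiable (at a)"
    using assms has_field_derivative_powr_right[of "z / 2" a] by (auto simp: field_differentiable_def)
  ultimately show ?thesis
    unfolding bessel_J_series by (rule field_differentiable_mult[rotated])
qed

lemma bessel_J_recurrence: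
  assumes "z \<noteq> 0"
  shows "bessel_J (a + 1) z + bessel_J (a - 1) z = 2 * a / z * bessel_J a z"
proof -
  let ?x = "z / 2" and ?B = "\<lambda>a. bessel_series a (- ((z / 2)\<^sup>2))"
  have x: "?x \<noteq> 0" using assms by simp
  have p: "?x powr (a + 1) = ?x powr (a - 1) * ?x\<^sup>2" "?x powr a = ?x powr (a - 1) * ?x"
    using x by (simp_all add: powr_add powr_diff power2_eq_square)
  have "bessel_J (a - 1) z = ?x powr (a - 1) * (a * ?B a - ?x\<^sup>2 * ?B (a + 1))"
    unfolding bessel_J_series bessel_series_recurrence[of a] by simp
  moreover have "bessel_J (a + 1) z = ?x powr (a - 1) * (?x\<^sup>2 * ?B (a + 1))"
    unfolding bessel_J_series p(1) by simp
  moreover have "bessel_J a z = ?x powr (a - 1) * (?x * ?B a)"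
    unfolding bessel_J_series p(2) by simp
  ultimately show ?thesis using assms by (simp add: algebra_simps)
qed

subsection \<open>Hankel functions of integer order as limits\<close>

text \<open>At an integer order the quotient is a division by zero with value 0; only limits of this
  function are taken there.\<close>

definition hankel_nonint :: "complex \<Rightarrow> complex \<Rightarrow> complex" where
  "hankel_nonint a z = bessel_J a z
     + \<i> * ((bessel_J a z * cos (a * of_real pi) - bessel_J (- a) z) / sin (a * of_real pi))"

lemma hankel_H1_nonint: "a \<notin> \<int> \<Longrightarrow> hankel_H1 a z = hankel_nonint a z"
  by (simp add: hankel_H1_def hankel_nonint_def bessel_Y_def Let_def)

lemma sin_pi_mult_nonint:
  fixes a :: complex
  assumes "a \<notin> \<int>"
  shows "sin (a * of_real pi) \<noteq> 0"
proof
  assume "sin (a * of_real pi) = 0"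
  then obtain n :: int where "a * of_real pi = of_real n * of_real pi"
    by (auto simp: sin_eq_0)
  then have "a = of_int n" by simp
  with assms show False by simp
qed

text \<open>The classical form (J_{-a} - exp(-i pi a) J_a) / (i sin(pi a)), in which both terms
  acquire the same phase after rotation to the right half-plane.\<close>

lemma hankel_nonint_eq:
  assumes "a \<notin> \<int>"
  shows "hankel_nonint a z = - \<i> * (bessel_J (- a) z - exp (- \<i> * of_real pi * a) * bessel_J a z) / sin (a * of_real pi)"
proof -
  let ?s = "sin (a * of_real pi)" and ?c = "cos (a * of_real pi)"
  have s: "?s \<noteq> 0" using sin_pi_mult_nonint[OF assms] .
  have e: "exp (- \<i> * of_real pi * a) = ?c - \<i> * ?s"
    using exp_Euler[of "- (a * of_real pi)"] by (simp add: mult_ac)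
  show ?thesis
    unfolding hankel_nonint_def e using s by (simp add: field_simps)
qed

lemma hankel_nonint_recurrence:
  assumes "z \<noteq> 0" "a \<notin> \<int>"
  shows "hankel_nonint (a + 1) z = 2 * a / z * hankel_nonint a z - hankel_nonint (a - 1) z"
proof -
  let ?s = "sin (a * of_real pi)" and ?c = "cos (a * of_real pi)"
  have s: "?s \<noteq> 0" using sin_pi_mult_nonint[OF assms(2)] .
  have sc: "sin ((a + 1) * of_real pi) = - ?s" "sin ((a - 1) * of_real pi) = - ?s"
     "cos ((a + 1) * of_real pi) = - ?c" "cos ((a - 1) * of_real pi) = - ?c"
    by (simp_all add: algebra_simps sin_add sin_diff cos_add cos_diff)
  have J1: "bessel_J (a + 1) z = 2 * a / z * bessel_J a z - bessel_J (a - 1) z"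
    using bessel_J_recurrence[OF assms(1), of a] by (simp add: algebra_simps)
  have J2: "bessel_J (- (a + 1)) z = - 2 * a / z * bessel_J (- a) z - bessel_J (- (a - 1)) z"
  proof -
    have e: "- (a + 1) = - a - 1" "- (a - 1) = - a + 1" by simp_all
    show ?thesis unfolding e using bessel_J_recurrence[OF assms(1), of "- a"] by (simp add: algebra_simps)
  qed
  show ?thesis
    unfolding hankel_nonint_def sc J1 J2 using s assms(1) by (simp add: field_simps)
qed

lemma eventually_nonint: "eventually (\<lambda>b. b \<notin> \<int>) (at (a::complex))"
proof -
  have "open (- (of_int ` {n. of_int n \<noteq> a}) :: complex set)"
    using closed_of_int_image by (simp add: open_closed)
  moreover have "a \<in> - (of_int ` {n. of_int n \<noteq> a})" by auto
  ultimately show ?thesis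
    unfolding eventually_at_topological
    by (intro exI[of _ "- (of_int ` {n. of_int n \<noteq> a})"]) (auto elim!: Ints_cases)
qed

text \<open>Evaluates the \<open>Lim\<close> inside \<open>bessel_Y\<close>: its quotient is
  \<open>(hankel_nonint b z - bessel_J b z) / \<i>\<close>, and \<open>bessel_J\<close> is
  continuous in the order.\<close>

lemma hankel_H1_int_eqI:
  assumes "a \<in> \<int>" "z \<noteq> 0" and lim: "((\<lambda>b. hankel_nonint b z) \<longlongrightarrow> L) (at a)"
  shows "hankel_H1 a z = L"
proof -
  let ?q = "\<lambda>b. (bessel_J b z * cos (b * of_real pi) - bessel_J (- b) z) / sin (b * of_real pi)"
  have "((\<lambda>b. bessel_J b z) \<longlongrightarrow> bessel_J a z) (at a)"
    using field_differentiable_imp_continuous_at[OF field_differentiable_bessel_J_order[OF \<open>z \<noteq> 0\<close>]]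
    by (simp add: isCont_def)
  then have "((\<lambda>b. (hankel_nonint b z - bessel_J b z) / \<i>) \<longlongrightarrow> (L - bessel_J a z) / \<i>) (at a)"
    using lim by (intro tendsto_intros) auto
  moreover have "(\<lambda>b. (hankel_nonint b z - bessel_J b z) / \<i>) = ?q"
    by (simp add: hankel_nonint_def)
  ultimately have "(?q \<longlongrightarrow> (L - bessel_J a z) / \<i>) (at a)" by simp
  then have "Lim (at a) ?q = (L - bessel_J a z) / \<i>"
    by (intro tendsto_Lim) auto
  then show ?thesis using \<open>a \<in> \<int>\<close> by (simp add: hankel_H1_def bessel_Y_def Let_def)
qed

text \<open>Difference quotients: by \<open>zero\<close> the numerator vanishes at the integer, the
  sine has a simple zero there, and both are differentiable in the order.\<close>

lemma hankel_nonint_converges: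
  assumes "z \<noteq> 0" and zero: "bessel_J (of_int m) z * cos (of_int m * of_real pi) = bessel_J (- of_int m) z"
  shows "\<exists>L. ((\<lambda>b. hankel_nonint b z) \<longlongrightarrow> L) (at (of_int m))"
proof -
  let ?a = "of_int m :: complex"
  let ?N = "\<lambda>b. bessel_J b z * cos (b * of_real pi) - bessel_J (- b) z"
  let ?s = "\<lambda>b::complex. sin (b * of_real pi)"
  note fd = field_differentiable_bessel_J_order[OF \<open>z \<noteq> 0\<close>]
  obtain D1 where D1: "((\<lambda>b. bessel_J b z) has_field_derivative D1) (at ?a)"
    using fd by (auto simp: field_differentiable_def)
  obtain D2 where D2: "((\<lambda>b. bessel_J b z) has_field_derivative D2) (at (- ?a))"
    using fd by (auto simp: field_differentiable_def)
  have D2': "((\<lambda>b. bessel_J (- b) z) has_field_derivative D2 * (- 1)) (at ?a)"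
    by (rule DERIV_chain2[where f = "\<lambda>b. bessel_J b z" and g = uminus, OF D2])
       (auto intro!: derivative_eq_intros)
  have "\<exists>D. (?N has_field_derivative D) (at ?a)"
    by (rule exI) (rule derivative_eq_intros D2' D1 refl)+
  then obtain D where "(?N has_field_derivative D) (at ?a)" by blast
  then have 1: "((\<lambda>b. ?N b / (b - ?a)) \<longlongrightarrow> D) (at ?a)"
    using zero by (simp add: has_field_derivative_iff)
  have s0: "?s ?a = 0" by (simp add: sin_eq_0)
  have "(?s has_field_derivative cos (?a * of_real pi) * of_real pi) (at ?a)"
    by (rule derivative_eq_intros refl)+ simp
  then have 2: "((\<lambda>b. ?s b / (b - ?a)) \<longlongrightarrow> cos (?a * of_real pi) * of_real pi) (at ?a)"
    using s0 by (simp add: has_field_derivative_iff)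
  have "cos (?a * of_real pi) \<noteq> 0"
    using s0 sin_cos_squared_add[of "?a * of_real pi"] by (metis power_zero_numeral add_0 zero_neq_one)
  then have "((\<lambda>b. (?N b / (b - ?a)) / (?s b / (b - ?a))) \<longlongrightarrow> D / (cos (?a * of_real pi) * of_real pi)) (at ?a)"
    by (intro tendsto_divide 1 2) auto
  then have q: "((\<lambda>b. ?N b / ?s b) \<longlongrightarrow> D / (cos (?a * of_real pi) * of_real pi)) (at ?a)"
    by (rule Lim_transform_eventually) (auto simp: eventually_at_filter)
  have "((\<lambda>b. bessel_J b z) \<longlongrightarrow> bessel_J ?a z) (at ?a)"
    using field_differentiable_imp_continuous_at[OF fd] by (simp add: isCont_def)
  then have "((\<lambda>b. bessel_J b z + \<i> * (?N b / ?s b)) \<longlongrightarrow> bessel_J ?a z + \<i> * (D / (cos (?a * of_real pi) * of_real pi))) (at ?a)"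
    by (intro tendsto_intros q)
  then show ?thesis unfolding hankel_nonint_def by blast
qed

text \<open>The quotient of difference quotients is used only at orders 0 and 1, where J_{-1} = -
  J_1 follows from the recurrence at order 0. The recurrence at nearby noninteger orders carries
  convergence to all larger integers.\<close>

lemma tendsto_hankel_H1_int:
  assumes "z \<noteq> 0"
  shows "((\<lambda>b. hankel_nonint b z) \<longlongrightarrow> hankel_H1 (of_nat n) z) (at (of_nat n))"
proof -
  have "\<exists>L. ((\<lambda>b. hankel_nonint b z) \<longlongrightarrow> L) (at (of_nat n))"
  proof (induction n rule: less_induct)
    case (less n)
    consider "n = 0" | "n = 1" | m where "n = Suc (Suc m)" by (metis One_nat_def not0_implies_Suc)
    then show ?case
    proof cases
      case 1
      then show ?thesis using hankel_nonint_converges[OF assms, of 0] by simp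
    next
      case 2
      have "bessel_J (-1) z = - bessel_J 1 z"
        using bessel_J_recurrence[OF assms, of 0] by (simp add: add_eq_0_iff)
      then show ?thesis using 2 hankel_nonint_converges[OF assms, of 1] by simp
    next
      case (3 m)
      obtain L0 where L0: "((\<lambda>b. hankel_nonint b z) \<longlongrightarrow> L0) (at (of_nat m))" using less(1)[of m] 3 by auto
      obtain L1 where L1: "((\<lambda>b. hankel_nonint b z) \<longlongrightarrow> L1) (at (of_nat (Suc m)))" using less(1)[of "Suc m"] 3 by auto
      have L0': "((\<lambda>b. hankel_nonint (b - 2) z) \<longlongrightarrow> L0) (at (of_nat n))"
        using LIM_offset[OF L0, of "-2"] 3 by (simp add: add.commute)
      have L1': "((\<lambda>b. hankel_nonint (b - 1) z) \<longlongrightarrow> L1) (at (of_nat n))"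
        using LIM_offset[OF L1, of "-1"] 3 by (simp add: add.commute)
      have "((\<lambda>b. 2 * (b - 1) / z * hankel_nonint (b - 1) z - hankel_nonint (b - 2) z)
         \<longlongrightarrow> 2 * (of_nat n - 1) / z * L1 - L0) (at (of_nat n))"
        using assms by (intro tendsto_intros L0' L1') auto
      moreover have "eventually (\<lambda>b. 2 * (b - 1) / z * hankel_nonint (b - 1) z - hankel_nonint (b - 2) z = hankel_nonint b z) (at (of_nat n))"
        using eventually_nonint
      proof eventually_elim
        fix b :: complex assume "b \<notin> \<int>"
        then have "b - 1 \<notin> \<int>" by (metis Ints_1 Ints_add diff_add_cancel)
        from hankel_nonint_recurrence[OF assms this]
        show "2 * (b - 1) / z * hankel_nonint (b - 1) z - hankel_nonint (b - 2) z = hankel_nonint b z" by simp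
      qed
      ultimately show ?thesis by (blast intro: Lim_transform_eventually)
    qed
  qed
  then obtain L where L: "((\<lambda>b. hankel_nonint b z) \<longlongrightarrow> L) (at (of_nat n))" by blast
  with hankel_H1_int_eqI[OF _ assms L] show ?thesis by simp
qed

text \<open>At a positive integer the identity is the limit of the one at noninteger orders. The
  form \<open>Suc n\<close> keeps \<open>a - 1\<close> nonnegative, within the range where the
  limits are identified.\<close>

lemma hankel_H1_recurrence:
  assumes "z \<noteq> 0" "a \<notin> \<int> \<or> (\<exists>n. a = of_nat (Suc n))"
  shows "hankel_H1 (a + 1) z = 2 * a / z * hankel_H1 a z - hankel_H1 (a - 1) z"
proof (cases "a \<in> \<int>")
  case False
  then have "a + 1 \<notin> \<int>" "a - 1 \<notin> \<int>"
    by (metis Ints_1 Ints_diff add_diff_cancel_right', metis Ints_1 Ints_add diff_add_cancel)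
  then show ?thesis
    using hankel_nonint_recurrence[OF assms(1) False] False by (simp add: hankel_H1_nonint)
next
  case True
  then obtain n where a: "a = of_nat (Suc n)" using assms(2) by blast
  note L = tendsto_hankel_H1_int[OF assms(1)]
  have L0: "((\<lambda>b. hankel_nonint (b - 1) z) \<longlongrightarrow> hankel_H1 (a - 1) z) (at a)"
    using LIM_offset[OF L[of n], of "-1"] by (simp add: a add.commute)
  have L1: "((\<lambda>b. hankel_nonint b z) \<longlongrightarrow> hankel_H1 a z) (at a)"
    using L[of "Suc n"] by (simp add: a)
  have L2: "((\<lambda>b. hankel_nonint (b + 1) z) \<longlongrightarrow> hankel_H1 (a + 1) z) (at a)"
    using LIM_offset[OF L[of "Suc (Suc n)"], of "1"] by (simp add: a add_ac)
  have "((\<lambda>b. 2 * b / z * hankel_nonint b z - hankel_nonint (b - 1) z)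
     \<longlongrightarrow> 2 * a / z * hankel_H1 a z - hankel_H1 (a - 1) z) (at a)"
    using assms(1) by (intro tendsto_intros L0 L1) auto
  moreover have "eventually (\<lambda>b. 2 * b / z * hankel_nonint b z - hankel_nonint (b - 1) z = hankel_nonint (b + 1) z) (at a)"
    using eventually_nonint by eventually_elim (simp add: hankel_nonint_recurrence[OF assms(1)])
  ultimately have "((\<lambda>b. hankel_nonint (b + 1) z) \<longlongrightarrow> 2 * a / z * hankel_H1 a z - hankel_H1 (a - 1) z) (at a)"
    by (rule Lim_transform_eventually)
  with L2 show ?thesis by (rule LIM_unique)
qed

section \<open>The modified Bessel function of the second kind\<close>

lemma of_real_cosh: "of_real (cosh t) = (cosh (of_real t) :: complex)"
  by (simp add: cosh_def scaleR_conv_of_real exp_of_real[symmetric])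

lemma of_real_sinh: "of_real (sinh t) = (sinh (of_real t) :: complex)"
  by (simp add: sinh_def scaleR_conv_of_real exp_of_real[symmetric])

definition mac_integrand :: "real \<Rightarrow> complex \<Rightarrow> real \<Rightarrow> complex" where
  "mac_integrand \<nu> w t = exp (- w * of_real (cosh t)) * of_real (cosh (\<nu> * t))"

text \<open>Truncation allows differentiation under the integral and integration by parts on a
  compact interval; statements on the improper integral are limits over integer
  \<open>N\<close>.\<close>

definition mac_trunc :: "real \<Rightarrow> real \<Rightarrow> complex \<Rightarrow> complex" where
  "mac_trunc N \<nu> w = integral {0..N} (mac_integrand \<nu> w)"

definition macdonald :: "real \<Rightarrow> complex \<Rightarrow> complex" where
  "macdonald \<nu> w = lim (\<lambda>n. mac_trunc (real n) \<nu> w)"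

lemma continuous_on_mac_integrand [continuous_intros]: "continuous_on S (mac_integrand \<nu> w)"
  unfolding mac_integrand_def by (intro continuous_intros)

lemma integrable_mac_integrand: "mac_integrand \<nu> w integrable_on {a..b}"
  by (intro integrable_continuous_real continuous_intros)

section \<open>Convergence of the truncated integrals\<close>

lemma cosh_mult_le:
  assumes "\<bar>\<nu>\<bar> \<le> (1::real)"
  shows "cosh (\<nu> * t) \<le> cosh t"
proof -
  have "\<bar>\<nu> * t\<bar> \<le> \<bar>t\<bar>" using mult_right_mono[OF assms, of "\<bar>t\<bar>"] by (simp add: abs_mult)
  then have "cosh \<bar>\<nu> * t\<bar> \<le> cosh \<bar>t\<bar>" by (subst cosh_real_nonneg_le_iff) auto
  then show ?thesis by (simp only: cosh_real_abs)
qed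

text \<open>From \<open>(a * u)\<^sup>2 / 2 \<le> exp (a * u)\<close> with
  \<open>u = cosh t\<close>: one power of \<open>u\<close> absorbs the factor \<open>cosh t\<close>,
  the other supplies \<open>exp (- t)\<close>.\<close>

lemma exp_neg_mult_cosh_le:
  fixes a t :: real
  assumes "a > 0"
  shows "exp (- a * cosh t) * cosh t \<le> 4 / a\<^sup>2 * exp (- t)"
proof -
  let ?u = "cosh t"
  have u: "?u \<ge> 1" by (rule cosh_real_ge_1)
  have "(a * ?u)\<^sup>2 / 2 \<le> exp (a * ?u)"
    using exp_lower_Taylor_quadratic[of "a * ?u"] assms u by (smt (verit) mult_nonneg_nonneg)
  then have "exp (- a * ?u) * ((a * ?u)\<^sup>2 / 2) \<le> exp (- a * ?u) * exp (a * ?u)"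
    by (intro mult_left_mono) auto
  then have "exp (- a * ?u) * ((a * ?u)\<^sup>2 / 2) \<le> 1" by (simp flip: exp_add)
  then have 1: "exp (- a * ?u) * ?u \<le> 2 / a\<^sup>2 * (1 / ?u)"
    using assms u by (simp add: field_simps power2_eq_square)
  have "exp t / 2 \<le> ?u" by (simp add: cosh_def)
  then have "1 / ?u \<le> 2 * exp (- t)"
    using u by (simp add: field_simps exp_minus)
  then have "2 / a\<^sup>2 * (1 / ?u) \<le> 2 / a\<^sup>2 * (2 * exp (- t))"
    using assms by (intro mult_left_mono) auto
  with 1 show ?thesis by (simp add: mult.assoc)
qed

lemma norm_exp_mult_cosh_le:
  assumes "a > 0" "Re w \<ge> a"
  shows "norm (exp (- w * of_real (cosh t))) * cosh t \<le> 4 / a\<^sup>2 * exp (- t)"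
proof -
  have "norm (exp (- w * of_real (cosh t))) \<le> exp (- a * cosh t)"
    using assms cosh_real_pos[of t] by (simp add: norm_exp_eq_Re mult_right_mono)
  then have "norm (exp (- w * of_real (cosh t))) * cosh t \<le> exp (- a * cosh t) * cosh t"
    by (intro mult_right_mono) auto
  with exp_neg_mult_cosh_le[OF assms(1), of t] show ?thesis by linarith
qed

lemma norm_mac_integrand_le:
  assumes "a > 0" "Re w \<ge> a" "\<bar>\<nu>\<bar> \<le> 1"
  shows "norm (mac_integrand \<nu> w t) \<le> 4 / a\<^sup>2 * exp (- t)"
proof -
  have "norm (mac_integrand \<nu> w t) \<le> norm (exp (- w * of_real (cosh t))) * cosh t"
    unfolding mac_integrand_def using cosh_mult_le[OF assms(3), of t]
    by (simp add: norm_mult mult_left_mono)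
  with norm_exp_mult_cosh_le[OF assms(1,2), of t] show ?thesis by linarith
qed

lemma norm_mac_trunc_diff_le:
  assumes "a > 0" "Re w \<ge> a" "\<bar>\<nu>\<bar> \<le> 1" "0 \<le> N" "N \<le> M"
  shows "norm (mac_trunc M \<nu> w - mac_trunc N \<nu> w) \<le> 4 / a\<^sup>2 * exp (- N)"
proof -
  have "mac_trunc N \<nu> w + integral {N..M} (mac_integrand \<nu> w) = mac_trunc M \<nu> w"
    unfolding mac_trunc_def
    by (rule Henstock_Kurzweil_Integration.integral_combine) (use assms integrable_mac_integrand in auto)
  then have "mac_trunc M \<nu> w - mac_trunc N \<nu> w = integral {N..M} (mac_integrand \<nu> w)"
    by (simp add: algebra_simps)
  moreover have I: "((\<lambda>t. c * exp (- t)) has_integral (- (c * exp (- M)) - - (c * exp (- N)))) {N..M}" for c :: real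
    by (rule fundamental_theorem_of_calculus[OF assms(5)])
       (auto intro!: derivative_eq_intros simp flip: has_real_derivative_iff_has_vector_derivative)
  moreover have "norm (integral {N..M} (mac_integrand \<nu> w)) \<le> integral {N..M} (\<lambda>t. 4 / a\<^sup>2 * exp (- t))"
    using I[of "4 / a\<^sup>2"] by (intro integral_norm_bound_integral integrable_mac_integrand norm_mac_integrand_le assms) blast
  moreover have "integral {N..M} (\<lambda>t. 4 / a\<^sup>2 * exp (- t)) \<le> 4 / a\<^sup>2 * exp (- N)"
    unfolding integral_unique[OF I] by simp
  ultimately show ?thesis by simp
qed

lemma mac_trunc_tendsto:
  assumes "Re w > 0" "\<bar>\<nu>\<bar> \<le> 1"
  shows "(\<lambda>n. mac_trunc (real n) \<nu> w) \<longlonglongrightarrow> macdonald \<nu> w"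
proof -
  have lim0: "(\<lambda>n. 4 / (Re w)\<^sup>2 * exp (- real n)) \<longlonglongrightarrow> 0"
    by (rule tendsto_mult_right_zero)
       (rule filterlim_compose[OF exp_at_bot], rule filterlim_compose[OF filterlim_uminus_at_bot_at_top filterlim_real_sequentially])
  have "Cauchy (\<lambda>n. mac_trunc (real n) \<nu> w)"
  proof (rule CauchyI')
    fix e :: real assume "e > 0"
    then obtain K where K: "\<And>n. n \<ge> K \<Longrightarrow> 4 / (Re w)\<^sup>2 * exp (- real n) < e"
      using order_tendstoD(2)[OF lim0] unfolding eventually_sequentially by blast
    show "\<exists>K. \<forall>m\<ge>K. \<forall>n>m. dist (mac_trunc (real m) \<nu> w) (mac_trunc (real n) \<nu> w) < e"
    proof (intro exI[of _ K] allI impI)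
      fix m n assume "m \<ge> K" "n > m"
      then show "dist (mac_trunc (real m) \<nu> w) (mac_trunc (real n) \<nu> w) < e"
        using norm_mac_trunc_diff_le[of "Re w" w \<nu> "real m" "real n"] K[of m] assms
        by (simp add: dist_norm norm_minus_commute)
    qed
  qed
  then show ?thesis
    by (simp add: macdonald_def Cauchy_convergent_iff convergent_LIMSEQ_iff)
qed

lemma norm_macdonald_diff_le:
  assumes "a > 0" "Re w \<ge> a" "\<bar>\<nu>\<bar> \<le> 1"
  shows "norm (macdonald \<nu> w - mac_trunc (real n) \<nu> w) \<le> 4 / a\<^sup>2 * exp (- real n)"
proof (rule LIMSEQ_le_const2)
  show "(\<lambda>m. norm (mac_trunc (real m) \<nu> w - mac_trunc (real n) \<nu> w)) \<longlonglongrightarrow> norm (macdonald \<nu> w - mac_trunc (real n) \<nu> w)"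
    using assms by (intro tendsto_intros mac_trunc_tendsto) auto
  show "\<exists>K. \<forall>m\<ge>K. norm (mac_trunc (real m) \<nu> w - mac_trunc (real n) \<nu> w) \<le> 4 / a\<^sup>2 * exp (- real n)"
    using norm_mac_trunc_diff_le[OF assms] by (intro exI[of _ n]) auto
qed

text \<open>Differentiation produces \<open>cosh t * cosh (\<nu> * t)\<close>, which the addition
  theorem splits into \<open>cosh ((1 - \<nu>) * t)\<close> and
  \<open>sinh t * sinh (\<nu> * t)\<close>; the latter is integrated by parts. Passing to
  \<open>1 - \<nu>\<close>, possible since the integral is even in the order, keeps both orders
  between 0 and 1.\<close>

lemma has_field_derivative_mac_trunc:
  assumes "N \<ge> 0" "w \<noteq> 0"
  shows "(mac_trunc N \<nu> has_field_derivative
     (- mac_trunc N (1 - \<nu>) w - of_real \<nu> / w * mac_trunc N \<nu> w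
        + exp (- w * of_real (cosh N)) * of_real (sinh (\<nu> * N)) / w)) (at w)"
proof -
  let ?d = "\<lambda>w t. - of_real (cosh t) * mac_integrand \<nu> w t"
  have der: "(mac_trunc N \<nu> has_field_derivative integral {0..N} (?d w)) (at w)"
  proof -
    have "((\<lambda>w. integral (cbox 0 N) (mac_integrand \<nu> w)) has_field_derivative integral (cbox 0 N) (?d w)) (at w within UNIV)"
    proof (rule leibniz_rule_field_derivative)
      fix v :: complex and t :: real
      show "((\<lambda>v. mac_integrand \<nu> v t) has_field_derivative ?d v t) (at v within UNIV)"
        unfolding mac_integrand_def by (auto intro!: derivative_eq_intros)
      show "mac_integrand \<nu> v integrable_on cbox 0 N"
        using integrable_mac_integrand by simp
      show "continuous_on (UNIV \<times> cbox 0 N) (\<lambda>(v, t). ?d v t)"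
        unfolding mac_integrand_def split_beta by (intro continuous_intros)
    qed auto
    then show ?thesis unfolding mac_trunc_def[abs_def] by simp
  qed
  let ?e = "\<lambda>t. exp (- w * of_real (cosh t)) :: complex"
  let ?ss = "\<lambda>t. ?e t * of_real (sinh t) * of_real (sinh (\<nu> * t))"
  \<comment> \<open>Integrates the derivative of
    \<open>exp (- w * cosh t) * sinh (\<nu> * t)\<close>, which expresses the integral of
    \<open>?ss\<close> through \<open>mac_trunc N \<nu> w\<close> and a boundary term at
    \<open>N\<close>.\<close>
  have FTC: "((\<lambda>t. of_real \<nu> * mac_integrand \<nu> w t - w * ?ss t) has_integral
      (?e N * of_real (sinh (\<nu> * N)) - ?e 0 * of_real (sinh (\<nu> * 0)))) {0..N}"
  proof (rule fundamental_theorem_of_calculus[OF assms(1)])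
    fix t :: real
    have "((\<lambda>s. exp (- w * cosh s) * sinh (of_real \<nu> * s)) has_field_derivative
        of_real \<nu> * mac_integrand \<nu> w t - w * ?ss t) (at (of_real t))"
      unfolding mac_integrand_def of_real_cosh of_real_sinh of_real_mult
      by (auto intro!: derivative_eq_intros simp: algebra_simps)
    then have "((\<lambda>s. exp (- w * cosh (of_real s)) * sinh (of_real \<nu> * of_real s)) has_vector_derivative
        of_real \<nu> * mac_integrand \<nu> w t - w * ?ss t) (at t within {0..N})"
      by (rule has_vector_derivative_real_field)
    then show "((\<lambda>t. ?e t * of_real (sinh (\<nu> * t))) has_vector_derivative
        of_real \<nu> * mac_integrand \<nu> w t - w * ?ss t) (at t within {0..N})"
      by (simp only: of_real_cosh of_real_sinh of_real_mult)
  qed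
  have iss: "?ss integrable_on {0..N}"
    by (intro integrable_continuous_real continuous_intros)
  have id: "integral {0..N} (?d w) = - mac_trunc N (1 - \<nu>) w - integral {0..N} ?ss"
  proof -
    have "?d w t = - mac_integrand (1 - \<nu>) w t - ?ss t" for t
    proof -
      have "cosh ((1 - \<nu>) * t) = cosh t * cosh (\<nu> * t) - sinh t * sinh (\<nu> * t)"
        using cosh_diff[of t "\<nu> * t"] by (simp add: left_diff_distrib)
      then have e: "(of_real (cosh ((1 - \<nu>) * t)) :: complex)
          = of_real (cosh t) * of_real (cosh (\<nu> * t)) - of_real (sinh t) * of_real (sinh (\<nu> * t))"
        by simp
      show ?thesis unfolding mac_integrand_def e by (simp add: algebra_simps)
    qed
    then have "integral {0..N} (?d w) = integral {0..N} (\<lambda>t. - mac_integrand (1 - \<nu>) w t - ?ss t)" by simp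
    also have "\<dots> = - mac_trunc N (1 - \<nu>) w - integral {0..N} ?ss"
      unfolding mac_trunc_def integral_diff[OF integrable_neg[OF integrable_mac_integrand] iss] by simp
    finally show ?thesis .
  qed
  have "integral {0..N} (\<lambda>t. of_real \<nu> * mac_integrand \<nu> w t - w * ?ss t) = of_real \<nu> * mac_trunc N \<nu> w - w * integral {0..N} ?ss"
    unfolding mac_trunc_def integral_diff[OF integrable_on_mult_right[OF integrable_mac_integrand] integrable_on_mult_right[OF iss]]
    by simp
  with integral_unique[OF FTC] have "of_real \<nu> * mac_trunc N \<nu> w - w * integral {0..N} ?ss = ?e N * of_real (sinh (\<nu> * N))"
    by simp
  then have iseq: "integral {0..N} ?ss = of_real \<nu> / w * mac_trunc N \<nu> w - ?e N * of_real (sinh (\<nu> * N)) / w"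
    using assms(2) by (simp add: field_simps)
  show ?thesis using der unfolding id iseq by (simp add: algebra_simps)
qed

text \<open>The truncations are holomorphic and converge locally uniformly, so their derivatives
  converge too, and the boundary term vanishes in the limit.\<close>

lemma has_field_derivative_macdonald:
  assumes "Re w > 0" "0 \<le> \<nu>" "\<nu> \<le> 1"
  shows "(macdonald \<nu> has_field_derivative (- macdonald (1 - \<nu>) w - of_real \<nu> / w * macdonald \<nu> w)) (at w)"
proof -
  let ?S = "{w. Re w > 0}"
  let ?D = "\<lambda>n w. - mac_trunc (real n) (1 - \<nu>) w - of_real \<nu> / w * mac_trunc (real n) \<nu> w
        + exp (- w * of_real (cosh (real n))) * of_real (sinh (\<nu> * real n)) / w"
  have lim0: "(\<lambda>n. c * exp (- real n)) \<longlonglongrightarrow> 0" for c :: real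
    by (rule tendsto_mult_right_zero)
       (rule filterlim_compose[OF exp_at_bot], rule filterlim_compose[OF filterlim_uminus_at_bot_at_top filterlim_real_sequentially])
  have "\<exists>g'. \<forall>w\<in>?S. (macdonald \<nu> has_field_derivative g' w) (at w) \<and> (\<lambda>n. ?D n w) \<longlonglongrightarrow> g' w"
  proof (rule has_complex_derivative_uniform_sequence)
    show "open ?S" by (rule open_halfspace_Re_gt)
    show "(mac_trunc (real n) \<nu> has_field_derivative ?D n w) (at w)" if "w \<in> ?S" for n w
      using that by (intro has_field_derivative_mac_trunc) auto
    fix w assume "w \<in> ?S"
    define d where "d = Re w / 2"
    have "d > 0" using \<open>w \<in> ?S\<close> by (simp add: d_def)
    have Re: "Re v \<ge> d" if "v \<in> cball w d" for v
      using that abs_Re_le_cmod[of "w - v"] by (simp add: dist_norm d_def)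
    have "uniform_limit (cball w d) (\<lambda>n. mac_trunc (real n) \<nu>) (macdonald \<nu>) sequentially"
    proof (rule uniform_limitI)
      fix e :: real assume "e > 0"
      have "\<forall>\<^sub>F n in sequentially. 4 / d\<^sup>2 * exp (- real n) < e"
        using lim0[of "4 / d\<^sup>2"] \<open>e > 0\<close> by (auto simp: order_tendsto_iff)
      then show "\<forall>\<^sub>F n in sequentially. \<forall>v\<in>cball w d. dist (mac_trunc (real n) \<nu> v) (macdonald \<nu> v) < e"
      proof eventually_elim
        fix n assume n: "4 / d\<^sup>2 * exp (- real n) < e"
        show "\<forall>v\<in>cball w d. dist (mac_trunc (real n) \<nu> v) (macdonald \<nu> v) < e"
        proof
          fix v assume "v \<in> cball w d"
          then show "dist (mac_trunc (real n) \<nu> v) (macdonald \<nu> v) < e"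
            using norm_macdonald_diff_le[OF \<open>d > 0\<close> Re, of v \<nu> n] n assms
            by (simp add: dist_norm norm_minus_commute)
        qed
      qed
    qed
    then show "\<exists>d>0. cball w d \<subseteq> ?S \<and> uniform_limit (cball w d) (\<lambda>n. mac_trunc (real n) \<nu>) (macdonald \<nu>) sequentially"
      using Re \<open>d > 0\<close> by (intro exI[of _ d]) force
  qed
  then obtain g' where g': "(macdonald \<nu> has_field_derivative g') (at w)" "(\<lambda>n. ?D n w) \<longlonglongrightarrow> g'"
    using assms by blast
  have "(\<lambda>n. exp (- w * of_real (cosh (real n))) * of_real (sinh (\<nu> * real n)) / w) \<longlonglongrightarrow> 0"
  proof (rule Lim_null_comparison[OF _ lim0[of "4 / (Re w)\<^sup>2 / norm w"]], intro always_eventually allI)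
    fix n
    have "\<bar>sinh (\<nu> * real n)\<bar> \<le> cosh (\<nu> * real n)"
      using sinh_le_cosh_real[of "\<nu> * real n"] sinh_le_cosh_real[of "- (\<nu> * real n)"] by (simp add: abs_le_iff)
    also have "\<dots> \<le> cosh (real n)" using assms by (intro cosh_mult_le) auto
    finally have "norm (exp (- w * of_real (cosh (real n)))) * \<bar>sinh (\<nu> * real n)\<bar> \<le> norm (exp (- w * of_real (cosh (real n)))) * cosh (real n)"
      by (intro mult_left_mono) auto
    also have "\<dots> \<le> 4 / (Re w)\<^sup>2 * exp (- real n)"
      using assms by (intro norm_exp_mult_cosh_le) auto
    finally have "norm (exp (- w * of_real (cosh (real n)))) * \<bar>sinh (\<nu> * real n)\<bar> / norm w \<le> 4 / (Re w)\<^sup>2 * exp (- real n) / norm w"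
      by (intro divide_right_mono) auto
    then show "norm (exp (- w * of_real (cosh (real n))) * of_real (sinh (\<nu> * real n)) / w) \<le> 4 / (Re w)\<^sup>2 / norm w * exp (- real n)"
      by (simp add: norm_mult norm_divide)
  qed
  then have "(\<lambda>n. ?D n w) \<longlonglongrightarrow> - macdonald (1 - \<nu>) w - of_real \<nu> / w * macdonald \<nu> w + 0"
    using assms by (intro tendsto_intros mac_trunc_tendsto) auto
  with g'(2) have "g' = - macdonald (1 - \<nu>) w - of_real \<nu> / w * macdonald \<nu> w"
    using LIMSEQ_unique by fastforce
  with g'(1) show ?thesis by simp
qed

text \<open>On an initial interval of length \<open>T\<close> the integrand is at most 2. Beyond it,
  \<open>exp (- w * cosh t) * sinh t\<close> is integrated and the quotient \<open>h\<close> is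
  differentiated, with a gain of \<open>1 / norm w\<close>. Nothing depends on how small
  \<open>Re w\<close> is, so the bound survives on approach to the imaginary axis.\<close>

lemma norm_macdonald_le:
  assumes "Re w > 0" "0 \<le> \<nu>" "\<nu> \<le> 1"
  shows "norm (macdonald \<nu> w) \<le> 6 * (1 / norm w + 1 / sqrt (norm w))"
proof -
  define r where "r = norm w"
  have r: "r > 0" using assms(1) by (auto simp: r_def)
  \<comment> \<open>The initial interval contributes order \<open>T\<close>, the rest order
    \<open>1 / (T * r)\<close>; \<open>1 / sqrt r\<close> balances the two for large
    \<open>r\<close>, and the cap 1 keeps \<open>cosh\<close> bounded.\<close>
  define T where "T = min 1 (1 / sqrt r)"
  have T: "T > 0" "T \<le> 1" "T \<le> 1 / sqrt r" using r by (auto simp: T_def)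
  have c1: "cosh T \<le> 2"
  proof -
    have "cosh T \<le> cosh (1::real)" using T by (subst cosh_real_nonneg_le_iff) auto
    also have "cosh (1::real) \<le> 2"
    proof -
      have "cosh (1::real) = (exp 1 + exp (-1)) / 2" by (simp add: cosh_def field_simps)
      also have "\<dots> \<le> (3 + 1) / 2"
        using e_less_272 by (intro divide_right_mono add_mono) auto
      finally show ?thesis by simp
    qed
    finally show ?thesis .
  qed
  have sinhT: "sinh T \<ge> T"
  proof -
    have "sinh 0 - 0 \<le> sinh T - T"
    proof (rule DERIV_nonneg_imp_nondecreasing[where f = "\<lambda>t. sinh t - t" and a = 0 and b = T])
      fix t :: real
      show "\<exists>y. ((\<lambda>t. sinh t - t) has_real_derivative y) (at t) \<and> 0 \<le> y"
        using cosh_real_ge_1[of t] by (intro exI[of _ "cosh t - 1"]) (auto intro!: derivative_eq_intros)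
    qed (use T in auto)
    then show ?thesis by simp
  qed
  define h where "h t = cosh (\<nu> * t) / sinh t" for t :: real
  define h' where "h' t = (\<nu> * sinh (\<nu> * t) * sinh t - cosh (\<nu> * t) * cosh t) / (sinh t)\<^sup>2" for t :: real
  have hT: "h T \<le> 2 / T"
  proof -
    have "h T \<le> 2 / sinh T"
      unfolding h_def using T c1 assms cosh_mult_le[of \<nu> T] by (intro divide_right_mono) auto
    also have "\<dots> \<le> 2 / T" using sinhT T by (intro divide_left_mono) auto
    finally show ?thesis .
  qed
  have h_nonneg: "h t \<ge> 0" if "t > 0" for t using that by (simp add: h_def)
  have der_h: "(h has_real_derivative h' t) (at t)" if "t > 0" for t
    unfolding h_def[abs_def] h'_def using that
    by (auto intro!: derivative_eq_intros simp: power2_eq_square algebra_simps)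
  \<comment> \<open>As \<open>h\<close> is nonincreasing and nonnegative, the integral of the
    modulus of \<open>h'\<close> telescopes, and the variation of \<open>h\<close> is controlled by
    \<open>h T\<close> alone.\<close>
  have h'_nonpos: "h' t \<le> 0" if "t > 0" for t
  proof -
    have "\<nu> * sinh (\<nu> * t) * sinh t \<le> 1 * cosh (\<nu> * t) * cosh t"
      using that assms sinh_le_cosh_real[of "\<nu> * t"] sinh_le_cosh_real[of t] by (intro mult_mono) auto
    then show ?thesis unfolding h'_def by (intro divide_nonpos_nonneg) auto
  qed
  let ?e = "\<lambda>t. exp (- w * of_real (cosh t)) :: complex"
  have e_le: "norm (?e t) \<le> 1" for t
    using assms(1) cosh_real_pos[of t] by (simp add: norm_exp_eq_Re)
  have "norm (mac_trunc (real n) \<nu> w) \<le> 6 * (1 / r + 1 / sqrt r)" if "n \<ge> 1" for n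
  proof -
    define N where "N = real n"
    have N: "T \<le> N" using T that by (simp add: N_def)
    have comb: "integral {0..T} (mac_integrand \<nu> w) + integral {T..N} (mac_integrand \<nu> w) = mac_trunc N \<nu> w"
      unfolding mac_trunc_def
      by (rule Henstock_Kurzweil_Integration.integral_combine) (use T N integrable_mac_integrand in auto)
    have near: "norm (integral {0..T} (mac_integrand \<nu> w)) \<le> 2 * T"
    proof -
      have "norm (integral {0..T} (mac_integrand \<nu> w)) \<le> 2 * (T - 0)"
      proof (rule integral_bound)
        fix t assume t: "t \<in> {0..T}"
        have "cosh (\<nu> * t) \<le> cosh t" using assms by (intro cosh_mult_le) auto
        also have "\<dots> \<le> cosh T" using t by (subst cosh_real_nonneg_le_iff) auto
        finally have "cosh (\<nu> * t) \<le> 2" using c1 by linarith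
        then have "norm (?e t) * cosh (\<nu> * t) \<le> 1 * 2" using e_le[of t] by (intro mult_mono) auto
        then show "norm (mac_integrand \<nu> w t) \<le> 2" by (simp add: mac_integrand_def norm_mult)
      qed (use T in \<open>auto intro: continuous_on_mac_integrand\<close>)
      then show ?thesis by simp
    qed
    have far: "norm (integral {T..N} (mac_integrand \<nu> w)) \<le> 2 * h T / r"
    proof -
      have FTC: "((\<lambda>t. mac_integrand \<nu> w t - ?e t * of_real (h' t) / w) has_integral
          (- (?e N * of_real (h N) / w) - - (?e T * of_real (h T) / w))) {T..N}"
      proof (rule fundamental_theorem_of_calculus[OF N])
        fix t assume "t \<in> {T..N}"
        then have t: "t > 0" using T by auto
        have "(?e has_vector_derivative - w * of_real (sinh t) * ?e t) (at t within {T..N})"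
        proof -
          have "((\<lambda>s. exp (- w * cosh s)) has_field_derivative - w * of_real (sinh t) * ?e t) (at (of_real t))"
            unfolding of_real_cosh of_real_sinh by (auto intro!: derivative_eq_intros)
          from has_vector_derivative_real_field[OF this] show ?thesis by (simp only: of_real_cosh)
        qed
        moreover have "((\<lambda>t. of_real (h t) :: complex) has_vector_derivative of_real (h' t)) (at t within {T..N})"
          by (intro has_vector_derivative_of_real)
             (use der_h[OF t] in \<open>auto intro: has_vector_derivative_at_within simp: has_real_derivative_iff_has_vector_derivative\<close>)
        ultimately have "((\<lambda>t. ?e t * of_real (h t)) has_vector_derivative
            (?e t * of_real (h' t) + - w * of_real (sinh t) * ?e t * of_real (h t))) (at t within {T..N})"
          by (rule has_vector_derivative_mult)
        then have "((\<lambda>t. (- 1 / w) * (?e t * of_real (h t))) has_vector_derivative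
            (- 1 / w) * (?e t * of_real (h' t) + - w * of_real (sinh t) * ?e t * of_real (h t))) (at t within {T..N})"
          by (rule has_vector_derivative_mult_right)
        moreover have "(- 1 / w) * (?e t * of_real (h' t) + - w * of_real (sinh t) * ?e t * of_real (h t))
            = mac_integrand \<nu> w t - ?e t * of_real (h' t) / w"
        proof -
          have "of_real (sinh t) * of_real (h t) = (of_real (cosh (\<nu> * t)) :: complex)"
          proof -
            have "sinh t * h t = cosh (\<nu> * t)" using t by (simp add: h_def)
            then show ?thesis by (simp only: of_real_mult[symmetric])
          qed
          then have "- w * of_real (sinh t) * ?e t * of_real (h t) = - w * mac_integrand \<nu> w t"
            unfolding mac_integrand_def by (metis (no_types, lifting) mult.assoc mult.commute)
          moreover have "w \<noteq> 0" using r by (auto simp: r_def)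
          ultimately show ?thesis by (simp add: field_simps)
        qed
        ultimately show "((\<lambda>t. - (?e t * of_real (h t) / w)) has_vector_derivative
            mac_integrand \<nu> w t - ?e t * of_real (h' t) / w) (at t within {T..N})"
          by simp
      qed
      have cont_h': "continuous_on {T..N} h'"
        unfolding h'_def using T by (intro continuous_intros) auto
      have ih': "(\<lambda>t. ?e t * of_real (h' t) / w) integrable_on {T..N}"
      proof (rule integrable_continuous_real)
        have ce: "continuous_on {T..N} ?e" by (intro continuous_intros)
        have ch: "continuous_on {T..N} (\<lambda>t. of_real (h' t) :: complex)"
          by (rule continuous_on_of_real[OF cont_h'])
        have "w \<noteq> 0" using r by (auto simp: r_def)
        then show "continuous_on {T..N} (\<lambda>t. ?e t * of_real (h' t) / w)"
          by (intro continuous_on_divide continuous_on_mult ce ch continuous_on_const) simp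
      qed
      have Ih': "((\<lambda>t. - h' t) has_integral (- h N - - h T)) {T..N}"
      proof (rule fundamental_theorem_of_calculus[OF N, where f = "\<lambda>t. - h t"])
        fix t assume "t \<in> {T..N}"
        then have "((\<lambda>t. - h t) has_real_derivative - h' t) (at t within {T..N})"
          using T by (intro DERIV_minus has_field_derivative_at_within[OF der_h]) auto
        then show "((\<lambda>t. - h t) has_vector_derivative - h' t) (at t within {T..N})"
          by (simp only: has_real_derivative_iff_has_vector_derivative)
      qed
      have b: "norm (integral {T..N} (\<lambda>t. ?e t * of_real (h' t) / w)) \<le> (h T - h N) / r"
      proof -
        have Ir: "((\<lambda>t. - h' t / r) has_integral ((- h N - - h T) / r)) {T..N}"
          by (rule has_integral_divide[OF Ih'])
        have "norm (integral {T..N} (\<lambda>t. ?e t * of_real (h' t) / w)) \<le> integral {T..N} (\<lambda>t. - h' t / r)"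
        proof (rule integral_norm_bound_integral[OF ih'])
          show "(\<lambda>t. - h' t / r) integrable_on {T..N}" using Ir by blast
          fix t assume "t \<in> {T..N}"
          then have "h' t \<le> 0" using T by (intro h'_nonpos) auto
          moreover have "norm (?e t) * \<bar>h' t\<bar> \<le> 1 * \<bar>h' t\<bar>" by (intro mult_right_mono e_le) auto
          ultimately show "norm (?e t * of_real (h' t) / w) \<le> - h' t / r"
            using r by (simp add: norm_mult norm_divide r_def divide_right_mono)
        qed
        also have "\<dots> = (h T - h N) / r" using integral_unique[OF Ir] by simp
        finally show ?thesis .
      qed
      have "integral {T..N} (mac_integrand \<nu> w) = (?e T * of_real (h T) / w - ?e N * of_real (h N) / w) + integral {T..N} (\<lambda>t. ?e t * of_real (h' t) / w)"
      proof -
        have alg: "A = (Y - X) + B" if "A - B = - X - - Y" for A B X Y :: complex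
          using that by (simp add: algebra_simps)
        show ?thesis
          by (rule alg) (rule integral_unique[OF FTC, unfolded integral_diff[OF integrable_mac_integrand ih']])
      qed
      moreover have tri: "norm ((a - b) + c) \<le> norm a + norm b + norm c" for a b c :: complex
        using norm_triangle_ineq[of "a - b" c] norm_triangle_ineq4[of a b] by linarith
      ultimately have "norm (integral {T..N} (mac_integrand \<nu> w)) \<le> norm (?e T * of_real (h T) / w) + norm (?e N * of_real (h N) / w)
         + norm (integral {T..N} (\<lambda>t. ?e t * of_real (h' t) / w))"
        by (simp only: tri)
      also have "\<dots> \<le> h T / r + h N / r + (h T - h N) / r"
      proof -
        have "norm (?e t * of_real (h t) / w) \<le> h t / r" if "t > 0" for t
          using mult_right_mono[OF e_le[of t] h_nonneg[OF that]] h_nonneg[OF that] r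
          by (simp add: norm_mult norm_divide r_def divide_right_mono)
        with b T N show ?thesis by (intro add_mono) auto
      qed
      also have "\<dots> = 2 * h T / r" by (simp flip: add_divide_distrib)
      finally show ?thesis .
    qed
    have T1: "1 / T \<le> 1 + sqrt r"
    proof (cases "1 \<le> 1 / sqrt r")
      case False
      then have "T = 1 / sqrt r" by (simp add: T_def)
      then show ?thesis by simp
    qed (use r in \<open>simp add: T_def\<close>)
    have "norm (mac_trunc N \<nu> w) \<le> 2 * T + 2 * h T / r"
      using near far comb norm_triangle_ineq[of "integral {0..T} (mac_integrand \<nu> w)" "integral {T..N} (mac_integrand \<nu> w)"]
      by simp
    also have "\<dots> \<le> 2 * (1 / sqrt r) + 4 * (1 + sqrt r) / r"
    proof (intro add_mono)
      show "2 * T \<le> 2 * (1 / sqrt r)" using T by simp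
      have "2 * h T \<le> 4 * (1 / T)" using hT by simp
      also have "\<dots> \<le> 4 * (1 + sqrt r)" using T1 by simp
      finally show "2 * h T / r \<le> 4 * (1 + sqrt r) / r" using r by (intro divide_right_mono) auto
    qed
    also have "4 * (1 + sqrt r) / r = 4 * (1 / r) + 4 * (1 / sqrt r)"
    proof -
      have "sqrt r / r = 1 / sqrt r"
        using r real_sqrt_mult_self[of r] by (simp add: frac_eq_eq)
      moreover have "4 * (1 + sqrt r) / r = 4 * (1 / r) + 4 * (sqrt r / r)"
        by (simp add: add_divide_distrib distrib_left)
      ultimately show ?thesis by simp
    qed
    also have "2 * (1 / sqrt r) + (4 * (1 / r) + 4 * (1 / sqrt r)) \<le> 6 * (1 / r + 1 / sqrt r)"
    proof -
      have "0 \<le> 1 / r" using r by simp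
      then show ?thesis by argo
    qed
    finally show ?thesis by (simp add: N_def)
  qed
  then show ?thesis
    unfolding r_def[symmetric]
    by (intro LIMSEQ_le_const2[OF tendsto_norm[OF mac_trunc_tendsto]]) (use assms in auto)
qed

section \<open>The Macdonald integral at the origin\<close>

lemma mac_trunc_of_real:
  "mac_trunc N \<nu> (of_real x) = of_real (integral {0..N} (\<lambda>t. exp (- x * cosh t) * cosh (\<nu> * t)))"
proof -
  have "mac_integrand \<nu> (of_real x) = (\<lambda>t. of_real (exp (- x * cosh t) * cosh (\<nu> * t)))"
    by (rule ext) (simp add: mac_integrand_def exp_of_real[symmetric])
  moreover have "(\<lambda>t. exp (- x * cosh t) * cosh (\<nu> * t)) integrable_on {0..N}"
    by (intro integrable_continuous_real continuous_intros)
  ultimately show ?thesis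
    unfolding mac_trunc_def using integral_linear[of "\<lambda>t. exp (- x * cosh t) * cosh (\<nu> * t)" "{0..N}" of_real]
    by (simp add: o_def bounded_linear_of_real)
qed

text \<open>After splitting \<open>cosh (\<nu> * t)\<close> into exponentials, the decaying part
  integrates to at most \<open>1 / \<nu>\<close>. In the growing part
  \<open>u = x * exp t / 2\<close> turns \<open>x * cosh t\<close> into
  \<open>u + x\<^sup>2 / (4 * u)\<close>, so that an incomplete Gamma integral over
  \<open>u \<ge> x / 2\<close> appears, up to a factor between \<open>exp (- x / 2)\<close> and
  1.\<close>

lemma macdonald_small_bounds:
  assumes x: "x > 0" and \<nu>: "0 < \<nu>"  "\<nu> < 1"
  obtains m where "macdonald \<nu> (of_real x) = of_real m"
    "2 powr (\<nu> - 1) * exp (- x / 2) * (Gamma \<nu> - (x / 2) powr \<nu> / \<nu>) \<le> x powr \<nu> * m"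
    "x powr \<nu> * m \<le> 2 powr (\<nu> - 1) * Gamma \<nu> + x powr \<nu> / (2 * \<nu>)"
proof -
  define h where "h u = u powr (\<nu> - 1) / exp u" for u :: real
  have h0: "h u \<ge> 0" for u by (simp add: h_def)
  have hG: "(h has_integral Gamma \<nu>) {0..}"
    unfolding h_def[abs_def] using Gamma_integral_real[OF \<nu>(1)] .
  have hcont: "continuous_on {a..b} h" if "a > 0" for a b
    unfolding h_def using that by (intro continuous_intros) auto
  \<comment> \<open>The image of \<open>t = n\<close> under the substitution, with
    \<open>x / 2\<close> as the image of 0.\<close>
  define M where "M n = x * exp (real n) / 2" for n
  have Mx: "x / 2 \<le> M n" for n using x by (simp add: M_def)
  define Rn where "Rn n = integral {0..real n} (\<lambda>t. exp (- x * cosh t) * cosh (\<nu> * t))" for n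
  define Pn where "Pn n = integral {0..real n} (\<lambda>t. exp (- x * cosh t) * exp (\<nu> * t))" for n
  define Qn where "Qn n = integral {0..real n} (\<lambda>t. exp (- x * cosh t) * exp (- \<nu> * t))" for n
  define Jn where "Jn n = integral {x / 2..M n} h" for n
  have iP: "(\<lambda>t. exp (- x * cosh t) * exp (\<nu> * t)) integrable_on {0..real n}"
    and iQ: "(\<lambda>t. exp (- x * cosh t) * exp (- \<nu> * t)) integrable_on {0..real n}" for n
    by (intro integrable_continuous_real continuous_intros)+
  have R: "Rn n = (Pn n + Qn n) / 2" for n
  proof -
    have "(\<lambda>t. exp (- x * cosh t) * cosh (\<nu> * t)) = (\<lambda>t. (exp (- x * cosh t) * exp (\<nu> * t) + exp (- x * cosh t) * exp (- \<nu> * t)) / 2)"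
    proof
      fix t
      have c: "cosh (\<nu> * t) = (exp (\<nu> * t) + exp (- \<nu> * t)) / 2" by (simp add: cosh_def field_simps)
      show "exp (- x * cosh t) * cosh (\<nu> * t) = (exp (- x * cosh t) * exp (\<nu> * t) + exp (- x * cosh t) * exp (- \<nu> * t)) / 2"
        unfolding c by (simp add: distrib_left)
    qed
    then show ?thesis
      unfolding Rn_def Pn_def Qn_def using integral_add[OF iP[of n] iQ[of n]] by simp
  qed
  have Q: "0 \<le> Qn n" "Qn n \<le> 1 / \<nu>" for n
  proof -
    show "0 \<le> Qn n" unfolding Qn_def by (intro integral_nonneg iQ) auto
    have I: "((\<lambda>t. exp (- \<nu> * t)) has_integral (- exp (- \<nu> * real n) / \<nu> - (- exp (- \<nu> * 0) / \<nu>))) {0..real n}"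
    proof (rule fundamental_theorem_of_calculus[where f = "\<lambda>t. - exp (- \<nu> * t) / \<nu>"])
      show "((\<lambda>t. - exp (- \<nu> * t) / \<nu>) has_vector_derivative exp (- \<nu> * t)) (at t within {0..real n})" for t
        using \<nu> by (auto intro!: derivative_eq_intros simp flip: has_real_derivative_iff_has_vector_derivative)
    qed simp
    have "Qn n \<le> integral {0..real n} (\<lambda>t. exp (- \<nu> * t))"
      unfolding Qn_def
    proof (rule integral_le[OF iQ])
      show "(\<lambda>t. exp (- \<nu> * t)) integrable_on {0..real n}" using I by blast
      show "exp (- x * cosh t) * exp (- \<nu> * t) \<le> exp (- \<nu> * t)" for t
        using x cosh_real_pos[of t] by (intro mult_left_le_one_le) auto
    qed
    also have "\<dots> = (1 - exp (- \<nu> * real n)) / \<nu>" using integral_unique[OF I] by (simp add: diff_divide_distrib)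
    also have "\<dots> \<le> 1 / \<nu>" using \<nu> by (intro divide_right_mono) auto
    finally show "Qn n \<le> 1 / \<nu>" .
  qed
  have iJ: "h integrable_on {x / 2..M n}" for n
    using x by (intro integrable_continuous_real hcont) auto
  have P: "exp (- x / 2) * (2 powr \<nu> * Jn n) \<le> x powr \<nu> * Pn n" "x powr \<nu> * Pn n \<le> 2 powr \<nu> * Jn n" for n
  proof -
    define f where "f u = (2 * u / x) powr \<nu> * exp (- u - x\<^sup>2 / (4 * u)) / u" for u
    have fcont: "continuous_on {x / 2..M n} f"
      unfolding f_def using x by (intro continuous_intros) auto
    have "((\<lambda>t. (x * exp t / 2) *\<^sub>R f (x * exp t / 2)) has_integral integral {x * exp 0 / 2..x * exp (real n) / 2} f) {0..real n}"
    proof (rule has_integral_substitution[where c = "x / 2" and d = "M n" and g = "\<lambda>t. x * exp t / 2"])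
      show "(\<lambda>t. x * exp t / 2) ` {0..real n} \<subseteq> {x / 2..M n}"
        using x by (auto simp: M_def)
      show "((\<lambda>t. x * exp t / 2) has_real_derivative x * exp t / 2) (at t within {0..real n})" for t
        by (auto intro!: derivative_eq_intros)
    qed (use x fcont in auto)
    moreover have "(x * exp t / 2) *\<^sub>R f (x * exp t / 2) = exp (- x * cosh t) * exp (\<nu> * t)" for t
    proof -
      have "2 * (x * exp t / 2) / x = exp t" using x by simp
      moreover have "x\<^sup>2 / (4 * (x * exp t / 2)) = x * exp (- t) / 2"
        using x by (simp add: power2_eq_square exp_minus field_simps)
      moreover have "- (x * exp t / 2) - x * exp (- t) / 2 = - x * cosh t"
        by (simp add: cosh_def field_simps)
      moreover have "exp t powr \<nu> = exp (\<nu> * t)" by (simp add: powr_def)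
      moreover have "x * exp t / 2 \<noteq> 0" using x by simp
      ultimately show ?thesis unfolding f_def by simp
    qed
    ultimately have PI: "Pn n = integral {x / 2..M n} f"
      unfolding Pn_def M_def by (simp add: integral_unique)
    have xf: "x powr \<nu> * f u = 2 powr \<nu> * (h u * exp (- (x\<^sup>2 / (4 * u))))" if "u \<in> {x / 2..M n}" for u
    proof -
      have u: "u > 0" using that x by auto
      have a1: "(2 * u / x) powr \<nu> = 2 powr \<nu> * u powr \<nu> / x powr \<nu>"
        using u x by (simp add: powr_divide powr_mult)
      have a2: "u powr \<nu> / u = u powr (\<nu> - 1)" using u by (simp add: powr_diff)
      have a3: "exp (- u - x\<^sup>2 / (4 * u)) = exp (- (x\<^sup>2 / (4 * u))) / exp u"
        by (simp add: exp_diff exp_minus field_simps)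
      show ?thesis
        unfolding f_def h_def a1 a3 a2[symmetric] using x by simp
    qed
    have iF: "(\<lambda>u. x powr \<nu> * f u) integrable_on {x / 2..M n}"
      by (intro integrable_continuous_real continuous_intros fcont)
    have eq: "x powr \<nu> * Pn n = integral {x / 2..M n} (\<lambda>u. x powr \<nu> * f u)" unfolding PI by simp
    have "integral {x / 2..M n} (\<lambda>u. x powr \<nu> * f u) \<le> integral {x / 2..M n} (\<lambda>u. 2 powr \<nu> * h u)"
    proof (rule integral_le[OF iF integrable_on_mult_right[OF iJ]])
      fix u assume u: "u \<in> {x / 2..M n}"
      then have "u > 0" using x by auto
      then have "h u * exp (- (x\<^sup>2 / (4 * u))) \<le> h u" using h0[of u] by (intro mult_right_le_one_le) auto
      then show "x powr \<nu> * f u \<le> 2 powr \<nu> * h u" unfolding xf[OF u] by (intro mult_left_mono) auto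
    qed
    then show "x powr \<nu> * Pn n \<le> 2 powr \<nu> * Jn n" unfolding eq Jn_def by simp
    have "integral {x / 2..M n} (\<lambda>u. exp (- x / 2) * (2 powr \<nu> * h u)) \<le> integral {x / 2..M n} (\<lambda>u. x powr \<nu> * f u)"
    proof (rule integral_le[OF integrable_on_mult_right[OF integrable_on_mult_right[OF iJ]] iF])
      fix u assume u: "u \<in> {x / 2..M n}"
      then have "u > 0" "x \<le> 2 * u" using x by auto
      then have "x * x \<le> x * (2 * u)" using x by (intro mult_left_mono) auto
      then have "x\<^sup>2 / (4 * u) \<le> x / 2" using \<open>u > 0\<close> by (simp add: field_simps power2_eq_square)
      then have "h u * exp (- x / 2) \<le> h u * exp (- (x\<^sup>2 / (4 * u)))" using h0[of u] by (intro mult_left_mono) auto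
      then have "2 powr \<nu> * (h u * exp (- x / 2)) \<le> x powr \<nu> * f u"
        unfolding xf[OF u] by (rule mult_left_mono) simp
      then show "exp (- x / 2) * (2 powr \<nu> * h u) \<le> x powr \<nu> * f u" by (simp only: mult_ac)
    qed
    then show "exp (- x / 2) * (2 powr \<nu> * Jn n) \<le> x powr \<nu> * Pn n" unfolding eq Jn_def by simp
  qed
  have J_le: "Jn n \<le> Gamma \<nu>" for n
    unfolding Jn_def integral_unique[OF hG, symmetric]
    using x h0 hG by (intro integral_subset_le iJ) auto
  \<comment> \<open>The limit of the truncated integrands. What it lacks of the full Gamma integral
    is the piece below \<open>x / 2\<close>, at most
    \<open>(x / 2) powr \<nu> / \<nu>\<close>.\<close>
  define k where "k u = (if u \<in> {x / 2..} then h u else 0)" for u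
  have k_int: "k integrable_on {0..}" and J_lim: "Jn \<longlonglongrightarrow> integral {0..} k"
  proof -
    let ?k = "\<lambda>n u. if u \<in> {x / 2..M n} then h u else 0"
    have Int: "{x / 2..M n} \<inter> {0..} = {x / 2..M n}" for n using x by auto
    have i: "?k n integrable_on {0..}" for n
      unfolding integrable_restrict_Int Int by (rule iJ)
    have J: "Jn n = integral {0..} (?k n)" for n
      unfolding Jn_def integral_restrict_Int Int ..
    have "M = (\<lambda>n. x / 2 * exp (real n))" by (rule ext) (simp add: M_def)
    moreover have "filterlim (\<lambda>n. x / 2 * exp (real n)) at_top sequentially"
      using x by (intro filterlim_tendsto_pos_mult_at_top[OF tendsto_const]
          filterlim_compose[OF exp_at_top filterlim_real_sequentially]) auto
    ultimately have Mlim: "filterlim M at_top sequentially" by simp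
    have le: "norm (?k n u) \<le> h u" for n u using h0[of u] by simp
    have cv: "(\<lambda>n. ?k n u) \<longlonglongrightarrow> k u" for u
    proof (rule tendsto_eventually)
      have "eventually (\<lambda>n. M n \<ge> u) sequentially" using Mlim by (simp add: filterlim_at_top)
      then show "eventually (\<lambda>n. ?k n u = k u) sequentially"
        by eventually_elim (auto simp: k_def)
    qed
    show "k integrable_on {0..}"
      by (rule dominated_convergence(1)[of ?k "{0..}" h, OF i _ le cv]) (use hG in blast)
    have "(\<lambda>n. integral {0..} (?k n)) \<longlonglongrightarrow> integral {0..} k"
      by (rule dominated_convergence(2)[of ?k "{0..}" h, OF i _ le cv]) (use hG in blast)
    then show "Jn \<longlonglongrightarrow> integral {0..} k" by (simp add: J[abs_def])
  qed
  have k_ge: "Gamma \<nu> - (x / 2) powr \<nu> / \<nu> \<le> integral {0..} k"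
  proof -
    let ?p = "\<lambda>u. if u \<in> {0..x / 2} then u powr (\<nu> - 1) else 0"
    have p0: "((\<lambda>u. u powr (\<nu> - 1)) has_integral ((x / 2) powr (\<nu> - 1 + 1) / (\<nu> - 1 + 1))) {0..x / 2}"
      by (rule has_integral_powr_from_0) (use \<nu> x in auto)
    then have p: "(?p has_integral ((x / 2) powr \<nu> / \<nu>)) {0..}"
      by (subst has_integral_restrict) auto
    have "integral {0..} h - integral {0..} k = integral {0..} (\<lambda>u. h u - k u)"
      using hG k_int by (intro integral_diff[symmetric]) blast+
    also have "\<dots> \<le> integral {0..} ?p"
    proof (rule integral_le)
      show "(\<lambda>u. h u - k u) integrable_on {0..}" using hG k_int by (intro integrable_diff) blast+
      show "?p integrable_on {0..}" using p by blast
      fix u :: real assume "u \<in> {0..}"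
      moreover have "h u \<le> u powr (\<nu> - 1)" if "u \<ge> 0"
        unfolding h_def using that divide_left_mono[of 1 "exp u" "u powr (\<nu> - 1)"] by simp
      ultimately show "h u - k u \<le> ?p u" by (auto simp: k_def)
    qed
    finally show ?thesis using integral_unique[OF hG] integral_unique[OF p] by simp
  qed
  define m where "m = Re (macdonald \<nu> (of_real x))"
  have lim: "(\<lambda>n. mac_trunc (real n) \<nu> (of_real x)) \<longlonglongrightarrow> macdonald \<nu> (of_real x)"
    by (rule mac_trunc_tendsto) (use x \<nu> in auto)
  have T: "mac_trunc (real n) \<nu> (of_real x) = of_real (Rn n)" for n
    unfolding Rn_def by (rule mac_trunc_of_real)
  have Rlim: "Rn \<longlonglongrightarrow> m" using tendsto_Re[OF lim] unfolding T m_def by simp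
  have "(\<lambda>n. Im (mac_trunc (real n) \<nu> (of_real x))) \<longlonglongrightarrow> Im (macdonald \<nu> (of_real x))"
    by (rule tendsto_Im[OF lim])
  then have "Im (macdonald \<nu> (of_real x)) = 0"
    unfolding T by (simp add: LIMSEQ_const_iff)
  then have mm: "macdonald \<nu> (of_real x) = of_real m"
    by (simp add: m_def complex_eq_iff)
  have p2: "2 powr (\<nu> - 1) = 2 powr \<nu> / (2::real)" by (simp add: powr_diff)
  have up: "x powr \<nu> * Rn n \<le> 2 powr (\<nu> - 1) * Gamma \<nu> + x powr \<nu> / (2 * \<nu>)" for n
  proof -
    have "x powr \<nu> * Rn n = (x powr \<nu> * Pn n + x powr \<nu> * Qn n) / 2" by (simp add: R algebra_simps)
    also have "\<dots> \<le> (2 powr \<nu> * Gamma \<nu> + x powr \<nu> * (1 / \<nu>)) / 2"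
      by (intro divide_right_mono add_mono order_trans[OF P(2)[of n] mult_left_mono[OF J_le[of n]]]
          mult_left_mono[OF Q(2)[of n]]) auto
    also have "\<dots> = 2 powr (\<nu> - 1) * Gamma \<nu> + x powr \<nu> / (2 * \<nu>)"
      unfolding p2 by (simp add: add_divide_distrib)
    finally show ?thesis .
  qed
  have low: "2 powr (\<nu> - 1) * exp (- x / 2) * Jn n \<le> x powr \<nu> * Rn n" for n
  proof -
    have "2 powr (\<nu> - 1) * exp (- x / 2) * Jn n = exp (- x / 2) * (2 powr \<nu> * Jn n) / 2"
      unfolding p2 by simp
    also have "\<dots> \<le> (x powr \<nu> * Pn n + x powr \<nu> * Qn n) / 2"
      using P(1)[of n] Q(1)[of n] by (intro divide_right_mono) (auto intro: add_increasing2)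
    also have "\<dots> = x powr \<nu> * Rn n" by (simp add: R algebra_simps)
    finally show ?thesis .
  qed
  have "x powr \<nu> * m \<le> 2 powr (\<nu> - 1) * Gamma \<nu> + x powr \<nu> / (2 * \<nu>)"
    by (rule LIMSEQ_le_const2[OF tendsto_mult_left[OF Rlim]]) (use up in auto)
  moreover have "2 powr (\<nu> - 1) * exp (- x / 2) * integral {0..} k \<le> x powr \<nu> * m"
    by (rule LIMSEQ_le[OF tendsto_mult_left[OF J_lim] tendsto_mult_left[OF Rlim]]) (use low in auto)
  moreover have "2 powr (\<nu> - 1) * exp (- x / 2) * (Gamma \<nu> - (x / 2) powr \<nu> / \<nu>) \<le> 2 powr (\<nu> - 1) * exp (- x / 2) * integral {0..} k"
    using k_ge by (intro mult_left_mono) auto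
  ultimately show ?thesis using that[OF mm] by linarith
qed

text \<open>The two bounds meet because \<open>x powr \<nu>\<close> tends to 0. The limit is the
  leading coefficient by which Wronskians are evaluated at the origin.\<close>

lemma macdonald_small_limit:
  assumes "0 < \<nu>" "\<nu> < 1" and X: "\<And>k. X k > (0::real)" "X \<longlonglongrightarrow> 0"
  shows "(\<lambda>k. of_real (X k powr \<nu>) * macdonald \<nu> (of_real (X k))) \<longlonglongrightarrow> of_real (2 powr (\<nu> - 1) * Gamma \<nu>)"
proof -
  have "\<exists>m. macdonald \<nu> (of_real (X k)) = of_real m \<and>
    2 powr (\<nu> - 1) * exp (- X k / 2) * (Gamma \<nu> - (X k / 2) powr \<nu> / \<nu>) \<le> X k powr \<nu> * m \<and>
    X k powr \<nu> * m \<le> 2 powr (\<nu> - 1) * Gamma \<nu> + X k powr \<nu> / (2 * \<nu>)" for k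
    using macdonald_small_bounds[OF X(1) assms(1,2), of k] by blast
  then obtain m where m: "\<And>k. macdonald \<nu> (of_real (X k)) = of_real (m k)"
    "\<And>k. 2 powr (\<nu> - 1) * exp (- X k / 2) * (Gamma \<nu> - (X k / 2) powr \<nu> / \<nu>) \<le> X k powr \<nu> * m k"
    "\<And>k. X k powr \<nu> * m k \<le> 2 powr (\<nu> - 1) * Gamma \<nu> + X k powr \<nu> / (2 * \<nu>)"
    by metis
  have pw: "(\<lambda>k. (c * X k) powr \<nu>) \<longlonglongrightarrow> 0" if "c > 0" for c
  proof -
    have "(\<lambda>k. (c * X k) powr \<nu>) \<longlonglongrightarrow> (c * 0) powr \<nu>"
      using assms(1) X(1) that by (intro tendsto_powr' tendsto_mult_left X(2) tendsto_const) (auto intro!: always_eventually less_imp_le)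
    then show ?thesis using assms(1) by simp
  qed
  have l1: "(\<lambda>k. 2 powr (\<nu> - 1) * exp (- X k / 2) * (Gamma \<nu> - (X k / 2) powr \<nu> / \<nu>)) \<longlonglongrightarrow> 2 powr (\<nu> - 1) * exp (- 0 / 2) * (Gamma \<nu> - 0 / \<nu>)"
    using pw[of "1 / 2"] assms(1) by (intro tendsto_intros X(2)) auto
  have l2: "(\<lambda>k. 2 powr (\<nu> - 1) * Gamma \<nu> + X k powr \<nu> / (2 * \<nu>)) \<longlonglongrightarrow> 2 powr (\<nu> - 1) * Gamma \<nu> + 0 / (2 * \<nu>)"
    using pw[of 1] assms(1) by (intro tendsto_intros) auto
  have "(\<lambda>k. X k powr \<nu> * m k) \<longlonglongrightarrow> 2 powr (\<nu> - 1) * Gamma \<nu>"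
  proof (rule real_tendsto_sandwich)
    show "\<forall>\<^sub>F k in sequentially. 2 powr (\<nu> - 1) * exp (- X k / 2) * (Gamma \<nu> - (X k / 2) powr \<nu> / \<nu>) \<le> X k powr \<nu> * m k"
      "\<forall>\<^sub>F k in sequentially. X k powr \<nu> * m k \<le> 2 powr (\<nu> - 1) * Gamma \<nu> + X k powr \<nu> / (2 * \<nu>)"
      by (rule always_eventually, rule allI, rule m)+
  qed (use l1 l2 in simp_all)
  then have "(\<lambda>k. of_real (X k powr \<nu> * m k) :: complex) \<longlonglongrightarrow> of_real (2 powr (\<nu> - 1) * Gamma \<nu>)"
    by (rule tendsto_of_real)
  then show ?thesis unfolding m(1) by simp
qed

subsection \<open>Identification with the Hankel functions\<close>

text \<open>The modified Bessel function I_a of the first kind; the name does not refer to an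
  imaginary part.\<close>

definition bessel_Im :: "complex \<Rightarrow> complex \<Rightarrow> complex" where
  "bessel_Im a w = (w / 2) powr a * bessel_series a ((w / 2)\<^sup>2)"

lemma bessel_Im_recurrence:
  assumes "w \<noteq> 0"
  shows "bessel_Im (a - 1) w = 2 * a / w * bessel_Im a w + bessel_Im (a + 1) w"
proof -
  let ?x = "w / 2" and ?B = "\<lambda>a. bessel_series a ((w / 2)\<^sup>2)"
  have x: "?x \<noteq> 0" using assms by simp
  have p: "?x powr (a + 1) = ?x powr (a - 1) * ?x\<^sup>2" "?x powr a = ?x powr (a - 1) * ?x"
    using x by (simp_all add: powr_add powr_diff power2_eq_square)
  have "bessel_Im (a - 1) w = ?x powr (a - 1) * (a * ?B a + ?x\<^sup>2 * ?B (a + 1))"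
    unfolding bessel_Im_def bessel_series_recurrence[of a] by simp
  moreover have "bessel_Im (a + 1) w = ?x powr (a - 1) * (?x\<^sup>2 * ?B (a + 1))"
    unfolding bessel_Im_def p(1) by simp
  moreover have "bessel_Im a w = ?x powr (a - 1) * (?x * ?B a)"
    unfolding bessel_Im_def p(2) by simp
  ultimately show ?thesis using assms by (simp add: algebra_simps)
qed

lemma has_field_derivative_bessel_Im:
  assumes "w \<notin> \<real>\<^sub>\<le>\<^sub>0"
  shows "(bessel_Im a has_field_derivative bessel_Im (a + 1) w + a / w * bessel_Im a w) (at w)"
    and "(bessel_Im a has_field_derivative bessel_Im (a - 1) w - a / w * bessel_Im a w) (at w)"
proof -
  have w: "w \<noteq> 0" "w / 2 \<notin> \<real>\<^sub>\<le>\<^sub>0" using assms by (auto simp: complex_nonpos_Reals_iff)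
  have "((\<lambda>w. (w / 2) powr a * bessel_series a ((w / 2)\<^sup>2)) has_field_derivative
      (a * (w / 2) powr (a - 1) * (1 / 2)) * bessel_series a ((w / 2)\<^sup>2)
      + (bessel_series (a + 1) ((w / 2)\<^sup>2) * (w / 2)) * (w / 2) powr a) (at w)"
  proof (rule DERIV_mult)
    show "((\<lambda>w. (w / 2) powr a) has_field_derivative a * (w / 2) powr (a - 1) * (1 / 2)) (at w)"
      using w by (auto intro!: derivative_eq_intros)
    have "((\<lambda>w. (w / 2)\<^sup>2) has_field_derivative w / 2) (at w)"
      by (auto intro!: derivative_eq_intros)
    from DERIV_chain2[OF has_field_derivative_bessel_series this]
    show "((\<lambda>w. bessel_series a ((w / 2)\<^sup>2)) has_field_derivative bessel_series (a + 1) ((w / 2)\<^sup>2) * (w / 2)) (at w)" .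
  qed
  moreover have "(a * (w / 2) powr (a - 1) * (1 / 2)) * bessel_series a ((w / 2)\<^sup>2)
      + (bessel_series (a + 1) ((w / 2)\<^sup>2) * (w / 2)) * (w / 2) powr a = bessel_Im (a + 1) w + a / w * bessel_Im a w"
    using w(1) by (simp add: bessel_Im_def powr_add powr_diff field_simps)
  ultimately show 1: "(bessel_Im a has_field_derivative bessel_Im (a + 1) w + a / w * bessel_Im a w) (at w)"
    by (simp add: bessel_Im_def[abs_def])
  have "bessel_Im (a + 1) w + a / w * bessel_Im a w = bessel_Im (a - 1) w - a / w * bessel_Im a w"
    using bessel_Im_recurrence[OF w(1), of a] by (simp add: algebra_simps)
  then show "(bessel_Im a has_field_derivative bessel_Im (a - 1) w - a / w * bessel_Im a w) (at w)"
    using 1 by (simp only:)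
qed

text \<open>First-order form of the modified Bessel equation: \<open>f\<close> has order \<open>a\<close> and \<open>g\<close> has order \<open>1 - a\<close>.\<close>

definition mac_system :: "complex \<Rightarrow> (complex \<Rightarrow> complex) \<Rightarrow> (complex \<Rightarrow> complex) \<Rightarrow> bool" where
  "mac_system a f g \<longleftrightarrow> (\<forall>w. Re w > 0 \<longrightarrow>
     (f has_field_derivative - g w - a / w * f w) (at w) \<and>
     (g has_field_derivative - f w - (1 - a) / w * g w) (at w))"

lemma mac_system_combination:
  assumes "mac_system a f1 g1" "mac_system a f2 g2"
  shows "mac_system a (\<lambda>w. f1 w + c * f2 w) (\<lambda>w. g1 w + c * g2 w)"
  unfolding mac_system_def
proof (intro allI impI conjI)
  fix w :: complex assume w: "Re w > 0"
  note d = assms[unfolded mac_system_def, rule_format, OF w]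
  show "((\<lambda>w. f1 w + c * f2 w) has_field_derivative - (g1 w + c * g2 w) - a / w * (f1 w + c * f2 w)) (at w)"
    using DERIV_add[OF conjunct1[OF d(1)] DERIV_cmult[OF conjunct1[OF d(2)], of c]] by (simp add: algebra_simps)
  show "((\<lambda>w. g1 w + c * g2 w) has_field_derivative - (f1 w + c * f2 w) - (1 - a) / w * (g1 w + c * g2 w)) (at w)"
    using DERIV_add[OF conjunct2[OF d(1)] DERIV_cmult[OF conjunct2[OF d(2)], of c]] by (simp add: algebra_simps)
qed

text \<open>Liouville's formula: the coefficient matrix has trace
  \<open>- a / w - (1 - a) / w = - 1 / w\<close>, so the determinant of two solutions is a constant
  multiple of \<open>1 / w\<close>.\<close>

lemma mac_system_wronskian:
  assumes "mac_system a f1 g1" "mac_system a f2 g2"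
  obtains c where "\<And>w. Re w > 0 \<Longrightarrow> w * (f1 w * g2 w - g1 w * f2 w) = c"
proof -
  let ?S = "{w::complex. Re w > 0}"
  have "\<exists>c. \<forall>w\<in>?S. w * (f1 w * g2 w - g1 w * f2 w) = c"
  proof (rule has_field_derivative_zero_constant)
    show "convex ?S" by (rule convex_halfspace_Re_gt)
    fix w assume "w \<in> ?S"
    then have w: "Re w > 0" "w \<noteq> 0" by auto
    note d = assms[unfolded mac_system_def, rule_format, OF w(1)]
    have "((\<lambda>w. w * (f1 w * g2 w - g1 w * f2 w)) has_field_derivative
       1 * (f1 w * g2 w - g1 w * f2 w) +
       ((- g1 w - a / w * f1 w) * g2 w + (- f2 w - (1 - a) / w * g2 w) * f1 w
        - ((- f1 w - (1 - a) / w * g1 w) * f2 w + (- g2 w - a / w * f2 w) * g1 w)) * w) (at w)"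
      using d by (intro DERIV_mult DERIV_diff DERIV_ident) auto
    moreover have "1 * (f1 w * g2 w - g1 w * f2 w) +
       ((- g1 w - a / w * f1 w) * g2 w + (- f2 w - (1 - a) / w * g2 w) * f1 w
        - ((- f1 w - (1 - a) / w * g1 w) * f2 w + (- g2 w - a / w * f2 w) * g1 w)) * w = 0"
      using w(2) by (simp add: field_simps)
    ultimately show "((\<lambda>w. w * (f1 w * g2 w - g1 w * f2 w)) has_field_derivative 0) (at w within ?S)"
      by (simp add: has_field_derivative_at_within)
  qed
  then show ?thesis using that by blast
qed

lemma mac_system_macdonald:
  assumes "0 \<le> \<nu>" "\<nu> \<le> 1"
  shows "mac_system (of_real \<nu>) (macdonald \<nu>) (macdonald (1 - \<nu>))"
  using assms has_field_derivative_macdonald[of _ \<nu>] has_field_derivative_macdonald[of _ "1 - \<nu>"]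
  by (simp add: mac_system_def)

lemma Re_pos_not_nonpos: "Re w > 0 \<Longrightarrow> w \<notin> \<real>\<^sub>\<le>\<^sub>0"
  by (simp add: complex_nonpos_Reals_iff)

text \<open>The second component is forced by the first equation to be
  \<open>- f' - a / w * f\<close>, here the negative of the modified Bessel function of the
  neighbouring order.\<close>

lemma mac_system_bessel_Im: "mac_system a (bessel_Im a) (\<lambda>w. - bessel_Im (a - 1) w)"
  unfolding mac_system_def
proof (intro allI impI conjI)
  fix w :: complex assume w: "Re w > 0"
  show "(bessel_Im a has_field_derivative - (- bessel_Im (a - 1) w) - a / w * bessel_Im a w) (at w)"
    using has_field_derivative_bessel_Im(2)[OF Re_pos_not_nonpos[OF w], of a] by simp
  show "((\<lambda>w. - bessel_Im (a - 1) w) has_field_derivative - bessel_Im a w - (1 - a) / w * (- bessel_Im (a - 1) w)) (at w)"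
    using DERIV_minus[OF has_field_derivative_bessel_Im(1)[OF Re_pos_not_nonpos[OF w], of "a - 1"]]
    by (simp add: diff_divide_distrib algebra_simps)
qed

lemma mac_system_bessel_Im_neg: "mac_system a (bessel_Im (- a)) (\<lambda>w. - bessel_Im (1 - a) w)"
  unfolding mac_system_def
proof (intro allI impI conjI)
  fix w :: complex assume w: "Re w > 0"
  show "(bessel_Im (- a) has_field_derivative - (- bessel_Im (1 - a) w) - a / w * bessel_Im (- a) w) (at w)"
    using has_field_derivative_bessel_Im(1)[OF Re_pos_not_nonpos[OF w], of "- a"] by (simp add: algebra_simps)
  show "((\<lambda>w. - bessel_Im (1 - a) w) has_field_derivative - bessel_Im (- a) w - (1 - a) / w * (- bessel_Im (1 - a) w)) (at w)"
    using DERIV_minus[OF has_field_derivative_bessel_Im(2)[OF Re_pos_not_nonpos[OF w], of "1 - a"]] by simp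
qed

lemma bessel_series_tendsto_0:
  assumes "X \<longlonglongrightarrow> (0::real)"
  shows "(\<lambda>k. bessel_series a ((of_real (X k) / 2)\<^sup>2)) \<longlonglongrightarrow> rGamma (a + 1)"
proof -
  have "isCont (bessel_series a) 0"
    using has_field_derivative_bessel_series by (rule DERIV_isCont)
  moreover have "(\<lambda>k. (of_real (X k) / 2 :: complex)\<^sup>2) \<longlonglongrightarrow> (of_real 0 / 2)\<^sup>2"
    by (intro tendsto_intros assms) auto
  ultimately show ?thesis
    using isCont_tendsto_compose[of 0 "bessel_series a"] by simp
qed

lemma bessel_Im_of_real:
  assumes "x > 0"
  shows "of_real (x powr \<mu>) * bessel_Im (of_real \<nu>) (of_real x)
    = of_real (2 powr (- \<nu>) * x powr (\<mu> + \<nu>)) * bessel_series (of_real \<nu>) ((of_real x / 2)\<^sup>2)"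
proof -
  have "(of_real x / 2 :: complex) powr of_real \<nu> = of_real ((x / 2) powr \<nu>)"
    using powr_of_real[of "x / 2" \<nu>] assms by simp
  moreover have "x powr \<mu> * (x / 2) powr \<nu> = 2 powr (- \<nu>) * x powr (\<mu> + \<nu>)"
    using assms by (simp add: powr_divide powr_add powr_minus field_simps)
  ultimately show ?thesis
    unfolding bessel_Im_def by (metis (no_types, lifting) mult.assoc of_real_mult)
qed

text \<open>Multiplication by \<open>x powr \<nu>\<close> makes the solution of order
  \<open>\<nu>\<close> disappear at the origin, while that of order \<open>- \<nu>\<close> keeps its
  first coefficient.\<close>

lemma bessel_Im_small:
  assumes "0 < \<nu>" and X: "\<And>k. X k > (0::real)" "X \<longlonglongrightarrow> 0"
  shows "(\<lambda>k. of_real (X k powr \<nu>) * bessel_Im (of_real \<nu>) (of_real (X k))) \<longlonglongrightarrow> 0"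
    and "(\<lambda>k. of_real (X k powr \<nu>) * bessel_Im (- of_real \<nu>) (of_real (X k))) \<longlonglongrightarrow> of_real (2 powr \<nu>) * rGamma (1 - of_real \<nu>)"
proof -
  have "(\<lambda>k. X k powr (\<nu> + \<nu>)) \<longlonglongrightarrow> 0 powr (\<nu> + \<nu>)"
    using assms(1) X(1) by (intro tendsto_powr' X(2) tendsto_const) (auto intro!: always_eventually less_imp_le)
  then have "(\<lambda>k. of_real (2 powr (- \<nu>) * X k powr (\<nu> + \<nu>)) * bessel_series (of_real \<nu>) ((of_real (X k) / 2)\<^sup>2))
     \<longlonglongrightarrow> of_real (2 powr (- \<nu>) * 0 powr (\<nu> + \<nu>)) * rGamma (of_real \<nu> + 1)"
    by (intro tendsto_mult tendsto_of_real tendsto_const bessel_series_tendsto_0 X(2))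
  then show "(\<lambda>k. of_real (X k powr \<nu>) * bessel_Im (of_real \<nu>) (of_real (X k))) \<longlonglongrightarrow> 0"
    using X(1) by (simp add: bessel_Im_of_real)
  have "(\<lambda>k. of_real (2 powr \<nu>) * bessel_series (of_real (- \<nu>)) ((of_real (X k) / 2)\<^sup>2))
     \<longlonglongrightarrow> of_real (2 powr \<nu>) * rGamma (of_real (- \<nu>) + 1)"
    by (intro tendsto_mult tendsto_const bessel_series_tendsto_0 X(2))
  moreover have "of_real (X k powr \<nu>) * bessel_Im (- of_real \<nu>) (of_real (X k)) = of_real (2 powr \<nu>) * bessel_series (of_real (- \<nu>)) ((of_real (X k) / 2)\<^sup>2)" for k
    using bessel_Im_of_real[OF X(1)[of k], of \<nu> "- \<nu>"] X(1)[of k] by simp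
  ultimately show "(\<lambda>k. of_real (X k powr \<nu>) * bessel_Im (- of_real \<nu>) (of_real (X k))) \<longlonglongrightarrow> of_real (2 powr \<nu>) * rGamma (1 - of_real \<nu>)"
    by simp
qed

text \<open>The difference of the two sides solves the system, and its components \<open>d1\<close>,
  \<open>d2\<close> are of smaller order than \<open>x powr (- \<nu>)\<close> and
  \<open>x powr (\<nu> - 1)\<close> at the origin. Its Wronskians with the two modified Bessel
  solutions, evaluated there, vanish, whereas these two solutions are independent.\<close>

lemma macdonald_eq_bessel_Im:
  assumes \<nu>: "0 < \<nu>" "\<nu> < 1" and w: "Re w > 0"
  shows "macdonald \<nu> w = of_real (pi / (2 * sin (pi * \<nu>))) * (bessel_Im (- of_real \<nu>) w - bessel_Im (of_real \<nu>) w)"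
proof -
  define X where "X k = inverse (real (Suc k))" for k
  have X: "\<And>k. X k > 0" "X \<longlonglongrightarrow> 0"
    unfolding X_def using LIMSEQ_inverse_real_of_nat by auto
  define \<mu> where "\<mu> = 1 - \<nu>"
  have \<mu>: "0 < \<mu>" "\<mu> < 1" "\<nu> + \<mu> = 1" using \<nu> by (auto simp: \<mu>_def)
  let ?a = "of_real \<nu> :: complex" and ?b = "of_real \<mu> :: complex"
  define c where "c = (of_real (pi / (2 * sin (pi * \<nu>))) :: complex)"
  have sin0: "sin (pi * \<nu>) > 0" using \<nu> by (intro sin_gt_zero) auto
  define d1 where "d1 w = macdonald \<nu> w + c * bessel_Im ?a w + (- c) * bessel_Im (- ?a) w" for w
  define d2 where "d2 w = macdonald \<mu> w + c * (- bessel_Im (?a - 1) w) + (- c) * (- bessel_Im (1 - ?a) w)" for w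
  have ab: "?a - 1 = - ?b" "1 - ?a = ?b" by (simp_all add: \<mu>_def)
  have d: "mac_system ?a d1 d2"
    unfolding d1_def d2_def \<mu>_def using \<nu>
    by (intro mac_system_combination mac_system_macdonald mac_system_bessel_Im mac_system_bessel_Im_neg) auto
  \<comment> \<open>By the reflection formula
    \<open>c = Gamma \<kappa> * Gamma (1 - \<kappa>) / 2\<close>, which matches the leading
    coefficient of order \<open>- \<kappa>\<close> with that of the integral. Both
    \<open>\<nu>\<close> and \<open>\<mu>\<close> occur because the second component has order
    \<open>1 - \<nu>\<close>.\<close>
  have cG: "c * rGamma (1 - of_real \<kappa>) = of_real (Gamma \<kappa> / 2)" if "\<kappa> = \<nu> \<or> \<kappa> = \<mu>" for \<kappa>
  proof -
    have s: "sin (pi * \<kappa>) = sin (pi * \<nu>)" and k: "0 < \<kappa>" "\<kappa> < 1"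
      using that \<nu> \<mu> sin_pi_minus[of "pi * \<nu>"] by (auto simp: \<mu>_def right_diff_distrib)
    have "Gamma (of_real \<kappa> :: complex) * Gamma (1 - of_real \<kappa>) = of_real (pi / sin (pi * \<nu>))"
      unfolding Gamma_reflection_complex s[symmetric]
      by (simp only: of_real_mult[symmetric] sin_of_real of_real_divide)
    then have c2: "c = Gamma (of_real \<kappa>) * Gamma (1 - of_real \<kappa>) / 2"
      unfolding c_def by simp
    have "Gamma (1 - of_real \<kappa> :: complex) \<noteq> 0"
    proof -
      have "1 - of_real \<kappa> \<notin> (\<int>\<^sub>\<le>\<^sub>0 :: complex set)"
        using k nonpos_Ints_nonpos[of "1 - \<kappa>"] by (metis diff_gt_0_iff_gt not_le of_real_1 of_real_diff of_real_in_nonpos_Ints_iff)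
      then show ?thesis by (rule Gamma_nonzero)
    qed
    then show ?thesis
      unfolding c2 rGamma_inverse_Gamma by (simp add: Gamma_complex_of_real)
  qed
  have lim_d: "(\<lambda>k. of_real (X k powr \<kappa>) * (macdonald \<kappa> (of_real (X k)) + c * bessel_Im (of_real \<kappa>) (of_real (X k))
       - c * bessel_Im (- of_real \<kappa>) (of_real (X k)))) \<longlonglongrightarrow> 0" if k: "\<kappa> = \<nu> \<or> \<kappa> = \<mu>" for \<kappa>
  proof -
    have "0 < \<kappa>" "\<kappa> < 1" using k \<nu> \<mu> by auto
    note L = macdonald_small_limit[OF this X] bessel_Im_small[OF \<open>0 < \<kappa>\<close> X]
    have "(\<lambda>k. of_real (X k powr \<kappa>) * macdonald \<kappa> (of_real (X k)) + c * (of_real (X k powr \<kappa>) * bessel_Im (of_real \<kappa>) (of_real (X k)))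
       - c * (of_real (X k powr \<kappa>) * bessel_Im (- of_real \<kappa>) (of_real (X k))))
      \<longlonglongrightarrow> of_real (2 powr (\<kappa> - 1) * Gamma \<kappa>) + c * 0 - c * (of_real (2 powr \<kappa>) * rGamma (1 - of_real \<kappa>))"
      by (intro tendsto_intros L)
    moreover have "of_real (2 powr (\<kappa> - 1) * Gamma \<kappa>) + c * 0 - c * (of_real (2 powr \<kappa>) * rGamma (1 - of_real \<kappa>)) = 0"
    proof -
      have "c * (of_real (2 powr \<kappa>) * rGamma (1 - of_real \<kappa>)) = of_real (2 powr \<kappa>) * (c * rGamma (1 - of_real \<kappa>))"
        by simp
      also have "\<dots> = of_real (2 powr (\<kappa> - 1) * Gamma \<kappa>)"
        unfolding cG[OF k] by (simp add: powr_diff)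
      finally show ?thesis by simp
    qed
    ultimately show ?thesis by (simp add: algebra_simps)
  qed
  have dd1: "(\<lambda>k. of_real (X k powr \<nu>) * d1 (of_real (X k))) \<longlonglongrightarrow> 0"
    using lim_d[of \<nu>] by (simp add: d1_def)
  have dd2: "(\<lambda>k. of_real (X k powr \<mu>) * d2 (of_real (X k))) \<longlonglongrightarrow> 0"
    using lim_d[of \<mu>] unfolding d2_def ab by (simp add: algebra_simps)
  \<comment> \<open>The factor \<open>w\<close> of the Wronskian is distributed over the two
    components according to their sizes at the origin.\<close>
  have prod: "of_real (X k) = (of_real (X k powr \<nu>) * of_real (X k powr \<mu>) :: complex)" for k
  proof -
    have "X k powr \<nu> * X k powr \<mu> = X k" using X(1)[of k] \<mu>(3) by (simp flip: powr_add)
    then show ?thesis by (metis of_real_mult)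
  qed
  note I\<nu> = bessel_Im_small[OF \<nu>(1) X] and I\<mu> = bessel_Im_small[OF \<mu>(1) X]
  have wr: "v * (f1 v * g2 v - g1 v * f2 v) = L"
    if "mac_system ?a f1 g1" "mac_system ?a f2 g2"
      "(\<lambda>k. (of_real (X k powr \<nu>) * f1 (of_real (X k))) * (of_real (X k powr \<mu>) * g2 (of_real (X k)))
          - (of_real (X k powr \<mu>) * g1 (of_real (X k))) * (of_real (X k powr \<nu>) * f2 (of_real (X k)))) \<longlonglongrightarrow> L"
      "Re v > 0" for f1 g1 f2 g2 L v
  proof -
    obtain C where C: "\<And>v. Re v > 0 \<Longrightarrow> v * (f1 v * g2 v - g1 v * f2 v) = C"
      using mac_system_wronskian[OF \<open>mac_system ?a f1 g1\<close> \<open>mac_system ?a f2 g2\<close>] by blast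
    have "(of_real (X k powr \<nu>) * f1 (of_real (X k))) * (of_real (X k powr \<mu>) * g2 (of_real (X k)))
          - (of_real (X k powr \<mu>) * g1 (of_real (X k))) * (of_real (X k powr \<nu>) * f2 (of_real (X k))) = C" for k
    proof -
      have "of_real (X k) * (f1 (of_real (X k)) * g2 (of_real (X k)) - g1 (of_real (X k)) * f2 (of_real (X k))) = C"
        by (rule C) (simp add: X(1))
      then show ?thesis by (subst (asm) (1) prod) (simp add: algebra_simps)
    qed
    with that(3) have "C = L" by (simp add: LIMSEQ_const_iff)
    with C[OF that(4)] show ?thesis by simp
  qed
  have W1: "w * (d1 w * (- bessel_Im (- ?b) w) - d2 w * bessel_Im ?a w) = 0 * (- (of_real (2 powr \<mu>) * rGamma (1 - ?b))) - 0 * 0"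
    by (rule wr[OF d mac_system_bessel_Im[of ?a, unfolded ab] _ w])
       (simp only: mult_minus_right, intro tendsto_diff tendsto_mult tendsto_minus dd1 dd2 I\<nu> I\<mu>)
  have W2: "w * (d1 w * (- bessel_Im ?b w) - d2 w * bessel_Im (- ?a) w) = 0 * (- 0) - 0 * (of_real (2 powr \<nu>) * rGamma (1 - ?a))"
    by (rule wr[OF d mac_system_bessel_Im_neg[of ?a, unfolded ab] _ w])
       (simp only: mult_minus_right, intro tendsto_diff tendsto_mult tendsto_minus dd1 dd2 I\<nu> I\<mu>)
  have W3: "w * (bessel_Im ?a w * (- bessel_Im ?b w) - (- bessel_Im (- ?b) w) * bessel_Im (- ?a) w)
      = 0 * (- 0) - (- (of_real (2 powr \<mu>) * rGamma (1 - ?b))) * (of_real (2 powr \<nu>) * rGamma (1 - ?a))"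
    by (rule wr[OF mac_system_bessel_Im[of ?a, unfolded ab] mac_system_bessel_Im_neg[of ?a, unfolded ab] _ w])
       (simp only: mult_minus_right, intro tendsto_diff tendsto_mult tendsto_minus I\<nu> I\<mu>)
  have "rGamma (1 - ?b) \<noteq> 0" "rGamma (1 - ?a) \<noteq> 0"
  proof -
    have "Gamma \<mu> \<noteq> 0" "Gamma \<nu> \<noteq> 0" using Gamma_real_pos[OF \<mu>(1)] Gamma_real_pos[OF \<nu>(1)] by linarith+
    then show "rGamma (1 - ?b) \<noteq> 0" "rGamma (1 - ?a) \<noteq> 0" using cG[of \<mu>] cG[of \<nu>] by auto
  qed
  then have det: "bessel_Im ?a w * (- bessel_Im ?b w) - (- bessel_Im (- ?b) w) * bessel_Im (- ?a) w \<noteq> 0"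
    using W3 by auto
  have w0: "w \<noteq> 0" using w by auto
  \<comment> \<open>Cramer's rule: eliminating \<open>d2 w\<close> from the two vanishing Wronskians
    leaves \<open>d1 w\<close> times the determinant of the modified Bessel solutions.\<close>
  have "d1 w * (bessel_Im ?a w * (- bessel_Im ?b w) - (- bessel_Im (- ?b) w) * bessel_Im (- ?a) w)
     = bessel_Im ?a w * (d1 w * (- bessel_Im ?b w) - d2 w * bessel_Im (- ?a) w)
       - bessel_Im (- ?a) w * (d1 w * (- bessel_Im (- ?b) w) - d2 w * bessel_Im ?a w)"
    by (simp add: algebra_simps)
  also have "\<dots> = 0" using W1 W2 w0 by simp
  finally have "d1 w = 0" using det by simp
  then have "macdonald \<nu> w = c * (bessel_Im (- ?a) w - bessel_Im ?a w)"
    by (simp add: d1_def algebra_simps)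
  then show ?thesis by (simp only: c_def)
qed

section \<open>Bounds for the Hankel functions\<close>

text \<open>For \<open>Im z \<ge> 0\<close> the argument of \<open>- \<i> * z\<close> lies between
  -pi/2 and pi/2, so rotating back by a right angle crosses no branch cut, and on the negative real
  axis it lands on the principal value pi. The convention for boundary values enters here.\<close>

lemma bessel_J_eq_bessel_Im:
  assumes "Im z \<ge> 0" "z \<noteq> 0"
  shows "bessel_J a z = exp (\<i> * of_real pi / 2 * a) * bessel_Im a (- \<i> * z)"
proof -
  let ?w = "- \<i> * z"
  have "Ln (\<i> * (?w / 2)) = Ln (?w / 2) + \<i> * of_real pi / 2"
    using assms by (subst Ln_times_ii) auto
  moreover have "\<i> * (?w / 2) = z / 2" by simp
  ultimately have "Ln (z / 2) = Ln (?w / 2) + \<i> * of_real pi / 2" by simp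
  then have "(z / 2) powr a = exp (\<i> * of_real pi / 2 * a) * (?w / 2) powr a"
    using assms(2) by (simp add: powr_def exp_add[symmetric] algebra_simps)
  moreover have "- ((z / 2)\<^sup>2) = (?w / 2)\<^sup>2" by (simp add: power_mult_distrib power_divide)
  ultimately show ?thesis unfolding bessel_J_series bessel_Im_def by (simp add: mult.assoc)
qed

lemma real_nonint: "0 < \<nu> \<Longrightarrow> \<nu> < 1 \<Longrightarrow> (of_real \<nu> :: complex) \<notin> \<int>"
proof
  assume "0 < \<nu>" "\<nu> < 1" "(of_real \<nu> :: complex) \<in> \<int>"
  then obtain n :: int where "of_real \<nu> = (of_int n :: complex)" by (auto elim: Ints_cases)
  then have "\<nu> = of_int n" by (metis of_real_eq_iff of_real_of_int_eq)
  with \<open>0 < \<nu>\<close> \<open>\<nu> < 1\<close> show False by simp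
qed

text \<open>For real order the phases have modulus 1. The right-hand side is kept in terms of
  \<open>bessel_Im\<close>: it is the Macdonald integral while \<open>- \<i> * z\<close> is in the
  open half-plane and remains continuous when \<open>z\<close> becomes real.\<close>

lemma norm_hankel_H1_eq:
  assumes "0 < \<nu>" "\<nu> < 1" "Im z \<ge> 0" "z \<noteq> 0"
  shows "cmod (hankel_H1 (of_real \<nu>) z) = 2 / pi * cmod (of_real (pi / (2 * sin (pi * \<nu>)))
     * (bessel_Im (- of_real \<nu>) (- \<i> * z) - bessel_Im (of_real \<nu>) (- \<i> * z)))"
proof -
  let ?a = "of_real \<nu> :: complex" and ?w = "- \<i> * z"
  have sin0: "sin (pi * \<nu>) > 0" using assms by (intro sin_gt_zero) auto
  let ?e = "exp (- (\<i> * of_real pi / 2 * ?a))"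
  have J1: "bessel_J (- ?a) z = ?e * bessel_Im (- ?a) ?w"
    using bessel_J_eq_bessel_Im[OF assms(3,4), of "- ?a"] by simp
  have J2: "exp (- \<i> * of_real pi * ?a) * bessel_J ?a z = ?e * bessel_Im ?a ?w"
  proof -
    have "- \<i> * of_real pi * ?a + \<i> * of_real pi / 2 * ?a = - (\<i> * of_real pi / 2 * ?a)"
      by (simp add: field_simps)
    then show ?thesis
      unfolding bessel_J_eq_bessel_Im[OF assms(3,4)] by (simp only: mult.assoc[symmetric] exp_add[symmetric])
  qed
  define D where "D = bessel_Im (- ?a) ?w - bessel_Im ?a ?w"
  have "hankel_H1 ?a z = - \<i> * (?e * D) / sin (?a * of_real pi)"
    unfolding hankel_H1_nonint[OF real_nonint[OF assms(1,2)]] hankel_nonint_eq[OF real_nonint[OF assms(1,2)]] J1 J2 D_def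
    by (simp add: algebra_simps)
  moreover have "sin (?a * of_real pi) = of_real (sin (pi * \<nu>))"
    by (simp only: of_real_mult[symmetric] sin_of_real mult.commute)
  moreover have "cmod ?e = 1" by (simp add: norm_exp_eq_Re)
  ultimately have "cmod (hankel_H1 ?a z) = cmod D / sin (pi * \<nu>)"
    using sin0 by (simp add: norm_mult norm_divide)
  moreover have "cmod (of_real (pi / (2 * sin (pi * \<nu>))) * D) = pi / (2 * sin (pi * \<nu>)) * cmod D"
    unfolding norm_mult norm_of_real using sin0 by simp
  ultimately show ?thesis unfolding D_def[symmetric] using sin0 by simp
qed

lemma extend_to_closed_half_plane:
  assumes bound: "\<And>w. Re w > 0 \<Longrightarrow> cmod (f w) \<le> b (cmod w)"
    and f: "isCont f w" and b: "isCont b (cmod w)" and w: "Re w \<ge> 0"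
  shows "cmod (f w) \<le> b (cmod w)"
proof -
  define W where "W k = w + of_real (inverse (real (Suc k)))" for k
  have W: "W \<longlonglongrightarrow> w + of_real 0"
    unfolding W_def by (intro tendsto_intros LIMSEQ_inverse_real_of_nat)
  then have W': "W \<longlonglongrightarrow> w" by simp
  show ?thesis
  proof (rule LIMSEQ_le)
    show "(\<lambda>k. cmod (f (W k))) \<longlonglongrightarrow> cmod (f w)"
      by (intro tendsto_norm isCont_tendsto_compose[OF f W'])
    show "(\<lambda>k. b (cmod (W k))) \<longlonglongrightarrow> b (cmod w)"
      by (intro isCont_tendsto_compose[OF b] tendsto_norm W')
    show "\<exists>N. \<forall>k\<ge>N. cmod (f (W k)) \<le> b (cmod (W k))"
      using w by (intro exI[of _ 0] allI impI bound) (auto simp: W_def intro: add_nonneg_pos)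
  qed
qed

lemma isCont_bessel_Im: "w \<notin> \<real>\<^sub>\<le>\<^sub>0 \<Longrightarrow> isCont (bessel_Im a) w"
  using has_field_derivative_bessel_Im(1) by (rule DERIV_isCont)

lemma rotate_not_nonpos: "Im z \<ge> 0 \<Longrightarrow> z \<noteq> 0 \<Longrightarrow> - \<i> * z \<notin> \<real>\<^sub>\<le>\<^sub>0"
  by (auto simp: complex_nonpos_Reals_iff complex_eq_iff)

text \<open>A bound for the integral in the open half-plane passes to the power series, extends to
  the imaginary axis by continuity and is rotated. The factor \<open>2 / pi\<close> is below 1 and
  is dropped.\<close>

lemma norm_hankel_H1_transfer:
  assumes \<nu>: "0 < \<nu>" "\<nu> < 1" and z: "Im z \<ge> 0" "z \<noteq> 0"
    and bound: "\<And>w. Re w > 0 \<Longrightarrow> cmod (macdonald \<nu> w) \<le> b (cmod w)"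
    and b: "isCont b (cmod z)"
  shows "cmod (hankel_H1 (of_real \<nu>) z) \<le> b (cmod z)"
proof -
  let ?F = "\<lambda>w. of_real (pi / (2 * sin (pi * \<nu>))) * (bessel_Im (- of_real \<nu>) w - bessel_Im (of_real \<nu>) w)"
  have "cmod (?F (- \<i> * z)) \<le> b (cmod (- \<i> * z))"
  proof (rule extend_to_closed_half_plane)
    show "cmod (?F w) \<le> b (cmod w)" if "Re w > 0" for w
      using bound[OF that] macdonald_eq_bessel_Im[OF \<nu> that] by simp
    show "isCont ?F (- \<i> * z)"
      by (intro continuous_intros isCont_bessel_Im rotate_not_nonpos z)
  qed (use z b in \<open>auto simp: norm_mult\<close>)
  then have "cmod (?F (- \<i> * z)) \<le> b (cmod z)" by (simp add: norm_mult)
  moreover have "2 / pi * cmod (?F (- \<i> * z)) \<le> 1 * cmod (?F (- \<i> * z))"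
    using pi_gt3 by (intro mult_right_mono) auto
  ultimately show ?thesis unfolding norm_hankel_H1_eq[OF \<nu> z] by linarith
qed

text \<open>The exponent \<open>s\<close> bounds the singularity at the origin; \<open>1 / 2\<close>
  is the decay exponent at infinity on the real axis. The exponential decay inside the half-plane is
  given up.\<close>

definition hankel_bound :: "real \<Rightarrow> real \<Rightarrow> bool" where
  "hankel_bound \<nu> s \<longleftrightarrow> (\<exists>C\<ge>0. \<forall>z. Im z \<ge> 0 \<longrightarrow> z \<noteq> 0 \<longrightarrow>
     cmod (hankel_H1 (of_real \<nu>) z) \<le> C * (cmod z powr (- s) + cmod z powr (- (1 / 2))))"

lemma norm_hankel_H1_le:
  assumes "0 < \<nu>" "\<nu> < 1" "Im z \<ge> 0" "z \<noteq> 0"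
  shows "cmod (hankel_H1 (of_real \<nu>) z) \<le> 6 * (cmod z powr (- 1) + cmod z powr (- (1 / 2)))"
proof (rule norm_hankel_H1_transfer[OF assms, where b = "\<lambda>r. 6 * (r powr (- 1) + r powr (- (1 / 2)))"])
  fix w :: complex assume w: "Re w > 0"
  then have "cmod w > 0" by auto
  then have "1 / cmod w = cmod w powr (- 1)" "1 / sqrt (cmod w) = cmod w powr (- (1 / 2))"
    by (simp_all add: powr_minus powr_half_sqrt inverse_eq_divide)
  then show "cmod (macdonald \<nu> w) \<le> 6 * (cmod w powr (- 1) + cmod w powr (- (1 / 2)))"
    using norm_macdonald_le[OF w, of \<nu>] assms by simp
next
  show "isCont (\<lambda>r. 6 * (r powr (- 1) + r powr (- (1 / 2)))) (cmod z)"
    using assms(4) by (intro continuous_intros) auto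
qed

text \<open>At \<open>\<nu> = 1 / 2\<close> the orders \<open>\<nu>\<close> and
  \<open>1 - \<nu>\<close> coincide, and the system becomes one equation with solutions
  \<open>c * w powr (- 1 / 2) * exp (- w)\<close>. This improves the singularity exponent from the
  general 1 to 1/2, the start of the recurrence for odd dimensions, where the orders are
  half-integers.\<close>

lemma hankel_bound_half: "hankel_bound (1 / 2) (1 / 2)"
proof -
  let ?S = "{w::complex. Re w > 0}"
  have "\<exists>c. \<forall>w\<in>?S. macdonald (1 / 2) w * w powr (1 / 2) * exp w = c"
  proof (rule has_field_derivative_zero_constant)
    show "convex ?S" by (rule convex_halfspace_Re_gt)
    fix w assume "w \<in> ?S"
    then have w: "Re w > 0" "w \<noteq> 0" "w \<notin> \<real>\<^sub>\<le>\<^sub>0" by (auto simp: complex_nonpos_Reals_iff)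
    let ?K = "macdonald (1 / 2) w"
    have dK: "(macdonald (1 / 2) has_field_derivative - ?K - 1 / 2 / w * ?K) (at w)"
      using has_field_derivative_macdonald[OF w(1), of "1 / 2"] by simp
    have dp: "((\<lambda>w. w powr (1 / 2)) has_field_derivative 1 / 2 * w powr (1 / 2) / w) (at w)"
      using has_field_derivative_powr[OF w(3), of "1 / 2"] w(2) powr_diff[of w "1 / 2" 1]
      by (simp add: mult.commute)
    have "((\<lambda>w. macdonald (1 / 2) w * w powr (1 / 2) * exp w) has_field_derivative
        ((- ?K - 1 / 2 / w * ?K) * w powr (1 / 2) + 1 / 2 * w powr (1 / 2) / w * ?K) * exp w + exp w * (?K * w powr (1 / 2))) (at w)"
      by (intro DERIV_mult dK dp DERIV_exp)
    moreover have "((- ?K - 1 / 2 / w * ?K) * w powr (1 / 2) + 1 / 2 * w powr (1 / 2) / w * ?K) * exp w + exp w * (?K * w powr (1 / 2)) = 0"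
      by (simp add: algebra_simps)
    ultimately show "((\<lambda>w. macdonald (1 / 2) w * w powr (1 / 2) * exp w) has_field_derivative 0) (at w within ?S)"
      by (simp add: has_field_derivative_at_within)
  qed
  then obtain c where c: "\<And>w. Re w > 0 \<Longrightarrow> macdonald (1 / 2) w * w powr (1 / 2) * exp w = c" by auto
  have bound: "cmod (macdonald (1 / 2) w) \<le> cmod c * cmod w powr (- (1 / 2))" if w: "Re w > 0" for w
  proof -
    have w0: "w \<noteq> 0" using w by auto
    have np: "cmod (w powr (1 / 2)) = cmod w powr (1 / 2)"
      using w0 by (simp add: powr_def norm_exp_eq_Re)
    have "cmod (macdonald (1 / 2) w) * cmod w powr (1 / 2) * exp (Re w) = cmod c"
      using c[OF w] np by (metis norm_exp_eq_Re norm_mult)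
    moreover have "cmod (macdonald (1 / 2) w) * cmod w powr (1 / 2) * 1 \<le> cmod (macdonald (1 / 2) w) * cmod w powr (1 / 2) * exp (Re w)"
      using w by (intro mult_left_mono) auto
    ultimately have "cmod (macdonald (1 / 2) w) * cmod w powr (1 / 2) \<le> cmod c" by simp
    then show ?thesis using w0 by (simp add: powr_minus field_simps)
  qed
  have "cmod (hankel_H1 (of_real (1 / 2)) z) \<le> cmod c * (cmod z powr (- (1 / 2)) + cmod z powr (- (1 / 2)))"
    if z: "Im z \<ge> 0" "z \<noteq> 0" for z
  proof -
    have "cmod (hankel_H1 (of_real (1 / 2)) z) \<le> cmod c * cmod z powr (- (1 / 2))"
    proof (rule norm_hankel_H1_transfer[where b = "\<lambda>r. cmod c * r powr (- (1 / 2))", OF _ _ z bound])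
      show "isCont (\<lambda>r. cmod c * r powr (- (1 / 2))) (cmod z)"
        using z(2) by (intro continuous_intros) auto
    qed auto
    also have "\<dots> \<le> cmod c * (cmod z powr (- (1 / 2)) + cmod z powr (- (1 / 2)))"
      by (intro mult_left_mono) auto
    finally show ?thesis .
  qed
  then show ?thesis unfolding hankel_bound_def by (intro exI[of _ "cmod c"]) auto
qed

text \<open>Reflection of the order multiplies the Hankel function by a phase. Order -1/2 is the
  lower neighbour from which the recurrence reaches 3/2.\<close>

lemma hankel_bound_neg_half: "hankel_bound (- (1 / 2)) (1 / 2)"
proof -
  let ?h = "1 / 2 :: complex"
  have ni: "?h \<notin> \<int>" "- ?h \<notin> \<int>"
    using real_nonint[of "1 / 2"] by (auto simp: minus_in_Ints_iff)
  have "cmod (hankel_H1 (- ?h) z) = cmod (hankel_H1 ?h z)" for z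
  proof -
    let ?e = "exp (\<i> * of_real pi * ?h)"
    have e: "exp (- \<i> * of_real pi * ?h) = inverse ?e" by (simp add: exp_minus)
    have s: "sin (?h * of_real pi) \<noteq> 0" by (rule sin_pi_mult_nonint[OF ni(1)])
    have "hankel_H1 (- ?h) z = ?e * hankel_H1 ?h z"
      unfolding hankel_H1_nonint[OF ni(1)] hankel_H1_nonint[OF ni(2)] hankel_nonint_eq[OF ni(1)] hankel_nonint_eq[OF ni(2)] e
      using s by (simp add: field_simps)
    moreover have "cmod ?e = 1" by (simp add: norm_exp_eq_Re)
    ultimately show ?thesis by (simp add: norm_mult)
  qed
  then show ?thesis using hankel_bound_half unfolding hankel_bound_def by simp
qed

text \<open>The approximating orders are taken inside the open interval, where the constant 6 is
  uniform. At order 0 the true singularity is logarithmic; the exponent 1 is what the planar Green's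
  function can afford.\<close>

lemma hankel_bound_0_1: "hankel_bound 0 1" "hankel_bound 1 1"
proof -
  have "cmod (hankel_H1 (of_nat n) z) \<le> 6 * (cmod z powr (- 1) + cmod z powr (- (1 / 2)))"
    if z: "Im z \<ge> 0" "z \<noteq> 0" and Y: "Y \<longlonglongrightarrow> real n" "\<And>k. 0 < Y k" "\<And>k. Y k < 1" "\<And>k. Y k \<noteq> real n" for n Y z
  proof (rule LIMSEQ_le_const2)
    have "(\<lambda>k. of_real (Y k) :: complex) \<longlonglongrightarrow> of_nat n"
      using tendsto_of_real[OF Y(1), where 'a = complex] by simp
    moreover have "of_real (Y k) \<noteq> (of_nat n :: complex)" for k
      using Y(4)[of k] by (metis of_real_eq_iff of_real_of_nat_eq)
    ultimately have "filterlim (\<lambda>k. of_real (Y k) :: complex) (at (of_nat n)) sequentially"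
      by (auto simp: filterlim_at)
    from filterlim_compose[OF tendsto_hankel_H1_int[OF z(2)] this]
    show "(\<lambda>k. cmod (hankel_nonint (of_real (Y k)) z)) \<longlonglongrightarrow> cmod (hankel_H1 (of_nat n) z)"
      by (rule tendsto_norm)
    show "\<exists>N. \<forall>k\<ge>N. cmod (hankel_nonint (of_real (Y k)) z) \<le> 6 * (cmod z powr (- 1) + cmod z powr (- (1 / 2)))"
      using norm_hankel_H1_le[OF Y(2,3) z] hankel_H1_nonint[OF real_nonint[OF Y(2,3)]] by auto
  qed
  note * = this
  \<comment> \<open>Starting from \<open>Suc (Suc k)\<close> keeps these values at most 1/2, so they
    and their differences from 1 stay strictly between 0 and 1.\<close>
  have lim: "(\<lambda>k. inverse (real (Suc (Suc k)))) \<longlonglongrightarrow> 0"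
    using LIMSEQ_Suc[OF LIMSEQ_inverse_real_of_nat] .
  have "cmod (hankel_H1 (of_nat 0) z) \<le> 6 * (cmod z powr (- 1) + cmod z powr (- (1 / 2)))" if z: "Im z \<ge> 0" "z \<noteq> 0" for z
    by (rule *[OF z, of "\<lambda>k. inverse (real (Suc (Suc k)))"]) (use lim in \<open>auto simp: field_simps\<close>)
  then show "hankel_bound 0 1" unfolding hankel_bound_def by (intro exI[of _ 6]) auto
  have lim1: "(\<lambda>k. 1 - inverse (real (Suc (Suc k)))) \<longlonglongrightarrow> 1 - 0"
    by (intro tendsto_intros lim)
  have "cmod (hankel_H1 (of_nat 1) z) \<le> 6 * (cmod z powr (- 1) + cmod z powr (- (1 / 2)))" if z: "Im z \<ge> 0" "z \<noteq> 0" for z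
    by (rule *[OF z, of "\<lambda>k. 1 - inverse (real (Suc (Suc k)))"]) (use lim1 in \<open>auto simp: field_simps\<close>)
  then show "hankel_bound 1 1" unfolding hankel_bound_def by (intro exI[of _ 6]) auto
qed

section \<open>Higher orders by recurrence\<close>

lemma powr_neg_le_add:
  fixes x p q r :: real
  assumes "x > 0" "p \<le> q" "q \<le> r"
  shows "x powr (- q) \<le> x powr (- r) + x powr (- p)"
proof (cases "x \<le> 1")
  case True
  then have "x powr (- q) \<le> x powr (- r)" using assms by (intro powr_mono') auto
  then show ?thesis by (simp add: add_increasing2)
next
  case False
  then have "x powr (- q) \<le> x powr (- p)" using assms by (intro powr_mono) auto
  then show ?thesis by (simp add: add_increasing)
qed

lemma hankel_bound_mono:
  assumes "hankel_bound \<nu> s" "1 / 2 \<le> s" "s \<le> s'"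
  shows "hankel_bound \<nu> s'"
proof -
  obtain C where C: "C \<ge> 0" "\<And>z. Im z \<ge> 0 \<Longrightarrow> z \<noteq> 0 \<Longrightarrow>
     cmod (hankel_H1 (of_real \<nu>) z) \<le> C * (cmod z powr (- s) + cmod z powr (- (1 / 2)))"
    using assms(1) unfolding hankel_bound_def by blast
  have "cmod (hankel_H1 (of_real \<nu>) z) \<le> 2 * C * (cmod z powr (- s') + cmod z powr (- (1 / 2)))"
    if z: "Im z \<ge> 0" "z \<noteq> 0" for z
  proof -
    have "cmod z powr (- s) \<le> cmod z powr (- s') + cmod z powr (- (1 / 2))"
      using assms z by (intro powr_neg_le_add) auto
    then have "cmod z powr (- s) + cmod z powr (- (1 / 2)) \<le> 2 * (cmod z powr (- s') + cmod z powr (- (1 / 2)))"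
    proof -
      have "a + c \<le> 2 * (b + c)" if "a \<le> b + c" "0 \<le> b" "0 \<le> c" for a b c :: real using that by simp
      then show ?thesis using \<open>cmod z powr (- s) \<le> _\<close> powr_ge_zero by blast
    qed
    then have "C * (cmod z powr (- s) + cmod z powr (- (1 / 2))) \<le> C * (2 * (cmod z powr (- s') + cmod z powr (- (1 / 2))))"
      using C(1) by (rule mult_left_mono)
    with C(2)[OF z] show ?thesis by (simp add: algebra_simps)
  qed
  then show ?thesis unfolding hankel_bound_def using C(1) by (intro exI[of _ "2 * C"]) auto
qed

text \<open>The factor \<open>1 / z\<close> raises \<open>s\<close> to \<open>s + 1\<close> and the
  decay exponent 1/2 to 3/2, which lies between 1/2 and \<open>s + 1\<close> and is absorbed by the
  sum of these two powers. The lower order enters without such a factor, so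
  \<open>s' \<le> s + 1\<close> is the condition for it.\<close>

lemma hankel_bound_step:
  assumes b1: "hankel_bound \<nu> s" and b2: "hankel_bound (\<nu> - 1) s'" and s: "1 / 2 \<le> s" "1 / 2 \<le> s'" "s' \<le> s + 1"
    and \<nu>: "(of_real \<nu> :: complex) \<notin> \<int> \<or> (\<exists>n. (of_real \<nu> :: complex) = of_nat (Suc n))"
  shows "hankel_bound (\<nu> + 1) (s + 1)"
proof -
  obtain C1 where C1: "C1 \<ge> 0" "\<And>z. Im z \<ge> 0 \<Longrightarrow> z \<noteq> 0 \<Longrightarrow>
     cmod (hankel_H1 (of_real \<nu>) z) \<le> C1 * (cmod z powr (- s) + cmod z powr (- (1 / 2)))"
    using b1 unfolding hankel_bound_def by blast
  obtain C2 where C2: "C2 \<ge> 0" "\<And>z. Im z \<ge> 0 \<Longrightarrow> z \<noteq> 0 \<Longrightarrow>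
     cmod (hankel_H1 (of_real (\<nu> - 1)) z) \<le> C2 * (cmod z powr (- (s + 1)) + cmod z powr (- (1 / 2)))"
    using hankel_bound_mono[OF b2 s(2,3)] unfolding hankel_bound_def by blast
  have "cmod (hankel_H1 (of_real (\<nu> + 1)) z) \<le> (4 * \<bar>\<nu>\<bar> * C1 + C2) * (cmod z powr (- (s + 1)) + cmod z powr (- (1 / 2)))"
    if z: "Im z \<ge> 0" "z \<noteq> 0" for z
  proof -
    let ?r = "cmod z" and ?T = "cmod z powr (- (s + 1)) + cmod z powr (- (1 / 2))"
    have r: "?r > 0" using z by simp
    have "hankel_H1 (of_real (\<nu> + 1)) z = 2 * of_real \<nu> / z * hankel_H1 (of_real \<nu>) z - hankel_H1 (of_real (\<nu> - 1)) z"
      using hankel_H1_recurrence[OF z(2) \<nu>] by simp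
    then have "cmod (hankel_H1 (of_real (\<nu> + 1)) z) \<le> cmod (2 * of_real \<nu> / z * hankel_H1 (of_real \<nu>) z) + cmod (hankel_H1 (of_real (\<nu> - 1)) z)"
      by (simp add: norm_triangle_ineq4)
    also have "\<dots> \<le> 2 * \<bar>\<nu>\<bar> * C1 * (2 * ?T) + C2 * ?T"
    proof (rule add_mono)
      have "cmod (2 * of_real \<nu> / z * hankel_H1 (of_real \<nu>) z) = 2 * \<bar>\<nu>\<bar> * (?r powr (- 1) * cmod (hankel_H1 (of_real \<nu>) z))"
        using r by (simp add: norm_mult norm_divide powr_minus_divide)
      also have "\<dots> \<le> 2 * \<bar>\<nu>\<bar> * (?r powr (- 1) * (C1 * (?r powr (- s) + ?r powr (- (1 / 2)))))"
        by (intro mult_left_mono C1(2) z) auto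
      also have "\<dots> = 2 * \<bar>\<nu>\<bar> * C1 * (?r powr (- 1) * ?r powr (- s) + ?r powr (- 1) * ?r powr (- (1 / 2)))"
        by (simp only: distrib_left mult_ac)
      also have "?r powr (- 1) * ?r powr (- s) + ?r powr (- 1) * ?r powr (- (1 / 2)) = ?r powr (- (s + 1)) + ?r powr (- (3 / 2))"
        unfolding powr_add[symmetric] by (simp add: algebra_simps)
      also have "2 * \<bar>\<nu>\<bar> * C1 * (?r powr (- (s + 1)) + ?r powr (- (3 / 2))) \<le> 2 * \<bar>\<nu>\<bar> * C1 * (2 * ?T)"
      proof (rule mult_left_mono)
        have "?r powr (- (3 / 2)) \<le> ?T" using r s by (intro powr_neg_le_add) auto
        then show "?r powr (- (s + 1)) + ?r powr (- (3 / 2)) \<le> 2 * ?T"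
        proof -
          have "a + d \<le> 2 * (a + c)" if "d \<le> a + c" "0 \<le> c" for a c d :: real using that by simp
          then show ?thesis using \<open>?r powr (- (3 / 2)) \<le> ?T\<close> powr_ge_zero by blast
        qed
      qed (use C1 in simp)
      finally show "cmod (2 * of_real \<nu> / z * hankel_H1 (of_real \<nu>) z) \<le> 2 * \<bar>\<nu>\<bar> * C1 * (2 * ?T)" .
      show "cmod (hankel_H1 (of_real (\<nu> - 1)) z) \<le> C2 * ?T" by (rule C2(2)[OF z])
    qed
    also have "\<dots> = (4 * \<bar>\<nu>\<bar> * C1 + C2) * ?T" by (simp add: algebra_simps)
    finally show ?thesis .
  qed
  then show ?thesis unfolding hankel_bound_def using C1(1) C2(1) by (intro exI[of _ "4 * \<bar>\<nu>\<bar> * C1 + C2"]) auto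
qed

text \<open>Two chains of step 1: half-integers from -1/2 and 1/2, integers from 0 and 1. The cases
  \<open>k = 3\<close> and \<open>k = 4\<close> are separate because their lower neighbours, the
  orders -1/2 and 0, carry the exponents 1/2 and 1, different from the order.\<close>

lemma hankel_bound_half_integer:
  assumes "k \<ge> 1"
  shows "hankel_bound (real k / 2) (real k / 2)"
  using assms
proof (induction k rule: less_induct)
  case (less k)
  consider "k = 1" | "k = 2" | "k = 3" | "k = 4" | "k \<ge> 5"
    using less.prems by linarith
  then show ?case
  proof cases
    case 1 then show ?thesis using hankel_bound_half by simp
  next
    case 2 then show ?thesis using hankel_bound_0_1 by simp
  next
    case 3
    have "hankel_bound (1 / 2 + 1) (1 / 2 + 1)"
      by (rule hankel_bound_step[where s' = "1 / 2"]) (use hankel_bound_half hankel_bound_neg_half real_nonint[of "1 / 2"] in auto)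
    then show ?thesis using 3 by simp
  next
    case 4
    have "hankel_bound (1 + 1) (1 + 1)"
      by (rule hankel_bound_step[where s' = 1]) (use hankel_bound_0_1 in \<open>auto intro!: exI[of _ 0]\<close>)
    then show ?thesis using 4 by simp
  next
    case 5
    define m where "m = k - 4"
    have m: "k = m + 4" "m \<ge> 1" using 5 by (auto simp: m_def)
    have k2: "hankel_bound (real (m + 2) / 2) (real (m + 2) / 2)" and k4: "hankel_bound (real m / 2) (real m / 2)"
      using less.IH[of "m + 2"] less.IH[of m] m by auto
    have ni: "(of_real (real (m + 2) / 2) :: complex) \<notin> \<int> \<or> (\<exists>n. (of_real (real (m + 2) / 2) :: complex) = of_nat (Suc n))"
    proof (cases "even m")
      case True
      then obtain j where "m = 2 * j" by blast
      then show ?thesis by (intro disjI2 exI[of _ j]) simp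
    next
      case False
      have "(of_real (real (m + 2) / 2) :: complex) \<notin> \<int>"
      proof
        assume "(of_real (real (m + 2) / 2) :: complex) \<in> \<int>"
        then obtain i :: int where "of_real (real (m + 2) / 2) = (of_int i :: complex)" by (auto elim: Ints_cases)
        then have "real (m + 2) / 2 = of_int i" by (metis of_real_eq_iff of_real_of_int_eq)
        then have "real_of_int (int (m + 2)) = real_of_int (2 * i)" by simp
        then have "int (m + 2) = 2 * i" by (simp only: of_int_eq_iff)
        then have "even (m + 2)" by presburger
        with False show False by simp
      qed
      then show ?thesis ..
    qed
    have "hankel_bound (real (m + 2) / 2 + 1) (real (m + 2) / 2 + 1)"
    proof (rule hankel_bound_step[OF k2 _ _ _ _ ni, where s' = "real m / 2"])
      show "hankel_bound (real (m + 2) / 2 - 1) (real m / 2)" using k4 by (simp add: add_divide_distrib)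
    qed (use m in \<open>auto simp: add_divide_distrib\<close>)
    then show ?thesis using m by (simp add: add_divide_distrib add.commute)
  qed
qed

section \<open>The kernel of the free Dirac operator\<close>

lemma norm_dirac_dot_entry_le:
  "cmod (dirac_dot \<alpha> v $ j $ k) \<le> (\<Sum>i\<in>UNIV. \<Sum>a\<in>UNIV. \<Sum>b\<in>UNIV. cmod (\<alpha> (Some i) $ a $ b)) * norm v"
proof -
  have "cmod (dirac_dot \<alpha> v $ j $ k) = cmod (\<Sum>i\<in>UNIV. of_real (v $ i) * \<alpha> (Some i) $ j $ k)"
    by (simp add: dirac_dot_def sum_component scale_matrix_def map_matrix_def)
  also have "\<dots> \<le> (\<Sum>i\<in>UNIV. (\<Sum>a\<in>UNIV. \<Sum>b\<in>UNIV. cmod (\<alpha> (Some i) $ a $ b)) * norm v)"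
  proof (rule order_trans[OF norm_sum sum_mono])
    fix i
    have "cmod (\<alpha> (Some i) $ j $ k) \<le> (\<Sum>b\<in>UNIV. cmod (\<alpha> (Some i) $ j $ b))"
      by (rule member_le_sum) auto
    also have "\<dots> \<le> (\<Sum>a\<in>UNIV. \<Sum>b\<in>UNIV. cmod (\<alpha> (Some i) $ a $ b))"
      by (rule member_le_sum[of j]) (auto intro: sum_nonneg)
    finally have "\<bar>v $ i\<bar> * cmod (\<alpha> (Some i) $ j $ k) \<le> norm v * (\<Sum>a\<in>UNIV. \<Sum>b\<in>UNIV. cmod (\<alpha> (Some i) $ a $ b))"
      by (intro mult_mono component_le_norm_cart) auto
    then show "norm (of_real (v $ i) * \<alpha> (Some i) $ j $ k) \<le> (\<Sum>a\<in>UNIV. \<Sum>b\<in>UNIV. cmod (\<alpha> (Some i) $ a $ b)) * norm v"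
      by (simp add: norm_mult mult.commute)
  qed
  finally show ?thesis by (simp add: sum_distrib_right)
qed

lemma norm_powr_of_real: "z \<noteq> 0 \<Longrightarrow> cmod (z powr of_real s) = cmod z powr s"
  by (simp add: powr_def norm_exp_eq_Re)

text \<open>Homogeneity of degree \<open>1 - n\<close>. On the diagonal both sides are 0, since
  \<open>powr\<close> with base 0 is 0.\<close>

lemma dirac_green_bound_0:
  fixes \<alpha> :: "'n::finite option \<Rightarrow> complex^'m^'m"
  obtains D where "D \<ge> 0"
    "\<And>x y j k. cmod (dirac_green \<alpha> 0 x y $ j $ k) \<le> D * norm (x - y) powr (- (real CARD('n) - 1))"
proof -
  let ?n = "real CARD('n)"
  define A where "A = (\<Sum>i\<in>UNIV. \<Sum>a\<in>UNIV. \<Sum>b\<in>UNIV. cmod (\<alpha> (Some i) $ a $ b))"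
  have A: "A \<ge> 0" unfolding A_def by (intro sum_nonneg) auto
  define c where "c = cmod (\<i> / 2 * of_real (pi powr (- ?n / 2) * Gamma (?n / 2)))"
  have "cmod (dirac_green \<alpha> 0 x y $ j $ k) \<le> c * A * norm (x - y) powr (- (?n - 1))" for x y j k
  proof -
    let ?r = "norm (x - y)"
    have "norm ((1 / ?r powr ?n) *\<^sub>R (x - y)) = ?r powr (- (?n - 1))"
    proof (cases "?r = 0")
      case False
      then show ?thesis by (simp add: powr_diff powr_minus_divide)
    qed simp
    then have "cmod (dirac_dot \<alpha> ((1 / ?r powr ?n) *\<^sub>R (x - y)) $ j $ k) \<le> A * ?r powr (- (?n - 1))"
      using norm_dirac_dot_entry_le[of \<alpha> "(1 / ?r powr ?n) *\<^sub>R (x - y)" j k] by (simp only: A_def)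
    then have "c * cmod (dirac_dot \<alpha> ((1 / ?r powr ?n) *\<^sub>R (x - y)) $ j $ k) \<le> c * (A * ?r powr (- (?n - 1)))"
      by (rule mult_left_mono) (simp add: c_def)
    then show ?thesis
      by (simp add: dirac_green_def Let_def scale_matrix_def map_matrix_def norm_mult c_def mult.assoc)
  qed
  then show ?thesis using that[of "c * A"] A by (simp add: c_def)
qed

text \<open>Both terms scale alike: \<open>r powr (2 - n) * r powr ((n - 2) / 2)\<close> and
  \<open>r powr (1 - n) * r powr (n / 2)\<close> equal \<open>r powr (1 - n / 2)\<close>, and the
  Hankel bound multiplies this by \<open>r powr (- n / 2)\<close> and
  \<open>r powr (- 1 / 2)\<close>. Powers of \<open>cmod z\<close> go into \<open>D\<close>, which
  depends on \<open>z\<close>.\<close>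

lemma dirac_green_bound:
  fixes \<alpha> :: "'n::finite option \<Rightarrow> complex^'m^'m"
  assumes n2: "CARD('n) \<ge> 2" and z: "Im z \<ge> 0" "z \<noteq> 0"
  obtains D where "D \<ge> 0"
    "\<And>x y j k. cmod (dirac_green \<alpha> z x y $ j $ k)
       \<le> D * (norm (x - y) powr (- (real CARD('n) - 1)) + norm (x - y) powr (- ((real CARD('n) - 1) / 2)))"
proof -
  define n where "n = real CARD('n)"
  define A where "A = (\<Sum>i\<in>UNIV. \<Sum>a\<in>UNIV. \<Sum>b\<in>UNIV. cmod (\<alpha> (Some i) $ a $ b))"
  have A: "A \<ge> 0" unfolding A_def by (intro sum_nonneg) auto
  have "hankel_bound (n / 2) (n / 2)"
    unfolding n_def using n2 by (intro hankel_bound_half_integer) auto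
  then obtain C2 where C2: "C2 \<ge> 0" "\<And>\<zeta>. Im \<zeta> \<ge> 0 \<Longrightarrow> \<zeta> \<noteq> 0 \<Longrightarrow>
     cmod (hankel_H1 (of_real (n / 2)) \<zeta>) \<le> C2 * (cmod \<zeta> powr (- (n / 2)) + cmod \<zeta> powr (- (1 / 2)))"
    unfolding hankel_bound_def by blast
  \<comment> \<open>The lower order is given the singularity exponent \<open>n / 2\<close> of the
    higher one, which makes the two terms comparable. In dimension 2 this is the exponent 1
    available at order 0.\<close>
  have "hankel_bound ((n - 2) / 2) (n / 2)"
  proof (cases "CARD('n) = 2")
    case True
    then show ?thesis using hankel_bound_0_1(1) by (simp add: n_def)
  next
    case False
    then have "hankel_bound (real (CARD('n) - 2) / 2) (real (CARD('n) - 2) / 2)"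
      using n2 by (intro hankel_bound_half_integer) auto
    then have "hankel_bound ((n - 2) / 2) ((n - 2) / 2)"
      using n2 by (simp add: n_def of_nat_diff)
    then show ?thesis by (rule hankel_bound_mono) (use n2 False in \<open>auto simp: n_def\<close>)
  qed
  then obtain C1 where C1: "C1 \<ge> 0" "\<And>\<zeta>. Im \<zeta> \<ge> 0 \<Longrightarrow> \<zeta> \<noteq> 0 \<Longrightarrow>
     cmod (hankel_H1 (of_real ((n - 2) / 2)) \<zeta>) \<le> C1 * (cmod \<zeta> powr (- (n / 2)) + cmod \<zeta> powr (- (1 / 2)))"
    unfolding hankel_bound_def by blast
  define Z where "Z = cmod z"
  have Z: "Z > 0" using z by (simp add: Z_def)
  define p where "p = (2 * pi) powr ((2 - n) / 2)"
  have p: "p \<ge> 0" by (simp add: p_def)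
  define M where "M = Z powr (- (n / 2)) + Z powr (- (1 / 2))"
  have M: "M \<ge> 0" by (simp add: M_def)
  define D where "D = p * Z * Z powr ((n - 2) / 2) * C1 * M + p * Z powr (n / 2) * C2 * M * A"
  have D: "D \<ge> 0" using p Z C1(1) C2(1) M A by (simp add: D_def)
  have "cmod (dirac_green \<alpha> z x y $ j $ k) \<le> D * (norm (x - y) powr (- (n - 1)) + norm (x - y) powr (- ((n - 1) / 2)))" for x y j k
  proof -
    define r where "r = norm (x - y)"
    define T where "T = r powr (- (n - 1)) + r powr (- ((n - 1) / 2))"
    let ?\<omega> = "(1 / r) *\<^sub>R (x - y)" and ?\<zeta> = "z * of_real r"
    define t1 where "t1 = \<i> / 4 * of_real (p * r powr (2 - n)) * z * ?\<zeta> powr of_real ((n - 2) / 2) * hankel_H1 (of_real ((n - 2) / 2)) ?\<zeta>"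
    define t2 where "t2 = 1 / 4 * of_real (p * r powr (1 - n)) * ?\<zeta> powr of_real (n / 2) * hankel_H1 (of_real (n / 2)) ?\<zeta>"
    have G: "dirac_green \<alpha> z x y $ j $ k = t1 * (mat 1 :: complex^'m^'m) $ j $ k - t2 * dirac_dot \<alpha> ?\<omega> $ j $ k"
      using z by (simp add: dirac_green_def Let_def scale_matrix_def map_matrix_def t1_def t2_def p_def r_def n_def)
    show ?thesis
    proof (cases "r = 0")
      \<comment> \<open>On the diagonal the prefactors vanish because \<open>powr\<close> with base
        0 is 0, so the bound holds at every pair.\<close>
      case True
      then have "t1 = 0" "t2 = 0" by (simp_all add: t1_def t2_def)
      then show ?thesis using G D by simp
    next
      case False
      then have r: "r > 0" by (simp add: r_def)
      have \<zeta>: "Im ?\<zeta> \<ge> 0" "?\<zeta> \<noteq> 0" "cmod ?\<zeta> = Z * r"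
        using z r by (auto simp: Z_def norm_mult)
      have zr: "(Z * r) powr (- (n / 2)) + (Z * r) powr (- (1 / 2)) \<le> M * (r powr (- (n / 2)) + r powr (- (1 / 2)))"
        using Z r by (simp add: M_def powr_mult algebra_simps)
      have e: "r powr a * r powr b * (r powr (- (n / 2)) + r powr (- (1 / 2))) = T"
        if "a + b = 1 - n / 2" for a b
      proof -
        have ex: "a + b + - (n / 2) = - (n - 1)" "a + b + - (1 / 2) = - ((n - 1) / 2)"
          using that by (simp_all add: field_simps)
        have "r powr a * r powr b * r powr (- (n / 2)) = r powr (- (n - 1))"
          "r powr a * r powr b * r powr (- (1 / 2)) = r powr (- ((n - 1) / 2))"
          unfolding powr_add[symmetric] ex by (rule refl)+
        then show ?thesis by (simp add: T_def distrib_left)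
      qed
      have "cmod t1 = 1 / 4 * (p * r powr (2 - n)) * Z * (Z * r) powr ((n - 2) / 2) * cmod (hankel_H1 (of_real ((n - 2) / 2)) ?\<zeta>)"
        unfolding t1_def norm_mult norm_powr_of_real[OF \<zeta>(2)] \<zeta>(3) norm_of_real Z_def[symmetric] using p r by simp
      also have "\<dots> \<le> 1 / 4 * (p * r powr (2 - n)) * Z * (Z * r) powr ((n - 2) / 2) * (C1 * (M * (r powr (- (n / 2)) + r powr (- (1 / 2)))))"
        using C1(2)[OF \<zeta>(1,2)] zr C1(1) p Z unfolding \<zeta>(3)
        by (intro mult_left_mono order_trans[OF _ mult_left_mono[OF zr C1(1)]]) auto
      also have "\<dots> = 1 / 4 * (p * Z * Z powr ((n - 2) / 2) * C1 * M) * (r powr (2 - n) * r powr ((n - 2) / 2) * (r powr (- (n / 2)) + r powr (- (1 / 2))))"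
        using Z r by (simp add: powr_mult)
      also have "r powr (2 - n) * r powr ((n - 2) / 2) * (r powr (- (n / 2)) + r powr (- (1 / 2))) = T"
        by (rule e) (simp add: field_simps)
      finally have b1: "cmod t1 \<le> 1 / 4 * (p * Z * Z powr ((n - 2) / 2) * C1 * M) * T" .
      have "cmod t2 = 1 / 4 * (p * r powr (1 - n)) * (Z * r) powr (n / 2) * cmod (hankel_H1 (of_real (n / 2)) ?\<zeta>)"
        unfolding t2_def norm_mult norm_powr_of_real[OF \<zeta>(2)] \<zeta>(3) norm_of_real Z_def[symmetric] using p r by simp
      also have "\<dots> \<le> 1 / 4 * (p * r powr (1 - n)) * (Z * r) powr (n / 2) * (C2 * (M * (r powr (- (n / 2)) + r powr (- (1 / 2)))))"
        using C2(2)[OF \<zeta>(1,2)] zr C2(1) p Z unfolding \<zeta>(3)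
        by (intro mult_left_mono order_trans[OF _ mult_left_mono[OF zr C2(1)]]) auto
      also have "\<dots> = 1 / 4 * (p * Z powr (n / 2) * C2 * M) * (r powr (1 - n) * r powr (n / 2) * (r powr (- (n / 2)) + r powr (- (1 / 2))))"
        using Z r by (simp add: powr_mult)
      also have "r powr (1 - n) * r powr (n / 2) * (r powr (- (n / 2)) + r powr (- (1 / 2))) = T"
        by (rule e) (simp add: field_simps)
      finally have b2: "cmod t2 \<le> 1 / 4 * (p * Z powr (n / 2) * C2 * M) * T" .
      have T: "T \<ge> 0" by (simp add: T_def)
      have m1: "cmod ((mat 1 :: complex^'m^'m) $ j $ k) \<le> 1" by (simp add: mat_def)
      have \<omega>: "norm ?\<omega> = 1" using r by (simp add: r_def)
      have m2: "cmod (dirac_dot \<alpha> ?\<omega> $ j $ k) \<le> A"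
        using norm_dirac_dot_entry_le[of \<alpha> ?\<omega> j k] unfolding \<omega> A_def[symmetric] by simp
      have "cmod (dirac_green \<alpha> z x y $ j $ k) \<le> cmod t1 * cmod ((mat 1 :: complex^'m^'m) $ j $ k) + cmod t2 * cmod (dirac_dot \<alpha> ?\<omega> $ j $ k)"
        unfolding G norm_mult[symmetric] by (rule norm_triangle_ineq4)
      also have "\<dots> \<le> (1 / 4 * (p * Z * Z powr ((n - 2) / 2) * C1 * M) * T) * 1 + (1 / 4 * (p * Z powr (n / 2) * C2 * M) * T) * A"
        using p Z C1(1) C2(1) M T A by (intro add_mono mult_mono b1 b2 m1 m2) auto
      also have "\<dots> = 1 / 4 * (D * T)" by (simp add: D_def algebra_simps)
      also have "\<dots> \<le> D * T" using D T by simp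
      finally show ?thesis by (simp add: T_def r_def)
    qed
  qed
  then show ?thesis using that[of D] D by (simp add: n_def)
qed

section \<open>From entrywise Green's function bounds to Schatten classes\<close>

lemma norm_matrix_le_sum: "norm K \<le> (\<Sum>j\<in>UNIV. \<Sum>k\<in>UNIV. cmod (K $ j $ k))"
  for K :: "complex^'m::finite^'k::finite"
proof -
  have "norm K \<le> (\<Sum>j\<in>UNIV. norm (K $ j))"
    unfolding norm_vec_def[of K] by (rule L2_set_le_sum) auto
  also have "\<dots> \<le> (\<Sum>j\<in>UNIV. \<Sum>k\<in>UNIV. cmod (K $ j $ k))"
    by (rule sum_mono) (unfold norm_vec_def[of "K $ _"], rule L2_set_le_sum, auto)
  finally show ?thesis .
qed

text \<open>Entrywise domination passes to the Frobenius norm by summing over all entries. The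
  requirement \<open>2 * \<delta> > n - a\<close> also covers the exponent \<open>n - 1\<close>,
  because \<open>a \<le> n - 1\<close>.\<close>

lemma in_schatten_class_of_green_bound:
  fixes R :: "(real^'n::finite, 'm::finite) L2 \<rightharpoonup> (real^'n, 'm) L2"
    and G :: "real^'n \<Rightarrow> real^'n \<Rightarrow> complex^'m^'m"
  assumes n: "CARD('n) \<ge> 2" and R: "is_integral_operator R K" and "C > 0" and K: "kernel_bound C \<delta> G K"
    and a: "0 < a" "a \<le> real CARD('n) - 1" "2 * \<delta> > real CARD('n) - a"
    and "D \<ge> 0" and G: "\<And>x y j k. cmod (G x y $ j $ k) \<le> D * (norm (x - y) powr (- (real CARD('n) - 1)) + norm (x - y) powr (- a))"
    and p: "p > real CARD('n)"
  shows "in_schatten_class R p"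
proof -
  let ?n = "real CARD('n)"
  \<comment> \<open>The summand 1 keeps \<open>E\<close> positive even for
    \<open>D = 0\<close>.\<close>
  define E where "E = real CARD('m) * real CARD('m) * (C * D) + 1"
  have E: "E > 0" using \<open>C > 0\<close> \<open>D \<ge> 0\<close> by (simp add: E_def add_nonneg_pos)
  show ?thesis
  proof (rule in_schatten_class_riesz[OF R, of "?n - 1" \<delta> a E p])
    show "AE (x, y) in lebesgue. norm (K x y) \<le> E * (riesz_weight \<delta> (?n - 1) x y + riesz_weight \<delta> a x y)"
      using K unfolding kernel_bound_def
    proof eventually_elim
      fix z :: "(real^'n) \<times> (real^'n)"
      assume *: "case z of (x, y) \<Rightarrow> \<forall>j k. cmod (K x y $ j $ k) \<le> C * bracket x powr (- \<delta>) * cmod (G x y $ j $ k) * bracket y powr (- \<delta>)"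
      obtain x y where z: "z = (x, y)" by (cases z)
      let ?W = "riesz_weight \<delta> (?n - 1) x y + riesz_weight \<delta> a x y"
      have W: "?W \<ge> 0" by (intro add_nonneg_nonneg riesz_weight_nonneg)
      have "cmod (K x y $ j $ k) \<le> C * D * ?W" for j k
      proof -
        have "cmod (K x y $ j $ k) \<le> C * bracket x powr (- \<delta>) * cmod (G x y $ j $ k) * bracket y powr (- \<delta>)"
          using * z by simp
        also have "\<dots> \<le> C * bracket x powr (- \<delta>) * (D * (norm (x - y) powr (- (?n - 1)) + norm (x - y) powr (- a))) * bracket y powr (- \<delta>)"
          using \<open>C > 0\<close> by (intro mult_right_mono mult_left_mono G) auto
        also have "\<dots> = C * D * ?W" by (simp add: riesz_weight_def algebra_simps)
        finally show ?thesis .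
      qed
      then have "norm (K x y) \<le> (\<Sum>j\<in>(UNIV::'m set). \<Sum>k\<in>(UNIV::'m set). C * D * ?W)"
        by (intro order_trans[OF norm_matrix_le_sum] sum_mono)
      also have "\<dots> = real CARD('m) * real CARD('m) * (C * D) * ?W" by simp
      also have "\<dots> \<le> E * ?W" using W by (intro mult_right_mono) (auto simp: E_def)
      finally show "case z of (x, y) \<Rightarrow> norm (K x y) \<le> E * (riesz_weight \<delta> (?n - 1) x y + riesz_weight \<delta> a x y)"
        by (simp add: z)
    qed
  qed (use n a p E in auto)
qed

theorem theorem6p13:
  fixes \<alpha> :: "'n::finite option \<Rightarrow> complex^'m^'m"
  assumes "CARD('n) \<ge> 2"
    and "CARD('m) = 2 ^ ((CARD('n) + 1) div 2)"
    and "dirac_matrices \<alpha>"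
  shows
    "(\<forall>(R :: (real^'n, 'm) L2 \<rightharpoonup> (real^'n, 'm) L2) K C \<delta>.
        is_integral_operator R K \<longrightarrow> C > 0 \<longrightarrow> \<delta> > 1 / 2 \<longrightarrow>
        kernel_bound C \<delta> (dirac_green \<alpha> 0) K \<longrightarrow>
        (\<forall>p > real CARD('n). in_schatten_class R p)) \<and>
     (\<forall>z. Im z \<ge> 0 \<longrightarrow>
        (\<forall>(R :: (real^'n, 'm) L2 \<rightharpoonup> (real^'n, 'm) L2) K C \<delta>.
          is_integral_operator R K \<longrightarrow> C > 0 \<longrightarrow> \<delta> > (real CARD('n) + 1) / 4 \<longrightarrow>
          kernel_bound C \<delta> (dirac_green \<alpha> z) K \<longrightarrow>
          (\<forall>p > real CARD('n). in_schatten_class R p)))"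
proof -
  let ?n = "real CARD('n)"
  have n: "?n \<ge> 2" using assms(1) by simp
  obtain D where D: "D \<ge> 0" "\<And>x y j k. cmod (dirac_green \<alpha> 0 x y $ j $ k) \<le> D * norm (x - y) powr (- (?n - 1))"
    using dirac_green_bound_0[of \<alpha>] by blast
  have zero: "in_schatten_class R p"
    if R: "is_integral_operator R K" and C: "C > 0" and \<delta>: "\<delta> > 1 / 2"
      and K: "kernel_bound C \<delta> (dirac_green \<alpha> 0) K" and p: "p > ?n"
    for R :: "(real^'n, 'm) L2 \<rightharpoonup> (real^'n, 'm) L2" and K C \<delta> p
  \<comment> \<open>Both exponents of the criterion are taken to be \<open>n - 1\<close>, so its
    weight condition reads \<open>2 * \<delta> > 1\<close>.\<close>
  proof (rule in_schatten_class_of_green_bound[OF assms(1) R C K, of "?n - 1" D])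
    show "cmod (dirac_green \<alpha> 0 x y $ j $ k) \<le> D * (norm (x - y) powr (- (?n - 1)) + norm (x - y) powr (- (?n - 1)))" for x y j k
      using D(1) by (intro order_trans[OF D(2)] mult_left_mono) auto
  qed (use n \<delta> D(1) p in auto)
  have nonzero: "in_schatten_class R p"
    if z: "Im z \<ge> 0" "z \<noteq> 0" and R: "is_integral_operator R K" and C: "C > 0" and \<delta>: "\<delta> > (?n + 1) / 4"
      and K: "kernel_bound C \<delta> (dirac_green \<alpha> z) K" and p: "p > ?n"
    for z and R :: "(real^'n, 'm) L2 \<rightharpoonup> (real^'n, 'm) L2" and K C \<delta> p
  proof -
    obtain D where D: "D \<ge> 0"
      "\<And>x y j k. cmod (dirac_green \<alpha> z x y $ j $ k) \<le> D * (norm (x - y) powr (- (?n - 1)) + norm (x - y) powr (- ((?n - 1) / 2)))"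
      using dirac_green_bound[OF assms(1) z] by blast
    show ?thesis
      by (rule in_schatten_class_of_green_bound[OF assms(1) R C K _ _ _ D(1) D(2) p]) (use n \<delta> in \<open>auto simp: field_simps\<close>)
  qed
  show ?thesis
  proof (intro conjI allI impI)
    fix R :: "(real^'n, 'm) L2 \<rightharpoonup> (real^'n, 'm) L2" and K C \<delta> p
    assume "is_integral_operator R K" "C > 0" "\<delta> > 1 / 2" "kernel_bound C \<delta> (dirac_green \<alpha> 0) K" "p > ?n"
    then show "in_schatten_class R p" by (rule zero)
  next
    fix z and R :: "(real^'n, 'm) L2 \<rightharpoonup> (real^'n, 'm) L2" and K C \<delta> p
    assume *: "Im z \<ge> 0" "is_integral_operator R K" "C > 0" "\<delta> > (?n + 1) / 4" "kernel_bound C \<delta> (dirac_green \<alpha> z) K" "p > ?n"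
    show "in_schatten_class R p"
    \<comment> \<open>The point \<open>z = 0\<close> is included in the second claim and follows
      there from the first, because \<open>(n + 1) / 4 \<ge> 3 / 4 > 1 / 2\<close>.\<close>
    proof (cases "z = 0")
      case True
      then show ?thesis using * n by (intro zero[of R K C \<delta> p]) auto
    qed (use * nonzero in blast)
  qed
qed

end
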